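(* Let $n\ge2$ be an integer and let $1\le p<\infty$. For all $f\in W^{1,p}(\mathbb{R}^n)$, $$\mathcal{E}_p(f^\circ)\ \le\ \frac{I_p}{I_1}\,\mathcal{E}_p(f)\qquad\text{and}\qquad \mathcal{E}_p^+(f^\circ)\ \le\ \frac{I_p}{I_1}\,\mathcal{E}_p^+(f).$$
   Context: Functions are real-valued on $\mathbb{R}^n$. $W^{1,p}(\mathbb{R}^n)$ is the usual Sobolev space, $\nabla f$ the (weak) gradient, $\Vert\cdot\Vert_p$ the $L_p(\mathbb{R}^n)$-norm with respect to Lebesgue measure, $|\cdot|_n$ is $n$-dimensional Lebesgue measure, $|x|$ is the Euclidean norm of $x\in\mathbb{R}^n$, $\omega_n$ is the Lebesgue measure of the Euclidean unit ball of $\mathbb{R}^n$, and $du$ is the normalized (probability) Haar measure on the unit sphere $S^{n-1}$. The decreasing rearrangement of $f$ is $f^*(t)=\inf\{\lambda>0 : |\{|f|>\lambda\}|_n\le t\}$, $t\ge 0$, and the symmetric Schwarz rearrangement of $f$ is $f^\circ(x)=f^*(\omega_n|x|^n)$, $x\in\mathbb{R}^n$. For $u\in S^{n-1}$ set $D_uf(x)=\langle\nabla f(x),u\rangle$ and $D_u^+f(x)=\max\{\langle\nabla f(x),u\rangle,0\}$. For $p\ge1$ let $I_p>0$ be given by $I_p^p=\int_{S^{n-1}}|u_1|^p\,du$, where $u_1$ is the first coordinate of $u$ (so $I_1=\int_{S^{n-1}}|u_1|\,du$), and define $$\mathcal{E}_p(f)=\frac{1}{I_p}\left(\int_{S^{n-1}}\Vert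 D_uf\Vert_p^{-n}\,du\right)^{-1/n},\qquad \mathcal{E}_p^+(f)=\frac{2^{1/p}}{I_p}\left(\int_{S^{n-1}}\Vert D_u^+f\Vert_p^{-n}\,du\right)^{-1/n}$$ (with the usual conventions $0^{-n}=\infty$ and $\infty^{-1/n}=0$). *)

theory Defs
  imports "HOL-Probability.Probability"
begin

section \<open>Powers of extended nonnegative reals\<close>

text \<open>Real powers on \<open>[0, \<infinity>]\<close>, with the conventions \<open>0 ^ (-a) = \<infinity>\<close> and \<open>\<infinity> ^ (-a) = 0\<close> for \<open>a > 0\<close>.\<close>

definition epowr :: "ennreal \<Rightarrow> real \<Rightarrow> ennreal" where
  "epowr x a =
     (if a = 0 then 1
      else if x = 0 then (if a > 0 then 0 else \<infinity>)
      else if x = \<infinity> then (if a > 0 then \<infinity> else 0)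
      else ennreal (enn2real x powr a))"

definition Lp_norm :: "real \<Rightarrow> ('a::euclidean_space \<Rightarrow> real) \<Rightarrow> ennreal" where
  "Lp_norm p h = epowr (\<integral>\<^sup>+ x. ennreal (\<bar>h x\<bar> powr p) \<partial>lebesgue) (1 / p)"


section \<open>Weak gradients and Sobolev functions\<close>

fun C_k :: "nat \<Rightarrow> ('a::euclidean_space \<Rightarrow> real) \<Rightarrow> bool" where
  "C_k 0 \<phi> \<longleftrightarrow> continuous_on UNIV \<phi>"
| "C_k (Suc k) \<phi> \<longleftrightarrow>
     \<phi> differentiable_on UNIV \<and> (\<forall>b\<in>Basis. C_k k (\<lambda>x. frechet_derivative \<phi> (at x) b))"

definition test_function :: "('a::euclidean_space \<Rightarrow> real) \<Rightarrow> bool" where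
  "test_function \<phi> \<longleftrightarrow> (\<forall>k. C_k k \<phi>) \<and> compact (closure {x. \<phi> x \<noteq> 0})"

definition locally_integrable ::
  "('a::euclidean_space \<Rightarrow> 'b::euclidean_space) \<Rightarrow> bool" where
  "locally_integrable h \<longleftrightarrow> (\<forall>K. compact K \<longrightarrow> set_integrable lebesgue K h)"

definition has_weak_gradient ::
  "('a::euclidean_space \<Rightarrow> real) \<Rightarrow> ('a \<Rightarrow> 'a) \<Rightarrow> bool" where
  "has_weak_gradient f g \<longleftrightarrow>
     locally_integrable f \<and> locally_integrable g \<and>
     (\<forall>\<phi>. test_function \<phi> \<longrightarrow> (\<forall>b\<in>Basis.
        (\<integral>x. f x * frechet_derivative \<phi> (at x) b \<partial>lebesgue) =
        - (\<integral>x. (g x \<bullet> b) * \<phi> x \<partial>lebesgue)))"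

text \<open>A weak gradient is unique up to a null set. Everything below depends only on its
  almost-everywhere class, so the choice of representative is immaterial.\<close>

definition weak_gradient :: "('a::euclidean_space \<Rightarrow> real) \<Rightarrow> 'a \<Rightarrow> 'a" where
  "weak_gradient f = (SOME g. has_weak_gradient f g)"

definition sobolev :: "real \<Rightarrow> ('a::euclidean_space \<Rightarrow> real) \<Rightarrow> bool" where
  "sobolev p f \<longleftrightarrow>
     f \<in> borel_measurable lebesgue \<and> Lp_norm p f < \<infinity> \<and>
     (\<exists>g. has_weak_gradient f g \<and> Lp_norm p (\<lambda>x. norm (g x)) < \<infinity>)"


section \<open>Rearrangements\<close>

text \<open>For \<open>f\<close> in \<open>L\<^sup>p\<close> the set under the infimum is nonempty whenever \<open>t > 0\<close>. For unbounded \<open>f\<close>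
  it is empty at \<open>t = 0\<close>, where the infimum should be \<open>\<infinity>\<close>; this affects the Schwarz
  rearrangement only at the origin, a null set.\<close>

definition decr_rearr :: "('a::euclidean_space \<Rightarrow> real) \<Rightarrow> real \<Rightarrow> real" where
  "decr_rearr f t = Inf {s. s > 0 \<and> emeasure lebesgue {x. \<bar>f x\<bar> > s} \<le> ennreal t}"

definition schwarz_rearr :: "('a::euclidean_space \<Rightarrow> real) \<Rightarrow> 'a \<Rightarrow> real" where
  "schwarz_rearr f x =
     decr_rearr f (measure lebesgue (cball (0::'a) 1) * norm x ^ DIM('a))"


section \<open>Normalized Haar measure on the sphere\<close>

text \<open>The radial projection of the uniform distribution on the unit ball. The lemmas below
  show that it is a rotation invariant probability measure carried by the unit sphere, and
  these properties characterize the normalized Haar measure. It is formally a measure on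
  the Borel sets of the whole space.\<close>

definition sphere_measure :: "'a::euclidean_space measure" where
  "sphere_measure = distr (uniform_measure lborel (ball 0 1)) borel sgn"

lemma sets_sphere_measure [simp, measurable_cong]: "sets sphere_measure = sets borel"
  and space_sphere_measure [simp]: "space sphere_measure = UNIV"
  by (simp_all add: sphere_measure_def)

lemma measurable_sgn_euclidean [measurable]:
  "(sgn :: 'a::euclidean_space \<Rightarrow> 'a) \<in> borel_measurable borel"
  unfolding sgn_div_norm by measurable

lemma emeasure_sphere_measure:
  fixes A :: "'a::euclidean_space set"
  assumes "A \<in> sets borel"
  shows "emeasure sphere_measure A =
    emeasure lborel (ball 0 1 \<inter> sgn -` A) / emeasure lborel (ball (0::'a) 1)"
proof -
  have [measurable]: "sgn -` A \<in> sets (borel :: 'a measure)"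
    using measurable_sets[OF measurable_sgn_euclidean assms] by simp
  show ?thesis
    unfolding sphere_measure_def
    by (subst emeasure_distr) (use assms in \<open>simp_all add: emeasure_uniform_measure\<close>)
qed

lemma prob_space_sphere_measure: "prob_space (sphere_measure :: 'a::euclidean_space measure)"
proof -
  have "prob_space (uniform_measure lborel (ball (0::'a) 1))"
    by (rule prob_space_uniform_measure)
       (simp_all add: emeasure_ball ennreal_eq_0_iff not_le)
  then show ?thesis
    unfolding sphere_measure_def by (rule prob_space.prob_space_distr) simp
qed

lemma AE_sphere_measure: "AE u in (sphere_measure :: 'a::euclidean_space measure). norm u = 1"
proof -
  have "AE x in lborel. x \<noteq> (0::'a)"
    by (rule AE_lborel_singleton)
  then have "AE x in uniform_measure lborel (ball 0 1). norm (sgn x :: 'a) = 1"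
    by (intro AE_uniform_measureI) (auto simp: norm_sgn)
  then show ?thesis
    unfolding sphere_measure_def by (subst AE_distr_iff) auto
qed

lemma sphere_measure_orthogonal_invariant:
  fixes T :: "real^'n::{finite,wellorder} \<Rightarrow> real^'n::_"
  assumes T: "orthogonal_transformation T"
  shows "distr sphere_measure borel T = sphere_measure"
proof (rule measure_eqI)
  have Tlin: "linear T" and Tnorm: "\<And>x. norm (T x) = norm x"
    using T by (auto simp: orthogonal_transformation)
  have [measurable]: "T \<in> borel_measurable borel"
    using Tlin by (intro borel_measurable_continuous_onI linear_continuous_on)
      (simp add: linear_conv_bounded_linear)
  have Tsgn: "sgn (T x) = T (sgn x)" for x
    by (simp add: sgn_div_norm Tnorm linear_cmul[OF Tlin])
  fix A assume "A \<in> sets (distr sphere_measure borel T)"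
  then have A: "A \<in> sets borel" by simp
  have TA: "T -` A \<in> sets borel"
    using measurable_sets[OF \<open>T \<in> borel_measurable borel\<close> A] by simp
  define S where "S = ball 0 1 \<inter> sgn -` (T -` A)"
  have mS: "sgn -` A \<in> sets (borel :: (real^'n::_) measure)"
    "sgn -` (T -` A) \<in> sets (borel :: (real^'n::_) measure)"
    using measurable_sets[OF measurable_sgn_euclidean A]
      measurable_sets[OF measurable_sgn_euclidean TA] by simp_all
  have S: "S \<in> sets borel" "S \<in> lmeasurable"
  proof -
    show "S \<in> sets borel" using mS by (simp add: S_def)
    show "S \<in> lmeasurable"
      by (rule bounded_set_imp_lmeasurable)
         (use \<open>S \<in> sets borel\<close> in \<open>auto simp: S_def\<close>)
  qed
  have img: "T ` S = ball 0 1 \<inter> sgn -` A"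
  proof
    show "T ` S \<subseteq> ball 0 1 \<inter> sgn -` A"
      by (auto simp: S_def Tnorm Tsgn)
    show "ball 0 1 \<inter> sgn -` A \<subseteq> T ` S"
    proof
      fix y assume y: "y \<in> ball 0 1 \<inter> sgn -` A"
      obtain x where x: "y = T x"
        using orthogonal_transformation_surj[OF T] by blast
      then show "y \<in> T ` S" using y by (auto simp: S_def Tnorm Tsgn)
    qed
  qed
  have "emeasure lborel (T ` S) = emeasure lborel S"
  proof -
    have 1: "T ` S \<in> lmeasurable" "measure lebesgue (T ` S) = measure lebesgue S"
      using measurable_orthogonal_image[OF T S(2)] measure_orthogonal_image[OF T S(2)] by auto
    have "emeasure lebesgue (T ` S) = emeasure lebesgue S"
      using 1 S(2) by (metis emeasure_eq_measure2)
    moreover have "T ` S \<in> sets borel" using mS by (simp add: img)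
    ultimately show ?thesis using S by simp
  qed
  then have "emeasure lborel (ball 0 1 \<inter> sgn -` A) = emeasure lborel S"
    unfolding img .
  then show "emeasure (distr sphere_measure borel T) A = emeasure sphere_measure A"
    using A TA by (simp add: emeasure_distr emeasure_sphere_measure S_def)
qed simp


section \<open>The energies\<close>

text \<open>The index type is well ordered, like \<open>{1..n}\<close>, and its least element is the first
  coordinate.\<close>

definition first_coord :: "real^'n::{finite,wellorder} \<Rightarrow> real" where
  "first_coord u = u $ (LEAST i. True)"

definition I_const :: "'n::{finite,wellorder} itself \<Rightarrow> real \<Rightarrow> real" where
  "I_const _ p =
     (\<integral>u. \<bar>first_coord (u :: real^'n::_)\<bar> powr p \<partial>sphere_measure) powr (1 / p)"

definition D_dir :: "(real^'n \<Rightarrow> real) \<Rightarrow> real^'n \<Rightarrow> real^'n \<Rightarrow> real" where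
  "D_dir f u x = weak_gradient f x \<bullet> u"

definition D_dir_plus :: "(real^'n \<Rightarrow> real) \<Rightarrow> real^'n \<Rightarrow> real^'n \<Rightarrow> real" where
  "D_dir_plus f u x = max (weak_gradient f x \<bullet> u) 0"

definition energy :: "real \<Rightarrow> (real^'n::{finite,wellorder} \<Rightarrow> real) \<Rightarrow> ennreal" where
  "energy p f = ennreal (1 / I_const TYPE('n) p) *
     epowr (\<integral>\<^sup>+ u. epowr (Lp_norm p (D_dir f u)) (- real CARD('n)) \<partial>sphere_measure)
       (- 1 / real CARD('n))"

definition energy_plus :: "real \<Rightarrow> (real^'n::{finite,wellorder} \<Rightarrow> real) \<Rightarrow> ennreal" where
  "energy_plus p f = ennreal (2 powr (1 / p) / I_const TYPE('n) p) *
     epowr (\<integral>\<^sup>+ u. epowr (Lp_norm p (D_dir_plus f u)) (- real CARD('n)) \<partial>sphere_measure)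
       (- 1 / real CARD('n))"

end

theory Submission
  imports Defs "HOL-Real_Asymp.Real_Asymp"
begin

text \<open>
  Already \<open>\<E>\<^sub>p(f\<^sup>\<circ>) \<le> \<E>\<^sub>p(f)\<close> holds, and likewise for the asymmetric energies; the factor
  \<open>I\<^sub>p / I\<^sub>1\<close> is at least 1 by Jensen's inequality. Write \<open>N(z) = \<integral> max (\<nabla>f \<cdot> z) 0 ^ p\<close>, and \<open>N\<^sup>\<circ>\<close> for
  the same quantity of \<open>f\<^sup>\<circ>\<close>.

  For a bounded convex set \<open>K\<close> and the centred ball \<open>B\<close> of the same volume, the Riesz rearrangement
  inequality, applied to pairs of superlevel sets with the kernel \<open>K\<close>, shows that
  \<open>\<integral>\<^sub>K \<integral> max (f (x + z) - f x) 0 ^ p dx dz\<close> does not increase when \<open>f\<close> and \<open>K\<close> are replaced by \<open>f\<^sup>\<circ>\<close> and \<open>B\<close>.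
  Replacing \<open>z\<close> by \<open>\<epsilon> z\<close> and letting \<open>\<epsilon>\<close> tend to 0 gives \<open>\<integral>\<^sub>B N\<^sup>\<circ> \<le> \<integral>\<^sub>K N\<close>.

  Take for \<open>K\<close> the part of the convex body \<open>{N \<le> 1}\<close> in a large ball. By homogeneity \<open>K\<close> contains its own
  dilates inside the smaller sublevel sets of \<open>N\<close>, so \<open>\<integral>\<^sub>K N \<le> \<integral>\<^sub>B (|z| / r) ^ p\<close> for the radius \<open>r\<close> of \<open>B\<close>. As
  \<open>N\<^sup>\<circ>(z) = C |z| ^ p\<close>, this yields \<open>C r ^ p \<le> 1\<close>, an upper bound on the volume of \<open>{N \<le> 1}\<close>, and in polar
  coordinates that volume is the integral over the sphere in the definition of the energy. The symmetric
  energy is treated in the same way with \<open>N(z) + N(-z)\<close>.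
\<close>

text \<open>Rearrangement acts on superlevel sets and not on gradients, hence the detour through
  finite differences. Convexity of \<open>K\<close> makes its fibres intervals, the kernels handled
  on the line, and survives Steiner symmetrization. Where \<open>f\<close> is negative, an increase
  of \<open>f\<close> along \<open>z\<close> is an increase of \<open>- f\<close> along
  \<open>- z\<close>; so both parts of \<open>f\<close> are rearranged jointly, with kernels
  \<open>K\<close> and \<open>- K\<close>. The main obstacle is that \<open>weak_gradient\<close> is
  a choice, so the energy of the rearrangement has a meaning only once a weak gradient of it is
  known to exist. A coarse isoperimetric estimate shows that its profile is absolutely continuous in
  the logarithm of the radius, and the density yields an explicit radial weak gradient. The limit in
  \<epsilon> is asymmetric. For \<open>f\<close> the gradient bounds the difference quotients at
  every \<epsilon>, by Jensen along segments. For the rearrangement, local L1 convergence and Fatou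
  give the opposite bound in the limit, with no prior knowledge that its energy is finite. The body
  \<open>{N \<le> 1}\<close> is cut by a large ball because it may be unbounded.\<close>

abbreviation vol :: "'a::euclidean_space set \<Rightarrow> ennreal" where "vol \<equiv> emeasure lborel"
abbreviation lborel_nn_integral (binder "\<integral>\<^sup>+" 10) where "lborel_nn_integral \<equiv> nn_integral lborel"
abbreviation lborel_integral (binder "\<integral>" 10) where "lborel_integral \<equiv> integral\<^sup>L lborel"

section \<open>The Riesz inequality on the line\<close>

lemma nn_integral_lborel_translate:
  fixes f :: "'a::euclidean_space \<Rightarrow> ennreal"
  assumes [measurable]: "f \<in> borel_measurable borel"
  shows "(\<integral>\<^sup>+x. f (x + c)) = (\<integral>\<^sup>+x. f x)"
proof -
  have "(\<integral>\<^sup>+x. f x) = (\<integral>\<^sup>+x. f x \<partial>distr lborel borel ((+) c))"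
    by (simp add: lborel_distr_plus)
  also have "\<dots> = (\<integral>\<^sup>+x. f (c + x))"
    by (subst nn_integral_distr) auto
  finally show ?thesis by (simp add: add.commute)
qed

text \<open>Every line parallel to \<open>u\<close> meets the slab
  \<open>0 \<le> x \<bullet> u < 1\<close> in a segment of length 1, so integrating over base points
  in the slab gives each line weight one, and no complement of \<open>u\<close> has to be split off.
  The weight enters as the integral over \<open>t\<close> of
  \<open>indicator {0..<1} (x \<bullet> u - t)\<close>, which is 1, followed by the translation by
  \<open>t *\<^sub>R u\<close>.\<close>

lemma line_fubini:
  fixes f :: "'a::euclidean_space \<Rightarrow> ennreal" and u :: 'a
  assumes [measurable]: "f \<in> borel_measurable borel" and u: "norm u = 1"
  shows "(\<integral>\<^sup>+x. f x)
    = (\<integral>\<^sup>+x. indicator {0..<1} (x \<bullet> u) * (\<integral>\<^sup>+t. f (x + t *\<^sub>R u)))"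
proof -
  have uu: "u \<bullet> u = 1" using u by (simp add: dot_square_norm)
  have 1: "(\<integral>\<^sup>+t. indicator {0..<1::real} (x \<bullet> u - t) * f x) = f x" for x
  proof -
    have "(\<integral>\<^sup>+t. indicator {0..<1::real} (x \<bullet> u - t) * f x)
        = (\<integral>\<^sup>+t. indicator {x \<bullet> u - 1<..x \<bullet> u} t) * f x"
      by (subst nn_integral_multc[symmetric])
        (auto intro!: nn_integral_cong simp: indicator_def)
    then show ?thesis by simp
  qed
  have "(\<integral>\<^sup>+x. f x)
      = (\<integral>\<^sup>+x. \<integral>\<^sup>+t. indicator {0..<1::real} (x \<bullet> u - t) * f x)"
    by (simp add: 1)
  also have "\<dots> = (\<integral>\<^sup>+t. \<integral>\<^sup>+x. indicator {0..<1::real} (x \<bullet> u - t) * f x)"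
    by (rule lborel_pair.Fubini') measurable
  also have "\<dots> = (\<integral>\<^sup>+t. \<integral>\<^sup>+x. indicator {0..<1::real} (x \<bullet> u) * f (x + t *\<^sub>R u))"
  proof (rule nn_integral_cong)
    fix t :: real
    show "(\<integral>\<^sup>+x. indicator {0..<1::real} (x \<bullet> u - t) * f x)
      = (\<integral>\<^sup>+x. indicator {0..<1::real} (x \<bullet> u) * f (x + t *\<^sub>R u))"
      using nn_integral_lborel_translate[of "\<lambda>x. indicator {0..<1::real} (x \<bullet> u - t) * f x" "t *\<^sub>R u"]
      by (simp add: inner_add_left uu)
  qed
  also have "\<dots> = (\<integral>\<^sup>+x. \<integral>\<^sup>+t. indicator {0..<1::real} (x \<bullet> u) * f (x + t *\<^sub>R u))"
    by (rule lborel_pair.Fubini') measurable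
  also have "\<dots> = (\<integral>\<^sup>+x. indicator {0..<1::real} (x \<bullet> u) * (\<integral>\<^sup>+t. f (x + t *\<^sub>R u)))"
    by (subst nn_integral_cmult) auto
  finally show ?thesis .
qed

text \<open>The convolution of the indicators of \<open>B\<close> and \<open>{-h..h}\<close>. Its
  integral over \<open>A\<close> is the Riesz integral with an interval kernel.\<close>

definition win :: "real set \<Rightarrow> real \<Rightarrow> real \<Rightarrow> real" where
  "win B h s = measure lborel (B \<inter> {s-h..s+h})"

lemma emeasure_win:
  assumes [measurable]: "B \<in> sets borel"
  shows "vol (B \<inter> {s-h..s+h}) = ennreal (win B h s)"
proof -
  have "vol (B \<inter> {s-h..s+h}) \<le> vol {s-h..s+h}"
    by (intro emeasure_mono) auto
  also have "\<dots> < \<infinity>" by (simp add: emeasure_lborel_Icc_eq)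
  finally show ?thesis unfolding win_def by (intro emeasure_eq_ennreal_measure) auto
qed

lemma win_nonneg: "0 \<le> win B h s"
  by (simp add: win_def)

lemma win_le_width:
  assumes [measurable]: "B \<in> sets borel" and "0 \<le> h"
  shows "win B h s \<le> 2 * h"
proof -
  have "ennreal (win B h s) \<le> vol {s-h..s+h}"
    unfolding emeasure_win[symmetric, OF assms(1)] by (intro emeasure_mono) auto
  then show ?thesis using assms(2) by (simp add: emeasure_lborel_Icc_eq)
qed

lemma win_le_measure:
  assumes [measurable]: "B \<in> sets borel" and "vol B < \<infinity>"
  shows "win B h s \<le> measure lborel B"
  unfolding win_def by (intro measure_mono_fmeasurable) (use assms in \<open>auto simp: fmeasurable_def\<close>)

lemma win_lipschitz_aux:
  assumes B[measurable]: "B \<in> sets borel" and "d \<ge> 0"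
  shows "win B h s \<le> win B h (s + d) + d" "win B h (s + d) \<le> win B h s + d"
proof -
  have "ennreal (win B h s) \<le> vol (B \<inter> {s+d-h..s+d+h} \<union> {s-h..s+d-h})"
    unfolding emeasure_win[OF B, symmetric] using \<open>d \<ge> 0\<close> by (intro emeasure_mono) auto
  also have "\<dots> \<le> vol (B \<inter> {s+d-h..s+d+h}) + vol {s-h..s+d-h}"
    by (intro emeasure_subadditive) auto
  also have "\<dots> = ennreal (win B h (s+d) + d)"
    unfolding emeasure_win[OF B] using assms(2)
    by (simp add: emeasure_lborel_Icc_eq win_nonneg ennreal_plus)
  finally show "win B h s \<le> win B h (s + d) + d"
    using assms(2) win_nonneg[of B h] by (subst (asm) ennreal_le_iff) auto
  have "ennreal (win B h (s+d)) \<le> vol (B \<inter> {s-h..s+h} \<union> {s+h..s+d+h})"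
    unfolding emeasure_win[OF B, symmetric] using \<open>d \<ge> 0\<close> by (intro emeasure_mono) auto
  also have "\<dots> \<le> vol (B \<inter> {s-h..s+h}) + vol {s+h..s+d+h}"
    by (intro emeasure_subadditive) auto
  also have "\<dots> = ennreal (win B h s + d)"
    unfolding emeasure_win[OF B] using assms(2)
    by (simp add: emeasure_lborel_Icc_eq win_nonneg)
  finally show "win B h (s + d) \<le> win B h s + d"
    using assms(2) win_nonneg[of B h] by (subst (asm) ennreal_le_iff) auto
qed

lemma win_lipschitz:
  assumes B: "B \<in> sets borel"
  shows "\<bar>win B h s - win B h t\<bar> \<le> \<bar>s - t\<bar>"
  using win_lipschitz_aux[OF B, of "t - s" h s] win_lipschitz_aux[OF B, of "s - t" h t]
  by (cases "s \<le> t") auto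

lemma win_continuous:
  assumes B: "B \<in> sets borel"
  shows "continuous_on UNIV (win B h)"
proof (rule continuous_onI)
  fix x e :: real assume "e > 0"
  then show "\<exists>d>0. \<forall>x'\<in>UNIV. dist x' x < d \<longrightarrow> dist (win B h x') (win B h x) \<le> e"
    by (intro exI[of _ e]) (auto simp: dist_real_def intro: order_trans[OF win_lipschitz[OF B, of h]] less_imp_le)
qed

lemma win_measurable [measurable]:
  assumes B: "B \<in> sets borel"
  shows "win B h \<in> borel_measurable borel"
  by (rule borel_measurable_continuous_onI[OF win_continuous[OF B]])

lemma bounded_win_superlevel:
  assumes B: "B \<in> sets borel" "bounded B" and "0 \<le> c"
  shows "bounded {s. win B h s > c}"
proof -
  obtain R where R: "\<And>x. x \<in> B \<Longrightarrow> \<bar>x\<bar> \<le> R"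
    using B(2) by (auto simp: bounded_iff)
  have "\<bar>s\<bar> \<le> R + \<bar>h\<bar>" if "win B h s > c" for s
  proof (rule ccontr)
    assume "\<not> ?thesis"
    then have "B \<inter> {s-h..s+h} = {}" using R by force
    then have "win B h s = 0" unfolding win_def by simp
    then show False using that \<open>0 \<le> c\<close> by simp
  qed
  then show ?thesis by (auto simp: bounded_iff)
qed

text \<open>The window function is 1-Lipschitz, so each superlevel set contains a
  neighbourhood of the higher ones.\<close>

lemma win_superlevel_decay:
  assumes B: "B \<in> sets borel" "bounded B" and "0 \<le> l" "l \<le> m" and ne: "{s. win B h s > m} \<noteq> {}"
  shows "measure lborel {s. win B h s > m} + 2 * (m - l) \<le> measure lborel {s. win B h s > l}"
proof -
  define S where "S = {s. win B h s > m}"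
  have bS: "bounded S" and ne: "S \<noteq> {}"
    using bounded_win_superlevel[OF B] \<open>0 \<le> l\<close> \<open>l \<le> m\<close> ne by (auto simp: S_def)
  have [measurable]: "S \<in> sets borel"
    unfolding S_def using B(1) by measurable
  have bL: "bounded {s. win B h s > l}"
    using bounded_win_superlevel[OF B] \<open>0 \<le> l\<close> by auto
  have [measurable]: "{s. win B h s > l} \<in> sets borel"
    using B(1) by measurable
  define d where "d = m - l"
  have d: "d \<ge> 0" using \<open>l \<le> m\<close> by (simp add: d_def)
  have near: "win B h t > l" if cl: "\<And>e. e > 0 \<Longrightarrow> \<exists>s\<in>S. \<bar>s - x\<bar> < e" and tx: "\<bar>t - x\<bar> < d" for t x
  proof -
    obtain s where s: "s \<in> S" "\<bar>s - x\<bar> < d - \<bar>t - x\<bar>"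
      using cl[of "d - \<bar>t - x\<bar>"] tx by auto
    have "\<bar>win B h s - win B h t\<bar> \<le> \<bar>s - t\<bar>" by (rule win_lipschitz[OF B(1)])
    then show ?thesis using s tx by (auto simp: S_def d_def)
  qed
  have bb: "bdd_below S" "bdd_above S" using bS
    by (auto simp: bounded_imp_bdd_below bounded_imp_bdd_above)
  define a b where "a = Inf S" and "b = Sup S"
  have ab: "S \<subseteq> {a..b}"
    using bb by (auto simp: a_def b_def cInf_lower cSup_upper)
  then have "a \<le> b" using ne by auto
  have na: "\<exists>s\<in>S. \<bar>s - a\<bar> < e" if e: "e > 0" for e
  proof -
    obtain s where "s \<in> S" "s < a + e"
      using cInf_lessD[OF ne, of "a + e"] e by (auto simp: a_def)
    then show ?thesis using ab by (intro bexI[of _ s]) (auto simp: abs_less_iff)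
  qed
  have nb: "\<exists>s\<in>S. \<bar>s - b\<bar> < e" if e: "e > 0" for e
  proof -
    obtain s where "s \<in> S" "b - e < s"
      using less_cSupD[OF ne, of "b - e"] e by (auto simp: b_def)
    then show ?thesis using ab by (intro bexI[of _ s]) (auto simp: abs_less_iff)
  qed
  \<comment> \<open>Only the intervals of length \<open>d\<close> beyond the two ends of the hull of
    \<open>S\<close> are added. Lying outside \<open>{a..b}\<close>, they are disjoint from
    \<open>S\<close>, and together they have length \<open>2 * d\<close>.\<close>
  have sub: "S \<union> ({a-d<..<a} \<union> {b<..<b+d}) \<subseteq> {s. win B h s > l}"
    using near[OF na] near[OF nb] \<open>l \<le> m\<close> by (auto simp: S_def abs_less_iff)
  have fin: "{s. win B h s > l} \<in> fmeasurable lborel"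
    using emeasure_bounded_finite[OF bL] by (simp add: fmeasurable_def)
  have finS: "vol S \<noteq> \<infinity>"
    using emeasure_bounded_finite[OF bS] by simp
  define T where "T = {a-d<..<a} \<union> {b<..<b+d}"
  have [measurable]: "T \<in> sets borel" by (simp add: T_def)
  have eT: "vol T = ennreal (2 * d)"
    unfolding T_def using d \<open>a \<le> b\<close>
    by (subst plus_emeasure[symmetric]) (auto simp: ennreal_plus[symmetric] simp del: ennreal_plus)
  have "measure lborel S + 2 * d = measure lborel S + measure lborel T"
    using d by (simp add: measure_def eT)
  also have "\<dots> = measure lborel (S \<union> T)"
    using ab finS eT by (subst measure_Union) (auto simp: T_def)
  also have "\<dots> \<le> measure lborel {s. win B h s > l}"
    using sub by (intro measure_mono_fmeasurable fin) (auto simp: T_def)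
  finally show ?thesis by (simp add: S_def d_def)
qed

lemma win_superlevel_mono:
  assumes B: "B \<in> sets borel" "bounded B" and "0 \<le> l" "l \<le> m"
  shows "measure lborel {s. win B h s > m} \<le> measure lborel {s. win B h s > l}"
proof (rule measure_mono_fmeasurable)
  show "{s. win B h s > l} \<in> fmeasurable lborel"
    using emeasure_bounded_finite[OF bounded_win_superlevel[OF B \<open>0 \<le> l\<close>]] B(1)
    by (auto simp: fmeasurable_def)
qed (use assms in auto)

lemma nn_integral_win_layers:
  assumes [measurable]: "A \<in> sets borel" "B \<in> sets borel"
  shows "(\<integral>\<^sup>+s. indicator A s * ennreal (win B h s))
     = (\<integral>\<^sup>+l. indicator {0..} l * vol (A \<inter> {s. win B h s > l}))"
proof -
  have 1: "ennreal (win B h s) = (\<integral>\<^sup>+l. indicator {0..<win B h s} l)" for s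
    using win_nonneg[of B h s] by simp
  have "(\<integral>\<^sup>+s. indicator A s * ennreal (win B h s))
      = (\<integral>\<^sup>+s. \<integral>\<^sup>+l. indicator A s * (indicator {0..} l * indicator {0<..} (win B h s - l)))"
    unfolding 1 by (subst nn_integral_cmult[symmetric])
      (auto intro!: nn_integral_cong simp: indicator_def)
  also have "\<dots> = (\<integral>\<^sup>+l. \<integral>\<^sup>+s. indicator A s * (indicator {0..} l * indicator {0<..} (win B h s - l)))"
    by (rule lborel_pair.Fubini') measurable
  also have "\<dots> = (\<integral>\<^sup>+l. \<integral>\<^sup>+s. indicator {0..} l * indicator (A \<inter> {s. win B h s > l}) s)"
    by (intro nn_integral_cong) (auto simp: indicator_def)
  also have "\<dots> = (\<integral>\<^sup>+l. indicator {0..} l * vol (A \<inter> {s. win B h s > l}))"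
    by (intro nn_integral_cong) (subst nn_integral_cmult, auto)
  finally show ?thesis .
qed

lemma win_eq_nn_integral:
  assumes [measurable]: "B \<in> sets borel"
  shows "ennreal (win B h s) = (\<integral>\<^sup>+t. indicator B t * indicator {-h..h} (s - t))"
proof -
  have "ennreal (win B h s) = (\<integral>\<^sup>+t. indicator (B \<inter> {s-h..s+h}) t)"
    by (subst emeasure_win[symmetric]) auto
  also have "\<dots> = (\<integral>\<^sup>+t. indicator B t * indicator {-h..h} (s - t))"
    by (intro nn_integral_cong) (auto simp: indicator_def)
  finally show ?thesis .
qed

lemma nn_integral_win:
  assumes [measurable]: "B \<in> sets borel" and h: "h \<ge> 0"
  shows "(\<integral>\<^sup>+s. ennreal (win B h s)) = vol B * ennreal (2 * h)"
proof -
  have "(\<integral>\<^sup>+s. ennreal (win B h s))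
     = (\<integral>\<^sup>+t. \<integral>\<^sup>+s. indicator B t * indicator {-h..h} (s - t))"
    unfolding win_eq_nn_integral[OF assms(1)] by (rule lborel_pair.Fubini') measurable
  also have "\<dots> = (\<integral>\<^sup>+t. indicator B t * ennreal (2 * h))"
  proof (intro nn_integral_cong)
    fix t
    have "(\<integral>\<^sup>+s. indicator {-h..h} (s - t)) = (\<integral>\<^sup>+s. indicator {t-h..t+h} s)"
      by (intro nn_integral_cong) (auto simp: indicator_def)
    also have "\<dots> = ennreal (2 * h)" using h by simp
    finally show "(\<integral>\<^sup>+s. indicator B t * indicator {-h..h} (s - t)) = indicator B t * ennreal (2 * h)"
      by (subst nn_integral_cmult) auto
  qed
  also have "\<dots> = vol B * ennreal (2 * h)"
    by (subst nn_integral_multc) auto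
  finally show ?thesis .
qed

text \<open>The convolution of centred intervals of lengths \<open>b\<close> and \<open>c\<close> is
  a trapezoid, and \<open>b + c - 2 * l\<close> is the length of its superlevel set at height
  \<open>l\<close>. The total \<open>b * c\<close> is the one that \<open>nn_integral_win\<close>
  gives for every set of length \<open>b\<close>.\<close>

lemma nn_integral_affine:
  fixes b c :: real
  assumes "b \<ge> 0" "c \<ge> 0"
  shows "(\<integral>\<^sup>+l. indicator {0..<min b c} l * ennreal (b + c - 2 * l)) = ennreal (b * c)"
proof -
  have "((\<lambda>l. b + c - 2 * l) has_integral ((b + c) * min b c - (min b c)^2) - ((b + c) * 0 - 0^2)) {0..min b c}"
    using assms by (intro fundamental_theorem_of_calculus)
      (auto intro!: derivative_eq_intros simp: has_real_derivative_iff_has_vector_derivative[symmetric])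
  moreover have "(b + c) * min b c - (min b c)^2 = b * c"
    by (cases "b \<le> c") (auto simp: min_def algebra_simps power2_eq_square)
  ultimately have "((\<lambda>l. b + c - 2 * l) has_integral b * c) {0..min b c}" by simp
  then have "(\<integral>\<^sup>+l. ennreal (indicator {0..min b c} l * (b + c - 2 * l))) = ennreal (b * c)"
    by (intro nn_integral_has_integral_lebesgue) auto
  moreover have "(\<integral>\<^sup>+l. indicator {0..<min b c} l * ennreal (b + c - 2 * l))
     = (\<integral>\<^sup>+l. ennreal (indicator {0..min b c} l * (b + c - 2 * l)))"
    by (intro nn_integral_cong_AE eventually_mono[OF AE_lborel_singleton[of "min b c"]])
      (auto simp: indicator_def)
  ultimately show ?thesis by simp
qed

text \<open>The layer sizes of the two window functions have equal integrals, and the difference of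
  the layer sizes changes sign at most once, from plus to minus; so truncation at a level
  favours the second one.\<close>

lemma truncated_layers_le:
  fixes g :: "real \<Rightarrow> real" and a b c :: real
  assumes [measurable]: "g \<in> borel_measurable borel" and nn: "a \<ge> 0" "b \<ge> 0" "c \<ge> 0"
    and g0: "\<And>l. g l \<ge> 0"
    and decay: "\<And>l m. 0 \<le> l \<Longrightarrow> l \<le> m \<Longrightarrow> g m > 0 \<Longrightarrow> g m + 2 * (m - l) \<le> g l"
    and total: "(\<integral>\<^sup>+l. indicator {0..<min b c} l * ennreal (g l)) = ennreal (b * c)"
  shows "(\<integral>\<^sup>+l. indicator {0..<min b c} l * ennreal (min a (g l)))
    \<le> (\<integral>\<^sup>+l. indicator {0..<min b c} l * ennreal (min a (b + c - 2 * l)))"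
proof -
  define h where "h l = b + c - 2 * l" for l
  define M where "M = min b c"
  have [measurable]: "h \<in> borel_measurable borel" unfolding h_def by measurable
  have h0: "0 \<le> h l" if "l < M" for l
    using that unfolding h_def M_def min_less_iff_conj by linarith
  have tot: "(\<integral>\<^sup>+l. indicator {0..<M} l * ennreal (g l)) = (\<integral>\<^sup>+l. indicator {0..<M} l * ennreal (h l))"
    using total nn_integral_affine[OF nn(2,3)] by (simp add: M_def h_def)
  \<comment> \<open>\<open>k\<close> is the level at which the affine layer size falls to
    \<open>a\<close>: up to \<open>k\<close> the truncated size is the constant \<open>a\<close>,
    beyond it the truncation is inactive.\<close>
  define k where "k = (b + c - a) / 2"
  have hk: "a < h l \<longleftrightarrow> l < k" "h l < a \<longleftrightarrow> k < l" for l by (auto simp: h_def k_def field_simps)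
  have mh: "l \<le> k \<Longrightarrow> min a (h l) = a" "k \<le> l \<Longrightarrow> min a (h l) = h l" for l
    using hk[of l] by linarith+
  have "(\<integral>\<^sup>+l. indicator {0..<M} l * ennreal (min a (g l)))
    \<le> (\<integral>\<^sup>+l. indicator {0..<M} l * ennreal (min a (h l)))"
  proof (cases "k < 0")
    case True
    have "(\<integral>\<^sup>+l. indicator {0..<M} l * ennreal (min a (g l))) \<le> (\<integral>\<^sup>+l. indicator {0..<M} l * ennreal (g l))"
      by (intro nn_integral_mono mult_left_mono) (auto intro: ennreal_leI)
    also have "\<dots> = (\<integral>\<^sup>+l. indicator {0..<M} l * ennreal (min a (h l)))"
      unfolding tot using True mh(2) by (intro nn_integral_cong) (simp add: indicator_def)
    finally show ?thesis .
  next
    case k0: False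
    show ?thesis
    proof (cases "g k \<le> a")
      case True
      have "min a (g l) \<le> min a (h l)" if l: "0 \<le> l" "l < M" for l
      proof (cases "l \<le> k")
        case True
        then show ?thesis using hk(2)[of l] by auto
      next
        case False
        show ?thesis
        proof (cases "g l > 0")
          case pos: True
          have "g l + 2 * (l - k) \<le> g k" using False k0 pos by (intro decay) auto
          then have "g l \<le> h l" using \<open>g k \<le> a\<close> by (auto simp: h_def k_def field_simps)
          then show ?thesis by auto
        next
          case False
          then show ?thesis using g0[of l] h0[of l] l nn by auto
        qed
      qed
      then show ?thesis
        by (intro nn_integral_mono) (auto simp: indicator_def intro!: ennreal_leI)
    next
      case False
      then have gk: "g k > 0" "g k > a" using nn by auto
      \<comment> \<open>In this case \<open>g\<close> dominates \<open>h\<close> below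
        \<open>k\<close>. The totals agree, so above \<open>k\<close> the integral of
        \<open>g\<close> is at most that of \<open>h\<close>; on that side \<open>h\<close> is not
        truncated, and below \<open>k\<close> the truncated \<open>h\<close> is already the maximal
        value \<open>a\<close>.\<close>
      have gh: "h l \<le> g l" if "0 \<le> l" "l < k" for l
        using decay[of l k] gk that by (auto simp: h_def k_def field_simps)
      define I where "I = (\<lambda>(S::real set) (f::real\<Rightarrow>real). (\<integral>\<^sup>+l. indicator (S \<inter> {0..<M}) l * ennreal (f l)))"
      have split: "(\<integral>\<^sup>+l. indicator {0..<M} l * ennreal (f l)) = I {..<k} f + I {k..} f"
        if [measurable]: "f \<in> borel_measurable borel" for f
        unfolding I_def by (subst nn_integral_add[symmetric])
          (auto intro!: nn_integral_cong simp: indicator_def)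
      have A: "I {..<k} h \<le> I {..<k} g"
        unfolding I_def using gh by (intro nn_integral_mono) (auto simp: indicator_def intro!: ennreal_leI)
      have fin: "I {..<k} h < \<infinity>"
      proof -
        have "I {..<k} h \<le> I {..<k} h + I {k..} h" by simp
        also have "\<dots> = ennreal (b * c)" using split[of h] nn_integral_affine[OF nn(2,3)] by (simp add: M_def h_def)
        finally show ?thesis by (rule order_le_less_trans) simp
      qed
      have "I {..<k} h + I {k..} g \<le> I {..<k} g + I {k..} g" using A by (intro add_right_mono)
      also have "\<dots> = I {..<k} h + I {k..} h" using split[of g] split[of h] tot by simp
      finally have B: "I {k..} g \<le> I {k..} h" using fin
        by (subst (asm) ennreal_add_left_cancel_le) auto
      have "I {..<k} (\<lambda>l. min a (g l)) \<le> I {..<k} (\<lambda>l. min a (h l))"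
        unfolding I_def using mh(1) by (intro nn_integral_mono) (simp add: indicator_def ennreal_leI)
      moreover have "I {k..} (\<lambda>l. min a (g l)) \<le> I {k..} g"
        unfolding I_def by (intro nn_integral_mono) (auto simp: indicator_def intro!: ennreal_leI)
      moreover have "I {k..} h = I {k..} (\<lambda>l. min a (h l))"
        unfolding I_def using mh(2) by (intro nn_integral_cong) (simp add: indicator_def)
      ultimately have "I {..<k} (\<lambda>l. min a (g l)) + I {k..} (\<lambda>l. min a (g l))
          \<le> I {..<k} (\<lambda>l. min a (h l)) + I {k..} (\<lambda>l. min a (h l))"
        using B by (intro add_mono) auto
      then show ?thesis by (subst (1 2) split) auto
    qed
  qed
  then show ?thesis by (simp add: M_def h_def)
qed

lemma symmetric_window_superlevel:
  assumes "0 \<le> l" "l < min b c" "2 * \<bar>s\<bar> < b + c - 2 * l"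
  shows "ennreal l < vol ({t. 2 * \<bar>t\<bar> < b} \<inter> {t. 2 * \<bar>s - t\<bar> < c})"
proof -
  have "{t. 2 * \<bar>t\<bar> < b} \<inter> {t. 2 * \<bar>s - t\<bar> < c} = {max (-b/2) (s - c/2)<..<min (b/2) (s + c/2)}"
    by (auto simp: abs_less_iff field_simps abs_if split: if_splits)
  note eq = this
  have "l < min (b/2) (s + c/2) - max (-b/2) (s - c/2)"
    using assms by (auto simp: min_def max_def abs_if split: if_splits)
  moreover from this assms(1) have "max (-b/2) (s - c/2) \<le> min (b/2) (s + c/2)" by linarith
  ultimately show ?thesis unfolding eq emeasure_lborel_Ioo[OF \<open>max (-b/2) (s - c/2) \<le> min (b/2) (s + c/2)\<close>]
    using assms(1) by (intro ennreal_lessI) linarith+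
qed

lemma emeasure_centered_interval:
  assumes "0 \<le> x"
  shows "vol {s::real. 2 * \<bar>s\<bar> < x} = ennreal x"
proof -
  have "{s::real. 2 * \<bar>s\<bar> < x} = {-x/2<..<x/2}" by (auto simp: abs_less_iff field_simps abs_if split: if_splits)
  then show ?thesis using assms by simp
qed

text \<open>In layers, the left side integrates the measure of
  \<open>A \<inter> {win B h > l}\<close>, which is at most the smaller of the two measures. For
  centred intervals the superlevel sets of the window are centred intervals as well, hence nested
  with \<open>{s. 2 * \<bar>s\<bar> < a}\<close>, and that minimum is attained. What remains is the
  comparison of layer sizes truncated at \<open>a\<close>.\<close>

lemma riesz_window:
  fixes A B :: "real set" and h :: real
  assumes [measurable]: "A \<in> sets borel" "B \<in> sets borel" and bd: "bounded A" "bounded B" and h: "h \<ge> 0"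
  defines "a \<equiv> measure lborel A" and "b \<equiv> measure lborel B"
  shows "(\<integral>\<^sup>+s. \<integral>\<^sup>+t. indicator A s * indicator B t * indicator {-h..h} (s - t))
    \<le> (\<integral>\<^sup>+s. \<integral>\<^sup>+t. indicator {s. 2 * \<bar>s\<bar> < a} s * indicator {t. 2 * \<bar>t\<bar> < b} t * indicator {r. 2 * \<bar>r\<bar> < 2 * h} (s - t))"
proof -
  define c where "c = 2 * h"
  have c: "c \<ge> 0" using h by (simp add: c_def)
  have ab: "a \<ge> 0" "b \<ge> 0" by (auto simp: a_def b_def)
  have fA: "vol A = ennreal a" and fB: "vol B = ennreal b"
    using emeasure_bounded_finite[OF bd(1)] emeasure_bounded_finite[OF bd(2)]
    by (auto simp: a_def b_def emeasure_eq_ennreal_measure)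
  define g where "g l = measure lborel {s. win B h s > max l 0}" for l
  have fin: "vol {s. win B h s > l} = ennreal (g l)" if "l \<ge> 0" for l
    using emeasure_bounded_finite[OF bounded_win_superlevel[OF _ bd(2) that, of h]] that
    by (simp add: g_def emeasure_eq_ennreal_measure max_absorb1)
  have gmono: "g m \<le> g l" if "l \<le> m" for l m
    unfolding g_def using that by (intro win_superlevel_mono bd) auto
  have [measurable]: "g \<in> borel_measurable borel"
  proof -
    have "mono (\<lambda>x. - g x)" using gmono by (auto simp: mono_def)
    then have "(\<lambda>x. - g x) \<in> borel_measurable borel" by (rule borel_measurable_mono)
    then have "(\<lambda>x. - (- g x)) \<in> borel_measurable borel" by (rule borel_measurable_uminus)
    then show ?thesis by simp
  qed
  have gz: "g l = 0" if "l \<ge> min b c" "l \<ge> 0" for l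
  proof -
    have "\<not> win B h s > l" for s
      using win_le_width[OF _ h, of B s] win_le_measure[of B h s] fB that
      by (auto simp: c_def b_def)
    then show ?thesis using that by (simp add: g_def max_def)
  qed
  have tot: "(\<integral>\<^sup>+l. indicator {0..<min b c} l * ennreal (g l)) = ennreal (b * c)"
  proof -
    have "ennreal (b * c) = (\<integral>\<^sup>+s. indicator UNIV s * ennreal (win B h s))"
      using nn_integral_win[of B h] h ab by (simp add: fB c_def ennreal_mult)
    also have "\<dots> = (\<integral>\<^sup>+l. indicator {0..} l * vol {s. win B h s > l})"
      by (subst nn_integral_win_layers) auto
    also have "\<dots> = (\<integral>\<^sup>+l. indicator {0..<min b c} l * ennreal (g l))"
      using fin gz by (intro nn_integral_cong) (auto simp: indicator_def)
    finally show ?thesis by simp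
  qed
  have decay: "g m + 2 * (m - l) \<le> g l" if "0 \<le> l" "l \<le> m" "g m > 0" for l m
  proof -
    have "max m 0 = m" using that by simp
    then have "{s. win B h s > m} \<noteq> {}" using that(3) unfolding g_def by (metis less_irrefl measure_empty)
    from win_superlevel_decay[OF _ bd(2) that(1,2) this]
    show ?thesis using that unfolding g_def by (simp only: max_absorb1 order_trans[OF that(1,2)]) simp
  qed
  have "(\<integral>\<^sup>+s. \<integral>\<^sup>+t. indicator A s * indicator B t * indicator {-h..h} (s - t))
      = (\<integral>\<^sup>+s. indicator A s * ennreal (win B h s))"
    by (subst win_eq_nn_integral) (auto simp: mult.assoc nn_integral_cmult)
  also have "\<dots> = (\<integral>\<^sup>+l. indicator {0..} l * vol (A \<inter> {s. win B h s > l}))"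
    by (rule nn_integral_win_layers) auto
  also have "\<dots> \<le> (\<integral>\<^sup>+l. indicator {0..<min b c} l * ennreal (min a (g l)))"
  proof (rule nn_integral_mono)
    fix l
    have "vol (A \<inter> {s. win B h s > l}) \<le> ennreal a"
      unfolding fA[symmetric] by (intro emeasure_mono) auto
    moreover have "vol (A \<inter> {s. win B h s > l}) \<le> ennreal (g l)" if "l \<ge> 0"
      unfolding fin[OF that, symmetric] by (intro emeasure_mono) auto
    ultimately show "indicator {0..} l * vol (A \<inter> {s. win B h s > l})
        \<le> indicator {0..<min b c} l * ennreal (min a (g l))"
      using gz[of l] by (auto simp: indicator_def min_def split: if_splits)
  qed
  also have "\<dots> \<le> (\<integral>\<^sup>+l. indicator {0..<min b c} l * ennreal (min a (b + c - 2 * l)))"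
    using tot decay ab c by (intro truncated_layers_le) (auto simp: g_def)
  also have "\<dots> \<le> (\<integral>\<^sup>+l. \<integral>\<^sup>+s. indicator {0..} l * (indicator {s. 2 * \<bar>s\<bar> < a} s * indicator {0<..} (win {t. 2 * \<bar>t\<bar> < b} h s - l)))"
  proof (rule nn_integral_mono)
    fix l :: real
    have "(\<integral>\<^sup>+s. indicator {s. 2 * \<bar>s\<bar> < a} s * indicator {0<..} (win {t. 2 * \<bar>t\<bar> < b} h s - l))
        \<ge> (\<integral>\<^sup>+s. indicator {s. 2 * \<bar>s\<bar> < min a (b + c - 2 * l)} s)" if l: "0 \<le> l" "l < min b c"
    proof (rule nn_integral_mono)
      fix s
      have "l < win {t. 2 * \<bar>t\<bar> < b} h s" if "2 * \<bar>s\<bar> < b + c - 2 * l"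
      proof -
        have "ennreal l < vol ({t. 2 * \<bar>t\<bar> < b} \<inter> {t. 2 * \<bar>s - t\<bar> < c})"
          by (rule symmetric_window_superlevel[OF l that])
        also have "\<dots> \<le> vol ({t. 2 * \<bar>t\<bar> < b} \<inter> {s-h..s+h})"
          by (intro emeasure_mono) (auto simp: c_def abs_less_iff)
        also have "\<dots> = ennreal (win {t. 2 * \<bar>t\<bar> < b} h s)" by (rule emeasure_win) measurable
        finally show ?thesis using l by (simp add: ennreal_less_iff)
      qed
      then show "indicator {s. 2 * \<bar>s\<bar> < min a (b + c - 2 * l)} s \<le>
         (indicator {s. 2 * \<bar>s\<bar> < a} s * indicator {0<..} (win {t. 2 * \<bar>t\<bar> < b} h s - l) :: ennreal)"
        by (auto simp: indicator_def)
    qed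
    moreover have "(\<integral>\<^sup>+s. indicator {s. 2 * \<bar>s\<bar> < min a (b + c - 2 * l)} s) = ennreal (min a (b + c - 2 * l))"
      if l: "0 \<le> l" "l < min b c"
    proof -
      have "0 \<le> min a (b + c - 2 * l)" using l ab by auto
      from emeasure_centered_interval[OF this] show ?thesis by simp
    qed
    ultimately show "indicator {0..<min b c} l * ennreal (min a (b + c - 2 * l))
      \<le> (\<integral>\<^sup>+s. indicator {0..} l * (indicator {s. 2 * \<bar>s\<bar> < a} s * indicator {0<..} (win {t. 2 * \<bar>t\<bar> < b} h s - l)))"
      by (subst nn_integral_cmult) (auto simp: indicator_def)
  qed
  also have "\<dots> = (\<integral>\<^sup>+l. indicator {0..} l * vol ({s. 2 * \<bar>s\<bar> < a} \<inter> {s. win {t. 2 * \<bar>t\<bar> < b} h s > l}))"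
  proof (rule nn_integral_cong)
    fix l :: real
    have "(\<integral>\<^sup>+s. indicator {s. 2 * \<bar>s\<bar> < a} s * indicator {0<..} (win {t. 2 * \<bar>t\<bar> < b} h s - l))
      = (\<integral>\<^sup>+s. indicator ({s. 2 * \<bar>s\<bar> < a} \<inter> {s. win {t. 2 * \<bar>t\<bar> < b} h s > l}) s)"
      by (intro nn_integral_cong) (auto simp: indicator_def)
    then show "(\<integral>\<^sup>+s. indicator {0..} l * (indicator {s. 2 * \<bar>s\<bar> < a} s * indicator {0<..} (win {t. 2 * \<bar>t\<bar> < b} h s - l)))
      = indicator {0..} l * vol ({s. 2 * \<bar>s\<bar> < a} \<inter> {s. win {t. 2 * \<bar>t\<bar> < b} h s > l})"
      by (subst nn_integral_cmult) auto
  qed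
  also have "\<dots> = (\<integral>\<^sup>+s. indicator {s. 2 * \<bar>s\<bar> < a} s * ennreal (win {t. 2 * \<bar>t\<bar> < b} h s))"
    by (rule nn_integral_win_layers[symmetric]) auto
  also have "\<dots> = (\<integral>\<^sup>+s. \<integral>\<^sup>+t. indicator {s. 2 * \<bar>s\<bar> < a} s * indicator {t. 2 * \<bar>t\<bar> < b} t * indicator {-h..h} (s - t))"
    by (subst win_eq_nn_integral) (auto simp: mult.assoc nn_integral_cmult)
  also have "\<dots> = (\<integral>\<^sup>+s. \<integral>\<^sup>+t. indicator {s. 2 * \<bar>s\<bar> < a} s * indicator {t. 2 * \<bar>t\<bar> < b} t * indicator {r. 2 * \<bar>r\<bar> < 2 * h} (s - t))"
  proof (rule nn_integral_cong, rule nn_integral_cong_AE)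
    fix s :: real
    have "AE t in lborel. t \<noteq> s - h" "AE t in lborel. t \<noteq> s + h" by (rule AE_lborel_singleton)+
    then show "AE t in lborel. (indicator {s. 2 * \<bar>s\<bar> < a} s * indicator {t. 2 * \<bar>t\<bar> < b} t * indicator {-h..h} (s - t) :: ennreal)
       = indicator {s. 2 * \<bar>s\<bar> < a} s * indicator {t. 2 * \<bar>t\<bar> < b} t * indicator {r. 2 * \<bar>r\<bar> < 2 * h} (s - t)"
      by eventually_elim (auto simp: indicator_def)
  qed
  finally show ?thesis .
qed

lemma measure_convex_real:
  fixes C :: "real set"
  assumes "convex C" "bounded C" "C \<noteq> {}" and [measurable]: "C \<in> sets borel"
  shows "C \<subseteq> {Inf C..Sup C}" "{Inf C<..<Sup C} \<subseteq> C" "measure lborel C = Sup C - Inf C" "Inf C \<le> Sup C"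
proof -
  have bb: "bdd_below C" "bdd_above C"
    using assms(2) by (auto simp: bounded_imp_bdd_below bounded_imp_bdd_above)
  show 1: "C \<subseteq> {Inf C..Sup C}" using bb by (auto simp: cInf_lower cSup_upper)
  show 2: "{Inf C<..<Sup C} \<subseteq> C"
  proof
    fix x assume "x \<in> {Inf C<..<Sup C}"
    then obtain a b where "a \<in> C" "a < x" "b \<in> C" "x < b"
      using cInf_lessD[OF assms(3), of x] less_cSupD[OF assms(3), of x] by auto
    then show "x \<in> C" using assms(1) mem_is_interval_1_I[of C a b x] by (auto simp: is_interval_convex_1)
  qed
  show 4: "Inf C \<le> Sup C" using assms(3) 1 by auto
  have "measure lborel {Inf C<..<Sup C} \<le> measure lborel C" "measure lborel C \<le> measure lborel {Inf C..Sup C}"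
    using measure_mono_fmeasurable[OF 1, of lborel] measure_mono_fmeasurable[OF 2, of lborel]
      emeasure_bounded_finite[OF assms(2)] emeasure_bounded_finite[of "{Inf C..Sup C}"]
    by (auto simp: fmeasurable_def)
  then show "measure lborel C = Sup C - Inf C" using 4 by simp
qed

text \<open>A bounded convex kernel is an interval up to its end points. Translating
  \<open>B\<close> by the midpoint \<open>k\<close> centres it, and translation does not change the
  length of \<open>B\<close>.\<close>

lemma riesz_line:
  fixes A B C :: "real set"
  assumes [measurable]: "A \<in> sets borel" "B \<in> sets borel" "C \<in> sets borel"
    and bd: "bounded A" "bounded B" "bounded C" and C: "convex C"
  shows "(\<integral>\<^sup>+s. \<integral>\<^sup>+t. indicator A s * indicator B t * indicator C (s - t))
    \<le> (\<integral>\<^sup>+s. \<integral>\<^sup>+t. indicator {s. 2 * \<bar>s\<bar> < measure lborel A} s * indicator {t. 2 * \<bar>t\<bar> < measure lborel B} t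
          * indicator {r. 2 * \<bar>r\<bar> < measure lborel C} (s - t))"
proof (cases "C = {}")
  case True
  then show ?thesis by simp
next
  case False
  note mC = measure_convex_real[OF C bd(3) False]
  define h k where "h = (Sup C - Inf C) / 2" and "k = (Inf C + Sup C) / 2"
  have h: "h \<ge> 0" "measure lborel C = 2 * h" using mC by (auto simp: h_def)
  define B' where "B' = {t. t - k \<in> B}"
  have [measurable]: "B' \<in> sets borel" unfolding B'_def by measurable
  have "B' = (\<lambda>t. t + k) ` B" by (force simp: B'_def image_iff)
  then have bB': "bounded B'" using bd(2) bounded_translation[of B k] by (simp add: add.commute)
  have ind: "indicator B' t = (indicator B (t - k) :: ennreal)" for t
    by (simp add: B'_def indicator_def)
  have "vol B' = vol B"
    using nn_integral_lborel_translate[of "indicator B" "-k"] by (simp flip: ind)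
  then have mB': "measure lborel B' = measure lborel B" by (simp add: measure_def)
  have "(\<integral>\<^sup>+s. \<integral>\<^sup>+t. indicator A s * indicator B t * indicator C (s - t))
    = (\<integral>\<^sup>+s. \<integral>\<^sup>+t. indicator A s * indicator B (t - k) * indicator C (s - (t - k)))"
  proof (rule nn_integral_cong)
    fix s
    show "(\<integral>\<^sup>+t. indicator A s * indicator B t * indicator C (s - t))
      = (\<integral>\<^sup>+t. indicator A s * indicator B (t - k) * indicator C (s - (t - k)))"
      using nn_integral_lborel_translate[of "\<lambda>t. indicator A s * indicator B t * indicator C (s - t)" "-k"]
      by simp
  qed
  also have "\<dots> \<le> (\<integral>\<^sup>+s. \<integral>\<^sup>+t. indicator A s * indicator B' t * indicator {-h..h} (s - t))"
    using mC(1) by (intro nn_integral_mono) (auto simp: indicator_def B'_def h_def k_def field_simps)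
  also have "\<dots> \<le> (\<integral>\<^sup>+s. \<integral>\<^sup>+t. indicator {s. 2 * \<bar>s\<bar> < measure lborel A} s * indicator {t. 2 * \<bar>t\<bar> < measure lborel B} t
          * indicator {r. 2 * \<bar>r\<bar> < measure lborel C} (s - t))"
    using riesz_window[of A B' h] bd bB' h mB' by simp
  finally show ?thesis .
qed

section \<open>Steiner symmetrization\<close>

lemma emeasure_lborel_shift:
  fixes S :: "'a::euclidean_space set"
  assumes [measurable]: "S \<in> sets borel"
  shows "vol {x. x + c \<in> S} = vol S"
proof -
  have "vol {x. x + c \<in> S} = (\<integral>\<^sup>+x. indicator {x. x + c \<in> S} x)"
    by (rule nn_integral_indicator[symmetric]) measurable
  also have "\<dots> = (\<integral>\<^sup>+x. indicator S (x + c))"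
    by (intro nn_integral_cong) (auto simp: indicator_def)
  also have "\<dots> = vol S" by (subst nn_integral_lborel_translate) auto
  finally show ?thesis .
qed

definition fiber :: "'a::euclidean_space \<Rightarrow> 'a set \<Rightarrow> 'a \<Rightarrow> real set" where
  "fiber u A x = {t. x + t *\<^sub>R u \<in> A}"

definition flen :: "'a::euclidean_space \<Rightarrow> 'a set \<Rightarrow> 'a \<Rightarrow> real" where
  "flen u A x = measure lborel (fiber u A x)"

text \<open>The strict inequality makes every fibre an open interval centred on the hyperplane
  orthogonal to \<open>u\<close> and drops the fibres of length 0. Open centred balls are thereby
  fixed exactly and not just up to null sets.\<close>

definition steiner :: "'a::euclidean_space \<Rightarrow> 'a set \<Rightarrow> 'a set" where
  "steiner u A = {x. 2 * \<bar>x \<bullet> u\<bar> < flen u A x}"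

lemma indicator_fiber: "indicator (fiber u A x) t = indicator A (x + t *\<^sub>R u)"
  by (simp add: fiber_def indicator_def)

lemma fiber_borel [measurable]:
  assumes [measurable]: "A \<in> sets borel"
  shows "fiber u A x \<in> sets borel"
  unfolding fiber_def by measurable

lemma bounded_fiber:
  assumes "bounded A" "norm u = 1"
  shows "bounded (fiber u A x)"
proof -
  obtain R where R: "\<And>y. y \<in> A \<Longrightarrow> norm y \<le> R" using assms(1) by (auto simp: bounded_iff)
  have "\<bar>t\<bar> \<le> R + norm x" if "t \<in> fiber u A x" for t
  proof -
    have "\<bar>t\<bar> = norm ((x + t *\<^sub>R u) - x)" using assms(2) by simp
    also have "\<dots> \<le> norm (x + t *\<^sub>R u) + norm x" by (rule norm_triangle_ineq4)
    finally show ?thesis using R[of "x + t *\<^sub>R u"] that by (auto simp: fiber_def)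
  qed
  then show ?thesis by (auto simp: bounded_iff)
qed

lemma emeasure_fiber:
  assumes "A \<in> sets borel" "bounded A" "norm u = 1"
  shows "vol (fiber u A x) = ennreal (flen u A x)"
  unfolding flen_def using emeasure_bounded_finite[OF bounded_fiber[OF assms(2,3), of x]]
  by (simp add: emeasure_eq_ennreal_measure)

lemma nn_integral_fiber:
  assumes [measurable]: "A \<in> sets borel" and "bounded A" "norm u = 1"
  shows "(\<integral>\<^sup>+t. indicator A (x + t *\<^sub>R u)) = ennreal (flen u A x)"
  using emeasure_fiber[OF assms, of x] by (simp flip: indicator_fiber)

lemma flen_shift: "flen u A (x + s *\<^sub>R u) = flen u A x" if [measurable]: "A \<in> sets borel"
proof -
  have "fiber u A (x + s *\<^sub>R u) = {t. t + s \<in> fiber u A x}"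
    by (auto simp: fiber_def algebra_simps)
  then show ?thesis by (simp add: flen_def measure_def emeasure_lborel_shift)
qed

lemma flen_measurable [measurable]:
  assumes [measurable]: "A \<in> sets borel"
  shows "flen u A \<in> borel_measurable borel"
proof -
  have "flen u A = (\<lambda>x. enn2real (\<integral>\<^sup>+t. indicator A (x + t *\<^sub>R u)))"
    unfolding indicator_fiber[symmetric] by (auto simp: flen_def measure_def)
  also have "\<dots> \<in> borel_measurable borel" by measurable
  finally show ?thesis .
qed

lemma steiner_borel [measurable]:
  assumes [measurable]: "A \<in> sets borel"
  shows "steiner u A \<in> sets borel"
  unfolding steiner_def by measurable

lemma flen_nonneg: "0 \<le> flen u A x" by (simp add: flen_def)

lemma flen_mono:
  assumes "A \<in> sets borel" "B \<in> sets borel" "bounded B" "norm u = 1" "A \<subseteq> B"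
  shows "flen u A x \<le> flen u B x"
  unfolding flen_def
  using assms emeasure_bounded_finite[OF bounded_fiber[OF assms(3,4), of x]]
  by (intro measure_mono_fmeasurable) (auto simp: fmeasurable_def fiber_def)

lemma steiner_mono:
  assumes "A \<in> sets borel" "B \<in> sets borel" "bounded B" "norm u = 1" "A \<subseteq> B"
  shows "steiner u A \<subseteq> steiner u B"
  by (auto simp: steiner_def intro: less_le_trans[OF _ flen_mono[OF assms]])

lemma fiber_steiner:
  assumes A: "A \<in> sets borel" and u: "norm u = 1"
  shows "fiber u (steiner u A) x = {t. 2 * \<bar>x \<bullet> u + t\<bar> < flen u A x}"
proof -
  have "u \<bullet> u = 1" using u by (simp add: dot_square_norm)
  then show ?thesis by (simp add: fiber_def steiner_def flen_shift[OF A] inner_add_left)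
qed

lemma flen_steiner:
  assumes A: "A \<in> sets borel" and u: "norm u = 1"
  shows "flen u (steiner u A) x = flen u A x"
proof -
  have "fiber u (steiner u A) x = {t. t + x \<bullet> u \<in> {s. 2 * \<bar>s\<bar> < flen u A x}}"
    unfolding fiber_steiner[OF assms] by (simp add: add.commute)
  then show ?thesis using emeasure_centered_interval[OF flen_nonneg[of u A x]]
    by (simp add: flen_def[of u "steiner u A"] measure_def emeasure_lborel_shift del: mem_Collect_eq)
      (simp add: flen_nonneg)
qed

lemma emeasure_eq_integral_flen:
  assumes [measurable]: "A \<in> sets borel" and "bounded A" and u: "norm u = 1"
  shows "vol A = (\<integral>\<^sup>+x. indicator {0..<1} (x \<bullet> u) * ennreal (flen u A x))"
proof -
  have "vol A = (\<integral>\<^sup>+x. indicator A x)" by simp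
  also have "\<dots> = (\<integral>\<^sup>+x. indicator {0..<1} (x \<bullet> u) * ennreal (flen u A x))"
    by (subst line_fubini[OF _ u]) (simp_all add: nn_integral_fiber assms)
  finally show ?thesis .
qed

text \<open>The chord through \<open>x\<close> in direction \<open>u\<close> has half-length
  \<open>sqrt d\<close>, and \<open>x\<close> lies in the ball exactly when
  \<open>(x \<bullet> u)\<^sup>2 < d\<close>. Combined with monotonicity this keeps symmetrized sets
  in a fixed ball.\<close>

lemma steiner_ball:
  assumes u: "norm u = 1"
  shows "steiner u (ball 0 R) = ball 0 R"
proof -
  have uu: "u \<bullet> u = 1" using u by (simp add: dot_square_norm)
  have nsq: "(norm (x + t *\<^sub>R u))\<^sup>2 = (x \<bullet> u + t)\<^sup>2 + ((norm x)\<^sup>2 - (x \<bullet> u)\<^sup>2)" for x t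
    unfolding power2_norm_eq_inner
    by (simp add: inner_add_left inner_add_right uu inner_commute power2_eq_square algebra_simps)
  show ?thesis
  proof (cases "R > 0")
    case False
    then have "ball 0 R = ({} :: 'a set)" by auto
    then show ?thesis by (simp only:) (simp add: steiner_def flen_def fiber_def)
  next
    case R: True
    have "x \<in> steiner u (ball 0 R) \<longleftrightarrow> x \<in> ball 0 R" for x
    proof -
      define d where "d = R\<^sup>2 - ((norm x)\<^sup>2 - (x \<bullet> u)\<^sup>2)"
      have eq: "fiber u (ball 0 R) x = {t. (x \<bullet> u + t)\<^sup>2 < d}"
      proof -
        have "norm (x + t *\<^sub>R u) < R \<longleftrightarrow> (x \<bullet> u + t)\<^sup>2 < d" for t
        proof -
          have "norm (x + t *\<^sub>R u) < R \<longleftrightarrow> (norm (x + t *\<^sub>R u))\<^sup>2 < R\<^sup>2"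
            using R by (metis norm_ge_zero power_strict_mono power_less_imp_less_base less_imp_le zero_less_numeral)
          then show ?thesis unfolding nsq by (auto simp: d_def)
        qed
        then show ?thesis by (auto simp: fiber_def)
      qed
      have "norm x < R \<longleftrightarrow> (norm x)\<^sup>2 < R\<^sup>2"
        using R by (metis norm_ge_zero power_strict_mono power_less_imp_less_base less_imp_le zero_less_numeral)
      then have inb: "x \<in> ball 0 R \<longleftrightarrow> (x \<bullet> u)\<^sup>2 < d" by (auto simp: d_def)
      show ?thesis
      proof (cases "d > 0")
        case False
        then have "fiber u (ball 0 R) x = {}" "\<not> (x \<bullet> u)\<^sup>2 < d" unfolding eq by (auto simp: not_less intro: order_trans[of _ 0])
        then show ?thesis using inb by (simp add: steiner_def flen_def)
      next
        case True
        have sq: "y\<^sup>2 < d \<longleftrightarrow> \<bar>y\<bar> < sqrt d" for y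
          by (metis real_sqrt_abs real_sqrt_less_iff)
        have "fiber u (ball 0 R) x = {t. t + x \<bullet> u \<in> {s. 2 * \<bar>s\<bar> < 2 * sqrt d}}"
          unfolding eq sq by (simp add: add.commute)
        then have "vol (fiber u (ball 0 R) x) = ennreal (2 * sqrt d)"
          using emeasure_centered_interval[of "2 * sqrt d"] True emeasure_lborel_shift[of "{s. 2 * \<bar>s\<bar> < 2 * sqrt d}" "x \<bullet> u"]
          by simp
        then have "flen u (ball 0 R) x = 2 * sqrt d" using True by (simp add: flen_def measure_def)
        then show ?thesis using inb sq by (simp add: steiner_def)
      qed
    qed
    then show ?thesis by blast
  qed
qed

lemma emeasure_steiner:
  assumes A: "A \<in> sets borel" "bounded A" and u: "norm u = 1"
  shows "vol (steiner u A) = vol A" "bounded (steiner u A)"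
proof -
  obtain R where "A \<subseteq> ball 0 R" using A(2) bounded_subset_ballD by blast
  then have "steiner u A \<subseteq> ball 0 R"
    using steiner_mono[OF A(1) _ _ u, of "ball 0 R"] steiner_ball[OF u] by auto
  then show b: "bounded (steiner u A)" using bounded_ball bounded_subset by blast
  show "vol (steiner u A) = vol A"
    using A b u by (simp add: emeasure_eq_integral_flen flen_steiner)
qed

definition riesz :: "'a::euclidean_space set \<Rightarrow> 'a set \<Rightarrow> 'a set \<Rightarrow> ennreal" where
  "riesz A B K = (\<integral>\<^sup>+x. \<integral>\<^sup>+y. indicator A x * indicator B y * indicator K (x - y))"

lemma riesz_fibers:
  assumes [measurable]: "A \<in> sets borel" "B \<in> sets borel" "K \<in> sets borel" and u: "norm u = 1"
  shows "riesz A B K = (\<integral>\<^sup>+x. indicator {0..<1} (x \<bullet> u) * (\<integral>\<^sup>+y. indicator {0..<1} (y \<bullet> u) *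
      (\<integral>\<^sup>+s. \<integral>\<^sup>+t. indicator (fiber u A x) s * indicator (fiber u B y) t * indicator (fiber u K (x - y)) (s - t)
)))"
proof -
  have eq: "x + s *\<^sub>R u - (y + t *\<^sub>R u) = x - y + (s - t) *\<^sub>R u" for x y s t
    by (simp add: algebra_simps)
  have "riesz A B K = (\<integral>\<^sup>+x. \<integral>\<^sup>+y. indicator {0..<1} (y \<bullet> u) *
      (\<integral>\<^sup>+t. indicator A x * indicator B (y + t *\<^sub>R u) * indicator K (x - (y + t *\<^sub>R u))))"
    unfolding riesz_def by (subst (2) line_fubini[OF _ u]) auto
  also have "\<dots> = (\<integral>\<^sup>+x. indicator {0..<1} (x \<bullet> u) * (\<integral>\<^sup>+s. \<integral>\<^sup>+y. indicator {0..<1} (y \<bullet> u) *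
      (\<integral>\<^sup>+t. indicator A (x + s *\<^sub>R u) * indicator B (y + t *\<^sub>R u) * indicator K (x + s *\<^sub>R u - (y + t *\<^sub>R u)))))"
    by (subst line_fubini[OF _ u]) auto
  also have "\<dots> = (\<integral>\<^sup>+x. indicator {0..<1} (x \<bullet> u) * (\<integral>\<^sup>+y. \<integral>\<^sup>+s. indicator {0..<1} (y \<bullet> u) *
      (\<integral>\<^sup>+t. indicator A (x + s *\<^sub>R u) * indicator B (y + t *\<^sub>R u) * indicator K (x + s *\<^sub>R u - (y + t *\<^sub>R u)))))"
    by (subst lborel_pair.Fubini') auto
  also have "\<dots> = (\<integral>\<^sup>+x. indicator {0..<1} (x \<bullet> u) * (\<integral>\<^sup>+y. indicator {0..<1} (y \<bullet> u) * (\<integral>\<^sup>+s.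
      (\<integral>\<^sup>+t. indicator A (x + s *\<^sub>R u) * indicator B (y + t *\<^sub>R u) * indicator K (x + s *\<^sub>R u - (y + t *\<^sub>R u))))))"
    by (subst nn_integral_cmult) auto
  finally show ?thesis unfolding indicator_fiber eq .
qed

text \<open>For each pair of base points this is the inequality on the line. The centred intervals
  that it produces are the fibres of the symmetrized sets up to shifts by
  \<open>x \<bullet> u\<close> and \<open>y \<bullet> u\<close>, and these shifts are consistent
  with the shift of the kernel fibre over \<open>x - y\<close>.\<close>

lemma riesz_steiner:
  assumes [measurable]: "A \<in> sets borel" "B \<in> sets borel" "K \<in> sets borel" and bd: "bounded A" "bounded B" "bounded K"
    and K: "convex K" and u: "norm u = 1"
  shows "riesz A B K \<le> riesz (steiner u A) (steiner u B) (steiner u K)"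
proof -
  have "(\<integral>\<^sup>+s. \<integral>\<^sup>+t. indicator (fiber u A x) s * indicator (fiber u B y) t * indicator (fiber u K (x - y)) (s - t))
    \<le> (\<integral>\<^sup>+s. \<integral>\<^sup>+t. indicator (fiber u (steiner u A) x) s * indicator (fiber u (steiner u B) y) t * indicator (fiber u (steiner u K) (x - y)) (s - t))"
    for x y
  proof -
    define F where "F s t = (indicator {s. 2 * \<bar>s\<bar> < flen u A x} s * indicator {t. 2 * \<bar>t\<bar> < flen u B y} t
          * indicator {r. 2 * \<bar>r\<bar> < flen u K (x - y)} (s - t) :: ennreal)" for s t :: real
    have [measurable]: "case_prod F \<in> borel_measurable (borel \<Otimes>\<^sub>M borel)" unfolding F_def by measurable
    have cf: "convex (fiber u K (x - y))"
    proof (rule convexI)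
      fix s t a b :: real assume h: "s \<in> fiber u K (x-y)" "t \<in> fiber u K (x-y)" "0 \<le> a" "0 \<le> b" "a + b = 1"
      have "a *\<^sub>R (x - y + s *\<^sub>R u) + b *\<^sub>R (x - y + t *\<^sub>R u) \<in> K"
        using h by (intro convexD[OF K]) (auto simp: fiber_def)
      moreover have "a *\<^sub>R (x - y + s *\<^sub>R u) + b *\<^sub>R (x - y + t *\<^sub>R u) = (a + b) *\<^sub>R (x - y) + (a * s + b * t) *\<^sub>R u"
        by (simp add: algebra_simps)
      ultimately show "a *\<^sub>R s + b *\<^sub>R t \<in> fiber u K (x-y)" using h(5) by (simp add: fiber_def)
    qed
    have "(\<integral>\<^sup>+s. \<integral>\<^sup>+t. indicator (fiber u A x) s * indicator (fiber u B y) t * indicator (fiber u K (x - y)) (s - t))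
        \<le> (\<integral>\<^sup>+s. \<integral>\<^sup>+t. F s t)"
      unfolding F_def flen_def using bounded_fiber[OF bd(1) u] bounded_fiber[OF bd(2) u] bounded_fiber[OF bd(3) u] cf
      by (intro riesz_line) auto
    also have "\<dots> = (\<integral>\<^sup>+s. \<integral>\<^sup>+t. F (s + x \<bullet> u) t)"
      by (rule nn_integral_lborel_translate[symmetric]) measurable
    also have "\<dots> = (\<integral>\<^sup>+s. \<integral>\<^sup>+t. F (s + x \<bullet> u) (t + y \<bullet> u))"
      by (rule nn_integral_cong, rule nn_integral_lborel_translate[symmetric]) measurable
    also have "\<dots> = (\<integral>\<^sup>+s. \<integral>\<^sup>+t. indicator (fiber u (steiner u A) x) s * indicator (fiber u (steiner u B) y) t * indicator (fiber u (steiner u K) (x - y)) (s - t))"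
      unfolding F_def fiber_steiner[OF assms(1) u] fiber_steiner[OF assms(2) u] fiber_steiner[OF assms(3) u]
      by (simp add: indicator_def inner_diff_left algebra_simps)
    finally show ?thesis .
  qed
  note ineq = this
  show ?thesis
    unfolding riesz_fibers[OF assms(1-3) u]
      riesz_fibers[OF steiner_borel[OF assms(1)] steiner_borel[OF assms(2)] steiner_borel[OF assms(3)] u]
    by (rule nn_integral_mono, rule mult_left_mono, rule nn_integral_mono, rule mult_left_mono[OF ineq]) auto
qed

text \<open>Symmetrization can be iterated only if the kernel stays convex. The reason is that the
  fibre length is concave where it is positive: convex combinations of the fibres over
  \<open>x\<close> and \<open>y\<close> lie in the fibre over \<open>z\<close>, and for intervals
  the lengths add up.\<close>

lemma convex_steiner:
  assumes [measurable]: "K \<in> sets borel" and K: "convex K" "bounded K" and u: "norm u = 1"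
  shows "convex (steiner u K)"
proof (rule convexI)
  fix x y and a b :: real
  assume x: "x \<in> steiner u K" and y: "y \<in> steiner u K" and ab: "0 \<le> a" "0 \<le> b" "a + b = 1"
  define z where "z = a *\<^sub>R x + b *\<^sub>R y"
  have bf: "bounded (fiber u K w)" for w by (rule bounded_fiber[OF K(2) u])
  have comb: "a * s + b * t \<in> fiber u K z" if "s \<in> fiber u K x" "t \<in> fiber u K y" for s t
  proof -
    have "a *\<^sub>R (x + s *\<^sub>R u) + b *\<^sub>R (y + t *\<^sub>R u) \<in> K"
      using that ab by (intro convexD[OF K(1)]) (auto simp: fiber_def)
    then show ?thesis by (simp add: fiber_def z_def algebra_simps)
  qed
  have cf: "convex (fiber u K w)" for w
  proof (rule convexI)
    fix s t a b :: real assume h: "s \<in> fiber u K w" "t \<in> fiber u K w" "0 \<le> a" "0 \<le> b" "a + b = 1"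
    have "a *\<^sub>R (w + s *\<^sub>R u) + b *\<^sub>R (w + t *\<^sub>R u) \<in> K"
      using h by (intro convexD[OF K(1)]) (auto simp: fiber_def)
    moreover have "a *\<^sub>R (w + s *\<^sub>R u) + b *\<^sub>R (w + t *\<^sub>R u) = (a + b) *\<^sub>R w + (a * s + b * t) *\<^sub>R u"
      by (simp add: algebra_simps)
    ultimately show "a *\<^sub>R s + b *\<^sub>R t \<in> fiber u K w" using h(5) by (simp add: fiber_def)
  qed
  have pos: "0 < flen u K x" "0 < flen u K y"
    using x y by (auto simp: steiner_def intro: le_less_trans[OF _ x[unfolded steiner_def, simplified]])
  then have ne: "fiber u K x \<noteq> {}" "fiber u K y \<noteq> {}" by (auto simp: flen_def)
  note mx = measure_convex_real[OF cf bf ne(1) fiber_borel[OF assms(1)], folded flen_def]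
  note my = measure_convex_real[OF cf bf ne(2) fiber_borel[OF assms(1)], folded flen_def]
  define lo hi where "lo = a * Inf (fiber u K x) + b * Inf (fiber u K y)"
    and "hi = a * Sup (fiber u K x) + b * Sup (fiber u K y)"
  have len: "hi - lo = a * flen u K x + b * flen u K y"
    by (simp add: lo_def hi_def mx(3) my(3) algebra_simps)
  have sub: "{lo<..<hi} \<subseteq> fiber u K z"
  proof
    fix t assume t: "t \<in> {lo<..<hi}"
    \<comment> \<open>\<theta> is the relative position of \<open>t\<close> between
      \<open>lo\<close> and \<open>hi\<close>; the points at the same relative position in the
      fibres over \<open>x\<close> and \<open>y\<close> combine to \<open>t\<close>.\<close>
    define \<theta> where "\<theta> = (t - lo) / (hi - lo)"
    have th: "0 < \<theta>" "\<theta> < 1" using t by (auto simp: \<theta>_def field_simps)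
    have in1: "Inf (fiber u K w) + \<theta> * (Sup (fiber u K w) - Inf (fiber u K w)) \<in> fiber u K w"
      if "{Inf (fiber u K w)<..<Sup (fiber u K w)} \<subseteq> fiber u K w" "0 < Sup (fiber u K w) - Inf (fiber u K w)" for w
    proof (rule subsetD[OF that(1)])
      have "\<theta> * (Sup (fiber u K w) - Inf (fiber u K w)) < Sup (fiber u K w) - Inf (fiber u K w)"
        using mult_strict_right_mono[OF th(2) that(2)] by simp
      then show "Inf (fiber u K w) + \<theta> * (Sup (fiber u K w) - Inf (fiber u K w)) \<in> {Inf (fiber u K w)<..<Sup (fiber u K w)}"
        using mult_pos_pos[OF th(1) that(2)] by simp
    qed
    have "a * (Inf (fiber u K x) + \<theta> * (Sup (fiber u K x) - Inf (fiber u K x)))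
        + b * (Inf (fiber u K y) + \<theta> * (Sup (fiber u K y) - Inf (fiber u K y))) = lo + \<theta> * (hi - lo)"
      by (simp add: lo_def hi_def algebra_simps)
    also have "\<dots> = t" using t by (simp add: \<theta>_def)
    finally show "t \<in> fiber u K z"
      using comb[OF in1[OF mx(2)] in1[OF my(2)]] pos mx(3) my(3) by simp
  qed
  have le: "hi - lo \<le> flen u K z"
  proof -
    have "hi - lo \<le> measure lborel {lo<..<hi}"
      by (cases "lo \<le> hi") auto
    also have "\<dots> \<le> measure lborel (fiber u K z)"
      using sub emeasure_bounded_finite[OF bf[of z]]
      by (intro measure_mono_fmeasurable) (auto simp: fmeasurable_def)
    finally show ?thesis by (simp add: flen_def)
  qed
  have "2 * \<bar>z \<bullet> u\<bar> \<le> a * (2 * \<bar>x \<bullet> u\<bar>) + b * (2 * \<bar>y \<bullet> u\<bar>)"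
    using abs_triangle_ineq[of "a * (x \<bullet> u)" "b * (y \<bullet> u)"] ab by (simp add: z_def inner_add_left abs_mult)
  also have "\<dots> < a * flen u K x + b * flen u K y"
  proof (cases "a = 0")
    case True then show ?thesis using ab y by (simp add: steiner_def)
  next
    case False
    then have "a * (2 * \<bar>x \<bullet> u\<bar>) < a * flen u K x" using ab x by (simp add: steiner_def)
    moreover have "b * (2 * \<bar>y \<bullet> u\<bar>) \<le> b * flen u K y" using ab y by (intro mult_left_mono) (auto simp: steiner_def)
    ultimately show ?thesis by linarith
  qed
  also have "\<dots> \<le> flen u K z" using le len by simp
  finally show "a *\<^sub>R x + b *\<^sub>R y \<in> steiner u K" by (simp add: steiner_def z_def)
qed

section \<open>Overlaps of sets and the gain of one symmetrization\<close>

definition overlap :: "'a::euclidean_space set \<Rightarrow> 'a set \<Rightarrow> 'a \<Rightarrow> ennreal" where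
  "overlap P Q z = (\<integral>\<^sup>+x. indicator P x * indicator Q (x + z))"

lemma overlap_measurable [measurable]:
  assumes [measurable]: "P \<in> sets borel" "Q \<in> sets borel"
  shows "overlap P Q \<in> borel_measurable borel"
  unfolding overlap_def by measurable

text \<open>The right side is the product of fibre lengths by which \<open>steiner_gain\<close>
  measures the progress in direction \<open>u\<close>. The left side is accessible to averaging over
  directions, since all the overlaps together integrate to \<open>vol P * vol Q\<close>.\<close>

lemma nn_integral_overlap_line:
  assumes [measurable]: "P \<in> sets borel" "Q \<in> sets borel" and bd: "bounded P" "bounded Q" and u: "norm u = 1"
  shows "(\<integral>\<^sup>+t. overlap P Q (t *\<^sub>R u))
     = (\<integral>\<^sup>+x. indicator {0..<1} (x \<bullet> u) * ennreal (flen u P x * flen u Q x))"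
proof -
  have "(\<integral>\<^sup>+t. overlap P Q (t *\<^sub>R u)) = (\<integral>\<^sup>+x. \<integral>\<^sup>+t. indicator P x * indicator Q (x + t *\<^sub>R u))"
    unfolding overlap_def by (rule lborel_pair.Fubini') measurable
  also have "\<dots> = (\<integral>\<^sup>+x. indicator P x * ennreal (flen u Q x))"
    by (rule nn_integral_cong, subst nn_integral_cmult) (auto simp: nn_integral_fiber bd u)
  also have "\<dots> = (\<integral>\<^sup>+x. indicator {0..<1} (x \<bullet> u) * (\<integral>\<^sup>+s. indicator P (x + s *\<^sub>R u) * ennreal (flen u Q x)))"
    by (subst line_fubini[OF _ u]) (auto simp: flen_shift)
  also have "\<dots> = (\<integral>\<^sup>+x. indicator {0..<1} (x \<bullet> u) * ennreal (flen u P x * flen u Q x))"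
    by (rule nn_integral_cong, subst nn_integral_multc) (auto simp: nn_integral_fiber bd u flen_nonneg ennreal_mult)
  finally show ?thesis .
qed

lemma flen_le_diameter:
  assumes [measurable]: "P \<in> sets borel" and "P \<subseteq> ball 0 R" and u: "norm u = 1" and R: "R > 0"
  shows "flen u P x \<le> 2 * R"
proof -
  have "u \<bullet> u = 1" using u by (simp add: dot_square_norm)
  have "fiber u P x \<subseteq> {- R - x \<bullet> u..R - x \<bullet> u}"
  proof
    fix t assume "t \<in> fiber u P x"
    then have "norm (x + t *\<^sub>R u) < R" using assms(2) by (auto simp: fiber_def)
    moreover have "\<bar>(x + t *\<^sub>R u) \<bullet> u\<bar> \<le> norm (x + t *\<^sub>R u)"
      using Cauchy_Schwarz_ineq2[of "x + t *\<^sub>R u" u] u by simp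
    ultimately show "t \<in> {- R - x \<bullet> u..R - x \<bullet> u}" using \<open>u \<bullet> u = 1\<close> by (auto simp: inner_add_left)
  qed
  then have "measure lborel (fiber u P x) \<le> measure lborel {- R - x \<bullet> u..R - x \<bullet> u}"
    by (intro measure_mono_fmeasurable) (auto simp: fmeasurable_def emeasure_lborel_Icc_eq)
  then show ?thesis using R by (simp add: flen_def)
qed

lemma flen_Diff:
  assumes [measurable]: "A \<in> sets borel" "D \<in> sets borel" and bd: "bounded A" "bounded D" and u: "norm u = 1"
  shows "flen u A x - flen u D x = flen u (A - D) x - flen u (D - A) x"
proof -
  have 1: "flen u A x = flen u (A \<inter> D) x + flen u (A - D) x"
    if [measurable]: "A \<in> sets borel" "D \<in> sets borel" and "bounded A" for A D
  proof -
    have "measure lborel (fiber u A x) = measure lborel (fiber u (A \<inter> D) x) + measure lborel (fiber u (A - D) x)"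
      using emeasure_bounded_finite[OF bounded_fiber[OF \<open>bounded A\<close> u, of x]]
        emeasure_bounded_finite[OF bounded_fiber[OF bounded_subset[OF \<open>bounded A\<close>] u, of "A \<inter> D" x]]
        emeasure_bounded_finite[OF bounded_fiber[OF bounded_subset[OF \<open>bounded A\<close>] u, of "A - D" x]]
      by (subst measure_Union[symmetric]) (auto simp: fiber_def intro!: arg_cong[where f="measure lborel"])
    then show ?thesis by (simp add: flen_def)
  qed
  show ?thesis using 1[of A D] 1[of D A] bd by (simp add: Int_commute)
qed

text \<open>On each line, a surplus of length \<open>\<alpha>\<close> of \<open>A - D\<close> and a deficit of length \<open>\<beta>\<close> cancel
  up to \<open>(\<alpha> - \<beta>)\<^sup>+\<close>, which gains at least \<open>\<alpha> * \<beta> / (2 * R)\<close>.\<close>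

lemma steiner_gain:
  assumes [measurable]: "A \<in> sets borel" and A: "A \<subseteq> ball 0 R" and r: "r \<le> R" and R: "R > 0" and u: "norm u = 1"
  defines "D \<equiv> ball 0 r"
  shows "ennreal (2 * R) * vol (steiner u A - D) + (\<integral>\<^sup>+t. overlap (A - D) (D - A) (t *\<^sub>R u))
     \<le> ennreal (2 * R) * vol (A - D)"
proof -
  have [measurable]: "D \<in> sets borel" by (simp add: D_def)
  have bA: "bounded A" using A bounded_ball bounded_subset by blast
  have bD: "bounded D" by (simp add: D_def)
  have DR: "D \<subseteq> ball 0 R" using r by (auto simp: D_def)
  have SD: "steiner u D = D" unfolding D_def by (rule steiner_ball[OF u])
  have bds: "bounded (A - D)" "bounded (D - A)" "bounded (steiner u A - D)"
    using bA bD emeasure_steiner(2)[OF assms(1) bA u] by (auto intro: bounded_subset)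
  have fS: "flen u (steiner u A - D) x = max (flen u A x - flen u D x) 0" for x
  proof -
    have fib: "fiber u (steiner u A - D) x = {t. 2 * \<bar>x \<bullet> u + t\<bar> < flen u A x} - {t. 2 * \<bar>x \<bullet> u + t\<bar> < flen u D x}"
      using fiber_steiner[OF assms(1) u, of x] fiber_steiner[of D u x] u SD by (auto simp: fiber_def)
    show ?thesis
    proof (cases "flen u A x \<le> flen u D x")
      case True
      then have "fiber u (steiner u A - D) x = {}" unfolding fib by auto
      then show ?thesis using True by (simp add: flen_def[of u "steiner u A - D"])
    next
      case False
      have c: "vol {t. 2 * \<bar>x \<bullet> u + t\<bar> < l} = ennreal l" if "l \<ge> 0" for l
        using emeasure_lborel_shift[of "{s. 2 * \<bar>s\<bar> < l}" "x \<bullet> u"] emeasure_centered_interval[OF that]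
        by (simp add: add.commute)
      have "vol (fiber u (steiner u A - D) x) = ennreal (flen u A x) - ennreal (flen u D x)"
        unfolding fib using False c flen_nonneg[of u A x] flen_nonneg[of u D x]
        by (subst emeasure_Diff) auto
      then have "vol (fiber u (steiner u A - D) x) = ennreal (flen u A x - flen u D x)"
        using flen_nonneg[of u D x] by (simp add: ennreal_minus)
      then show ?thesis using False by (simp add: flen_def[of u "steiner u A - D"] measure_def)
    qed
  qed
  \<comment> \<open>The new surplus \<open>max (\<alpha> - \<beta>) 0\<close> equals
    \<open>\<alpha> - min \<alpha> \<beta>\<close>, and
    \<open>\<alpha> * \<beta> \<le> 2 * R * min \<alpha> \<beta>\<close> because neither length
    exceeds the diameter \<open>2 * R\<close>.\<close>
  have pt: "2 * R * flen u (steiner u A - D) x + flen u (A - D) x * flen u (D - A) x \<le> 2 * R * flen u (A - D) x" for x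
  proof -
    define \<alpha> \<beta> where "\<alpha> = flen u (A - D) x" and "\<beta> = flen u (D - A) x"
    have nn: "0 \<le> \<alpha>" "0 \<le> \<beta>" by (auto simp: \<alpha>_def \<beta>_def flen_nonneg)
    have le: "\<alpha> \<le> 2 * R" "\<beta> \<le> 2 * R"
      unfolding \<alpha>_def \<beta>_def using A DR u R by (auto intro!: flen_le_diameter)
    have eq: "flen u (steiner u A - D) x = max (\<alpha> - \<beta>) 0"
      unfolding fS flen_Diff[OF assms(1) _ bA bD u, OF \<open>D \<in> sets borel\<close>] \<alpha>_def \<beta>_def ..
    show ?thesis
    proof (cases "\<beta> \<le> \<alpha>")
      case True
      have "\<alpha> * \<beta> \<le> 2 * R * \<beta>" using le nn by (intro mult_right_mono) auto
      then show ?thesis using True unfolding eq \<alpha>_def[symmetric] \<beta>_def[symmetric] by (simp add: algebra_simps)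
    next
      case False
      have "\<beta> * \<alpha> \<le> 2 * R * \<alpha>" using le nn by (intro mult_right_mono) auto
      then show ?thesis using False unfolding eq \<alpha>_def[symmetric] \<beta>_def[symmetric] by (simp add: algebra_simps)
    qed
  qed
  have "ennreal (2 * R) * vol (steiner u A - D) + (\<integral>\<^sup>+t. overlap (A - D) (D - A) (t *\<^sub>R u))
    = (\<integral>\<^sup>+x. ennreal (2 * R) * (indicator {0..<1} (x \<bullet> u) * ennreal (flen u (steiner u A - D) x))
        + indicator {0..<1} (x \<bullet> u) * ennreal (flen u (A - D) x * flen u (D - A) x))"
    using bds u by (simp add: nn_integral_add nn_integral_cmult nn_integral_overlap_line emeasure_eq_integral_flen)
  also have "\<dots> \<le> (\<integral>\<^sup>+x. ennreal (2 * R) * (indicator {0..<1} (x \<bullet> u) * ennreal (flen u (A - D) x)))"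
  proof (rule nn_integral_mono)
    fix x
    show "ennreal (2 * R) * (indicator {0..<1} (x \<bullet> u) * ennreal (flen u (steiner u A - D) x))
        + indicator {0..<1} (x \<bullet> u) * ennreal (flen u (A - D) x * flen u (D - A) x)
      \<le> ennreal (2 * R) * (indicator {0..<1} (x \<bullet> u) * ennreal (flen u (A - D) x))"
      using pt[of x] R flen_nonneg[of u "A - D" x] flen_nonneg[of u "D - A" x] flen_nonneg[of u "steiner u A - D" x]
      by (cases "x \<bullet> u \<in> {0..<1}") (auto simp: ennreal_mult[symmetric] ennreal_plus[symmetric] ennreal_leI simp del: ennreal_plus)
  qed
  also have "\<dots> = ennreal (2 * R) * vol (A - D)"
    using bds u by (simp add: nn_integral_cmult emeasure_eq_integral_flen)
  finally show ?thesis .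
qed

lemma nn_integral_lborel_scale:
  fixes f :: "'a::euclidean_space \<Rightarrow> ennreal"
  assumes [measurable]: "f \<in> borel_measurable borel" and "c > 0"
  shows "(\<integral>\<^sup>+x. f x) = ennreal (c ^ DIM('a)) * (\<integral>\<^sup>+x. f (c *\<^sub>R x))"
proof -
  have "(\<integral>\<^sup>+x. f x) = (\<integral>\<^sup>+x. f x \<partial>density (distr lborel borel (\<lambda>x. 0 + c *\<^sub>R x)) (\<lambda>_. \<bar>c\<bar> ^ DIM('a)))"
    using lborel_affine[of c "0::'a"] assms(2) by simp
  also have "\<dots> = ennreal (c ^ DIM('a)) * (\<integral>\<^sup>+x. f (c *\<^sub>R x))"
    using assms(2) by (simp add: nn_integral_density nn_integral_distr nn_integral_cmult)
  finally show ?thesis .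
qed

section \<open>The Riesz inequality with a convex kernel\<close>

lemma nn_integral_lborel_reflect:
  fixes f :: "'a::euclidean_space \<Rightarrow> ennreal"
  assumes [measurable]: "f \<in> borel_measurable borel"
  shows "(\<integral>\<^sup>+x. f (c - x)) = (\<integral>\<^sup>+x. f x)"
proof -
  have "(\<integral>\<^sup>+x. f x) = (\<integral>\<^sup>+x. f x \<partial>density (distr lborel borel (\<lambda>x. c + (-1) *\<^sub>R x)) (\<lambda>_. \<bar>-1::real\<bar> ^ DIM('a)))"
    using lborel_affine[of "-1" c] by simp
  also have "\<dots> = (\<integral>\<^sup>+x. f (c - x))"
    by (simp add: nn_integral_density nn_integral_distr)
  finally show ?thesis by simp
qed

lemma riesz_le_12:
  assumes [measurable]: "A \<in> sets borel" "B \<in> sets borel"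
  shows "riesz A B K \<le> vol A * vol B"
proof -
  have "riesz A B K \<le> (\<integral>\<^sup>+x. \<integral>\<^sup>+y. indicator A x * indicator B y)"
    unfolding riesz_def by (intro nn_integral_mono) (auto simp: indicator_def)
  also have "\<dots> = vol A * vol B"
    by (simp add: nn_integral_cmult nn_integral_multc)
  finally show ?thesis .
qed

lemma riesz_le_13:
  assumes [measurable]: "A \<in> sets borel" "K \<in> sets borel"
  shows "riesz A B K \<le> vol A * vol K"
proof -
  have "riesz A B K \<le> (\<integral>\<^sup>+x. \<integral>\<^sup>+y. indicator A x * indicator K (x - y))"
    unfolding riesz_def by (intro nn_integral_mono) (auto simp: indicator_def)
  also have "\<dots> = (\<integral>\<^sup>+x. indicator A x * vol K)"
    by (rule nn_integral_cong, subst nn_integral_cmult) (auto simp: nn_integral_lborel_reflect)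
  also have "\<dots> = vol A * vol K"
    by (simp add: nn_integral_multc)
  finally show ?thesis .
qed

lemma riesz_split:
  assumes [measurable]: "A \<in> sets borel" "B \<in> sets borel" "K \<in> sets borel" "D \<in> sets borel"
  shows "riesz A B K \<le> riesz D B K + riesz (A - D) B K"
    and "riesz A B K \<le> riesz A D K + riesz A (B - D) K"
    and "riesz A B K \<le> riesz A B D + riesz A B (K - D)"
  unfolding riesz_def
  by (subst nn_integral_add[symmetric]; (subst nn_integral_add[symmetric])?;
      auto intro!: nn_integral_mono simp: indicator_def)+

lemma overlap_eq_0:
  assumes "P \<subseteq> ball 0 R" "Q \<subseteq> ball 0 R" "norm z \<ge> 2 * R"
  shows "overlap P Q z = 0"
proof -
  have "x + z \<notin> Q" if "x \<in> P" for x
  proof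
    assume "x + z \<in> Q"
    then have "norm (x + z) < R" "norm x < R" using assms that by auto
    moreover have "norm z \<le> norm (x + z) + norm x" using norm_triangle_ineq4[of "x + z" x] by simp
    ultimately show False using assms(3) by simp
  qed
  then show ?thesis unfolding overlap_def by (subst nn_integral_cong[of _ _ "\<lambda>_. 0"]) (auto simp: indicator_def)
qed

lemma nn_integral_overlap:
  assumes [measurable]: "P \<in> sets borel" "Q \<in> sets borel"
  shows "(\<integral>\<^sup>+z. overlap P Q z) = vol P * vol Q"
proof -
  have "(\<integral>\<^sup>+z. overlap P Q z) = (\<integral>\<^sup>+x. \<integral>\<^sup>+z. indicator P x * indicator Q (x + z))"
    unfolding overlap_def by (rule lborel_pair.Fubini') measurable
  also have "\<dots> = (\<integral>\<^sup>+x. indicator P x * vol Q)"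
    using nn_integral_lborel_translate[of "indicator Q"]
    by (intro nn_integral_cong, subst nn_integral_cmult) (auto simp: add.commute)
  also have "\<dots> = vol P * vol Q"
    by (simp add: nn_integral_multc)
  finally show ?thesis .
qed

text \<open>The annulus \<open>1/2 < norm v < 1\<close> stands in for the sphere of directions; each difference
  vector \<open>z\<close> is met by the dilates \<open>t v\<close> with \<open>norm z < t < 2 * norm z\<close>.\<close>

lemma overlap_direction_average:
  fixes P Q :: "'a::euclidean_space set"
  assumes [measurable]: "P \<in> sets borel" "Q \<in> sets borel" and PQ: "P \<subseteq> ball 0 R" "Q \<subseteq> ball 0 R" and R: "R > 0"
  shows "ennreal (2 * R / (4 * R) ^ DIM('a)) * (vol P * vol Q)
    \<le> (\<integral>\<^sup>+v. indicator {v. 1/2 < norm v \<and> norm v < 1} v * (\<integral>\<^sup>+t. overlap P Q (t *\<^sub>R v)))"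
proof -
  let ?n = "DIM('a)"
  define Ann where "Ann = {v::'a. 1/2 < norm v \<and> norm v < 1}"
  have [measurable]: "Ann \<in> sets borel" unfolding Ann_def by measurable
  have low: "ennreal (2 * R / (4 * R) ^ ?n) * overlap P Q z
     \<le> (\<integral>\<^sup>+t. indicator {0<..} t * ennreal (1 / t ^ ?n) * indicator Ann ((1/t) *\<^sub>R z)) * overlap P Q z" if "z \<noteq> 0" for z
  proof (cases "norm z < 2 * R")
    case False
    then show ?thesis using overlap_eq_0[OF PQ, of z] by simp
  next
    case True
    define s where "s = norm z"
    have s: "0 < s" "s < 2 * R" using that True by (auto simp: s_def)
    \<comment> \<open>The quotient \<open>s / (2 * s) ^ n\<close> bounds the integral over
      \<open>t\<close> from below: the interval \<open>{s<..<2 * s}\<close> has length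
      \<open>s\<close>, and \<open>1 / t ^ n\<close> is at least \<open>1 / (2 * s) ^ n\<close> on
      it. It does not increase in \<open>s\<close>, and at \<open>s = 2 * R\<close> it is the
      constant of the statement.\<close>
    have "2 * R / (4 * R) ^ ?n \<le> s / (2 * s) ^ ?n"
    proof -
      define q where "q = s / (2 * R)"
      have q: "0 < q" "q \<le> 1" using s R by (auto simp: q_def)
      obtain m where m: "?n = Suc m" using DIM_positive[where 'a='a] gr0_conv_Suc by blast
      have "q ^ m \<le> 1" using q by (simp add: power_le_one)
      have "s / (2 * s) ^ ?n = (q * (2 * R)) / (q * (4 * R)) ^ ?n" using R by (simp add: q_def)
      also have "\<dots> = (2 * R / (4 * R) ^ ?n) * (1 / q ^ m)"
        using q by (simp add: m power_mult_distrib field_simps)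
      finally have "s / (2 * s) ^ ?n = (2 * R / (4 * R) ^ ?n) * (1 / q ^ m)" .
      moreover have "1 \<le> 1 / q ^ m" using \<open>q ^ m \<le> 1\<close> q by simp
      ultimately show ?thesis using R mult_left_mono[of 1 "1 / q ^ m" "2 * R / (4 * R) ^ ?n"] by simp
    qed
    then have "ennreal (2 * R / (4 * R) ^ ?n) \<le> ennreal (1 / (2 * s) ^ ?n) * vol {s<..<2 * s}"
      using s R by (simp add: ennreal_mult[symmetric] ennreal_leI)
    also have "\<dots> = (\<integral>\<^sup>+t. ennreal (1 / (2 * s) ^ ?n) * indicator {s<..<2 * s} t)"
      by (subst nn_integral_cmult) auto
    also have "\<dots> \<le> (\<integral>\<^sup>+t. indicator {0<..} t * ennreal (1 / t ^ ?n) * indicator Ann ((1/t) *\<^sub>R z))"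
    proof (rule nn_integral_mono)
      fix t
      show "ennreal (1 / (2 * s) ^ ?n) * indicator {s<..<2 * s} t \<le> indicator {0<..} t * ennreal (1 / t ^ ?n) * indicator Ann ((1/t) *\<^sub>R z)"
      proof (cases "t \<in> {s<..<2 * s}")
        case True
        then have "1 / (2 * s) ^ ?n \<le> 1 / t ^ ?n" using s by (intro divide_left_mono power_mono) auto
        moreover have "(1/t) *\<^sub>R z \<in> Ann" using True s by (auto simp: Ann_def s_def[symmetric] field_simps)
        ultimately show ?thesis using True s by (simp add: ennreal_leI)
      qed simp
    qed
    finally show ?thesis by (rule mult_right_mono) simp
  qed
  have "ennreal (2 * R / (4 * R) ^ ?n) * (vol P * vol Q)
     = (\<integral>\<^sup>+z. ennreal (2 * R / (4 * R) ^ ?n) * overlap P Q z)"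
    by (simp add: nn_integral_cmult nn_integral_overlap)
  also have "\<dots> \<le> (\<integral>\<^sup>+z. (\<integral>\<^sup>+t. indicator {0<..} t * ennreal (1 / t ^ ?n) * indicator Ann ((1/t) *\<^sub>R z)) * overlap P Q z)"
    using low by (intro nn_integral_mono_AE eventually_mono[OF AE_lborel_singleton[of 0]]) auto
  also have "\<dots> = (\<integral>\<^sup>+z. \<integral>\<^sup>+t. indicator {0<..} t * ennreal (1 / t ^ ?n) * indicator Ann ((1/t) *\<^sub>R z) * overlap P Q z)"
    by (subst nn_integral_multc) auto
  also have "\<dots> = (\<integral>\<^sup>+t. \<integral>\<^sup>+z. indicator {0<..} t * ennreal (1 / t ^ ?n) * indicator Ann ((1/t) *\<^sub>R z) * overlap P Q z)"
    by (rule lborel_pair.Fubini') measurable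
  also have "\<dots> = (\<integral>\<^sup>+t. \<integral>\<^sup>+v. indicator {0<..} t * indicator Ann v * overlap P Q (t *\<^sub>R v))"
  proof (rule nn_integral_cong)
    fix t :: real
    show "(\<integral>\<^sup>+z. indicator {0<..} t * ennreal (1 / t ^ ?n) * indicator Ann ((1/t) *\<^sub>R z) * overlap P Q z)
      = (\<integral>\<^sup>+v. indicator {0<..} t * indicator Ann v * overlap P Q (t *\<^sub>R v))"
    proof (cases "t > 0")
      case True
      have "(\<integral>\<^sup>+z. ennreal (1 / t ^ ?n) * (indicator Ann ((1/t) *\<^sub>R z) * overlap P Q z))
        = ennreal (1 / t ^ ?n) * (ennreal (t ^ ?n) * (\<integral>\<^sup>+v. indicator Ann v * overlap P Q (t *\<^sub>R v)))"
        using True by (subst nn_integral_cmult, simp, subst nn_integral_lborel_scale[of _ t]) auto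
      also have "\<dots> = (\<integral>\<^sup>+v. indicator Ann v * overlap P Q (t *\<^sub>R v))"
        using True by (simp add: mult.assoc[symmetric] ennreal_mult[symmetric])
      finally show ?thesis using True by (simp add: mult.assoc)
    qed simp
  qed
  also have "\<dots> = (\<integral>\<^sup>+v. \<integral>\<^sup>+t. indicator {0<..} t * indicator Ann v * overlap P Q (t *\<^sub>R v))"
    by (rule lborel_pair.Fubini') measurable
  also have "\<dots> \<le> (\<integral>\<^sup>+v. \<integral>\<^sup>+t. indicator Ann v * overlap P Q (t *\<^sub>R v))"
    by (intro nn_integral_mono) (auto simp: indicator_def)
  also have "\<dots> = (\<integral>\<^sup>+v. indicator Ann v * (\<integral>\<^sup>+t. overlap P Q (t *\<^sub>R v)))"
    by (subst nn_integral_cmult) auto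
  finally show ?thesis by (simp add: Ann_def)
qed

section \<open>Iterated symmetrization and the Riesz inequality for bounded sets\<close>

text \<open>Since \<open>A i\<close> and its ball have equal volume, the surplus \<open>P i\<close>
  and the deficit \<open>Q i\<close> both have volume \<open>dev i\<close>, so their overlaps
  integrate to the square of \<open>dev i\<close>. Some direction carries its share of the average,
  and one direction serves all the sets because the gains are summed before averaging. The
  quantitative decrease takes the place of a compactness argument.\<close>

lemma steiner_step:
  fixes A :: "'i \<Rightarrow> 'a::euclidean_space set" and r :: "'i \<Rightarrow> real"
  assumes I: "finite I" and A[measurable]: "\<And>i. A i \<in> sets borel" and AR: "\<And>i. A i \<subseteq> ball 0 R"
    and eq: "\<And>i. vol (A i) = vol (ball (0::'a) (r i))" and r: "\<And>i. r i \<le> R" and R: "R > 0"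
  defines "dev \<equiv> \<lambda>i. measure lborel (A i - ball 0 (r i))"
  shows "\<exists>u. norm u = 1 \<and> (\<Sum>i\<in>I. measure lborel (steiner u (A i) - ball 0 (r i)))
    \<le> (\<Sum>i\<in>I. dev i) - (1 / ((4 * R) ^ DIM('a) * 4 * unit_ball_vol DIM('a))) * (\<Sum>i\<in>I. (dev i)\<^sup>2)"
proof -
  let ?n = "DIM('a)"
  define P Q where "P i = A i - ball 0 (r i)" and "Q i = ball 0 (r i) - A i" for i
  have [measurable]: "P i \<in> sets borel" "Q i \<in> sets borel" for i by (auto simp: P_def Q_def)
  have PR: "P i \<subseteq> ball 0 R" "Q i \<subseteq> ball 0 R" for i
    using AR[of i] r[of i] by (auto simp: P_def Q_def)
  have bA: "bounded (A i)" for i using AR bounded_ball bounded_subset by blast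
  have fin: "vol X < \<infinity>" if "X \<subseteq> ball 0 R" for X :: "'a set"
    using emeasure_bounded_finite[of X] bounded_subset[OF bounded_ball that] by auto
  have eP: "vol (P i) = ennreal (dev i)" for i
    using fin[OF PR(1)[of i]] by (simp add: dev_def P_def emeasure_eq_ennreal_measure)
  have eQ: "vol (Q i) = ennreal (dev i)" for i
  proof -
    have "vol (A i \<inter> ball 0 (r i)) + vol (P i) = vol (A i)"
      by (subst plus_emeasure) (auto simp: P_def intro!: arg_cong[where f="emeasure lborel"])
    moreover have "vol (A i \<inter> ball 0 (r i)) + vol (Q i) = vol (ball (0::'a) (r i))"
      by (subst plus_emeasure) (auto simp: Q_def intro!: arg_cong[where f="emeasure lborel"])
    ultimately have "vol (A i \<inter> ball 0 (r i)) + vol (P i)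
        = vol (A i \<inter> ball 0 (r i)) + vol (Q i)" using eq by simp
    moreover have "vol (A i \<inter> ball 0 (r i)) < \<infinity>" using AR[of i] by (intro fin) auto
    ultimately show ?thesis by (auto simp: ennreal_add_left_cancel eP)
  qed
  have d0: "0 \<le> dev i" for i by (simp add: dev_def)
  define S where "S = (\<Sum>i\<in>I. (dev i)\<^sup>2)"
  have S0: "0 \<le> S" by (simp add: S_def sum_nonneg)
  define c0 W where "c0 = 2 * R / (4 * R) ^ ?n" and "W = unit_ball_vol ?n"
  have c0: "c0 > 0" and W: "W > 0" using R by (auto simp: c0_def W_def)
  define Ann where "Ann = {v::'a. 1/2 < norm v \<and> norm v < 1}"
  have [measurable]: "Ann \<in> sets borel" unfolding Ann_def by measurable
  define \<Psi> where "\<Psi> v = (\<Sum>i\<in>I. \<integral>\<^sup>+t. overlap (P i) (Q i) (t *\<^sub>R v) \<partial>lborel)" for v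
  have [measurable]: "\<Psi> \<in> borel_measurable borel" unfolding \<Psi>_def by measurable
  have avg: "ennreal (c0 * S) \<le> (\<integral>\<^sup>+v. indicator Ann v * \<Psi> v)"
  proof -
    have "ennreal (c0 * S) = (\<Sum>i\<in>I. ennreal c0 * (vol (P i) * vol (Q i)))"
      using c0 d0 by (simp add: S_def eP eQ sum_distrib_left ennreal_mult[symmetric] power2_eq_square sum_ennreal[symmetric] del: sum_ennreal)
    also have "\<dots> \<le> (\<Sum>i\<in>I. \<integral>\<^sup>+v. indicator Ann v * (\<integral>\<^sup>+t. overlap (P i) (Q i) (t *\<^sub>R v)) \<partial>lborel)"
      unfolding c0_def Ann_def by (intro sum_mono overlap_direction_average PR R) auto
    also have "\<dots> = (\<integral>\<^sup>+v. indicator Ann v * \<Psi> v)"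
      unfolding \<Psi>_def by (subst nn_integral_sum[symmetric]) (auto simp: sum_distrib_left)
    finally show ?thesis .
  qed
  \<comment> \<open>The annulus has volume at most \<open>W\<close>, so a vector \<open>v\<close>
    with at least half of the average value exists; the half supplies the strict inequality of the
    contradiction. Normalizing \<open>v\<close> multiplies \<Psi> by \<open>norm v > 1/2\<close>,
    which accounts for the 4 in the denominator.\<close>
  obtain u where u: "norm u = 1" and gain: "ennreal (c0 * S / (4 * W)) \<le> \<Psi> u"
  proof (cases "S = 0")
    case True
    obtain b :: 'a where "b \<in> Basis" using nonempty_Basis by blast
    then show ?thesis using that[of b] True by simp
  next
    case False
    then have S: "S > 0" using S0 by simp
    have "\<exists>v\<in>Ann. ennreal (c0 * S / (2 * W)) \<le> \<Psi> v"
    proof (rule ccontr)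
      assume "\<not> ?thesis"
      then have "(\<integral>\<^sup>+v. indicator Ann v * \<Psi> v) \<le> (\<integral>\<^sup>+v. ennreal (c0 * S / (2 * W)) * indicator (ball (0::'a) 1) v)"
        by (intro nn_integral_mono) (auto simp: indicator_def Ann_def)
      also have "\<dots> = ennreal (c0 * S / (2 * W)) * ennreal W"
        by (simp add: nn_integral_cmult_indicator emeasure_ball W_def)
      also have "\<dots> = ennreal (c0 * S / 2)" using W c0 S by (simp add: ennreal_mult[symmetric])
      finally have "ennreal (c0 * S) \<le> ennreal (c0 * S / 2)" using avg by (rule order_trans[rotated])
      then show False using c0 S by simp
    qed
    then obtain v where v: "v \<in> Ann" "ennreal (c0 * S / (2 * W)) \<le> \<Psi> v" by blast
    define u where "u = v /\<^sub>R norm v"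
    have nv: "norm v > 1/2" "norm v > 0" using v(1) by (auto simp: Ann_def)
    then have u: "norm u = 1" "norm v *\<^sub>R u = v" by (auto simp: u_def)
    have "\<Psi> u = ennreal (norm v) * \<Psi> v"
    proof -
      have "(\<integral>\<^sup>+t. overlap (P i) (Q i) (t *\<^sub>R u)) = ennreal (norm v) * (\<integral>\<^sup>+t. overlap (P i) (Q i) (t *\<^sub>R v))" for i
      proof -
        have *: "(norm v * t) *\<^sub>R u = t *\<^sub>R v" for t
          using u(2) by (metis mult.commute scaleR_scaleR)
        show ?thesis
          using nn_integral_lborel_scale[of "\<lambda>t. overlap (P i) (Q i) (t *\<^sub>R u)" "norm v"] nv by (simp add: *)
      qed
      then show ?thesis by (simp add: \<Psi>_def sum_distrib_left)
    qed
    moreover have "ennreal (c0 * S / (4 * W)) \<le> ennreal (norm v) * ennreal (c0 * S / (2 * W))"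
    proof -
      have "1/2 * (c0 * S / (2 * W)) \<le> norm v * (c0 * S / (2 * W))"
        using nv c0 S W by (intro mult_right_mono) auto
      then show ?thesis using nv c0 S W by (subst ennreal_mult[symmetric]) (auto intro!: ennreal_leI)
    qed
    ultimately have "ennreal (c0 * S / (4 * W)) \<le> \<Psi> u" using v(2) by (metis mult_left_mono order_trans zero_le)
    then show ?thesis using that u by blast
  qed
  define dev' where "dev' i = measure lborel (steiner u (A i) - ball 0 (r i))" for i
  have e': "vol (steiner u (A i) - ball 0 (r i)) = ennreal (dev' i)" for i
    using emeasure_bounded_finite[of "steiner u (A i) - ball 0 (r i)"] bounded_subset[OF emeasure_steiner(2)[OF A bA u, of i], of "steiner u (A i) - ball 0 (r i)"]
    by (auto simp: dev'_def emeasure_eq_ennreal_measure)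
  have "ennreal (2 * R * (\<Sum>i\<in>I. dev' i) + c0 * S / (4 * W))
      = (\<Sum>i\<in>I. ennreal (2 * R) * ennreal (dev' i)) + ennreal (c0 * S / (4 * W))"
    using R c0 S0 W by (simp add: sum_distrib_left ennreal_mult[symmetric] dev'_def sum_nonneg)
  also have "\<dots> \<le> (\<Sum>i\<in>I. ennreal (2 * R) * ennreal (dev' i)) + \<Psi> u"
    using gain by (intro add_left_mono)
  also have "\<dots> = (\<Sum>i\<in>I. ennreal (2 * R) * ennreal (dev' i) + (\<integral>\<^sup>+t. overlap (P i) (Q i) (t *\<^sub>R u)))"
    by (simp add: \<Psi>_def sum.distrib)
  also have "\<dots> \<le> (\<Sum>i\<in>I. ennreal (2 * R) * ennreal (dev i))"
    unfolding e'[symmetric] eP[symmetric] P_def Q_def by (intro sum_mono steiner_gain A AR r R u)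
  also have "\<dots> = ennreal (2 * R * (\<Sum>i\<in>I. dev i))"
    using R d0 by (simp add: sum_distrib_left ennreal_mult[symmetric])
  finally have "2 * R * (\<Sum>i\<in>I. dev' i) + c0 * S / (4 * W) \<le> 2 * R * (\<Sum>i\<in>I. dev i)"
    using R d0 by (subst (asm) ennreal_le_iff) (auto intro!: sum_nonneg mult_nonneg_nonneg)
  then have "(2 * R) * ((\<Sum>i\<in>I. dev' i) + c0 * S / (8 * R * W)) \<le> 2 * R * (\<Sum>i\<in>I. dev i)"
  proof -
    have "2 * R * (c0 * S / (8 * R * W)) = c0 * S / (4 * W)" using R W by (simp add: field_simps)
    then show ?thesis using \<open>2 * R * (\<Sum>i\<in>I. dev' i) + c0 * S / (4 * W) \<le> 2 * R * (\<Sum>i\<in>I. dev i)\<close>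
      by (simp only: distrib_left)
  qed
  then have "(\<Sum>i\<in>I. dev' i) + c0 * S / (8 * R * W) \<le> (\<Sum>i\<in>I. dev i)"
    using R by (subst (asm) mult_le_cancel_left_pos) auto
  moreover have "c0 * S / (8 * R * W) = 1 / ((4 * R) ^ ?n * 4 * W) * S"
    using R W by (simp add: c0_def field_simps)
  ultimately show ?thesis using u by (intro exI[of _ u]) (auto simp: dev'_def S_def W_def)
qed

text \<open>The three sets are exchanged one at a time, and each exchange costs at most
  \<open>M\<close> times the volume of the part of the old set outside the new one.\<close>

lemma riesz_perturb:
  fixes A B K :: "'a::euclidean_space set"
  assumes [measurable]: "A \<in> sets borel" "B \<in> sets borel" "K \<in> sets borel"
      "DA \<in> sets borel" "DB \<in> sets borel" "DK \<in> sets borel"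
    and M: "vol B \<le> M" "vol DA \<le> M"
  shows "riesz A B K \<le> riesz DA DB DK + M * (vol (A - DA) + vol (B - DB) + vol (K - DK))"
proof -
  have "riesz A B K \<le> riesz DA B K + riesz (A - DA) B K" by (rule riesz_split) auto
  also have "riesz DA B K \<le> riesz DA DB K + riesz DA (B - DB) K" by (rule riesz_split) auto
  also have "riesz DA DB K \<le> riesz DA DB DK + riesz DA DB (K - DK)" by (rule riesz_split) auto
  also have "riesz (A - DA) B K \<le> vol (A - DA) * M"
    using M by (intro order_trans[OF riesz_le_12] mult_left_mono) auto
  also have "riesz DA (B - DB) K \<le> M * vol (B - DB)"
    using M by (intro order_trans[OF riesz_le_12] mult_right_mono) auto
  also have "riesz DA DB (K - DK) \<le> M * vol (K - DK)"
    using M by (intro order_trans[OF riesz_le_13] mult_right_mono) auto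
  finally show ?thesis by (simp add: distrib_left distrib_right add_mono mult_ac add_ac)
qed

text \<open>No convergent sequence of symmetrizations is constructed. \<open>good\<close> collects
  all triples with the right volumes, a convex kernel and a Riesz integral at least that of
  \<open>A\<close>, \<open>B\<close>, \<open>K\<close>. A positive infimum of their deviations from
  balls would be undercut by one more step, since a step lowers the deviation by a multiple of its
  square. So the deviation becomes arbitrarily small, and the Riesz integral is stable under such
  changes.\<close>

theorem riesz_rearrangement_bounded:
  fixes A B K :: "'a::euclidean_space set"
  assumes m[measurable]: "A \<in> sets borel" "B \<in> sets borel" "K \<in> sets borel" and bd: "bounded A" "bounded B" "bounded K"
    and K: "convex K"
    and eq: "vol A = vol (ball (0::'a) a)" "vol B = vol (ball (0::'a) b)"
      "vol K = vol (ball (0::'a) k)"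
    and nn: "0 \<le> a" "0 \<le> b" "0 \<le> k"
  shows "riesz A B K \<le> riesz (ball (0::'a) a) (ball 0 b) (ball 0 k)"
proof -
  let ?n = "DIM('a)"
  have "bounded (A \<union> B \<union> K)" using bd by simp
  from bounded_subset_ballD[OF this, of 0] obtain R1 where R1: "A \<union> B \<union> K \<subseteq> ball 0 R1" by blast
  define R where "R = max 1 (max R1 (max a (max b k)))"
  have R: "R > 0" "a \<le> R" "b \<le> R" "k \<le> R" "A \<subseteq> ball 0 R" "B \<subseteq> ball 0 R" "K \<subseteq> ball 0 R"
    using R1 by (auto simp: R_def)
  define r where "r i = (if i = 0 then a else if i = 1 then b else k)" for i :: nat
  have rR: "r i \<le> R" for i using R by (auto simp: r_def)
  define good where "good T \<longleftrightarrow> (\<forall>i. T i \<in> sets borel \<and> T i \<subseteq> ball 0 R \<and> vol (T i) = vol (ball (0::'a) (r i)))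
     \<and> convex (T 2) \<and> riesz A B K \<le> riesz (T 0) (T 1) (T 2)" for T :: "nat \<Rightarrow> 'a set"
  define dev where "dev T = (\<Sum>i\<in>{0,1,2::nat}. measure lborel (T i - ball 0 (r i)))" for T :: "nat \<Rightarrow> 'a set"
  have dev0: "0 \<le> dev T" for T by (simp add: dev_def)
  define T0 where "T0 i = (if i = 0 then A else if i = 1 then B else K)" for i :: nat
  have good0: "good T0" using eq R K by (auto simp: good_def T0_def r_def)
  define c where "c = 1 / ((4 * R) ^ ?n * 4 * unit_ball_vol ?n)"
  have c: "c > 0" using R by (simp add: c_def)
  have step: "\<exists>T'. good T' \<and> dev T' \<le> dev T - c / 3 * (dev T)\<^sup>2" if T: "good T" for T
  proof -
    have T1: "T i \<in> sets borel" "T i \<subseteq> ball 0 R" "vol (T i) = vol (ball (0::'a) (r i))" for i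
      using T by (auto simp: good_def)
    have bT: "bounded (T i)" for i using T1(2) bounded_ball bounded_subset by blast
    obtain u where u: "norm u = 1" and le: "(\<Sum>i\<in>{0,1,2}. measure lborel (steiner u (T i) - ball 0 (r i)))
       \<le> dev T - c * (\<Sum>i\<in>{0,1,2}. (measure lborel (T i - ball 0 (r i)))\<^sup>2)"
      using steiner_step[of "{0,1,2::nat}" T R r, OF _ T1 rR R(1)] by (auto simp: dev_def c_def)
    have "(dev T)\<^sup>2 \<le> 3 * (\<Sum>i\<in>{0,1,2}. (measure lborel (T i - ball 0 (r i)))\<^sup>2)"
    proof -
      have "(x + y + z)\<^sup>2 \<le> 3 * (x\<^sup>2 + y\<^sup>2 + z\<^sup>2)" for x y z :: real
        using sum_squares_ge_zero[of "x - y" "y - z"] zero_le_power2[of "x - z"]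
        by (simp add: power2_eq_square algebra_simps)
      from this[of "measure lborel (T 0 - ball 0 (r 0))" "measure lborel (T 1 - ball 0 (r 1))" "measure lborel (T 2 - ball 0 (r 2))"]
      show ?thesis by (simp add: dev_def add.assoc)
    qed
    then have "c / 3 * (dev T)\<^sup>2 \<le> c * (\<Sum>i\<in>{0,1,2}. (measure lborel (T i - ball 0 (r i)))\<^sup>2)"
      using c by (simp add: mult_left_mono)
    then have "dev (\<lambda>i. steiner u (T i)) \<le> dev T - c / 3 * (dev T)\<^sup>2" using le by (simp add: dev_def)
    moreover have "good (\<lambda>i. steiner u (T i))"
      unfolding good_def
    proof (intro conjI allI)
      fix i
      show "steiner u (T i) \<in> sets borel" using T1(1) by (rule steiner_borel)
      show "steiner u (T i) \<subseteq> ball 0 R"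
        using steiner_mono[OF T1(1) _ _ u T1(2), of i] steiner_ball[OF u, of R] by auto
      show "vol (steiner u (T i)) = vol (ball (0::'a) (r i))"
        using emeasure_steiner(1)[OF T1(1) bT u] T1(3) by simp
    next
      show "convex (steiner u (T 2))" using T by (intro convex_steiner T1 bT u) (auto simp: good_def)
      have "riesz (T 0) (T 1) (T 2) \<le> riesz (steiner u (T 0)) (steiner u (T 1)) (steiner u (T 2))"
        using T by (intro riesz_steiner T1 bT u) (auto simp: good_def)
      then show "riesz A B K \<le> riesz (steiner u (T 0)) (steiner u (T 1)) (steiner u (T 2))"
        using T by (auto simp: good_def)
    qed
    ultimately show ?thesis by blast
  qed
  have small: "\<exists>T. good T \<and> dev T < e" if e: "e > 0" for e
  proof (rule ccontr)
    assume no: "\<not> ?thesis"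
    define X where "X = dev ` {T. good T}"
    have X: "X \<noteq> {}" "bdd_below X" "\<And>x. x \<in> X \<Longrightarrow> e \<le> x"
      using good0 no dev0 by (auto simp: X_def not_less intro!: bdd_belowI[of _ 0])
    define d where "d = Inf X"
    have d: "d \<ge> e" unfolding d_def using X by (intro cInf_greatest) auto
    have "d < d + c / 3 * d\<^sup>2" using d e c by simp
    then obtain T where T: "good T" "dev T < d + c / 3 * d\<^sup>2"
      using cInf_lessD[OF X(1), of "d + c / 3 * d\<^sup>2"] by (auto simp: d_def X_def)
    have "d \<le> dev T" unfolding d_def using X T by (intro cInf_lower) (auto simp: X_def)
    obtain T' where T': "good T'" "dev T' \<le> dev T - c / 3 * (dev T)\<^sup>2" using step[OF T(1)] by blast
    have "d \<le> dev T'" unfolding d_def using X T' by (intro cInf_lower) (auto simp: X_def)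
    moreover have "c / 3 * d\<^sup>2 \<le> c / 3 * (dev T)\<^sup>2" using \<open>d \<le> dev T\<close> d e c by (intro mult_left_mono power_mono) auto
    ultimately show False using T' T by linarith
  qed
  define M where "M = unit_ball_vol ?n * R ^ ?n"
  have M: "vol (ball (0::'a) R) = ennreal M" "M > 0" using R by (auto simp: M_def emeasure_ball)
  show ?thesis
  proof (rule ennreal_le_epsilon)
    fix e :: real assume e: "e > 0"
    obtain T where T: "good T" "dev T < e / M" using small[of "e / M"] e M by auto
    have T1[measurable]: "T i \<in> sets borel" and T2: "T i \<subseteq> ball 0 R" for i using T by (auto simp: good_def)
    have dT: "vol (T i - ball 0 (r i)) = ennreal (measure lborel (T i - ball 0 (r i)))" for i
    proof -
      have "T i - ball 0 (r i) \<subseteq> ball 0 R" using T2[of i] by auto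
      from emeasure_bounded_finite[OF bounded_subset[OF bounded_ball this]]
      show ?thesis by (intro emeasure_eq_ennreal_measure) auto
    qed
    have "riesz A B K \<le> riesz (T 0) (T 1) (T 2)" using T by (auto simp: good_def)
    also have "\<dots> \<le> riesz (ball (0::'a) (r 0)) (ball 0 (r 1)) (ball 0 (r 2)) + ennreal M *
       (vol (T 0 - ball 0 (r 0)) + vol (T 1 - ball 0 (r 1)) + vol (T 2 - ball 0 (r 2)))"
      unfolding M(1)[symmetric]
    proof (rule riesz_perturb)
      show "vol (T 1) \<le> vol (ball (0::'a) R)" using T2[of 1] by (intro emeasure_mono) auto
      show "vol (ball (0::'a) (r 0)) \<le> vol (ball (0::'a) R)" using rR[of 0] by (intro emeasure_mono) auto
    qed auto
    also have "\<dots> = riesz (ball (0::'a) a) (ball 0 b) (ball 0 k) + ennreal (M * dev T)"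
      using M(2) unfolding dT by (simp add: r_def dev_def ennreal_mult add.assoc)
    also have "M * dev T \<le> e" using T(2) M(2) by (simp add: field_simps)
    finally show "riesz A B K \<le> riesz (ball (0::'a) a) (ball 0 b) (ball 0 k) + ennreal e"
      by (auto simp: add_left_mono ennreal_leI)
  qed
qed

section \<open>Pairs of sets and sets of finite volume\<close>

lemma radius_exists:
  assumes "m < (\<infinity>::ennreal)"
  shows "\<exists>r\<ge>0. vol (ball (0::'a::euclidean_space) r) = m"
proof -
  let ?n = "DIM('a)"
  define r where "r = root ?n (enn2real m / unit_ball_vol ?n)"
  have r: "r \<ge> 0" by (simp add: r_def)
  have "r ^ ?n = enn2real m / unit_ball_vol ?n"
    unfolding r_def by (rule real_root_pow_pos2) auto
  then have "unit_ball_vol ?n * r ^ ?n = enn2real m" by (simp add: less_imp_neq[THEN not_sym])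
  then show ?thesis using r assms by (intro exI[of _ r]) (simp add: emeasure_ball less_top)
qed

lemma emeasure_ball_le_imp_le:
  assumes "vol (ball (0::'a::euclidean_space) r) \<le> vol (ball (0::'a) s)" "0 \<le> r" "0 \<le> s"
  shows "r \<le> s"
proof -
  have "unit_ball_vol DIM('a) * r ^ DIM('a) \<le> unit_ball_vol DIM('a) * s ^ DIM('a)"
    using assms by (simp add: emeasure_ball)
  then have "r ^ DIM('a) \<le> s ^ DIM('a)" by simp
  then show ?thesis using assms by (simp add: power_mono_iff)
qed

lemma riesz_mono:
  assumes "A \<subseteq> A'" "B \<subseteq> B'" "K \<subseteq> K'"
  shows "riesz A B K \<le> riesz A' B' K'"
  unfolding riesz_def using assms by (intro nn_integral_mono) (auto simp: indicator_def)

lemma riesz_LIMSEQ: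
  assumes [measurable]: "A \<in> sets borel" "B \<in> sets borel" "K \<in> sets borel"
  shows "(\<lambda>j. riesz (A \<inter> ball 0 (real j)) (B \<inter> ball 0 (real j)) K) \<longlonglongrightarrow> riesz A B K"
proof -
  define F where "F j x y = (indicator (A \<inter> ball 0 (real j)) x * indicator (B \<inter> ball 0 (real j)) y * indicator K (x - y) :: ennreal)" for j x y
  have lim: "(\<lambda>j. F j x y) \<longlonglongrightarrow> indicator A x * indicator B y * indicator K (x - y)" for x y
  proof (rule tendsto_eventually)
    obtain N :: nat where N: "max (norm x) (norm y) < real N" using reals_Archimedean2 by blast
    show "\<forall>\<^sub>F j in sequentially. F j x y = indicator A x * indicator B y * indicator K (x - y)"
      using N by (intro eventually_sequentiallyI[of N]) (auto simp: F_def indicator_def)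
  qed
  have mono: "F i x y \<le> F j x y" if "i \<le> j" for i j x y
    using that by (auto simp: F_def indicator_def)
  have [measurable]: "A \<inter> ball 0 (real j) \<in> sets borel" "B \<inter> ball 0 (real j) \<in> sets borel" for j
    by measurable
  have "(\<lambda>j. \<integral>\<^sup>+x. \<integral>\<^sup>+y. F j x y) \<longlonglongrightarrow> riesz A B K"
    unfolding riesz_def
  proof (rule nn_integral_LIMSEQ)
    show "incseq (\<lambda>j x. \<integral>\<^sup>+y. F j x y)"
      by (auto simp: incseq_def le_fun_def intro!: nn_integral_mono mono)
    show "(\<lambda>j. \<integral>\<^sup>+y. F j x y) \<longlonglongrightarrow> (\<integral>\<^sup>+y. indicator A x * indicator B y * indicator K (x - y))" for x
    proof (rule nn_integral_LIMSEQ)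
      show "incseq (\<lambda>j. F j x)" using mono by (auto simp: incseq_def le_fun_def)
      show "F j x \<in> borel_measurable lborel" for j unfolding F_def by measurable
    qed (rule lim)
    show "(\<lambda>x. \<integral>\<^sup>+y. F j x y) \<in> borel_measurable lborel" for j
      unfolding F_def by measurable
  qed
  then show ?thesis by (simp add: F_def riesz_def)
qed

lemma emeasure_lborel_reflect:
  fixes S :: "'a::euclidean_space set"
  assumes [measurable]: "S \<in> sets borel"
  shows "vol {x. c - x \<in> S} = vol S"
proof -
  have "vol {x. c - x \<in> S} = (\<integral>\<^sup>+x. indicator {x. c - x \<in> S} x)"
    by (rule nn_integral_indicator[symmetric]) measurable
  also have "\<dots> = (\<integral>\<^sup>+x. indicator S (c - x))"
    by (intro nn_integral_cong) (auto simp: indicator_def)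
  also have "\<dots> = vol S" by (subst nn_integral_lborel_reflect) auto
  finally show ?thesis .
qed

lemma riesz_reflect:
  fixes A B K :: "'a::euclidean_space set"
  assumes [measurable]: "A \<in> sets borel" "B \<in> sets borel" "K \<in> sets borel"
  shows "riesz {x. v - x \<in> A} {x. v - x \<in> B} K = riesz A B {z. - z \<in> K}"
proof -
  have "riesz {x. v - x \<in> A} {x. v - x \<in> B} K
    = (\<integral>\<^sup>+x. (\<integral>\<^sup>+y. indicator A (v - x) * indicator B y * indicator K (x - (v - y))))"
    unfolding riesz_def
  proof (rule nn_integral_cong)
    fix x
    have "(\<integral>\<^sup>+y. indicator A (v - x) * indicator B y * indicator K (x - (v - y)))
      = (\<integral>\<^sup>+y. indicator A (v - x) * indicator B (v - y) * indicator K (x - (v - (v - y))))"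
      by (rule nn_integral_lborel_reflect[symmetric]) measurable
    then show "(\<integral>\<^sup>+y. indicator {x. v - x \<in> A} x * indicator {x. v - x \<in> B} y * indicator K (x - y))
      = (\<integral>\<^sup>+y. indicator A (v - x) * indicator B y * indicator K (x - (v - y)))"
      by (simp add: indicator_def)
  qed
  also have "\<dots> = (\<integral>\<^sup>+x. (\<integral>\<^sup>+y. indicator A (v - (v - x)) * indicator B y * indicator K ((v - x) - (v - y))))"
    by (rule nn_integral_lborel_reflect[symmetric]) measurable
  also have "\<dots> = riesz A B {z. - z \<in> K}"
    unfolding riesz_def by (simp add: indicator_def)
  finally show ?thesis .
qed

text \<open>Two pairs of sets are merged by placing a reflected copy of the second pair far away;
  the reflection is needed for the negative part of a function.\<close>

lemma riesz_rearrangement_pair_bounded: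
  fixes A1 A2 B1 B2 K :: "'a::euclidean_space set"
  assumes m[measurable]: "A1 \<in> sets borel" "B1 \<in> sets borel" "A2 \<in> sets borel" "B2 \<in> sets borel" "K \<in> sets borel"
    and bd: "bounded A1" "bounded B1" "bounded A2" "bounded B2" "bounded K" and K: "convex K"
    and eq: "vol A1 + vol A2 = vol (ball (0::'a) a)"
      "vol B1 + vol B2 = vol (ball (0::'a) b)"
      "vol K = vol (ball (0::'a) k)"
    and nn: "0 \<le> a" "0 \<le> b" "0 \<le> k"
  shows "riesz A1 B1 K + riesz A2 B2 {z. - z \<in> K} \<le> riesz (ball (0::'a) a) (ball 0 b) (ball 0 k)"
proof -
  have "bounded (A1 \<union> B1 \<union> A2 \<union> B2)" using bd by simp
  from bounded_subset_ballD[OF this, of 0] obtain R where R: "A1 \<union> B1 \<union> A2 \<union> B2 \<subseteq> ball 0 R" "R > 0" by blast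
  obtain e :: 'a where e: "e \<in> Basis" using nonempty_Basis by blast
  \<comment> \<open>Any vector of length at least \<open>2 * R\<close> separates
    \<open>ball 0 R\<close> from its reflected copy \<open>ball v R\<close>.\<close>
  define v where "v = (3 * R) *\<^sub>R e"
  have v: "norm v = 3 * R" using e R by (simp add: v_def)
  define T where "T X = {x. v - x \<in> X}" for X
  have T[measurable]: "T X \<in> sets borel" if "X \<in> sets borel" for X
    using that unfolding T_def by measurable
  have far: "x \<notin> T Y" if "X \<subseteq> ball 0 R" "Y \<subseteq> ball 0 R" "x \<in> X" for x X Y
  proof
    assume "x \<in> T Y"
    then have "norm (v - x) < R" "norm x < R" using that by (auto simp: T_def)
    moreover have "norm v \<le> norm (v - x) + norm x" using norm_triangle_ineq[of "v - x" x] by simp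
    ultimately show False using v R(2) by linarith
  qed
  have bT: "bounded (T X)" if "X \<subseteq> ball 0 R" for X
  proof -
    have "norm x \<le> 4 * R" if "x \<in> T X" for x
    proof -
      have "norm (v - x) < R" using that \<open>X \<subseteq> ball 0 R\<close> by (auto simp: T_def)
      moreover have "norm x \<le> norm v + norm (v - x)" using norm_triangle_ineq4[of v "v - x"] by simp
      ultimately show ?thesis using v by simp
    qed
    then show ?thesis by (auto simp: bounded_iff)
  qed
  have "riesz A1 B1 K + riesz A2 B2 {z. - z \<in> K} = riesz A1 B1 K + riesz (T A2) (T B2) K"
    by (simp add: T_def riesz_reflect)
  also have "\<dots> = (\<integral>\<^sup>+x. \<integral>\<^sup>+y. indicator A1 x * indicator B1 y * indicator K (x - y) + indicator (T A2) x * indicator (T B2) y * indicator K (x - y))"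
    unfolding riesz_def by (simp add: nn_integral_add)
  also have "\<dots> \<le> riesz (A1 \<union> T A2) (B1 \<union> T B2) K"
    unfolding riesz_def using far[of A1 A2] far[of B1 B2] R(1) by (intro nn_integral_mono) (auto simp: indicator_def)
  also have "\<dots> \<le> riesz (ball (0::'a) a) (ball 0 b) (ball 0 k)"
  proof (rule riesz_rearrangement_bounded)
    show "vol (A1 \<union> T A2) = vol (ball (0::'a) a)"
      using far[of A1 A2] R(1) eq(1) emeasure_lborel_reflect[of A2 v, folded T_def] by (subst plus_emeasure[symmetric]) auto
    show "vol (B1 \<union> T B2) = vol (ball (0::'a) b)"
      using far[of B1 B2] R(1) eq(2) emeasure_lborel_reflect[of B2 v, folded T_def] by (subst plus_emeasure[symmetric]) auto
    show "bounded (A1 \<union> T A2)" "bounded (B1 \<union> T B2)" using bT R(1) bd by auto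
  qed (use nn K eq bd in auto)
  finally show ?thesis .
qed

text \<open>The sets are cut off by large balls. The left side converges by monotone convergence,
  while the balls for the truncated sets have smaller radii, so that the right side bounds all
  truncations.\<close>

theorem riesz_rearrangement_pair:
  fixes A1 A2 B1 B2 K :: "'a::euclidean_space set"
  assumes m[measurable]: "A1 \<in> sets borel" "B1 \<in> sets borel" "A2 \<in> sets borel" "B2 \<in> sets borel" "K \<in> sets borel"
    and K: "convex K" "bounded K"
    and eq: "vol A1 + vol A2 = vol (ball (0::'a) a)"
      "vol B1 + vol B2 = vol (ball (0::'a) b)"
      "vol K = vol (ball (0::'a) k)"
    and nn: "0 \<le> a" "0 \<le> b" "0 \<le> k"
  shows "riesz A1 B1 K + riesz A2 B2 {z. - z \<in> K} \<le> riesz (ball (0::'a) a) (ball 0 b) (ball 0 k)"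
proof -
  define cut where "cut X j = X \<inter> ball (0::'a) (real j)" for X j
  have lim: "(\<lambda>j. riesz (cut A1 j) (cut B1 j) K + riesz (cut A2 j) (cut B2 j) {z. - z \<in> K})
      \<longlonglongrightarrow> riesz A1 B1 K + riesz A2 B2 {z. - z \<in> K}"
    unfolding cut_def by (intro tendsto_add riesz_LIMSEQ) auto
  have "riesz (cut A1 j) (cut B1 j) K + riesz (cut A2 j) (cut B2 j) {z. - z \<in> K}
     \<le> riesz (ball (0::'a) a) (ball 0 b) (ball 0 k)" for j
  proof -
    have le: "vol (cut X j) + vol (cut Y j) \<le> vol X + vol Y"
      if "X \<in> sets borel" "Y \<in> sets borel" for X Y
      using that by (intro add_mono emeasure_mono) (auto simp: cut_def)
    have fin: "vol (cut X j) + vol (cut Y j) < \<infinity>" for X Y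
    proof -
      have "bounded (cut X j)" "bounded (cut Y j)" by (auto simp: cut_def)
      then show ?thesis using emeasure_bounded_finite[of "cut X j"] emeasure_bounded_finite[of "cut Y j"] by simp
    qed
    obtain a' where a': "a' \<ge> 0" "vol (ball (0::'a) a') = vol (cut A1 j) + vol (cut A2 j)"
      using radius_exists[OF fin] by blast
    obtain b' where b': "b' \<ge> 0" "vol (ball (0::'a) b') = vol (cut B1 j) + vol (cut B2 j)"
      using radius_exists[OF fin] by blast
    have "riesz (cut A1 j) (cut B1 j) K + riesz (cut A2 j) (cut B2 j) {z. - z \<in> K} \<le> riesz (ball (0::'a) a') (ball 0 b') (ball 0 k)"
    proof (rule riesz_rearrangement_pair_bounded)
      have c: "cut X j \<in> sets borel" if "X \<in> sets borel" for X
        unfolding cut_def using that by (intro sets.Int) simp_all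
      show "cut A1 j \<in> sets borel" "cut B1 j \<in> sets borel" "cut A2 j \<in> sets borel" "cut B2 j \<in> sets borel"
        by (intro c m)+
      show "bounded (cut A1 j)" "bounded (cut B1 j)" "bounded (cut A2 j)" "bounded (cut B2 j)"
        by (auto simp: cut_def)
    qed (rule m K eq nn a' b' a'(2)[symmetric] b'(2)[symmetric])+
    also have "\<dots> \<le> riesz (ball (0::'a) a) (ball 0 b) (ball 0 k)"
    proof (rule riesz_mono)
      have "a' \<le> a"
        by (rule emeasure_ball_le_imp_le[where 'a = 'a]) (use le[OF m(1,3)] nn a'(1) in \<open>simp_all only: a'(2) eq(1)\<close>)
      then show "ball 0 a' \<subseteq> ball (0::'a) a" by auto
      have "b' \<le> b"
        by (rule emeasure_ball_le_imp_le[where 'a = 'a]) (use le[OF m(2,4)] nn b'(1) in \<open>simp_all only: b'(2) eq(2)\<close>)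
      then show "ball 0 b' \<subseteq> ball (0::'a) b" by auto
    qed simp
    finally show ?thesis .
  qed
  then show ?thesis by (intro LIMSEQ_le_const2[OF lim]) auto
qed

section \<open>Positive differences under rearrangement\<close>

text \<open>For each \<open>z\<close> in \<open>K\<close>, the inner integral is the volume of the
  points outside \<open>B\<close> that the translation by \<open>z\<close> carries into
  \<open>A\<close>. It complements \<open>riesz\<close> to \<open>vol A * vol K\<close>, so
  rearrangement decreases it.\<close>

definition escape :: "'a::euclidean_space set \<Rightarrow> 'a set \<Rightarrow> 'a set \<Rightarrow> ennreal" where
  "escape A B K = (\<integral>\<^sup>+z. \<integral>\<^sup>+x. indicator K z * indicator A (x + z) * indicator (- B) x)"

lemma escape_add_riesz:
  fixes A B K :: "'a::euclidean_space set"
  assumes [measurable]: "A \<in> sets borel" "B \<in> sets borel" "K \<in> sets borel"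
  shows "escape A B K + riesz A B K = vol A * vol K"
proof -
  have "riesz A B K = (\<integral>\<^sup>+y. \<integral>\<^sup>+x. indicator A x * indicator B y * indicator K (x - y))"
    unfolding riesz_def by (rule lborel_pair.Fubini') measurable
  also have "\<dots> = (\<integral>\<^sup>+y. \<integral>\<^sup>+z. indicator K z * indicator A (y + z) * indicator B y)"
  proof (rule nn_integral_cong)
    fix y
    have "(\<integral>\<^sup>+x. indicator A x * indicator B y * indicator K (x - y))
       = (\<integral>\<^sup>+z. indicator A (z + y) * indicator B y * indicator K (z + y - y))"
      by (rule nn_integral_lborel_translate[symmetric]) measurable
    then show "(\<integral>\<^sup>+x. indicator A x * indicator B y * indicator K (x - y))
       = (\<integral>\<^sup>+z. indicator K z * indicator A (y + z) * indicator B y)"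
      by (simp add: mult_ac add_ac)
  qed
  also have "\<dots> = (\<integral>\<^sup>+z. \<integral>\<^sup>+x. indicator K z * indicator A (x + z) * indicator B x)"
    by (rule lborel_pair.Fubini') measurable
  finally have "escape A B K + riesz A B K
      = (\<integral>\<^sup>+z. \<integral>\<^sup>+x. indicator K z * indicator A (x + z) * indicator (- B) x + indicator K z * indicator A (x + z) * indicator B x)"
    by (simp add: escape_def nn_integral_add)
  also have "\<dots> = (\<integral>\<^sup>+z. indicator K z * vol A)"
  proof (rule nn_integral_cong)
    fix z
    have "(\<integral>\<^sup>+x. indicator K z * indicator A (x + z) * indicator (- B) x + indicator K z * indicator A (x + z) * indicator B x)
       = (\<integral>\<^sup>+x. indicator K z * indicator A (x + z))"
      by (intro nn_integral_cong) (auto simp: indicator_def)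
    also have "\<dots> = indicator K z * vol A"
      by (subst nn_integral_cmult, simp, subst nn_integral_lborel_translate) auto
    finally show "(\<integral>\<^sup>+x. indicator K z * indicator A (x + z) * indicator (- B) x + indicator K z * indicator A (x + z) * indicator B x)
       = indicator K z * vol A" .
  qed
  also have "\<dots> = vol A * vol K"
    by (simp add: nn_integral_multc mult.commute)
  finally show ?thesis .
qed

theorem escape_rearrangement_pair:
  fixes A1 A2 B1 B2 K :: "'a::euclidean_space set"
  assumes m[measurable]: "A1 \<in> sets borel" "B1 \<in> sets borel" "A2 \<in> sets borel" "B2 \<in> sets borel" "K \<in> sets borel"
    and K: "convex K" "bounded K"
    and eq: "vol A1 + vol A2 = vol (ball (0::'a) a)"
      "vol B1 + vol B2 = vol (ball (0::'a) b)"
      "vol K = vol (ball (0::'a) k)"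
    and nn: "0 \<le> a" "0 \<le> b" "0 \<le> k"
  shows "escape (ball (0::'a) a) (ball 0 b) (ball 0 k) \<le> escape A1 B1 K + escape A2 B2 {z. - z \<in> K}"
proof -
  have K': "vol {z. - z \<in> K} = vol K"
    using emeasure_lborel_reflect[of K 0] by simp
  have [measurable]: "{z. - z \<in> K} \<in> sets borel" by measurable
  let ?r = "riesz (ball (0::'a) a) (ball 0 b) (ball 0 k)"
  have "?r \<le> vol (ball (0::'a) a) * vol (ball (0::'a) b)"
    by (rule riesz_le_12) auto
  also have "\<dots> < \<infinity>" using emeasure_lborel_ball_finite[where 'a='a] by (simp add: ennreal_mult_less_top)
  finally have fin: "?r < \<infinity>" .
  have "escape (ball (0::'a) a) (ball 0 b) (ball 0 k) + ?r
      = (vol A1 + vol A2) * vol K"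
    by (simp add: escape_add_riesz eq)
  also have "\<dots> = (escape A1 B1 K + riesz A1 B1 K) + (escape A2 B2 {z. - z \<in> K} + riesz A2 B2 {z. - z \<in> K})"
    by (simp add: escape_add_riesz K' distrib_right)
  also have "\<dots> = (escape A1 B1 K + escape A2 B2 {z. - z \<in> K}) + (riesz A1 B1 K + riesz A2 B2 {z. - z \<in> K})"
    by (simp add: add_ac)
  also have "\<dots> \<le> (escape A1 B1 K + escape A2 B2 {z. - z \<in> K}) + ?r"
    using riesz_rearrangement_pair[OF m K eq nn] by (intro add_left_mono)
  finally have "?r + escape (ball (0::'a) a) (ball 0 b) (ball 0 k) \<le> ?r + (escape A1 B1 K + escape A2 B2 {z. - z \<in> K})"
    by (simp only: add.commute)
  then show ?thesis using fin by (subst (asm) ennreal_add_left_cancel_le) auto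
qed

text \<open>\<open>ennreal\<close> sends negative numbers to 0, so the integrand is the positive
  part of \<open>f (x + z) - f x - \<tau>\<close>. The threshold \<tau> is there to compose powers
  from such functions.\<close>

definition excess :: "('a::euclidean_space \<Rightarrow> real) \<Rightarrow> 'a set \<Rightarrow> real \<Rightarrow> ennreal" where
  "excess f K \<tau> = (\<integral>\<^sup>+z. indicator K z * (\<integral>\<^sup>+x. ennreal (f (x + z) - f x - \<tau>)))"

text \<open>For fixed \<open>x\<close> and \<open>z\<close> the integrand is the length of the set
  of levels \<open>t\<close> with \<open>f x \<le> t < f (x + z) - \<tau>\<close>. At such a level
  \<open>x + z\<close> lies in the superlevel set of \<open>t + \<tau>\<close> and \<open>x\<close>
  outside that of \<open>t\<close>.\<close>

lemma excess_layers:
  fixes f :: "'a::euclidean_space \<Rightarrow> real"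
  assumes [measurable]: "f \<in> borel_measurable borel" "K \<in> sets borel" and f: "\<And>x. 0 \<le> f x"
  shows "excess f K \<tau> = (\<integral>\<^sup>+t. indicator {0<..} t * escape {x. f x > t + \<tau>} {x. f x > t} K)"
proof -
  have 1: "ennreal (a - b - \<tau>) = (\<integral>\<^sup>+t. indicator {0<..} t * (indicator {0<..} (a - t - \<tau>) * indicator {..0} (b - t)))"
    if "0 \<le> b" for a b
  proof -
    have "(\<integral>\<^sup>+t. indicator {0<..} t * (indicator {0<..} (a - t - \<tau>) * indicator {..0} (b - t)))
       = (\<integral>\<^sup>+t. indicator {b..<a - \<tau>} t)"
      using that by (intro nn_integral_cong_AE eventually_mono[OF AE_lborel_singleton[of 0]]) (auto simp: indicator_def)
    also have "\<dots> = ennreal (a - b - \<tau>)"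
      by (cases "b \<le> a - \<tau>") (auto simp: ennreal_neg algebra_simps)
    finally show ?thesis by simp
  qed
  have "excess f K \<tau> = (\<integral>\<^sup>+z. \<integral>\<^sup>+x. \<integral>\<^sup>+t. indicator K z * (indicator {0<..} t * (indicator {0<..} (f (x + z) - t - \<tau>) * indicator {..0} (f x - t))))"
    unfolding excess_def 1[OF f] by (simp add: nn_integral_cmult)
  also have "\<dots> = (\<integral>\<^sup>+z. \<integral>\<^sup>+t. \<integral>\<^sup>+x. indicator K z * (indicator {0<..} t * (indicator {0<..} (f (x + z) - t - \<tau>) * indicator {..0} (f x - t))))"
    by (rule nn_integral_cong, rule lborel_pair.Fubini') measurable
  also have "\<dots> = (\<integral>\<^sup>+t. \<integral>\<^sup>+z. \<integral>\<^sup>+x. indicator K z * (indicator {0<..} t * (indicator {0<..} (f (x + z) - t - \<tau>) * indicator {..0} (f x - t))))"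
    by (rule lborel_pair.Fubini') measurable
  also have "\<dots> = (\<integral>\<^sup>+t. indicator {0<..} t * escape {x. f x > t + \<tau>} {x. f x > t} K)"
  proof (rule nn_integral_cong)
    fix t :: real
    have "(\<integral>\<^sup>+z. \<integral>\<^sup>+x. indicator K z * (indicator {0<..} t * (indicator {0<..} (f (x + z) - t - \<tau>) * indicator {..0} (f x - t))))
      = (\<integral>\<^sup>+z. \<integral>\<^sup>+x. indicator {0<..} t * (indicator K z * indicator {x. f x > t + \<tau>} (x + z) * indicator (- {x. f x > t}) x))"
      by (intro nn_integral_cong) (auto simp: indicator_def)
    then show "(\<integral>\<^sup>+z. \<integral>\<^sup>+x. indicator K z * (indicator {0<..} t * (indicator {0<..} (f (x + z) - t - \<tau>) * indicator {..0} (f x - t))))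
      = indicator {0<..} t * escape {x. f x > t + \<tau>} {x. f x > t} K"
      by (simp add: escape_def nn_integral_cmult)
  qed
  finally show ?thesis .
qed

text \<open>The origin is exempt because the Schwarz rearrangement has a junk value there.\<close>

definition rearrangement_of :: "('a::euclidean_space \<Rightarrow> real) \<Rightarrow> ('a \<Rightarrow> real) \<Rightarrow> bool" where
  "rearrangement_of f h \<longleftrightarrow> h \<in> borel_measurable borel \<and> (\<forall>x. 0 \<le> h x) \<and>
     (\<forall>t>0. \<exists>\<rho>\<ge>0. vol {x. \<bar>f x\<bar> > t} = vol (ball (0::'a) \<rho>) \<and>
        (\<forall>x. x \<noteq> 0 \<longrightarrow> (h x > t \<longleftrightarrow> norm x < \<rho>)))"

lemma escape_cong_AE:
  fixes A B K :: "'a::euclidean_space set"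
  assumes "AE x in lborel. x \<in> A \<longleftrightarrow> x \<in> A'" "AE x in lborel. x \<in> B \<longleftrightarrow> x \<in> B'"
  shows "escape A B K = escape A' B' K"
  unfolding escape_def
proof (rule nn_integral_cong, rule nn_integral_cong_AE)
  fix z :: 'a
  have "AE x in distr lborel borel ((+) z). x \<in> A \<longleftrightarrow> x \<in> A'"
    unfolding lborel_distr_plus by (rule assms(1))
  then have "AE x in lborel. z + x \<in> A \<longleftrightarrow> z + x \<in> A'"
    by (rule AE_distrD[rotated]) measurable
  with assms(2) show "AE x in lborel. (indicator K z * indicator A (x + z) * indicator (- B) x :: ennreal) = indicator K z * indicator A' (x + z) * indicator (- B') x"
    by eventually_elim (auto simp: indicator_def add.commute)
qed

text \<open>At each positive level \<open>s\<close> the set \<open>{x. \<bar>f x\<bar> > s}\<close>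
  is the disjoint union of superlevel sets of the two parts of \<open>f\<close>. Their volumes
  therefore add up to the ball that \<open>h\<close> assigns to this level, as the inequality for
  pairs of sets demands. The level sets of \<open>h\<close> are balls only away from the origin,
  which \<open>escape\<close> does not see.\<close>

lemma excess_rearrangement:
  fixes f h :: "'a::euclidean_space \<Rightarrow> real"
  assumes f[measurable]: "f \<in> borel_measurable borel" and h: "rearrangement_of f h" and \<tau>: "0 \<le> \<tau>"
    and K[measurable]: "K \<in> sets borel" "convex K" "bounded K" "vol K = vol (ball (0::'a) k)" "0 \<le> k"
  shows "excess h (ball 0 k) \<tau> \<le> excess (\<lambda>x. max (f x) 0) K \<tau> + excess (\<lambda>x. max (- f x) 0) {z. - z \<in> K} \<tau>"
proof -
  have [measurable]: "h \<in> borel_measurable borel" and h0: "\<And>x. 0 \<le> h x" using h by (auto simp: rearrangement_of_def)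
  have [measurable]: "{z. - z \<in> K} \<in> sets borel" by measurable
  have "excess h (ball 0 k) \<tau> = (\<integral>\<^sup>+t. indicator {0<..} t * escape {x. h x > t + \<tau>} {x. h x > t} (ball 0 k))"
    using h0 by (intro excess_layers) auto
  also have "\<dots> \<le> (\<integral>\<^sup>+t. indicator {0<..} t * escape {x. max (f x) 0 > t + \<tau>} {x. max (f x) 0 > t} K
      + indicator {0<..} t * escape {x. max (- f x) 0 > t + \<tau>} {x. max (- f x) 0 > t} {z. - z \<in> K})"
  proof (rule nn_integral_mono)
    fix t :: real
    have "escape {x. h x > t + \<tau>} {x. h x > t} (ball 0 k) \<le> escape {x. max (f x) 0 > t + \<tau>} {x. max (f x) 0 > t} K
        + escape {x. max (- f x) 0 > t + \<tau>} {x. max (- f x) 0 > t} {z. - z \<in> K}" if t: "t > 0"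
    proof -
      have *: "\<exists>\<rho>\<ge>0. vol {x. max (f x) 0 > s} + vol {x. max (- f x) 0 > s} = vol (ball (0::'a) \<rho>) \<and>
        (\<forall>x. x \<noteq> 0 \<longrightarrow> (h x > s \<longleftrightarrow> norm x < \<rho>))" if s: "s > 0" for s
      proof -
        have "{x. \<bar>f x\<bar> > s} = {x. max (f x) 0 > s} \<union> {x. max (- f x) 0 > s}" using s by auto
        then have "vol {x. max (f x) 0 > s} + vol {x. max (- f x) 0 > s} = vol {x. \<bar>f x\<bar> > s}"
          using s by (subst plus_emeasure) auto
        then show ?thesis using h s by (auto simp: rearrangement_of_def)
      qed
      obtain a where a: "a \<ge> 0" "vol {x. max (f x) 0 > t + \<tau>} + vol {x. max (- f x) 0 > t + \<tau>} = vol (ball (0::'a) a)"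
         "\<And>x. x \<noteq> 0 \<Longrightarrow> h x > t + \<tau> \<longleftrightarrow> norm x < a" using *[of "t + \<tau>"] t \<tau> by auto
      obtain b where b: "b \<ge> 0" "vol {x. max (f x) 0 > t} + vol {x. max (- f x) 0 > t} = vol (ball (0::'a) b)"
         "\<And>x. x \<noteq> 0 \<Longrightarrow> h x > t \<longleftrightarrow> norm x < b" using *[of "t"] t by auto
      have "escape {x. h x > t + \<tau>} {x. h x > t} (ball 0 k) = escape (ball (0::'a) a) (ball 0 b) (ball 0 k)"
        using a(3) b(3) by (intro escape_cong_AE eventually_mono[OF AE_lborel_singleton[of 0]]) auto
      also have "\<dots> \<le> escape {x. max (f x) 0 > t + \<tau>} {x. max (f x) 0 > t} K
        + escape {x. max (- f x) 0 > t + \<tau>} {x. max (- f x) 0 > t} {z. - z \<in> K}"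
        by (rule escape_rearrangement_pair) (use a(1,2) b(1,2) K in auto)
      finally show ?thesis .
    qed
    then show "indicator {0<..} t * escape {x. h x > t + \<tau>} {x. h x > t} (ball 0 k) \<le> indicator {0<..} t * escape {x. max (f x) 0 > t + \<tau>} {x. max (f x) 0 > t} K
      + indicator {0<..} t * escape {x. max (- f x) 0 > t + \<tau>} {x. max (- f x) 0 > t} {z. - z \<in> K}"
      by (auto simp: indicator_def)
  qed
  also have "\<dots> = excess (\<lambda>x. max (f x) 0) K \<tau> + excess (\<lambda>x. max (- f x) 0) {z. - z \<in> K} \<tau>"
  proof -
    have m: "(\<lambda>t. escape {x. g x > t + \<tau>} {x. g x > t} L) \<in> borel_measurable borel"
      if [measurable]: "g \<in> borel_measurable borel" "L \<in> sets borel" for g :: "'a \<Rightarrow> real" and L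
    proof -
      have "(\<lambda>t. escape {x. g x > t + \<tau>} {x. g x > t} L) = (\<lambda>t. \<integral>\<^sup>+z. \<integral>\<^sup>+x. indicator L z * indicator {0<..} (g (x + z) - t - \<tau>) * indicator {..0} (g x - t))"
        unfolding escape_def by (intro ext nn_integral_cong) (auto simp: indicator_def)
      also have "\<dots> \<in> borel_measurable borel" by measurable
      finally show ?thesis .
    qed
    show ?thesis
      by (subst nn_integral_add) (auto intro!: borel_measurable_times_ennreal m simp: excess_layers)
  qed
  finally show ?thesis .
qed

section \<open>Powers of the positive difference\<close>

definition excess_p :: "real \<Rightarrow> ('a::euclidean_space \<Rightarrow> real) \<Rightarrow> 'a set \<Rightarrow> ennreal" where
  "excess_p p f K = (\<integral>\<^sup>+z. indicator K z * (\<integral>\<^sup>+x. ennreal (max (f (x + z) - f x) 0 powr p)))"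

text \<open>Taylor's formula with integral remainder for the power function at 0, with
  antiderivative \<open>F\<close>. It represents the power as a superposition, with nonnegative
  weight, of the functions \<open>y - \<tau>\<close> cut off at 0. At \<open>p = 1\<close> the
  weight vanishes, and that case is read off from \<open>excess\<close> with threshold 0.\<close>

lemma powr_layers:
  assumes p: "p > 1" and y: "y \<ge> 0"
  shows "ennreal (y powr p) = (\<integral>\<^sup>+\<tau>. indicator {0<..} \<tau> * (ennreal (p * (p - 1) * \<tau> powr (p - 2)) * ennreal (y - \<tau>)))"
proof -
  define F where "F \<tau> = p * y * \<tau> powr (p - 1) - (p - 1) * \<tau> powr p" for \<tau>
  have cont: "continuous_on {0..y} F" unfolding F_def
    using p by (intro continuous_intros continuous_on_powr') auto
  have "((\<lambda>\<tau>. p * (p - 1) * \<tau> powr (p - 2) * (y - \<tau>)) has_integral (F y - F 0)) {0..y}"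
  \<comment> \<open>For \<open>p < 2\<close> the weight is singular at 0, so the derivative is taken
    only in the interior, with continuity of \<open>F\<close> at the end points.\<close>
  proof (rule fundamental_theorem_of_calculus_interior[OF y cont])
    fix \<tau> assume t: "\<tau> \<in> {0<..<y}"
    have "(F has_real_derivative p * y * ((p - 1) * \<tau> powr (p - 1 - 1)) - (p - 1) * (p * \<tau> powr (p - 1))) (at \<tau>)"
      unfolding F_def using t by (auto intro!: derivative_eq_intros)
    moreover have "\<tau> powr (p - 1) = \<tau> powr (p - 2) * \<tau>" using t powr_add[of \<tau> "p - 2" 1] by simp
    ultimately show "(F has_vector_derivative p * (p - 1) * \<tau> powr (p - 2) * (y - \<tau>)) (at \<tau>)"
      by (simp add: has_real_derivative_iff_has_vector_derivative[symmetric] algebra_simps)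
  qed
  moreover have "F y - F 0 = y powr p"
  proof (cases "y = 0")
    case False
    then have "y * y powr (p - 1) = y powr p" using y powr_add[of y 1 "p - 1"] by simp
    then have "p * y * y powr (p - 1) = p * y powr p" by (simp add: mult.assoc)
    then show ?thesis using p by (simp add: F_def algebra_simps)
  qed (use p in \<open>simp add: F_def\<close>)
  ultimately have "((\<lambda>\<tau>. p * (p - 1) * \<tau> powr (p - 2) * (y - \<tau>)) has_integral (y powr p)) {0..y}" by simp
  then have "ennreal (y powr p) = (\<integral>\<^sup>+\<tau>. ennreal (indicator {0..y} \<tau> * (p * (p - 1) * \<tau> powr (p - 2) * (y - \<tau>))))"
    using p by (intro nn_integral_has_integral_lebesgue[symmetric]) auto
  also have "\<dots> = (\<integral>\<^sup>+\<tau>. indicator {0<..} \<tau> * (ennreal (p * (p - 1) * \<tau> powr (p - 2)) * ennreal (y - \<tau>)))"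
    using p by (intro nn_integral_cong_AE eventually_mono[OF AE_lborel_singleton[of 0]])
      (auto simp: indicator_def ennreal_mult ennreal_neg)
  finally show ?thesis .
qed

lemma excess_p_layers:
  fixes f :: "'a::euclidean_space \<Rightarrow> real"
  assumes [measurable]: "f \<in> borel_measurable borel" "K \<in> sets borel" and p: "p > 1"
  shows "excess_p p f K = (\<integral>\<^sup>+\<tau>. indicator {0<..} \<tau> * ennreal (p * (p - 1) * \<tau> powr (p - 2)) * excess f K \<tau>)"
proof -
  have "excess_p p f K = (\<integral>\<^sup>+z. \<integral>\<^sup>+x. \<integral>\<^sup>+\<tau>. indicator K z * (indicator {0<..} \<tau> * (ennreal (p * (p - 1) * \<tau> powr (p - 2)) * ennreal (max (f (x + z) - f x) 0 - \<tau>))))"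
    unfolding excess_p_def by (subst powr_layers[OF p]) (auto simp: nn_integral_cmult)
  also have "\<dots> = (\<integral>\<^sup>+z. \<integral>\<^sup>+\<tau>. \<integral>\<^sup>+x. indicator K z * (indicator {0<..} \<tau> * (ennreal (p * (p - 1) * \<tau> powr (p - 2)) * ennreal (max (f (x + z) - f x) 0 - \<tau>))))"
    by (rule nn_integral_cong, rule lborel_pair.Fubini') measurable
  also have "\<dots> = (\<integral>\<^sup>+\<tau>. \<integral>\<^sup>+z. \<integral>\<^sup>+x. indicator K z * (indicator {0<..} \<tau> * (ennreal (p * (p - 1) * \<tau> powr (p - 2)) * ennreal (max (f (x + z) - f x) 0 - \<tau>))))"
    by (rule lborel_pair.Fubini') measurable
  also have "\<dots> = (\<integral>\<^sup>+\<tau>. indicator {0<..} \<tau> * ennreal (p * (p - 1) * \<tau> powr (p - 2)) * excess f K \<tau>)"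
  proof (rule nn_integral_cong)
    fix \<tau> :: real
    define w where "w = indicator {0<..} \<tau> * ennreal (p * (p - 1) * \<tau> powr (p - 2))"
    have "(\<integral>\<^sup>+z. \<integral>\<^sup>+x. indicator K z * (indicator {0<..} \<tau> * (ennreal (p * (p - 1) * \<tau> powr (p - 2)) * ennreal (max (f (x + z) - f x) 0 - \<tau>))))
       = (\<integral>\<^sup>+z. \<integral>\<^sup>+x. w * (indicator K z * ennreal (f (x + z) - f x - \<tau>)))"
      by (intro nn_integral_cong) (auto simp: w_def indicator_def max_def ennreal_neg)
    also have "\<dots> = w * excess f K \<tau>"
      unfolding excess_def by (simp add: nn_integral_cmult)
    finally show "(\<integral>\<^sup>+z. \<integral>\<^sup>+x. indicator K z * (indicator {0<..} \<tau> * (ennreal (p * (p - 1) * \<tau> powr (p - 2)) * ennreal (max (f (x + z) - f x) 0 - \<tau>))))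
       = indicator {0<..} \<tau> * ennreal (p * (p - 1) * \<tau> powr (p - 2)) * excess f K \<tau>" by (simp add: w_def)
  qed
  finally show ?thesis .
qed

lemma excess_p_1: "excess_p 1 f K = excess f K 0"
  unfolding excess_p_def excess_def by (intro nn_integral_cong arg_cong2[where f="(*)"]) (auto simp: max_def ennreal_neg)

lemma add_powr_le:
  fixes x y p :: real
  assumes "0 \<le> x" "0 \<le> y" "1 \<le> p"
  shows "x powr p + y powr p \<le> (x + y) powr p"
proof (cases "x + y = 0")
  case True
  then show ?thesis using assms by (simp add: add_nonneg_eq_0_iff)
next
  case False
  then have s: "x + y > 0" using assms by simp
  have *: "u powr p \<le> u" if "0 \<le> u" "u \<le> 1" for u :: real
    using powr_mono'[of 1 p u] that assms by (cases "u = 0") auto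
  have "x powr p + y powr p = (x + y) powr p * ((x / (x + y)) powr p + (y / (x + y)) powr p)"
    using assms s by (simp add: powr_divide distrib_left)
  also have "\<dots> \<le> (x + y) powr p * (x / (x + y) + y / (x + y))"
    using assms s by (intro mult_left_mono add_mono *) auto
  also have "\<dots> = (x + y) powr p" using s by (simp add: add_divide_distrib[symmetric])
  finally show ?thesis .
qed

text \<open>The positive difference of two values is the sum of the increase of the positive part
  and the decrease of the negative part, and powers with \<open>p \<ge> 1\<close> are superadditive
  on nonnegative numbers. A decrease along \<open>z\<close> is an increase along \<open>- z\<close>;
  hence the reflected kernel for the negative part.\<close>

lemma excess_p_parts_le:
  fixes f :: "'a::euclidean_space \<Rightarrow> real"
  assumes [measurable]: "f \<in> borel_measurable borel" "K \<in> sets borel" and p: "p \<ge> 1"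
  shows "excess_p p (\<lambda>x. max (f x) 0) K + excess_p p (\<lambda>x. max (- f x) 0) {z. - z \<in> K} \<le> excess_p p f K"
proof -
  define d where "d a b = max (max a 0 - max b 0) 0 powr p" for a b :: real
  have [measurable]: "(\<lambda>x. d (a x) (b x)) \<in> borel_measurable M" if "a \<in> borel_measurable M" "b \<in> borel_measurable M" for a b and M :: "'b measure"
    using that unfolding d_def by measurable
  have "excess_p p (\<lambda>x. max (- f x) 0) {z. - z \<in> K}
      = (\<integral>\<^sup>+z. indicator {z. - z \<in> K} (0 - z) * (\<integral>\<^sup>+x. ennreal (d (- f (x + (0 - z))) (- f x))))"
    unfolding excess_p_def d_def by (rule nn_integral_lborel_reflect[symmetric]) measurable
  also have "\<dots> = (\<integral>\<^sup>+z. indicator K z * (\<integral>\<^sup>+x. ennreal (d (- f x) (- f (x + z)))))"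
  proof (rule nn_integral_cong)
    fix z
    have "(\<integral>\<^sup>+x. ennreal (d (- f (x + (0 - z))) (- f x))) = (\<integral>\<^sup>+x. ennreal (d (- f ((x + z) + (0 - z))) (- f (x + z))))"
      by (rule nn_integral_lborel_translate[symmetric]) measurable
    then show "indicator {z. - z \<in> K} (0 - z) * (\<integral>\<^sup>+x. ennreal (d (- f (x + (0 - z))) (- f x)))
      = indicator K z * (\<integral>\<^sup>+x. ennreal (d (- f x) (- f (x + z))))"
      by (simp add: indicator_def)
  qed
  finally have "excess_p p (\<lambda>x. max (f x) 0) K + excess_p p (\<lambda>x. max (- f x) 0) {z. - z \<in> K}
     = (\<integral>\<^sup>+z. indicator K z * (\<integral>\<^sup>+x. ennreal (d (f (x + z)) (f x)) + ennreal (d (- f x) (- f (x + z)))))"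
    unfolding excess_p_def d_def[symmetric] by (simp add: nn_integral_add distrib_left)
  also have "\<dots> \<le> excess_p p f K"
    unfolding excess_p_def
  proof (rule nn_integral_mono, rule mult_left_mono, rule nn_integral_mono)
    fix z x
    have d0: "0 \<le> d a b" for a b by (simp add: d_def)
    have "d a b + d (- b) (- a) \<le> max (a - b) 0 powr p" for a b
    proof -
      have "d a b + d (- b) (- a) \<le> (max (max a 0 - max b 0) 0 + max (max (-b) 0 - max (-a) 0) 0) powr p"
        unfolding d_def using p by (intro add_powr_le) auto
      also have "max (max a 0 - max b 0) 0 + max (max (-b) 0 - max (-a) 0) 0 = max (a - b) 0"
        by (auto simp: max_def)
      finally show ?thesis .
    qed
    then show "ennreal (d (f (x + z)) (f x)) + ennreal (d (- f x) (- f (x + z))) \<le> ennreal (max (f (x + z) - f x) 0 powr p)"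
      by (simp add: ennreal_plus[symmetric] d0 ennreal_leI del: ennreal_plus)
  qed simp
  finally show ?thesis .
qed

theorem excess_p_rearrangement:
  fixes f h :: "'a::euclidean_space \<Rightarrow> real"
  assumes f[measurable]: "f \<in> borel_measurable borel" and h: "rearrangement_of f h" and p: "1 \<le> p"
    and K[measurable]: "K \<in> sets borel" "convex K" "bounded K" "vol K = vol (ball (0::'a) k)" "0 \<le> k"
  shows "excess_p p h (ball 0 k) \<le> excess_p p f K"
proof -
  have [measurable]: "h \<in> borel_measurable borel" using h by (auto simp: rearrangement_of_def)
  have [measurable]: "{z. - z \<in> K} \<in> sets borel" by measurable
  have "excess_p p h (ball 0 k) \<le> excess_p p (\<lambda>x. max (f x) 0) K + excess_p p (\<lambda>x. max (- f x) 0) {z. - z \<in> K}"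
  proof (cases "p = 1")
    case True
    then show ?thesis using excess_rearrangement[OF f h _ K, of 0] by (simp add: excess_p_1)
  next
    case False
    then have p1: "p > 1" using p by simp
    define w where "w \<tau> = indicator {0<..} \<tau> * ennreal (p * (p - 1) * \<tau> powr (p - 2))" for \<tau>
    have [measurable]: "w \<in> borel_measurable borel" unfolding w_def by measurable
    have [measurable]: "excess g L \<in> borel_measurable borel"
      if [measurable]: "g \<in> borel_measurable borel" "L \<in> sets borel" for g :: "'a \<Rightarrow> real" and L
      unfolding excess_def by measurable
    have "excess_p p h (ball 0 k) = (\<integral>\<^sup>+\<tau>. w \<tau> * excess h (ball 0 k) \<tau>)"
      unfolding w_def by (rule excess_p_layers) (use p1 in auto)
    also have "\<dots> \<le> (\<integral>\<^sup>+\<tau>. w \<tau> * excess (\<lambda>x. max (f x) 0) K \<tau> + w \<tau> * excess (\<lambda>x. max (- f x) 0) {z. - z \<in> K} \<tau>)"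
    proof (rule nn_integral_mono)
      fix \<tau>
      show "w \<tau> * excess h (ball 0 k) \<tau> \<le> w \<tau> * excess (\<lambda>x. max (f x) 0) K \<tau> + w \<tau> * excess (\<lambda>x. max (- f x) 0) {z. - z \<in> K} \<tau>"
      proof (cases "\<tau> > 0")
        case True
        then show ?thesis using excess_rearrangement[OF f h _ K, of \<tau>] by (simp add: distrib_left[symmetric] mult_left_mono)
      qed (simp add: w_def)
    qed
    also have "\<dots> = excess_p p (\<lambda>x. max (f x) 0) K + excess_p p (\<lambda>x. max (- f x) 0) {z. - z \<in> K}"
      using p1 by (simp add: nn_integral_add excess_p_layers w_def)
    finally show ?thesis .
  qed
  also have "\<dots> \<le> excess_p p f K" by (rule excess_p_parts_le) (use p in auto)
  finally show ?thesis .
qed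

section \<open>Test functions and the fundamental lemma\<close>

lemma ball_measurable [measurable]:
  "ball (c::'a::euclidean_space) r \<in> sets borel" "cball c r \<in> sets borel"
  by auto

lemma frechet_derivative_eq:
  "(f has_derivative f') (at x) \<Longrightarrow> frechet_derivative f (at x) = f'"
  using frechet_derivative_at by metis

lemma C_k_Suc_imp: "C_k (Suc k) f \<Longrightarrow> C_k k f"
proof (induction k arbitrary: f)
  case 0
  then show ?case by (simp add: differentiable_imp_continuous_on)
next
  case (Suc k)
  then show ?case by auto
qed

lemma C_k_const: "C_k k (\<lambda>_::'a::euclidean_space. c)"
proof (induction k arbitrary: c)
  case (Suc k)
  have "frechet_derivative (\<lambda>_::'a. c) (at x) = (\<lambda>_. 0)" for x
    by (rule frechet_derivative_eq) simp
  then show ?case using Suc by (simp add: differentiable_on_def)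
qed simp

lemma C_k_has_derivative:
  assumes "C_k (Suc k) f"
  shows "(f has_derivative frechet_derivative f (at x)) (at x)"
  using assms by (simp add: differentiable_on_def frechet_derivative_works)

lemma C_k_SucI:
  assumes "\<And>x. (f has_derivative f' x) (at x)" and "\<And>b. b \<in> Basis \<Longrightarrow> C_k k (\<lambda>x. f' x b)"
  shows "C_k (Suc k) f"
proof -
  have "frechet_derivative f (at x) = f' x" for x by (rule frechet_derivative_eq[OF assms(1)])
  then show ?thesis using assms by (auto simp: differentiable_on_def differentiable_def)
qed

lemma C_k_add: "C_k k f \<Longrightarrow> C_k k g \<Longrightarrow> C_k k (\<lambda>x. f x + g x)"
proof (induction k arbitrary: f g)
  case 0
  then show ?case by (simp add: continuous_on_add)
next
  case (Suc k)
  show ?case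
    using C_k_has_derivative[OF Suc.prems(1)] C_k_has_derivative[OF Suc.prems(2)]
    by (rule C_k_SucI[OF has_derivative_add]) (use Suc in auto)
qed

lemma C_k_mult: "C_k k f \<Longrightarrow> C_k k g \<Longrightarrow> C_k k (\<lambda>x. f x * g x)"
proof (induction k arbitrary: f g)
  case 0
  then show ?case by (simp add: continuous_on_mult)
next
  case (Suc k)
  show ?case
    using C_k_has_derivative[OF Suc.prems(1)] C_k_has_derivative[OF Suc.prems(2)]
  proof (rule C_k_SucI[OF has_derivative_mult])
    fix b :: 'a assume b: "b \<in> Basis"
    show "C_k k (\<lambda>x. f x * frechet_derivative g (at x) b + frechet_derivative f (at x) b * g x)"
      using Suc.prems b C_k_Suc_imp[OF Suc.prems(1)] C_k_Suc_imp[OF Suc.prems(2)]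
      by (intro C_k_add Suc.IH) auto
  qed
qed

lemma C_k_prod: "finite I \<Longrightarrow> (\<And>i. i \<in> I \<Longrightarrow> C_k k (f i)) \<Longrightarrow> C_k k (\<lambda>x. \<Prod>i\<in>I. f i x)"
  by (induction I rule: finite_induct) (auto intro: C_k_const C_k_mult)

lemma C_k_translate: "C_k k f \<Longrightarrow> C_k k (\<lambda>x. f (x - c))"
proof (induction k arbitrary: f)
  case 0
  then show ?case by (auto intro!: continuous_intros intro: continuous_on_compose2)
next
  case (Suc k)
  have "((\<lambda>x. f (x - c)) has_derivative frechet_derivative f (at (x - c))) (at x)" for x
  proof -
    have "((\<lambda>x. x - c) has_derivative (\<lambda>h. h)) (at x)" by (auto intro!: derivative_eq_intros)
    from has_derivative_compose[OF this C_k_has_derivative[OF Suc.prems]] show ?thesis .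
  qed
  then show ?case by (rule C_k_SucI) (use Suc in auto)
qed

section \<open>Smooth bumps on boxes\<close>

text \<open>The classical smooth function \<open>exp (- c / s)\<close> extended by 0. The powers of
  \<open>s\<close> in the denominator make the family closed under differentiation, including at 0,
  so that \<open>C_k\<close> follows by induction over \<open>k\<close> for all \<open>m\<close> at
  once.\<close>

definition flat :: "real \<Rightarrow> nat \<Rightarrow> real \<Rightarrow> real" where
  "flat c m s = (if s > 0 then exp (- c / s) / s ^ m else 0)"

lemma flat_deriv:
  assumes c: "c > 0"
  shows "(flat c m has_real_derivative - real m * flat c (Suc m) s + c * flat c (Suc (Suc m)) s) (at s)"
proof -
  consider "s > 0" | "s < 0" | "s = 0" by linarith
  then show ?thesis
  proof cases
    case 1
    have "((\<lambda>s. exp (- c / s) / s ^ m) has_real_derivative - real m * flat c (Suc m) s + c * flat c (Suc (Suc m)) s) (at s)"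
    proof -
      have pm: "real m * s ^ (m - Suc 0) = real m * s ^ m / s" using 1 by (cases m) auto
      have "((\<lambda>s. exp (- c / s) / s ^ m) has_real_derivative
          ((exp (- c / s) * (c / s ^ 2)) * s ^ m - exp (- c / s) * (real m * s ^ (m - Suc 0))) / (s ^ m * s ^ m)) (at s)"
        using 1 by (auto intro!: derivative_eq_intros simp: power2_eq_square)
      moreover have "((exp (- c / s) * (c / s ^ 2)) * s ^ m - exp (- c / s) * (real m * s ^ (m - Suc 0))) / (s ^ m * s ^ m)
          = - real m * flat c (Suc m) s + c * flat c (Suc (Suc m)) s"
      proof -
        have "((E * (c / s ^ 2)) * S - E * (real m * S / s)) / (S * S) = - real m * (E / (s * S)) + c * (E / (s * (s * S)))"
          if "S \<noteq> 0" for E S :: real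
          using 1 that by (simp add: field_simps power2_eq_square)
        from this[of "s ^ m" "exp (- c / s)"] show ?thesis unfolding pm flat_def using 1 by simp
      qed
      ultimately show ?thesis by simp
    qed
    then show ?thesis
      by (rule has_field_derivative_transform_within[of _ _ _ _ s]) (use 1 in \<open>auto simp: flat_def dist_real_def\<close>)
  next
    case 2
    have "((\<lambda>s. 0) has_real_derivative 0) (at s)" by simp
    then have "(flat c m has_real_derivative 0) (at s)"
      by (rule has_field_derivative_transform_within[of _ _ _ _ "-s"]) (use 2 in \<open>auto simp: flat_def dist_real_def\<close>)
    then show ?thesis using 2 by (simp add: flat_def)
  next
    case 3
    have "((\<lambda>h. flat c m h / h) \<longlongrightarrow> 0) (at_right 0)"
    proof -
      have "((\<lambda>h. exp (- c / h) / h ^ m / h) \<longlongrightarrow> 0) (at_right 0)"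
        using c by real_asymp
      then show ?thesis
        by (rule Lim_transform_eventually) (auto simp: flat_def eventually_at_right_less intro!: eventually_mono[OF eventually_at_right_less])
    qed
    moreover have "((\<lambda>h. flat c m h / h) \<longlongrightarrow> 0) (at_left 0)"
      by (rule tendsto_eventually) (auto simp: flat_def eventually_at_left_real intro!: eventually_at_leftI[of "-1"])
    ultimately have "((\<lambda>h. flat c m h / h) \<longlongrightarrow> 0) (at 0)" by (rule filterlim_split_at[rotated])
    then show ?thesis using 3 by (simp add: DERIV_def flat_def)
  qed
qed

lemma C_k_flat:
  fixes i :: "'a::euclidean_space"
  assumes c: "c > 0"
  shows "C_k k (\<lambda>x. flat c m (\<sigma> * (x \<bullet> i) - a))"
proof (induction k arbitrary: m)
  case 0
  have "continuous_on UNIV (flat c m)"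
    using DERIV_isCont[OF flat_deriv[OF c]] by (auto intro!: continuous_at_imp_continuous_on)
  then show ?case by (auto intro!: continuous_intros intro: continuous_on_compose2)
next
  case (Suc k)
  define D where "D x h = (- real m * flat c (Suc m) (\<sigma> * (x \<bullet> i) - a) + c * flat c (Suc (Suc m)) (\<sigma> * (x \<bullet> i) - a)) * (\<sigma> * (h \<bullet> i))" for x h :: 'a
  have "((\<lambda>x. flat c m (\<sigma> * (x \<bullet> i) - a)) has_derivative D x) (at x)" for x :: 'a
  proof -
    have "((\<lambda>x. \<sigma> * (x \<bullet> i) - a) has_derivative (\<lambda>h. \<sigma> * (h \<bullet> i))) (at x)"
      by (auto intro!: derivative_eq_intros)
    from has_derivative_compose[OF this flat_deriv[OF c, unfolded has_field_derivative_def, of m]]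
    show ?thesis by (simp add: D_def[abs_def])
  qed
  moreover have "C_k k (\<lambda>x. D x b)" for b
    unfolding D_def by (intro C_k_add C_k_mult C_k_const Suc.IH)
  ultimately show ?case by (rule C_k_SucI)
qed

text \<open>One factor for each face of the box. The coefficients \<open>1\<close> and
  \<open>-1\<close> are spelled out to match the parameter \<sigma> of \<open>C_k_flat\<close>. For
  \<open>c\<close> tending to 0 the bumps converge to the indicator of the open box.\<close>

definition bump :: "real \<Rightarrow> 'a::euclidean_space \<Rightarrow> 'a \<Rightarrow> 'a \<Rightarrow> real" where
  "bump c a b x = (\<Prod>i\<in>Basis. flat c 0 (1 * (x \<bullet> i) - a \<bullet> i) * flat c 0 (-1 * (x \<bullet> i) - (- (b \<bullet> i))))"

lemma bump_outside: "x \<notin> box a b \<Longrightarrow> bump c a b x = 0"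
  by (auto simp: bump_def flat_def mem_box prod_zero_iff)

lemma bump_bounds: "c > 0 \<Longrightarrow> 0 \<le> bump c a b x \<and> bump c a b x \<le> 1"
proof -
  assume c: "c > 0"
  have "0 \<le> flat c 0 s \<and> flat c 0 s \<le> 1" for s using c by (auto simp: flat_def)
  then show ?thesis unfolding bump_def
    by (intro conjI prod_nonneg prod_le_1) (auto intro!: mult_nonneg_nonneg mult_le_one)
qed

lemma bump_tendsto: "(\<lambda>j. bump (1 / real (Suc j)) a b x) \<longlonglongrightarrow> indicator (box a b) x"
proof (cases "x \<in> box a b")
  case True
  have f: "(\<lambda>j. flat (1 / real (Suc j)) 0 s) \<longlonglongrightarrow> 1" if "s > 0" for s
  proof -
    have "(\<lambda>j. exp (- (1 / real (Suc j)) / s)) \<longlonglongrightarrow> 1" using that by real_asymp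
    then show ?thesis using that by (simp add: flat_def)
  qed
  have "(\<lambda>j. bump (1 / real (Suc j)) a b x) \<longlonglongrightarrow> (\<Prod>i\<in>(Basis::'a set). 1 * 1)"
    unfolding bump_def using True by (intro tendsto_prod tendsto_mult f) (auto simp: mem_box)
  then show ?thesis using True by simp
qed (simp add: bump_outside)

lemma test_function_bump: "c > 0 \<Longrightarrow> test_function (bump c a b)"
proof -
  assume c: "c > 0"
  have "C_k k (bump c a b)" for k
    unfolding bump_def by (intro C_k_prod C_k_mult C_k_flat c) simp
  moreover have "{x. bump c a b x \<noteq> 0} \<subseteq> cbox a b"
    using bump_outside[of _ a b c] box_subset_cbox[of a b] by blast
  then have "compact (closure {x. bump c a b x \<noteq> 0})"
    by (meson bounded_cbox bounded_subset compact_closure)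
  ultimately show ?thesis by (simp add: test_function_def)
qed

section \<open>Local integrability and the fundamental lemma\<close>

lemma locally_integrable_iff_lborel:
  fixes h :: "'a::euclidean_space \<Rightarrow> 'b::euclidean_space"
  assumes [measurable]: "h \<in> borel_measurable borel"
  shows "locally_integrable h \<longleftrightarrow> (\<forall>R. integrable lborel (\<lambda>x. indicator (cball 0 R) x *\<^sub>R h x))"
proof
  have m: "(\<lambda>x. indicator (cball 0 R) x *\<^sub>R h x) \<in> borel_measurable lborel" for R :: real
    by simp
  assume "locally_integrable h"
  then have "set_integrable lebesgue (cball 0 R) h" for R by (simp add: locally_integrable_def)
  then show "\<forall>R. integrable lborel (\<lambda>x. indicator (cball 0 R) x *\<^sub>R h x)"
    unfolding set_integrable_def integrable_completion[OF m] by blast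
next
  assume int: "\<forall>R. integrable lborel (\<lambda>x. indicator (cball 0 R) x *\<^sub>R h x)"
  show "locally_integrable h"
    unfolding locally_integrable_def
  proof (intro allI impI)
    fix K :: "'a set" assume K: "compact K"
    then obtain R where R: "K \<subseteq> cball 0 R" using bounded_subset_ballD[of K 0] compact_imp_bounded ball_subset_cball by blast
    have [measurable]: "K \<in> sets borel" using K by (simp add: borel_compact)
    have "norm (indicator K x *\<^sub>R h x) \<le> norm (indicator (cball 0 R) x *\<^sub>R h x)" for x
      using subsetD[OF R, of x] by (auto simp: indicator_def)
    then have "integrable lborel (\<lambda>x. indicator K x *\<^sub>R h x)"
      by (intro Bochner_Integration.integrable_bound[OF int[rule_format, of R]] AE_I2) auto
    then show "set_integrable lebesgue K h"
      unfolding set_integrable_def by (subst integrable_completion) auto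
  qed
qed

lemma locally_integrable_measurable:
  fixes h :: "'a::euclidean_space \<Rightarrow> 'b::euclidean_space"
  assumes "locally_integrable h"
  shows "h \<in> borel_measurable lebesgue"
proof (rule borel_measurable_LIMSEQ_metric)
  show "(\<lambda>x. indicator (cball 0 (real j)) x *\<^sub>R h x) \<in> borel_measurable lebesgue" for j
    using assms[unfolded locally_integrable_def, rule_format, of "cball 0 (real j)"] by (auto simp: set_integrable_def)
  show "(\<lambda>j. indicator (cball 0 (real j)) x *\<^sub>R h x) \<longlonglongrightarrow> h x" for x
  proof (rule tendsto_eventually)
    obtain N :: nat where N: "norm x < real N" using reals_Archimedean2 by blast
    show "\<forall>\<^sub>F j in sequentially. indicator (cball 0 (real j)) x *\<^sub>R h x = h x"
      using N by (intro eventually_sequentiallyI[of N]) (auto simp: indicator_def)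
  qed
qed

lemma locally_integrable_cong_AE:
  fixes h h' :: "'a::euclidean_space \<Rightarrow> 'b::euclidean_space"
  assumes "locally_integrable h" "AE x in lborel. h x = h' x" and "h' \<in> borel_measurable borel"
  shows "locally_integrable h'"
  unfolding locally_integrable_def
proof (intro allI impI)
  fix K :: "'a set" assume K: "compact K"
  then have [measurable]: "K \<in> sets borel" by (simp add: borel_compact)
  have 1: "set_integrable lebesgue K h" using assms(1) K by (simp add: locally_integrable_def)
  have 2: "AE x in lebesgue. indicator K x *\<^sub>R h x = indicator K x *\<^sub>R h' x"
    using AE_completion[OF assms(2)] by eventually_elim simp
  have "(\<lambda>x. indicator K x *\<^sub>R h' x) \<in> borel_measurable lebesgue"
    using assms(3) by (intro measurable_completion) simp
  from integrable_cong_AE_imp[OF 1[unfolded set_integrable_def] this 2] show "set_integrable lebesgue K h'"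
    unfolding set_integrable_def .
qed

text \<open>The measures with densities \<open>h\<close> and \<open>- h\<close>, each cut off at 0
  by \<open>ennreal\<close>, agree on boxes. Boxes form an intersection-stable generator, so the
  measures coincide and the densities agree almost everywhere; positive and negative part can be
  equal only if both vanish.\<close>

lemma AE_zero_if_box_integrals_zero:
  fixes h :: "'a::euclidean_space \<Rightarrow> real"
  assumes [measurable]: "h \<in> borel_measurable borel"
    and int: "\<And>a b. integrable lborel (\<lambda>x. indicator (box a b) x * h x)"
    and zero: "\<And>a b. (\<integral>x. indicator (box a b) x * h x) = 0"
  shows "AE x in lborel. h x = 0"
proof -
  have eq: "(\<integral>\<^sup>+x. ennreal (indicator (box a b) x * h x)) = (\<integral>\<^sup>+x. ennreal (- (indicator (box a b) x * h x)))"
    and fin: "(\<integral>\<^sup>+x. ennreal (indicator (box a b) x * h x)) < \<infinity>" for a b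
  proof -
    let ?P = "\<integral>\<^sup>+x. ennreal (indicator (box a b) x * h x)"
      and ?N = "\<integral>\<^sup>+x. ennreal (- (indicator (box a b) x * h x))"
    have f: "?P < \<infinity>" "?N < \<infinity>" using int[of a b] by (auto simp: real_integrable_def less_top)
    have "enn2real ?P - enn2real ?N = 0"
      using zero[of a b] real_lebesgue_integral_def[OF int[of a b]] by simp
    then show "?P = ?N" using f by (metis eq_iff_diff_eq_0 ennreal_enn2real infinity_ennreal_def)
    show "?P < \<infinity>" by fact
  qed
  have em: "emeasure (density lborel (\<lambda>x. ennreal (s * h x))) (box a b) = (\<integral>\<^sup>+x. ennreal (s * (indicator (box a b) x * h x)))" for s a b
    by (subst emeasure_density) (auto intro!: nn_integral_cong simp: indicator_def)
  have "density lborel (\<lambda>x. ennreal (1 * h x)) = density lborel (\<lambda>x. ennreal (-1 * h x))"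
  proof (rule measure_eqI_generator_eq)
    let ?E = "range (\<lambda>(a, b). box a b::'a set)"
    show "Int_stable ?E" by (auto simp: Int_stable_def box_Int_box)
    show "?E \<subseteq> Pow UNIV" "sets (density lborel (\<lambda>x. ennreal (1 * h x))) = sigma_sets UNIV ?E"
       "sets (density lborel (\<lambda>x. ennreal (-1 * h x))) = sigma_sets UNIV ?E"
      by (simp_all add: borel_eq_box)
    let ?A = "\<lambda>n::nat. box (- (real n *\<^sub>R One)) (real n *\<^sub>R One) :: 'a set"
    show "range ?A \<subseteq> ?E" "(\<Union>i. ?A i) = UNIV"
      unfolding UN_box_eq_UNIV by auto
    show "emeasure (density lborel (\<lambda>x. ennreal (1 * h x))) (?A i) \<noteq> \<infinity>" for i
      unfolding em using fin by (simp add: less_top[symmetric])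
    show "emeasure (density lborel (\<lambda>x. ennreal (1 * h x))) X = emeasure (density lborel (\<lambda>x. ennreal (-1 * h x))) X" if XE: "X \<in> ?E" for X
    proof -
      obtain a b where X: "X = box a b" using XE by auto
      show ?thesis unfolding X em using eq[of a b] by simp
    qed
  qed
  then have "AE x in lborel. ennreal (1 * h x) = ennreal (-1 * h x)"
    by (intro sigma_finite_measure.density_unique[OF sigma_finite_lborel]) auto
  then show ?thesis
  proof eventually_elim
    case (elim x)
    show ?case
    proof (cases "0 \<le> h x")
      case True
      then have "ennreal (h x) = 0" using elim by (simp add: ennreal_neg)
      then show ?thesis using True by (simp add: ennreal_eq_0_iff)
    next
      case False
      then have "ennreal (- h x) = 0" using elim by (simp add: ennreal_neg)
      then show ?thesis using False by (simp add: ennreal_eq_0_iff)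
    qed
  qed
qed

text \<open>Bumps converge boundedly to box indicators, so vanishing against test functions gives
  vanishing over every box.\<close>

lemma fundamental_lemma:
  fixes h :: "'a::euclidean_space \<Rightarrow> real"
  assumes m[measurable]: "h \<in> borel_measurable borel" and h: "locally_integrable h"
    and zero: "\<And>\<phi>. test_function \<phi> \<Longrightarrow> (\<integral>x. h x * \<phi> x) = 0"
  shows "AE x in lborel. h x = 0"
proof (rule AE_zero_if_box_integrals_zero[OF m])
  fix a b :: 'a
  have cb: "integrable lborel (\<lambda>x. indicator (cbox a b) x * h x)"
  proof -
    have "set_integrable lebesgue (cbox a b) h" using h by (simp add: locally_integrable_def)
    then show ?thesis unfolding set_integrable_def by (subst (asm) integrable_completion) auto
  qed
  show "integrable lborel (\<lambda>x. indicator (box a b) x * h x)"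
    by (rule Bochner_Integration.integrable_bound[OF cb]) (use box_subset_cbox[of a b] in \<open>auto simp: indicator_def\<close>)
  have mb: "(\<lambda>x. bump (1 / real (Suc j)) a b x) \<in> borel_measurable borel" for j
  proof -
    have "C_k 0 (bump (1 / real (Suc j)) a b)"
      using test_function_bump[of "1 / real (Suc j)" a b] unfolding test_function_def by (simp del: of_nat_Suc)
    then show ?thesis by (intro borel_measurable_continuous_onI) simp
  qed
  have "(\<lambda>j. \<integral>x. h x * bump (1 / real (Suc j)) a b x) \<longlonglongrightarrow> (\<integral>x. indicator (box a b) x * h x)"
  proof (rule integral_dominated_convergence[where w = "\<lambda>x. norm (indicator (cbox a b) x * h x)"])
    show "AE x in lborel. (\<lambda>j. h x * bump (1 / real (Suc j)) a b x) \<longlonglongrightarrow> indicator (box a b) x * h x"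
      using tendsto_mult[OF tendsto_const[of "h _"] bump_tendsto[of a b]] by (simp add: mult.commute)
    show "AE x in lborel. norm (h x * bump (1 / real (Suc j)) a b x) \<le> norm (indicator (cbox a b) x * h x)" for j
    proof (rule AE_I2)
      fix x
      have "\<bar>bump (1 / real (Suc j)) a b x\<bar> \<le> indicator (cbox a b) x"
      proof (cases "x \<in> box a b")
        case True
        then show ?thesis using bump_bounds[of "1 / real (Suc j)" a b x] box_subset_cbox[of a b] by auto
      qed (simp add: bump_outside)
      then show "norm (h x * bump (1 / real (Suc j)) a b x) \<le> norm (indicator (cbox a b) x * h x)"
        by (simp add: abs_mult mult.commute mult_left_mono)
    qed
  qed (use cb mb in auto)
  moreover have "(\<integral>x. h x * bump (1 / real (Suc j)) a b x) = 0" for j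
    by (rule zero[OF test_function_bump]) simp
  ultimately show "(\<integral>x. indicator (box a b) x * h x) = 0"
    using LIMSEQ_unique tendsto_const by (metis (no_types, lifting) ext)
qed

section \<open>Weak gradients and differences\<close>

definition bounded_support :: "('a::euclidean_space \<Rightarrow> real) \<Rightarrow> bool" where
  "bounded_support \<phi> \<longleftrightarrow> \<phi> \<in> borel_measurable borel \<and> (\<exists>R C. \<forall>x. \<bar>\<phi> x\<bar> \<le> C * indicator (cball 0 R) x)"

lemma bounded_support_continuous:
  assumes "continuous_on UNIV \<phi>" and R: "\<And>x. norm x > R \<Longrightarrow> \<phi> x = 0"
  shows "bounded_support \<phi>"
proof -
  have "compact (\<phi> ` cball 0 R)"
    using assms(1) by (intro compact_continuous_image compact_cball) (auto intro: continuous_on_subset)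
  then obtain C where C: "\<And>x. x \<in> cball 0 R \<Longrightarrow> \<bar>\<phi> x\<bar> \<le> C"
    using compact_imp_bounded by (fastforce simp: bounded_iff)
  have "\<bar>\<phi> x\<bar> \<le> C * indicator (cball 0 R) x" for x
    using C[of x] R[of x] by (cases "norm x \<le> R") auto
  then show ?thesis using borel_measurable_continuous_onI[OF assms(1)] unfolding bounded_support_def by blast
qed

lemma test_function_facts:
  fixes \<phi> :: "'a::euclidean_space \<Rightarrow> real"
  assumes "test_function \<phi>"
  shows "bounded_support \<phi>" "continuous_on UNIV \<phi>" "(\<phi> has_derivative frechet_derivative \<phi> (at x)) (at x)"
    "continuous_on UNIV (\<lambda>x. frechet_derivative \<phi> (at x) z)" "bounded_support (\<lambda>x. frechet_derivative \<phi> (at x) z)"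
    "frechet_derivative \<phi> (at x) z = (\<Sum>b\<in>Basis. (z \<bullet> b) * frechet_derivative \<phi> (at x) b)"
proof -
  have C: "C_k k \<phi>" for k using assms by (simp add: test_function_def)
  show cont: "continuous_on UNIV \<phi>" using C[of 0] by simp
  show der: "(\<phi> has_derivative frechet_derivative \<phi> (at x)) (at x)" for x
    by (rule C_k_has_derivative[OF C[of "Suc 0"]])
  have lin: "linear (frechet_derivative \<phi> (at x))" for x using der has_derivative_linear by blast
  show sum: "frechet_derivative \<phi> (at x) z = (\<Sum>b\<in>Basis. (z \<bullet> b) * frechet_derivative \<phi> (at x) b)" for x z
    by (subst euclidean_representation[of z, symmetric]) (simp add: linear_sum[OF lin] linear_cmul[OF lin] del: euclidean_representation)
  have "continuous_on UNIV (\<lambda>x. frechet_derivative \<phi> (at x) b)" if "b \<in> Basis" for b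
    using C[of "Suc 0"] that by simp
  then show contD: "continuous_on UNIV (\<lambda>x. frechet_derivative \<phi> (at x) z)" for z
    by (subst sum) (intro continuous_intros)
  obtain R where R: "{x. \<phi> x \<noteq> 0} \<subseteq> ball 0 R"
    using assms bounded_subset_ballD[of "{x. \<phi> x \<noteq> 0}" 0] closure_subset bounded_subset
    unfolding test_function_def by (metis compact_imp_bounded)
  show "bounded_support \<phi>" using R by (intro bounded_support_continuous[OF cont, of R]) force
  have "frechet_derivative \<phi> (at x) z = 0" if x: "norm x > R" for x z
  proof -
    have "((\<lambda>_. 0) has_derivative (\<lambda>_. 0)) (at x)" by simp
    then have "(\<phi> has_derivative (\<lambda>_. 0)) (at x)"
    proof (rule has_derivative_transform_within_open[of _ _ _ _ "- cball 0 R"])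
      show "0 = \<phi> y" if "y \<in> - cball 0 R" for y using R that by force
    qed (use x in auto)
    then show ?thesis using frechet_derivative_eq by metis
  qed
  then show "bounded_support (\<lambda>x. frechet_derivative \<phi> (at x) z)"
    by (intro bounded_support_continuous[OF contD, of R])
qed

lemma test_function_translate:
  assumes "test_function \<phi>"
  shows "test_function (\<lambda>x. \<phi> (x - c))" "frechet_derivative (\<lambda>x. \<phi> (x - c)) (at x) = frechet_derivative \<phi> (at (x - c))"
proof -
  have "{x. \<phi> (x - c) \<noteq> 0} = (+) c ` {x. \<phi> x \<noteq> 0}" by (force simp: image_iff algebra_simps)
  then have "closure {x. \<phi> (x - c) \<noteq> 0} = (+) c ` closure {x. \<phi> x \<noteq> 0}" by (simp add: closure_translation)
  then show "test_function (\<lambda>x. \<phi> (x - c))"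
    using assms by (auto simp: test_function_def C_k_translate compact_translation)
  have "((\<lambda>x. x - c) has_derivative (\<lambda>h. h)) (at x)" by (auto intro!: derivative_eq_intros)
  from has_derivative_compose[OF this test_function_facts(3)[OF assms]]
  show "frechet_derivative (\<lambda>x. \<phi> (x - c)) (at x) = frechet_derivative \<phi> (at (x - c))"
    by (rule frechet_derivative_eq)
qed

section \<open>Locally integrable functions and integrals along segments\<close>

text \<open>Borel instead of Lebesgue measurability, so that
  \<open>h (x + \<sigma> *\<^sub>R z)\<close> is jointly measurable in \<open>x\<close> and \<sigma>
  and Fubini applies along segments.\<close>

definition LI :: "('a::euclidean_space \<Rightarrow> 'b::euclidean_space) \<Rightarrow> bool" where
  "LI h \<longleftrightarrow> h \<in> borel_measurable borel \<and> locally_integrable h"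

lemma LI_measurable [measurable_dest]: "LI h \<Longrightarrow> h \<in> borel_measurable borel" by (simp add: LI_def)

lemma LI_iff: "LI h \<longleftrightarrow> h \<in> borel_measurable borel \<and> (\<forall>R. integrable lborel (\<lambda>x. indicator (cball 0 R) x *\<^sub>R h x))"
  using locally_integrable_iff_lborel by (auto simp: LI_def)

lemma LI_integrable: "LI h \<Longrightarrow> integrable lborel (\<lambda>x. indicator (cball 0 R) x *\<^sub>R h x)"
  by (simp add: LI_iff)

lemma LI_inner:
  assumes "LI g" shows "LI (\<lambda>x. g x \<bullet> z)"
proof -
  have [measurable]: "g \<in> borel_measurable borel" using assms by measurable
  have "integrable lborel (\<lambda>x. indicator (cball 0 R) x *\<^sub>R (g x \<bullet> z))" for R
    using integrable_inner_left[OF LI_integrable[OF assms, of R], of z] by simp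
  then show ?thesis by (simp add: LI_iff)
qed

lemma LI_diff:
  assumes "LI f" "LI g" shows "LI (\<lambda>x. f x - g x)"
proof -
  have [measurable]: "f \<in> borel_measurable borel" "g \<in> borel_measurable borel" using assms by (auto dest: LI_measurable)
  have "integrable lborel (\<lambda>x. indicator (cball 0 R) x *\<^sub>R (f x - g x))" for R
    using Bochner_Integration.integrable_diff[OF LI_integrable[OF assms(1), of R] LI_integrable[OF assms(2), of R]] by (simp add: scaleR_diff_right)
  then show ?thesis by (simp add: LI_iff)
qed

lemma integrable_lborel_translate:
  fixes f :: "'a::euclidean_space \<Rightarrow> 'b::euclidean_space"
  shows "integrable lborel f \<Longrightarrow> integrable lborel (\<lambda>x. f (x + c))"
    and "f \<in> borel_measurable borel \<Longrightarrow> (\<integral>x. f (x + c)) = (\<integral>x. f x)"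
proof -
  show "(\<integral>x. f (x + c)) = (\<integral>x. f x)" if [measurable]: "f \<in> borel_measurable borel"
  proof -
    have "(\<integral>x. f x) = (\<integral>x. f x \<partial>distr lborel borel ((+) c))" by (simp add: lborel_distr_plus)
    also have "\<dots> = (\<integral>x. f (c + x))" by (subst integral_distr) auto
    finally show ?thesis by (simp add: add.commute)
  qed
  show "integrable lborel (\<lambda>x. f (x + c))" if f: "integrable lborel f"
  proof -
    have [measurable]: "f \<in> borel_measurable borel" using borel_measurable_integrable[OF f] by simp
    have "integrable (distr lborel borel ((+) c)) f" using f by (simp add: lborel_distr_plus)
    then have "integrable lborel (\<lambda>x. f (c + x))" by (subst (asm) integrable_distr_eq) auto
    then show ?thesis by (simp add: add.commute)
  qed
qed

lemma LI_translate:
  fixes f :: "'a::euclidean_space \<Rightarrow> 'b::euclidean_space"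
  assumes "LI f" shows "LI (\<lambda>x. f (x + c))"
proof -
  have [measurable]: "f \<in> borel_measurable borel" using assms by measurable
  have "integrable lborel (\<lambda>x. indicator (cball 0 R) x *\<^sub>R f (x + c))" for R
  proof (rule Bochner_Integration.integrable_bound[OF integrable_lborel_translate(1)[OF LI_integrable[OF assms, of "R + norm c"], of c]])
    show "AE x in lborel. norm (indicator (cball 0 R) x *\<^sub>R f (x + c)) \<le> norm (indicator (cball 0 (R + norm c)) (x + c) *\<^sub>R f (x + c))"
      by (auto intro!: AE_I2 simp: indicator_def intro: norm_triangle_le)
  qed simp
  then show ?thesis by (simp add: LI_iff)
qed

lemma LI_bounded_support_integrable:
  assumes h: "LI h" and \<phi>: "bounded_support \<phi>"
  shows "integrable lborel (\<lambda>x. h x * \<phi> x :: real)"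
proof -
  obtain R C where C: "\<And>x. \<bar>\<phi> x\<bar> \<le> C * indicator (cball 0 R) x" using \<phi> by (auto simp: bounded_support_def)
  have [measurable]: "\<phi> \<in> borel_measurable borel" "h \<in> borel_measurable borel" using \<phi> h by (auto simp: bounded_support_def LI_def)
  show ?thesis
  proof (rule Bochner_Integration.integrable_bound[OF integrable_mult_left[OF LI_integrable[OF h, of R], of C]])
    show "AE x in lborel. norm (h x * \<phi> x) \<le> norm (indicator (cball 0 R) x *\<^sub>R h x * C)"
    proof (rule AE_I2)
      fix x
      have "\<bar>h x\<bar> * \<bar>\<phi> x\<bar> \<le> \<bar>h x\<bar> * (C * indicator (cball 0 R) x)" using C[of x] by (rule mult_left_mono) simp
      also have "\<dots> \<le> norm (indicator (cball 0 R) x *\<^sub>R h x * C)" by (auto simp: abs_mult indicator_def mult_left_mono)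
      finally show "norm (h x * \<phi> x) \<le> norm (indicator (cball 0 R) x *\<^sub>R h x * C)" by (simp add: abs_mult)
    qed
  qed simp
qed

lemma integrable_sweep:
  fixes h :: "'a::euclidean_space \<Rightarrow> real"
  assumes h: "integrable lborel h" and t: "0 \<le> t"
  shows "integrable (lborel \<Otimes>\<^sub>M lborel) (\<lambda>(x, \<sigma>). indicator {0..t} \<sigma> * h (x + \<sigma> *\<^sub>R z))"
proof (rule integrableI_bounded)
  have [measurable]: "h \<in> borel_measurable borel" using borel_measurable_integrable[OF h] by simp
  show "(\<lambda>(x, \<sigma>). indicator {0..t} \<sigma> * h (x + \<sigma> *\<^sub>R z)) \<in> borel_measurable (lborel \<Otimes>\<^sub>M lborel)" by measurable
  have "(\<integral>\<^sup>+p. ennreal (norm (case p of (x, \<sigma>) \<Rightarrow> indicator {0..t} \<sigma> * h (x + \<sigma> *\<^sub>R z))) \<partial>(lborel \<Otimes>\<^sub>M lborel))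
     = (\<integral>\<^sup>+\<sigma>. \<integral>\<^sup>+x. ennreal (norm (indicator {0..t} \<sigma> * h (x + \<sigma> *\<^sub>R z))))"
    by (subst lborel_pair.nn_integral_snd[symmetric]) (auto simp: split_beta')
  also have "\<dots> = (\<integral>\<^sup>+\<sigma>. indicator {0..t} \<sigma> * (\<integral>\<^sup>+x. ennreal (norm (h x))))"
  proof (rule nn_integral_cong)
    fix \<sigma> :: real
    have "(\<integral>\<^sup>+x. ennreal (norm (indicator {0..t} \<sigma> * h (x + \<sigma> *\<^sub>R z)))) = (\<integral>\<^sup>+x. indicator {0..t} \<sigma> * ennreal (norm (h (x + \<sigma> *\<^sub>R z))))"
      by (intro nn_integral_cong) (auto simp: indicator_def)
    also have "\<dots> = indicator {0..t} \<sigma> * (\<integral>\<^sup>+x. ennreal (norm (h x)))"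
      using nn_integral_lborel_translate[of "\<lambda>x. ennreal (norm (h x))" "\<sigma> *\<^sub>R z"] by (simp add: nn_integral_cmult)
    finally show "(\<integral>\<^sup>+x. ennreal (norm (indicator {0..t} \<sigma> * h (x + \<sigma> *\<^sub>R z)))) = indicator {0..t} \<sigma> * (\<integral>\<^sup>+x. ennreal (norm (h x)))" .
  qed
  also have "\<dots> = ennreal t * (\<integral>\<^sup>+x. ennreal (norm (h x)))"
    using t by (subst nn_integral_multc) auto
  also have "\<dots> < \<infinity>" using h by (simp add: integrable_iff_bounded ennreal_mult_less_top)
  finally show "(\<integral>\<^sup>+p. ennreal (norm (case p of (x, \<sigma>) \<Rightarrow> indicator {0..t} \<sigma> * h (x + \<sigma> *\<^sub>R z))) \<partial>(lborel \<Otimes>\<^sub>M lborel)) < \<infinity>" .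
qed

definition sweep :: "real \<Rightarrow> 'a::euclidean_space \<Rightarrow> ('a \<Rightarrow> real) \<Rightarrow> 'a \<Rightarrow> real" where
  "sweep t z h x = (\<integral>\<sigma>. indicator {0..t} \<sigma> * h (x + \<sigma> *\<^sub>R z))"

lemma sweep_measurable [measurable]:
  assumes [measurable]: "h \<in> borel_measurable borel"
  shows "sweep t z h \<in> borel_measurable borel"
  unfolding sweep_def by measurable

lemma norm_sweep_le: "\<sigma> \<in> {0..t} \<Longrightarrow> norm (x + \<sigma> *\<^sub>R z) \<le> norm x + t * norm z"
  by (rule order_trans[OF norm_triangle_ineq]) (auto simp: mult_right_mono)

context
  fixes h :: "'a::euclidean_space \<Rightarrow> real" and t :: real and z :: 'a
  assumes h: "LI h" and t: "0 \<le> t"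
begin

lemma integrable_sweep_local:
  "integrable (lborel \<Otimes>\<^sub>M lborel) (\<lambda>(x, \<sigma>). indicator (cball 0 R) x * (indicator {0..t} \<sigma> * h (x + \<sigma> *\<^sub>R z)))"
proof (rule Bochner_Integration.integrable_bound[OF integrable_sweep[OF LI_integrable[OF h, of "R + t * norm z"] t, of z]])
  have [measurable]: "h \<in> borel_measurable borel" using h by measurable
  show "(\<lambda>(x, \<sigma>). indicator (cball 0 R) x * (indicator {0..t} \<sigma> * h (x + \<sigma> *\<^sub>R z))) \<in> borel_measurable (lborel \<Otimes>\<^sub>M lborel)"
    by measurable
  show "AE p in lborel \<Otimes>\<^sub>M lborel. norm (case p of (x, \<sigma>) \<Rightarrow> indicator (cball 0 R) x * (indicator {0..t} \<sigma> * h (x + \<sigma> *\<^sub>R z)))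
     \<le> norm (case p of (x, \<sigma>) \<Rightarrow> indicator {0..t} \<sigma> * indicator (cball 0 (R + t * norm z)) (x + \<sigma> *\<^sub>R z) *\<^sub>R h (x + \<sigma> *\<^sub>R z))"
  proof (rule AE_I2, safe)
    fix x :: 'a and \<sigma> :: real
    show "norm (indicator (cball 0 R) x * (indicator {0..t} \<sigma> * h (x + \<sigma> *\<^sub>R z)))
      \<le> norm (indicator {0..t} \<sigma> * indicator (cball 0 (R + t * norm z)) (x + \<sigma> *\<^sub>R z) *\<^sub>R h (x + \<sigma> *\<^sub>R z))"
      using norm_sweep_le[of \<sigma> t x z] by (auto simp: indicator_def)
  qed
qed

text \<open>Fubini gives the claim on each ball of integer radius; countably many such balls cover
  the space.\<close>

lemma AE_integrable_sweep: "AE x in lborel. integrable lborel (\<lambda>\<sigma>. indicator {0..t} \<sigma> * h (x + \<sigma> *\<^sub>R z))"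
proof -
  have "AE x in lborel. integrable lborel (\<lambda>\<sigma>. indicator (cball 0 (real j)) x * (indicator {0..t} \<sigma> * h (x + \<sigma> *\<^sub>R z)))" for j
    using lborel_pair.AE_integrable_fst'[OF integrable_sweep_local[of "real j"]] by simp
  then have "AE x in lborel. \<forall>j. integrable lborel (\<lambda>\<sigma>. indicator (cball 0 (real j)) x * (indicator {0..t} \<sigma> * h (x + \<sigma> *\<^sub>R z)))"
    unfolding AE_all_countable ..
  then show ?thesis
  proof eventually_elim
    case (elim x)
    obtain N :: nat where N: "norm x < real N" using reals_Archimedean2 by blast
    then have "indicator (cball 0 (real N)) x = (1::real)" by simp
    then show ?case using elim[rule_format, of N] by simp
  qed
qed

lemma LI_sweep: "LI (sweep t z h)"
proof -
  have [measurable]: "h \<in> borel_measurable borel" using h by measurable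
  have "integrable lborel (\<lambda>x. indicator (cball 0 R) x *\<^sub>R sweep t z h x)" for R
    using lborel_pair.integrable_fst'[OF integrable_sweep_local[of R]] by (simp add: sweep_def)
  then show ?thesis by (simp add: LI_iff)
qed

text \<open>The equal right sides say that sweeping along \<open>z\<close> and sweeping along
  \<open>- z\<close> are adjoint to each other.\<close>

lemma integral_sweep:
  assumes \<phi>: "bounded_support \<phi>"
  shows "(\<integral>x. \<phi> x * sweep t z h x) = (\<integral>\<sigma>. indicator {0..t} \<sigma> * (\<integral>x. h x * \<phi> (x - \<sigma> *\<^sub>R z)))"
    and "(\<integral>x. h x * sweep t (- z) \<phi> x) = (\<integral>\<sigma>. indicator {0..t} \<sigma> * (\<integral>x. h x * \<phi> (x - \<sigma> *\<^sub>R z)))"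
proof -
  obtain R C where C: "\<And>x. \<bar>\<phi> x\<bar> \<le> C * indicator (cball 0 R) x" using \<phi> by (auto simp: bounded_support_def)
  have [measurable]: "\<phi> \<in> borel_measurable borel" "h \<in> borel_measurable borel" using \<phi> h by (auto simp: bounded_support_def LI_def)
  have i1: "integrable (lborel \<Otimes>\<^sub>M lborel) (\<lambda>(x, \<sigma>). \<phi> x * (indicator {0..t} \<sigma> * h (x + \<sigma> *\<^sub>R z)))"
  proof (rule Bochner_Integration.integrable_bound[OF integrable_mult_right[OF integrable_sweep_local[of R], of C]])
    show "AE p in lborel \<Otimes>\<^sub>M lborel. norm (case p of (x, \<sigma>) \<Rightarrow> \<phi> x * (indicator {0..t} \<sigma> * h (x + \<sigma> *\<^sub>R z)))
      \<le> norm (C * (case p of (x, \<sigma>) \<Rightarrow> indicator (cball 0 R) x * (indicator {0..t} \<sigma> * h (x + \<sigma> *\<^sub>R z))))"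
    proof (rule AE_I2, safe)
      fix x :: 'a and \<sigma> :: real
      have "\<bar>\<phi> x\<bar> \<le> \<bar>C\<bar> * indicator (cball 0 R) x" using C[of x] by (auto simp: indicator_def split: if_splits)
      then show "norm (\<phi> x * (indicator {0..t} \<sigma> * h (x + \<sigma> *\<^sub>R z))) \<le> norm (C * (indicator (cball 0 R) x * (indicator {0..t} \<sigma> * h (x + \<sigma> *\<^sub>R z))))"
        by (auto simp: abs_mult mult.assoc[symmetric] intro!: mult_right_mono)
    qed
  qed (simp add: split_beta')
  have i2: "integrable (lborel \<Otimes>\<^sub>M lborel) (\<lambda>(x, \<sigma>). indicator {0..t} \<sigma> * (h x * \<phi> (x - \<sigma> *\<^sub>R z)))"
  proof (rule Bochner_Integration.integrable_bound[OF integrable_mult_right[OF integrable_sweep[OF LI_integrable[OF h, of "R + t * norm z"] t, of 0], of C]])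
    show "AE p in lborel \<Otimes>\<^sub>M lborel. norm (case p of (x, \<sigma>) \<Rightarrow> indicator {0..t} \<sigma> * (h x * \<phi> (x - \<sigma> *\<^sub>R z)))
      \<le> norm (C * (case p of (x, \<sigma>) \<Rightarrow> indicator {0..t} \<sigma> * indicator (cball 0 (R + t * norm z)) (x + \<sigma> *\<^sub>R 0) *\<^sub>R h (x + \<sigma> *\<^sub>R 0)))"
    proof (rule AE_I2, safe)
      fix x :: 'a and \<sigma> :: real
      show "norm (indicator {0..t} \<sigma> * (h x * \<phi> (x - \<sigma> *\<^sub>R z)))
        \<le> norm (C * (indicator {0..t} \<sigma> * indicator (cball 0 (R + t * norm z)) (x + \<sigma> *\<^sub>R 0) *\<^sub>R h (x + \<sigma> *\<^sub>R 0)))"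
      proof (cases "\<sigma> \<in> {0..t} \<and> norm (x - \<sigma> *\<^sub>R z) \<le> R")
        case True
        have "norm x \<le> R + t * norm z" using norm_sweep_le[of \<sigma> t "x - \<sigma> *\<^sub>R z" z] True by simp
        moreover have "\<bar>\<phi> (x - \<sigma> *\<^sub>R z)\<bar> \<le> \<bar>C\<bar>" using C[of "x - \<sigma> *\<^sub>R z"] True by simp
        ultimately show ?thesis using True by (simp add: abs_mult mult.commute[of "\<bar>C\<bar>"] mult_left_mono)
      next
        case False
        then show ?thesis using C[of "x - \<sigma> *\<^sub>R z"] by auto
      qed
    qed
  qed (simp add: split_beta')
  show "(\<integral>x. \<phi> x * sweep t z h x) = (\<integral>\<sigma>. indicator {0..t} \<sigma> * (\<integral>x. h x * \<phi> (x - \<sigma> *\<^sub>R z)))"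
  proof -
    have "(\<integral>x. \<phi> x * sweep t z h x) = (\<integral>x. \<integral>\<sigma>. \<phi> x * (indicator {0..t} \<sigma> * h (x + \<sigma> *\<^sub>R z)))"
      by (simp add: sweep_def)
    also have "\<dots> = (\<integral>\<sigma>. \<integral>x. \<phi> x * (indicator {0..t} \<sigma> * h (x + \<sigma> *\<^sub>R z)))"
      by (rule lborel_pair.Fubini_integral[symmetric, OF i1])
    also have "\<dots> = (\<integral>\<sigma>. indicator {0..t} \<sigma> * (\<integral>x. h x * \<phi> (x - \<sigma> *\<^sub>R z)))"
    proof (rule Bochner_Integration.integral_cong[OF refl])
      fix \<sigma> :: real
      have "(\<integral>x. \<phi> (x + \<sigma> *\<^sub>R z - \<sigma> *\<^sub>R z) * h (x + \<sigma> *\<^sub>R z)) = (\<integral>x. \<phi> (x - \<sigma> *\<^sub>R z) * h x)"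
        by (rule integrable_lborel_translate(2)[where f = "\<lambda>x. \<phi> (x - \<sigma> *\<^sub>R z) * h x"]) measurable
      then show "(\<integral>x. \<phi> x * (indicator {0..t} \<sigma> * h (x + \<sigma> *\<^sub>R z))) = indicator {0..t} \<sigma> * (\<integral>x. h x * \<phi> (x - \<sigma> *\<^sub>R z))"
        by (simp add: indicator_def mult.commute)
    qed
    finally show ?thesis .
  qed
  show "(\<integral>x. h x * sweep t (- z) \<phi> x) = (\<integral>\<sigma>. indicator {0..t} \<sigma> * (\<integral>x. h x * \<phi> (x - \<sigma> *\<^sub>R z)))"
  proof -
    have "(\<integral>x. h x * sweep t (- z) \<phi> x) = (\<integral>x. \<integral>\<sigma>. indicator {0..t} \<sigma> * (h x * \<phi> (x - \<sigma> *\<^sub>R z)))"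
      unfolding sweep_def by (subst integral_mult_right_zero[symmetric]) (simp add: mult_ac)
    also have "\<dots> = (\<integral>\<sigma>. \<integral>x. indicator {0..t} \<sigma> * (h x * \<phi> (x - \<sigma> *\<^sub>R z)))"
      by (rule lborel_pair.Fubini_integral[symmetric, OF i2])
    finally show ?thesis by simp
  qed
qed

end

section \<open>Differences as integrals of the weak gradient\<close>

definition wgrad :: "('a::euclidean_space \<Rightarrow> real) \<Rightarrow> ('a \<Rightarrow> 'a) \<Rightarrow> bool" where
  "wgrad f g \<longleftrightarrow> f \<in> borel_measurable borel \<and> g \<in> borel_measurable borel \<and> has_weak_gradient f g"

lemma wgrad_LI: "wgrad f g \<Longrightarrow> LI f" "wgrad f g \<Longrightarrow> LI g"
  by (auto simp: wgrad_def has_weak_gradient_def LI_def)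

lemma wgrad_direction:
  assumes w: "wgrad f g" and \<phi>: "test_function \<phi>"
  shows "(\<integral>x. f x * frechet_derivative \<phi> (at x) z) = - (\<integral>x. (g x \<bullet> z) * \<phi> x)"
proof -
  note LI = wgrad_LI[OF w] and tf = test_function_facts[OF \<phi>]
  have [measurable]: "f \<in> borel_measurable borel" "g \<in> borel_measurable borel" "\<phi> \<in> borel_measurable borel"
     "(\<lambda>x. frechet_derivative \<phi> (at x) b) \<in> borel_measurable borel" for b
    using LI tf(1) tf(5)[of b] by (auto simp: LI_def bounded_support_def)
  have b: "(\<integral>x. f x * frechet_derivative \<phi> (at x) b) = - (\<integral>x. (g x \<bullet> b) * \<phi> x)" if "b \<in> Basis" for b
  proof -
    have "(\<integral>x. f x * frechet_derivative \<phi> (at x) b \<partial>lebesgue) = - (\<integral>x. (g x \<bullet> b) * \<phi> x \<partial>lebesgue)"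
      using w \<phi> that by (auto simp: wgrad_def has_weak_gradient_def)
    then show ?thesis by (simp add: integral_completion)
  qed
  have "(\<integral>x. f x * frechet_derivative \<phi> (at x) z) = (\<integral>x. (\<Sum>b\<in>Basis. (z \<bullet> b) * (f x * frechet_derivative \<phi> (at x) b)))"
    by (subst tf(6)) (simp add: sum_distrib_left mult_ac)
  also have "\<dots> = (\<Sum>b\<in>Basis. (z \<bullet> b) * (\<integral>x. f x * frechet_derivative \<phi> (at x) b))"
    by (subst Bochner_Integration.integral_sum) (auto intro!: integrable_mult_right LI_bounded_support_integrable LI tf)
  also have "\<dots> = (\<Sum>b\<in>Basis. (z \<bullet> b) * - (\<integral>x. (g x \<bullet> b) * \<phi> x))" by (simp add: b)
  also have "\<dots> = - (\<integral>x. (\<Sum>b\<in>Basis. (z \<bullet> b) * ((g x \<bullet> b) * \<phi> x)))"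
    by (subst Bochner_Integration.integral_sum) (auto intro!: integrable_mult_right LI_bounded_support_integrable LI_inner LI tf simp: sum_negf)
  also have "\<dots> = - (\<integral>x. (g x \<bullet> z) * \<phi> x)"
    by (subst (3) euclidean_inner) (simp add: sum_distrib_left sum_distrib_right mult_ac)
  finally show ?thesis .
qed

lemma line_FTC:
  assumes \<phi>: "test_function \<phi>" and t: "0 \<le> t"
  shows "\<phi> (x - t *\<^sub>R z) - \<phi> x = - sweep t (- z) (\<lambda>x. frechet_derivative \<phi> (at x) z) x"
proof -
  have lin: "linear (frechet_derivative \<phi> (at y))" for y
    using test_function_facts(3)[OF \<phi>] has_derivative_linear by blast
  have "(\<integral>\<sigma>. (- frechet_derivative \<phi> (at (x - \<sigma> *\<^sub>R z)) z) * indicator {0..t} \<sigma>) = \<phi> (x - t *\<^sub>R z) - \<phi> (x - 0 *\<^sub>R z)"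
  proof (rule integral_FTC_Icc_real[OF t])
    fix \<sigma> :: real
    have "((\<lambda>\<sigma>. x - \<sigma> *\<^sub>R z) has_derivative (\<lambda>d. - d *\<^sub>R z)) (at \<sigma>)" by (auto intro!: derivative_eq_intros)
    from has_derivative_compose[OF this test_function_facts(3)[OF \<phi>]]
    have "((\<lambda>\<sigma>. \<phi> (x - \<sigma> *\<^sub>R z)) has_derivative (\<lambda>d. frechet_derivative \<phi> (at (x - \<sigma> *\<^sub>R z)) (- d *\<^sub>R z))) (at \<sigma>)" .
    then show "((\<lambda>\<sigma>. \<phi> (x - \<sigma> *\<^sub>R z)) has_real_derivative - frechet_derivative \<phi> (at (x - \<sigma> *\<^sub>R z)) z) (at \<sigma>)"
      unfolding has_field_derivative_def
      by (rule has_derivative_eq_rhs) (simp add: fun_eq_iff linear_cmul[OF lin] linear_neg[OF lin])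
    show "isCont (\<lambda>\<sigma>. - frechet_derivative \<phi> (at (x - \<sigma> *\<^sub>R z)) z) \<sigma>"
    proof -
      have "continuous_on UNIV (\<lambda>\<sigma>. frechet_derivative \<phi> (at (x - \<sigma> *\<^sub>R z)) z)"
        by (rule continuous_on_compose2[OF test_function_facts(4)[OF \<phi>, of z]]) (auto intro!: continuous_intros)
      then show ?thesis by (auto intro!: continuous_intros simp: continuous_on_eq_continuous_at)
    qed
  qed
  then show ?thesis by (simp add: sweep_def mult.commute)
qed

text \<open>Tested against \<phi>, the translation of \<open>f\<close> moves to \<phi>; the
  fundamental theorem of calculus turns the difference of \<phi> into a sweep of its derivative, the
  definition of the weak gradient moves that derivative to \<open>f\<close> at each \<sigma>, and
  adjointness returns the sweep to \<open>g\<close>. The exceptional null set depends on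
  \<open>t\<close> and \<open>z\<close>.\<close>

theorem wgrad_difference:
  fixes f :: "'a::euclidean_space \<Rightarrow> real"
  assumes w: "wgrad f g" and t: "0 \<le> t"
  shows "AE x in lborel. f (x + t *\<^sub>R z) - f x = sweep t z (\<lambda>x. g x \<bullet> z) x"
proof -
  note LI = wgrad_LI[OF w]
  note LIz = LI_inner[OF LI(2), of z]
  have [measurable]: "f \<in> borel_measurable borel" "g \<in> borel_measurable borel" using LI by (auto simp: LI_def)
  define D where "D x = (f (x + t *\<^sub>R z) - f x) - sweep t z (\<lambda>x. g x \<bullet> z) x" for x
  have LID: "LI D" unfolding D_def by (intro LI_diff LI_translate LI LI_sweep LIz t)
  have "AE x in lborel. D x = 0"
  proof (rule fundamental_lemma)
    show "D \<in> borel_measurable borel" "locally_integrable D" using LID by (auto simp: LI_def)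
    fix \<phi> :: "'a \<Rightarrow> real" assume \<phi>: "test_function \<phi>"
    note tf = test_function_facts[OF \<phi>]
    have [measurable]: "\<phi> \<in> borel_measurable borel" using tf(1) by (simp add: bounded_support_def)
    have tr: "bounded_support (\<lambda>x. \<phi> (x - c))" for c by (rule test_function_facts(1)[OF test_function_translate(1)[OF \<phi>]])
    have int: "integrable lborel (\<lambda>x. f (x + t *\<^sub>R z) * \<phi> x)" "integrable lborel (\<lambda>x. f x * \<phi> x)"
       "integrable lborel (\<lambda>x. sweep t z (\<lambda>x. g x \<bullet> z) x * \<phi> x)"
      by (intro LI_bounded_support_integrable LI_translate LI LI_sweep LIz t tf)+
    have "(\<integral>x. f (x + t *\<^sub>R z) * \<phi> x) = (\<integral>x. f x * \<phi> (x - t *\<^sub>R z))"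
      using integrable_lborel_translate(2)[of "\<lambda>x. f x * \<phi> (x - t *\<^sub>R z)" "t *\<^sub>R z"] by simp
    then have "(\<integral>x. f (x + t *\<^sub>R z) * \<phi> x) - (\<integral>x. f x * \<phi> x) = (\<integral>x. f x * (\<phi> (x - t *\<^sub>R z) - \<phi> x))"
      using LI_bounded_support_integrable[OF LI(1) tr[of "t *\<^sub>R z"]] int(2) by (simp add: right_diff_distrib)
    also have "\<dots> = - (\<integral>x. f x * sweep t (- z) (\<lambda>x. frechet_derivative \<phi> (at x) z) x)"
      by (simp add: line_FTC[OF \<phi> t])
    also have "\<dots> = - (\<integral>\<sigma>. indicator {0..t} \<sigma> * (\<integral>x. f x * frechet_derivative \<phi> (at (x - \<sigma> *\<^sub>R z)) z))"
      by (simp add: integral_sweep(2)[OF LI(1) t tf(5)])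
    also have "\<dots> = - (\<integral>\<sigma>. indicator {0..t} \<sigma> * - (\<integral>x. (g x \<bullet> z) * \<phi> (x - \<sigma> *\<^sub>R z)))"
      using wgrad_direction[OF w test_function_translate(1)[OF \<phi>]] by (simp add: test_function_translate(2)[OF \<phi>])
    also have "\<dots> = (\<integral>x. sweep t z (\<lambda>x. g x \<bullet> z) x * \<phi> x)"
      using integral_sweep(1)[OF LIz t tf(1)] by (simp add: mult.commute)
    finally show "(\<integral>x. D x * \<phi> x) = 0"
      using int by (simp add: D_def left_diff_distrib)
  qed
  then show ?thesis by (simp add: D_def)
qed

section \<open>Upper bounds for differences\<close>

lemma powr_above_tangent:
  fixes m u p :: real
  assumes p: "p \<ge> 1" and m: "m > 0"
  shows "m powr p + p * m powr (p - 1) * (u - m) \<le> max u 0 powr p"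
proof (cases "u > 0")
  case True
  have "max u 0 powr p - m powr p \<ge> p * m powr (p - 1) * (u - m)"
  proof -
    have "(\<lambda>x. x powr p) u - (\<lambda>x. x powr p) m \<ge> p * m powr (p - 1) * (u - m)"
    proof (rule convex_on_imp_above_tangent[OF powr_convex[OF p]])
      show "((\<lambda>x. x powr p) has_real_derivative p * m powr (p - 1)) (at m within {0<..})"
        using m by (auto intro!: derivative_eq_intros)
    qed (use m True in \<open>auto simp: interior_open\<close>)
    then show ?thesis using True by simp
  qed
  then show ?thesis by simp
next
  case False
  have "p * m powr (p - 1) * (u - m) \<le> p * m powr (p - 1) * (- m)"
    using False p m by (intro mult_left_mono) auto
  also have "\<dots> = - p * m powr p"
    using m powr_add[of m "p - 1" 1] by simp
  also have "\<dots> \<le> - 1 * m powr p" using p by (intro mult_right_mono) auto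
  finally show ?thesis using False by (simp add: max_def)
qed

text \<open>The tangent of the convex function at the mean \<open>m\<close> is integrated. When
  \<open>m \<le> 0\<close> or the right side is infinite there is nothing to show, so integrability
  of the power is available where it is used.\<close>

lemma jensen_pos_powr:
  fixes k :: "real \<Rightarrow> real"
  assumes k: "integrable lborel (\<lambda>\<sigma>. indicator {0..1} \<sigma> * k \<sigma>)" and [measurable]: "k \<in> borel_measurable borel" and p: "p \<ge> 1"
  shows "ennreal (max (\<integral>\<sigma>. indicator {0..1} \<sigma> * k \<sigma>) 0 powr p)
    \<le> (\<integral>\<^sup>+\<sigma>. indicator {0..1} \<sigma> * ennreal (max (k \<sigma>) 0 powr p))"
proof -
  define m where "m = (\<integral>\<sigma>. indicator {0..1} \<sigma> * k \<sigma>)"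
  have eq: "(\<integral>\<^sup>+\<sigma>. indicator {0..1} \<sigma> * ennreal (max (k \<sigma>) 0 powr p)) = (\<integral>\<^sup>+\<sigma>. ennreal (indicator {0..1} \<sigma> * max (k \<sigma>) 0 powr p))"
    by (intro nn_integral_cong) (auto simp: indicator_def)
  show ?thesis
  proof (cases "m > 0 \<and> (\<integral>\<^sup>+\<sigma>. ennreal (indicator {0..1} \<sigma> * max (k \<sigma>) 0 powr p)) < \<infinity>")
    case False
    then show ?thesis unfolding eq m_def[symmetric] by (auto simp: less_top[symmetric] max_def)
  next
    case True
    then have m: "m > 0" by simp
    have int: "integrable lborel (\<lambda>\<sigma>. indicator {0..1} \<sigma> * max (k \<sigma>) 0 powr p)"
      using True by (intro integrableI_nonneg) auto
    have int1: "integrable lborel (indicator {0..1::real} :: real \<Rightarrow> real)" by simp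
    define c where "c = p * m powr (p - 1)"
    have "(\<integral>\<sigma>. (m powr p - c * m) * indicator {0..1} \<sigma> + c * (indicator {0..1} \<sigma> * k \<sigma>)) = (m powr p - c * m) * 1 + c * m"
      by (subst Bochner_Integration.integral_add) (use k int1 in \<open>auto simp: m_def\<close>)
    then have "m powr p = (\<integral>\<sigma>. (m powr p - c * m) * indicator {0..1} \<sigma> + c * (indicator {0..1} \<sigma> * k \<sigma>))" by simp
    also have "\<dots> \<le> (\<integral>\<sigma>. indicator {0..1} \<sigma> * max (k \<sigma>) 0 powr p)"
    proof (rule integral_mono[OF _ int])
      show "integrable lborel (\<lambda>\<sigma>. (m powr p - c * m) * indicator {0..1} \<sigma> + c * (indicator {0..1} \<sigma> * k \<sigma>))"
        using k int1 by auto
      show "(m powr p - c * m) * indicator {0..1} \<sigma> + c * (indicator {0..1} \<sigma> * k \<sigma>) \<le> indicator {0..1} \<sigma> * max (k \<sigma>) 0 powr p" for \<sigma>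
        using powr_above_tangent[OF p m, of "k \<sigma>"] by (auto simp: indicator_def c_def algebra_simps)
    qed
    finally have "ennreal (m powr p) \<le> ennreal (\<integral>\<sigma>. indicator {0..1} \<sigma> * max (k \<sigma>) 0 powr p)" by (rule ennreal_leI)
    also have "\<dots> = (\<integral>\<^sup>+\<sigma>. ennreal (indicator {0..1} \<sigma> * max (k \<sigma>) 0 powr p))"
      by (rule nn_integral_eq_integral[symmetric, OF int]) auto
    finally show ?thesis unfolding eq m_def[symmetric] using m by simp
  qed
qed

text \<open>Jensen on almost every segment, after which translation invariance makes the inner
  integral independent of \<sigma>.\<close>

theorem wgrad_difference_powr_le:
  fixes f :: "'a::euclidean_space \<Rightarrow> real"
  assumes w: "wgrad f g" and p: "p \<ge> 1"
  shows "(\<integral>\<^sup>+x. ennreal (max (f (x + z) - f x) 0 powr p)) \<le> (\<integral>\<^sup>+x. ennreal (max (g x \<bullet> z) 0 powr p))"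
proof -
  note LI = wgrad_LI[OF w]
  note LIz = LI_inner[OF LI(2), of z]
  have [measurable]: "f \<in> borel_measurable borel" "g \<in> borel_measurable borel" using LI by (auto simp: LI_def)
  have "AE x in lborel. ennreal (max (f (x + z) - f x) 0 powr p) \<le> (\<integral>\<^sup>+\<sigma>. indicator {0..1} \<sigma> * ennreal (max (g (x + \<sigma> *\<^sub>R z) \<bullet> z) 0 powr p))"
    using wgrad_difference[OF w zero_le_one, of z] AE_integrable_sweep[OF LIz zero_le_one, of z]
  proof eventually_elim
    case (elim x)
    have "f (x + z) - f x = (\<integral>\<sigma>. indicator {0..1} \<sigma> * (g (x + \<sigma> *\<^sub>R z) \<bullet> z))"
      using elim(1) by (simp add: sweep_def)
    then show ?case using jensen_pos_powr[OF elim(2) _ p] by simp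
  qed
  then have "(\<integral>\<^sup>+x. ennreal (max (f (x + z) - f x) 0 powr p))
     \<le> (\<integral>\<^sup>+x. \<integral>\<^sup>+\<sigma>. indicator {0..1} \<sigma> * ennreal (max (g (x + \<sigma> *\<^sub>R z) \<bullet> z) 0 powr p))"
    by (rule nn_integral_mono_AE)
  also have "\<dots> = (\<integral>\<^sup>+\<sigma>. \<integral>\<^sup>+x. indicator {0..1} \<sigma> * ennreal (max (g (x + \<sigma> *\<^sub>R z) \<bullet> z) 0 powr p))"
    by (rule lborel_pair.Fubini') measurable
  also have "\<dots> = (\<integral>\<^sup>+\<sigma>. indicator {0..1::real} \<sigma> * (\<integral>\<^sup>+x. ennreal (max (g x \<bullet> z) 0 powr p)))"
  proof (rule nn_integral_cong)
    fix \<sigma> :: real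
    show "(\<integral>\<^sup>+x. indicator {0..1} \<sigma> * ennreal (max (g (x + \<sigma> *\<^sub>R z) \<bullet> z) 0 powr p)) = indicator {0..1} \<sigma> * (\<integral>\<^sup>+x. ennreal (max (g x \<bullet> z) 0 powr p))"
      using nn_integral_lborel_translate[of "\<lambda>x. ennreal (max (g x \<bullet> z) 0 powr p)" "\<sigma> *\<^sub>R z"] by (simp add: nn_integral_cmult)
  qed
  also have "\<dots> = (\<integral>\<^sup>+x. ennreal (max (g x \<bullet> z) 0 powr p))"
    by (subst nn_integral_multc) auto
  finally show ?thesis .
qed

text \<open>The increase of \<open>\<bar>h\<bar>\<close>, truncated to the levels from
  \<open>a\<close> to \<open>b\<close>, is paid for while \<open>\<bar>h\<bar>\<close> lies strictly
  between these levels. The relevant piece runs from the last time \<open>s\<close> at which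
  \<open>\<bar>h\<bar>\<close> is at most the truncated start value to the first later time
  \<open>u\<close> at which it reaches the truncated end value. This stands in for a chain rule for
  truncations.\<close>

lemma crossing:
  fixes h k :: "real \<Rightarrow> real"
  assumes k: "integrable lborel (\<lambda>\<sigma>. indicator {0..1} \<sigma> * k \<sigma>)" and [measurable]: "k \<in> borel_measurable borel"
    and h: "\<And>t. 0 \<le> t \<Longrightarrow> t \<le> 1 \<Longrightarrow> h t = h0 + (\<integral>\<sigma>. indicator {0..t} \<sigma> * k \<sigma>)"
    and a: "0 \<le> a"
  shows "ennreal (min (max \<bar>h 1\<bar> a) b - min (max \<bar>h 0\<bar> a) b)
    \<le> (\<integral>\<^sup>+\<sigma>. indicator {\<sigma>\<in>{0..1}. a < \<bar>h \<sigma>\<bar> \<and> \<bar>h \<sigma>\<bar> < b} \<sigma> * ennreal \<bar>k \<sigma>\<bar>)"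
proof -
  define I where "I s t = (\<integral>\<sigma>. indicator {s..t} \<sigma> * k \<sigma>)" for s t
  have sub: "integrable lborel (\<lambda>\<sigma>. indicator {s..t} \<sigma> * k \<sigma>)" if "0 \<le> s" "t \<le> 1" for s t
    by (rule Bochner_Integration.integrable_bound[OF k]) (use that in \<open>auto simp: indicator_def\<close>)
  have diff: "h t - h s = (\<integral>\<sigma>. indicator {s..t} \<sigma> * k \<sigma>)" if "0 \<le> s" "s \<le> t" "t \<le> 1" for s t
  proof -
    have "(\<integral>\<sigma>. indicator {0..t} \<sigma> * k \<sigma>) = (\<integral>\<sigma>. indicator {0..s} \<sigma> * k \<sigma> + indicator {s..t} \<sigma> * k \<sigma>)"
      using that by (intro integral_cong_AE eventually_mono[OF AE_lborel_singleton[of s]]) (auto simp: indicator_def)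
    also have "\<dots> = (\<integral>\<sigma>. indicator {0..s} \<sigma> * k \<sigma>) + (\<integral>\<sigma>. indicator {s..t} \<sigma> * k \<sigma>)"
      using that by (intro Bochner_Integration.integral_add sub) auto
    finally show ?thesis using that h[of s] h[of t] by simp
  qed
  have cont: "continuous_on {0..1} h"
  proof -
    have ki: "k absolutely_integrable_on {0..1}"
      using k unfolding set_integrable_def by (subst integrable_completion) auto
    then have "continuous_on {0..1} (\<lambda>t. h0 + integral {0..t} k)"
      by (intro continuous_intros indefinite_integral_continuous_1) (auto simp: absolutely_integrable_on_def)
    moreover have "h0 + integral {0..t} k = h t" if "t \<in> {0..1}" for t
    proof -
      have "set_integrable lborel {0..t} k" using sub[of 0 t] that by (simp add: set_integrable_def)
      from set_borel_integral_eq_integral(2)[OF this] show ?thesis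
        using h[of t] that by (simp add: set_lebesgue_integral_def)
    qed
    ultimately show ?thesis by (rule continuous_on_eq)
  qed
  define v where "v t = \<bar>h t\<bar>" for t
  have cv: "continuous_on {0..1} v" unfolding v_def using cont by (intro continuous_intros)
  define T where "T y = min (max y a) b" for y
  show ?thesis
  proof (cases "T (v 1) \<le> T (v 0)")
    case True
    then show ?thesis by (simp add: T_def v_def ennreal_neg)
  next
    case False
    define a' b' where "a' = T (v 0)" and "b' = T (v 1)"
    have ab: "a' < b'" "a \<le> a'" "b' \<le> b" "v 0 \<le> a'" "b' \<le> v 1"
      using False by (auto simp: a'_def b'_def T_def min_def max_def split: if_splits)
    define S where "S = {t\<in>{0..1}. v t \<le> a'}"
    have S: "closed S" "S \<noteq> {}" "bdd_above S"
    proof -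
      have "closed ({0..1} \<inter> v -` {..a'})" using cv by (intro continuous_closed_preimage) auto
      moreover have "S = {0..1} \<inter> v -` {..a'}" by (auto simp: S_def)
      ultimately show "closed S" by simp
      have "0 \<in> S" using ab by (simp add: S_def)
      then show "S \<noteq> {}" by auto
      show "bdd_above S" by (auto simp: S_def intro!: bdd_aboveI[of _ 1])
    qed
    define s where "s = Sup S"
    have s: "s \<in> S" unfolding s_def using S by (intro closed_contains_Sup) auto
    define U where "U = {t\<in>{s..1}. b' \<le> v t}"
    have s01: "0 \<le> s" "s \<le> 1" "v s \<le> a'" using s by (auto simp: S_def)
    have U: "closed U" "U \<noteq> {}" "bdd_below U"
    proof -
      have "closed ({s..1} \<inter> v -` {b'..})" using continuous_on_subset[OF cv, of "{s..1}"] s01 by (intro continuous_closed_preimage) auto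
      moreover have "U = {s..1} \<inter> v -` {b'..}" by (auto simp: U_def)
      ultimately show "closed U" by simp
      have "1 \<in> U" using ab s01 by (simp add: U_def)
      then show "U \<noteq> {}" by auto
      show "bdd_below U" by (auto simp: U_def intro!: bdd_belowI[of _ s])
    qed
    define u where "u = Inf U"
    have u: "u \<in> U" unfolding u_def using U by (intro closed_contains_Inf) auto
    then have u1: "s \<le> u" "u \<le> 1" "b' \<le> v u" by (auto simp: U_def)
    have mid: "a < v t \<and> v t < b" if t: "s < t" "t < u" for t
    proof
      have "t \<notin> S" using cSup_upper[of t S] S(3) t by (auto simp: s_def)
      then have "a' < v t" using t s01 u1 by (auto simp: S_def)
      then show "a < v t" using ab by simp
      have "t \<notin> U" using cInf_lower[of t U] U(3) t by (auto simp: u_def)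
      then have "v t < b'" using t s01 u1 by (auto simp: U_def)
      then show "v t < b" using ab by simp
    qed
    have "T (v 1) - T (v 0) \<le> v u - v s" using s01 u1 by (simp add: a'_def b'_def)
    also have "\<dots> \<le> \<bar>h u - h s\<bar>" by (simp add: v_def)
    also have "\<dots> = \<bar>\<integral>\<sigma>. indicator {s..u} \<sigma> * k \<sigma> \<partial>lborel\<bar>" using diff[of s u] s01 u1 by simp
    also have "\<dots> \<le> (\<integral>\<sigma>. \<bar>indicator {s..u} \<sigma> * k \<sigma>\<bar>)" by (rule integral_abs_bound)
    finally have "ennreal (T (v 1) - T (v 0)) \<le> ennreal (\<integral>\<sigma>. \<bar>indicator {s..u} \<sigma> * k \<sigma>\<bar>)" by (rule ennreal_leI)
    also have "\<dots> = (\<integral>\<^sup>+\<sigma>. ennreal \<bar>indicator {s..u} \<sigma> * k \<sigma>\<bar>)"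
      using sub[of s u] s01 u1 by (intro nn_integral_eq_integral[symmetric]) auto
    also have "\<dots> \<le> (\<integral>\<^sup>+\<sigma>. indicator {\<sigma>\<in>{0..1}. a < \<bar>h \<sigma>\<bar> \<and> \<bar>h \<sigma>\<bar> < b} \<sigma> * ennreal \<bar>k \<sigma>\<bar>)"
    proof (rule nn_integral_mono_AE)
      show "AE \<sigma> in lborel. ennreal \<bar>indicator {s..u} \<sigma> * k \<sigma>\<bar> \<le> indicator {\<sigma>\<in>{0..1}. a < \<bar>h \<sigma>\<bar> \<and> \<bar>h \<sigma>\<bar> < b} \<sigma> * ennreal \<bar>k \<sigma>\<bar>"
        using AE_lborel_singleton[of s] AE_lborel_singleton[of u]
      proof eventually_elim
        case (elim \<sigma>)
        show ?case
        proof (cases "\<sigma> \<in> {s..u}")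
          case True
          then have "s < \<sigma>" "\<sigma> < u" using elim by auto
          from mid[OF this] show ?thesis using True s01 u1 by (simp add: v_def)
        qed simp
      qed
    qed
    finally show ?thesis by (simp add: T_def v_def)
  qed
qed

text \<open>\<open>crossing\<close> is applied on almost every segment in direction
  \<open>z\<close>; the restriction to values strictly between \<open>a\<close> and \<open>b\<close>
  survives the integration and localizes the gradient to a slab of values of
  \<open>f\<close>.\<close>

theorem wgrad_slab:
  fixes f :: "'a::euclidean_space \<Rightarrow> real"
  assumes w: "wgrad f g" and a: "0 \<le> a"
  shows "(\<integral>\<^sup>+x. ennreal (min (max \<bar>f (x + z)\<bar> a) b - min (max \<bar>f x\<bar> a) b))
    \<le> ennreal (norm z) * (\<integral>\<^sup>+x. indicator {x. a < \<bar>f x\<bar> \<and> \<bar>f x\<bar> < b} x * ennreal (norm (g x)))"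
proof -
  note LI = wgrad_LI[OF w]
  note LIz = LI_inner[OF LI(2), of z]
  have [measurable]: "f \<in> borel_measurable borel" "g \<in> borel_measurable borel" using LI by (auto simp: LI_def)
  define k where "k x \<sigma> = g (x + \<sigma> *\<^sub>R z) \<bullet> z" for x \<sigma>
  \<comment> \<open>On the segment from \<open>x\<close>, \<open>H x\<close> is the continuous
    representative of \<open>f\<close>. The product of indicators expresses
    \<open>0 \<le> s \<le> \<sigma>\<close> in a form whose joint measurability in \<open>x\<close>
    and \<sigma> is immediate.\<close>
  define H where "H x \<sigma> = f x + (\<integral>s. indicator {0..} s * indicator {0..} (\<sigma> - s) * k x s)" for x \<sigma>
  have Hsw: "H x \<sigma> = f x + sweep \<sigma> z (\<lambda>x. g x \<bullet> z) x" for x \<sigma>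
    unfolding H_def sweep_def k_def by (intro arg_cong2[where f="(+)"] refl Bochner_Integration.integral_cong) (auto simp: indicator_def)
  have [measurable]: "(\<lambda>p. H (fst p) (snd p)) \<in> borel_measurable (borel \<Otimes>\<^sub>M borel)" unfolding H_def k_def by measurable
  have "{p \<in> space (borel \<Otimes>\<^sub>M borel :: ('a \<times> real) measure). 0 \<le> snd p \<longrightarrow> H (fst p) (snd p) = f (fst p + snd p *\<^sub>R z)} \<in> sets (borel \<Otimes>\<^sub>M borel)"
    by measurable
  note ms = this[simplified space_pair_measure space_borel]
  have "AE \<sigma> in lborel. AE x in lborel. 0 \<le> \<sigma> \<longrightarrow> H x \<sigma> = f (x + \<sigma> *\<^sub>R z)"
  proof (rule AE_I2)
    fix \<sigma> :: real
    show "AE x in lborel. 0 \<le> \<sigma> \<longrightarrow> H x \<sigma> = f (x + \<sigma> *\<^sub>R z)"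
    proof (cases "0 \<le> \<sigma>")
      case True
      from wgrad_difference[OF w this, of z] show ?thesis by eventually_elim (simp add: Hsw)
    qed simp
  qed
  \<comment> \<open>So far the identity holds for each \<sigma> and almost every \<open>x\<close>.
    Exchanging the quantifiers gives, for almost every \<open>x\<close>, a function
    \<open>H x\<close> that agrees with \<open>f\<close> at almost every point of the
    segment.\<close>
  then have swap: "AE x in lborel. AE \<sigma> in lborel. 0 \<le> \<sigma> \<longrightarrow> H x \<sigma> = f (x + \<sigma> *\<^sub>R z)"
    by (subst lborel_pair.AE_commute) (use ms in \<open>auto simp: space_pair_measure\<close>)
  have "AE x in lborel. ennreal (min (max \<bar>f (x + z)\<bar> a) b - min (max \<bar>f x\<bar> a) b)
     \<le> (\<integral>\<^sup>+\<sigma>. indicator {0..1} \<sigma> * (indicator {x. a < \<bar>f x\<bar> \<and> \<bar>f x\<bar> < b} (x + \<sigma> *\<^sub>R z) * ennreal \<bar>g (x + \<sigma> *\<^sub>R z) \<bullet> z\<bar>))"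
    using wgrad_difference[OF w zero_le_one, of z] AE_integrable_sweep[OF LIz zero_le_one, of z] swap
  proof eventually_elim
    case (elim x)
    have H01: "H x 1 = f (x + z)" "H x 0 = f x"
      using elim(1) by (simp_all add: Hsw sweep_def) (auto intro!: integral_eq_zero_AE eventually_mono[OF AE_lborel_singleton[of 0]])
    have "ennreal (min (max \<bar>H x 1\<bar> a) b - min (max \<bar>H x 0\<bar> a) b)
      \<le> (\<integral>\<^sup>+\<sigma>. indicator {\<sigma>\<in>{0..1}. a < \<bar>H x \<sigma>\<bar> \<and> \<bar>H x \<sigma>\<bar> < b} \<sigma> * ennreal \<bar>k x \<sigma>\<bar>)"
      using elim(2) a by (intro crossing[where ?h0.0 = "f x"]) (auto simp: k_def Hsw sweep_def)
    also have "\<dots> = (\<integral>\<^sup>+\<sigma>. indicator {0..1} \<sigma> * (indicator {x. a < \<bar>f x\<bar> \<and> \<bar>f x\<bar> < b} (x + \<sigma> *\<^sub>R z) * ennreal \<bar>g (x + \<sigma> *\<^sub>R z) \<bullet> z\<bar>))"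
      by (rule nn_integral_cong_AE, rule eventually_mono[OF elim(3)]) (auto simp: indicator_def k_def)
    finally show ?case by (simp add: H01)
  qed
  then have "(\<integral>\<^sup>+x. ennreal (min (max \<bar>f (x + z)\<bar> a) b - min (max \<bar>f x\<bar> a) b))
     \<le> (\<integral>\<^sup>+x. \<integral>\<^sup>+\<sigma>. indicator {0..1} \<sigma> * (indicator {x. a < \<bar>f x\<bar> \<and> \<bar>f x\<bar> < b} (x + \<sigma> *\<^sub>R z) * ennreal \<bar>g (x + \<sigma> *\<^sub>R z) \<bullet> z\<bar>))"
    by (rule nn_integral_mono_AE)
  also have "\<dots> = (\<integral>\<^sup>+\<sigma>. \<integral>\<^sup>+x. indicator {0..1} \<sigma> * (indicator {x. a < \<bar>f x\<bar> \<and> \<bar>f x\<bar> < b} (x + \<sigma> *\<^sub>R z) * ennreal \<bar>g (x + \<sigma> *\<^sub>R z) \<bullet> z\<bar>))"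
    by (rule lborel_pair.Fubini') measurable
  also have "\<dots> = (\<integral>\<^sup>+\<sigma>. indicator {0..1::real} \<sigma> * (\<integral>\<^sup>+x. indicator {x. a < \<bar>f x\<bar> \<and> \<bar>f x\<bar> < b} x * ennreal \<bar>g x \<bullet> z\<bar>))"
  proof (rule nn_integral_cong)
    fix \<sigma> :: real
    show "(\<integral>\<^sup>+x. indicator {0..1} \<sigma> * (indicator {x. a < \<bar>f x\<bar> \<and> \<bar>f x\<bar> < b} (x + \<sigma> *\<^sub>R z) * ennreal \<bar>g (x + \<sigma> *\<^sub>R z) \<bullet> z\<bar>))
      = indicator {0..1} \<sigma> * (\<integral>\<^sup>+x. indicator {x. a < \<bar>f x\<bar> \<and> \<bar>f x\<bar> < b} x * ennreal \<bar>g x \<bullet> z\<bar>)"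
      using nn_integral_lborel_translate[of "\<lambda>x. indicator {x. a < \<bar>f x\<bar> \<and> \<bar>f x\<bar> < b} x * ennreal \<bar>g x \<bullet> z\<bar>" "\<sigma> *\<^sub>R z"]
      by (simp add: nn_integral_cmult)
  qed
  also have "\<dots> = (\<integral>\<^sup>+x. indicator {x. a < \<bar>f x\<bar> \<and> \<bar>f x\<bar> < b} x * ennreal \<bar>g x \<bullet> z\<bar>)"
    by (subst nn_integral_multc) auto
  also have "\<dots> \<le> (\<integral>\<^sup>+x. ennreal (norm z) * (indicator {x. a < \<bar>f x\<bar> \<and> \<bar>f x\<bar> < b} x * ennreal (norm (g x))))"
  proof (rule nn_integral_mono)
    fix x
    have "ennreal \<bar>g x \<bullet> z\<bar> \<le> ennreal (norm z) * ennreal (norm (g x))"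
      using Cauchy_Schwarz_ineq2[of "g x" z] by (simp add: ennreal_mult[symmetric] mult.commute ennreal_leI)
    then show "indicator {x. a < \<bar>f x\<bar> \<and> \<bar>f x\<bar> < b} x * ennreal \<bar>g x \<bullet> z\<bar>
      \<le> ennreal (norm z) * (indicator {x. a < \<bar>f x\<bar> \<and> \<bar>f x\<bar> < b} x * ennreal (norm (g x)))"
      by (auto simp: indicator_def)
  qed
  also have "\<dots> = ennreal (norm z) * (\<integral>\<^sup>+x. indicator {x. a < \<bar>f x\<bar> \<and> \<bar>f x\<bar> < b} x * ennreal (norm (g x)))"
    by (rule nn_integral_cmult) measurable
  finally show ?thesis .
qed

section \<open>Recovering a weak gradient from differences\<close>

lemma sweep_rescale:
  assumes t: "t > 0"
  shows "sweep t z \<psi> x = t * (\<integral>s. indicator {0..1} s * \<psi> (x + (t * s) *\<^sub>R z))"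
proof -
  have "sweep t z \<psi> x = t * (\<integral>s. indicator {0..t} (0 + t * s) * \<psi> (x + (0 + t * s) *\<^sub>R z))"
    unfolding sweep_def using t lborel_integral_real_affine[of t "\<lambda>\<sigma>. indicator {0..t} \<sigma> * \<psi> (x + \<sigma> *\<^sub>R z)" 0] by simp
  also have "(\<integral>s. indicator {0..t} (0 + t * s) * \<psi> (x + (0 + t * s) *\<^sub>R z)) = (\<integral>s. indicator {0..1} s * \<psi> (x + (t * s) *\<^sub>R z))"
    using t by (intro Bochner_Integration.integral_cong) (auto simp: indicator_def zero_le_mult_iff)
  finally show ?thesis .
qed

lemma sweep_average_limit:
  fixes h \<psi> :: "'a::euclidean_space \<Rightarrow> real" and z :: 'a
  assumes h: "LI h" and \<psi>: "continuous_on UNIV \<psi>" "bounded_support \<psi>"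
  defines "A \<equiv> \<lambda>j x. \<integral>s. indicator {0..1} s * \<psi> (x + (1 / real (Suc j) * s) *\<^sub>R z)"
  shows "(\<lambda>j. \<integral>x. h x * A j x) \<longlonglongrightarrow> (\<integral>x. h x * \<psi> x)"
proof -
  obtain R C where C: "\<And>x. \<bar>\<psi> x\<bar> \<le> C * indicator (cball 0 R) x" using \<psi> by (auto simp: bounded_support_def)
  have [measurable]: "\<psi> \<in> borel_measurable borel" "h \<in> borel_measurable borel" using \<psi> h by (auto simp: bounded_support_def LI_def)
  have C': "\<bar>\<psi> x\<bar> \<le> \<bar>C\<bar>" for x using C[of x] by (cases "norm x \<le> R") auto
  have [measurable]: "A j \<in> borel_measurable borel" for j unfolding A_def by measurable
  have lim: "(\<lambda>j. A j x) \<longlonglongrightarrow> \<psi> x" for x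
  proof -
    have "(\<lambda>j. A j x) \<longlonglongrightarrow> (\<integral>s. indicator {0..1::real} s * \<psi> x)"
      unfolding A_def
    proof (rule integral_dominated_convergence[where w = "\<lambda>s::real. indicator {0..1} s * \<bar>C\<bar>"])
      have "(\<lambda>j. x + (1 / real (Suc j) * s) *\<^sub>R z) \<longlonglongrightarrow> x + (0 * s) *\<^sub>R z" for s
        by (intro tendsto_intros LIMSEQ_inverse_real_of_nat[unfolded inverse_eq_divide])
      then have "(\<lambda>j. \<psi> (x + (1 / real (Suc j) * s) *\<^sub>R z)) \<longlonglongrightarrow> \<psi> x" for s
        using \<psi>(1) by (intro isCont_tendsto_compose[of x \<psi>]) (auto simp: continuous_on_eq_continuous_at)
      then show "AE s in lborel. (\<lambda>j. indicator {0..1} s * \<psi> (x + (1 / real (Suc j) * s) *\<^sub>R z)) \<longlonglongrightarrow> indicator {0..1} s * \<psi> x"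
        by (intro AE_I2 tendsto_mult tendsto_const)
      show "AE s in lborel. norm (indicator {0..1} s * \<psi> (x + (1 / real (Suc j) * s) *\<^sub>R z)) \<le> indicator {0..1} s * \<bar>C\<bar>" for j
        using C' by (intro AE_I2) (auto simp: indicator_def)
    qed auto
    then show ?thesis by simp
  qed
  have bound: "\<bar>A j x\<bar> \<le> \<bar>C\<bar> * indicator (cball 0 (R + norm z)) x" for j x
  proof -
    have pt: "norm (indicator {0..1} s * \<psi> (x + (1 / real (Suc j) * s) *\<^sub>R z)) \<le> (\<bar>C\<bar> * indicator (cball 0 (R + norm z)) x) * indicator {0..1} s" for s :: real
    proof (cases "s \<in> {0..1} \<and> norm (x + (1 / real (Suc j) * s) *\<^sub>R z) \<le> R")
      case True
      have le: "\<bar>1 / real (Suc j) * s\<bar> \<le> 1" using True by (auto simp: field_simps)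
      have "norm x \<le> norm (x + (1 / real (Suc j) * s) *\<^sub>R z) + norm ((1 / real (Suc j) * s) *\<^sub>R z)"
        using norm_triangle_ineq4[of "x + (1 / real (Suc j) * s) *\<^sub>R z" "(1 / real (Suc j) * s) *\<^sub>R z"] by (simp del: of_nat_Suc)
      also have "norm ((1 / real (Suc j) * s) *\<^sub>R z) \<le> 1 * norm z"
        unfolding norm_scaleR by (rule mult_right_mono[OF le]) simp
      finally have "norm x \<le> R + norm z" using True by simp
      then show ?thesis using True C'[of "x + (1 / real (Suc j) * s) *\<^sub>R z"] by (simp del: of_nat_Suc)
    next
      case False
      then show ?thesis using C[of "x + (1 / real (Suc j) * s) *\<^sub>R z"] by (auto simp del: of_nat_Suc)
    qed
    have "\<bar>A j x\<bar> \<le> (\<integral>s. \<bar>indicator {0..1} s * \<psi> (x + (1 / real (Suc j) * s) *\<^sub>R z)\<bar>)"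
      unfolding A_def by (rule integral_abs_bound)
    also have "\<dots> \<le> (\<integral>s. (\<bar>C\<bar> * indicator (cball 0 (R + norm z)) x) * indicator {0..1::real} s)"
      using pt by (intro integral_mono') auto
    finally have "\<bar>A j x\<bar> \<le> (\<integral>s. (\<bar>C\<bar> * indicator (cball 0 (R + norm z)) x) * indicator {0..1::real} s)" .
    then show ?thesis by simp
  qed
  show ?thesis
  proof (rule integral_dominated_convergence[where w = "\<lambda>x. norm (indicator (cball 0 (R + norm z)) x *\<^sub>R h x) * \<bar>C\<bar>"])
    show "integrable lborel (\<lambda>x. norm (indicator (cball 0 (R + norm z)) x *\<^sub>R h x) * \<bar>C\<bar>)"
      using LI_integrable[OF h] by (intro integrable_mult_left Bochner_Integration.integrable_norm)
    show "AE x in lborel. (\<lambda>j. h x * A j x) \<longlonglongrightarrow> h x * \<psi> x"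
      by (intro AE_I2 tendsto_mult tendsto_const lim)
    show "AE x in lborel. norm (h x * A j x) \<le> norm (indicator (cball 0 (R + norm z)) x *\<^sub>R h x) * \<bar>C\<bar>" for j
    proof (rule AE_I2)
      fix x
      have "\<bar>h x\<bar> * \<bar>A j x\<bar> \<le> \<bar>h x\<bar> * (\<bar>C\<bar> * indicator (cball 0 (R + norm z)) x)"
        by (intro mult_left_mono bound) simp
      then show "norm (h x * A j x) \<le> norm (indicator (cball 0 (R + norm z)) x *\<^sub>R h x) * \<bar>C\<bar>"
        by (simp add: abs_mult mult_ac)
    qed
  qed auto
qed

text \<open>A converse of \<open>wgrad_difference\<close>. The difference identity, tested against
  \<phi> and divided by \<open>t = 1 / (j + 1)\<close>, says that averages of \<phi> and of its
  derivative over segments of length \<open>t\<close> satisfy the defining equation; as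
  \<open>t\<close> tends to 0 the averages converge to the functions themselves. Only coordinate
  directions are demanded, because a weak gradient is defined through them.\<close>

theorem wgradI_difference:
  fixes f :: "'a::euclidean_space \<Rightarrow> real"
  assumes f: "LI f" and g: "LI g"
    and diff: "\<And>b t. b \<in> Basis \<Longrightarrow> 0 < t \<Longrightarrow> t \<le> 1 \<Longrightarrow> AE x in lborel. f (x + t *\<^sub>R b) - f x = sweep t b (\<lambda>x. g x \<bullet> b) x"
  shows "wgrad f g"
  unfolding wgrad_def has_weak_gradient_def
proof (intro conjI allI impI ballI)
  show [measurable]: "f \<in> borel_measurable borel" "g \<in> borel_measurable borel" and "locally_integrable f" "locally_integrable g"
    using f g by (auto simp: LI_def)
  fix \<phi> :: "'a \<Rightarrow> real" and b :: 'a assume \<phi>: "test_function \<phi>" and b: "b \<in> Basis"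
  note tf = test_function_facts[OF \<phi>]
  have [measurable]: "\<phi> \<in> borel_measurable borel" "(\<lambda>x. frechet_derivative \<phi> (at x) b) \<in> borel_measurable borel"
    using tf(1) tf(5)[of b] by (auto simp: bounded_support_def)
  note gb = LI_inner[OF g, of b]
  define A where "A \<psi> j x = (\<integral>s. indicator {0..1} s * \<psi> (x + (1 / real (Suc j) * s) *\<^sub>R (- b)))" for \<psi> :: "'a \<Rightarrow> real" and j x
  have key: "- (\<integral>x. f x * A (\<lambda>x. frechet_derivative \<phi> (at x) b) j x) = (\<integral>x. (g x \<bullet> b) * A \<phi> j x)" for j
  proof -
    define t where "t = 1 / real (Suc j)"
    have t: "0 < t" "t \<le> 1" by (auto simp: t_def)
    have sw: "sweep t (- b) \<psi> x = t * A \<psi> j x" for \<psi> x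
      using sweep_rescale[OF t(1), of "- b" \<psi> x] by (simp add: A_def t_def)
    have tr: "bounded_support (\<lambda>x. \<phi> (x - c))" for c by (rule test_function_facts(1)[OF test_function_translate(1)[OF \<phi>]])
    have "t * (- (\<integral>x. f x * A (\<lambda>x. frechet_derivative \<phi> (at x) b) j x)) = (\<integral>x. f x * (\<phi> (x - t *\<^sub>R b) - \<phi> x))"
      unfolding line_FTC[OF \<phi> less_imp_le[OF t(1)]] sw by (simp add: mult.left_commute[of "f _"])
    also have "\<dots> = (\<integral>x. f x * \<phi> (x - t *\<^sub>R b)) - (\<integral>x. f x * \<phi> x)"
      using LI_bounded_support_integrable[OF f tr[of "t *\<^sub>R b"]] LI_bounded_support_integrable[OF f tf(1)] by (simp add: right_diff_distrib)
    also have "(\<integral>x. f x * \<phi> (x - t *\<^sub>R b)) = (\<integral>x. f (x + t *\<^sub>R b) * \<phi> x)"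
      using integrable_lborel_translate(2)[of "\<lambda>x. f x * \<phi> (x - t *\<^sub>R b)" "t *\<^sub>R b"] by simp
    also have "\<dots> - (\<integral>x. f x * \<phi> x) = (\<integral>x. (f (x + t *\<^sub>R b) - f x) * \<phi> x)"
      using LI_bounded_support_integrable[OF LI_translate[OF f, of "t *\<^sub>R b"] tf(1)] LI_bounded_support_integrable[OF f tf(1)] by (simp add: left_diff_distrib)
    also have "\<dots> = (\<integral>x. \<phi> x * sweep t b (\<lambda>x. g x \<bullet> b) x)"
      by (intro integral_cong_AE eventually_mono[OF diff[OF b t]]) auto
    also have "\<dots> = (\<integral>x. (g x \<bullet> b) * sweep t (- b) \<phi> x)"
      using integral_sweep[OF gb less_imp_le[OF t(1)] tf(1), of b] by simp
    also have "\<dots> = t * (\<integral>x. (g x \<bullet> b) * A \<phi> j x)"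
      unfolding sw by (simp add: mult.left_commute[of _ t])
    finally show ?thesis using t(1) by (subst (asm) mult_cancel_left) auto
  qed
  have "(\<lambda>j. - (\<integral>x. f x * A (\<lambda>x. frechet_derivative \<phi> (at x) b) j x)) \<longlonglongrightarrow> - (\<integral>x. f x * frechet_derivative \<phi> (at x) b)"
    unfolding A_def by (intro tendsto_minus sweep_average_limit f tf)
  moreover have "(\<lambda>j. \<integral>x. (g x \<bullet> b) * A \<phi> j x) \<longlonglongrightarrow> (\<integral>x. (g x \<bullet> b) * \<phi> x)"
    unfolding A_def by (intro sweep_average_limit gb tf)
  ultimately have "- (\<integral>x. f x * frechet_derivative \<phi> (at x) b) = (\<integral>x. (g x \<bullet> b) * \<phi> x)"
    unfolding key by (rule LIMSEQ_unique)
  then show "(\<integral>x. f x * frechet_derivative \<phi> (at x) b \<partial>lebesgue) = - (\<integral>x. (g x \<bullet> b) * \<phi> x \<partial>lebesgue)"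
    by (simp add: integral_completion)
qed

section \<open>Borel representatives and uniqueness\<close>

lemma locally_integrable_borel_version:
  fixes h :: "'a::euclidean_space \<Rightarrow> 'b::euclidean_space"
  assumes h: "locally_integrable h"
  shows "\<exists>h'. LI h' \<and> (AE x in lborel. h x = h' x)"
proof -
  have [measurable]: "h \<in> borel_measurable lebesgue" by (rule locally_integrable_measurable[OF h])
  have "\<exists>k\<in>borel_measurable lborel. AE x in lborel. h x \<bullet> b = k x" for b
    by (rule completion_ex_borel_measurable_real) measurable
  then obtain k where k: "\<And>b. k b \<in> borel_measurable lborel" "\<And>b. AE x in lborel. h x \<bullet> b = k b x" by metis
  define h' where "h' x = (\<Sum>b\<in>Basis. k b x *\<^sub>R b)" for x
  have [measurable]: "k b \<in> borel_measurable borel" for b using k(1)[of b] by simp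
  have m: "h' \<in> borel_measurable borel" unfolding h'_def by measurable
  have "AE x in lborel. \<forall>b\<in>Basis. h x \<bullet> b = k b x" using k(2) by (intro AE_finite_allI) auto
  then have ae: "AE x in lborel. h x = h' x"
  proof eventually_elim
    case (elim x)
    have "(\<Sum>b\<in>Basis. (h x \<bullet> b) *\<^sub>R b) = h' x" unfolding h'_def using elim by (intro sum.cong) auto
    then show ?case by (simp add: euclidean_representation)
  qed
  show ?thesis using locally_integrable_cong_AE[OF h ae m] m ae by (auto simp: LI_def)
qed

lemma has_weak_gradient_cong_AE:
  fixes f :: "'a::euclidean_space \<Rightarrow> real"
  assumes w: "has_weak_gradient f g" and f': "LI f'" "AE x in lborel. f x = f' x" and g': "LI g'" "AE x in lborel. g x = g' x"
  shows "wgrad f' g'"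
  unfolding wgrad_def has_weak_gradient_def
proof (intro conjI allI impI ballI)
  show m: "f' \<in> borel_measurable borel" "g' \<in> borel_measurable borel" and "locally_integrable f'" "locally_integrable g'"
    using f' g' by (auto simp: LI_def)
  fix \<phi> :: "'a \<Rightarrow> real" and b :: 'a assume \<phi>: "test_function \<phi>" and b: "b \<in> Basis"
  note tf = test_function_facts[OF \<phi>]
  have [measurable]: "\<phi> \<in> borel_measurable lebesgue" "(\<lambda>x. frechet_derivative \<phi> (at x) b) \<in> borel_measurable lebesgue"
    using tf(1) tf(5)[of b] by (auto simp: bounded_support_def intro!: measurable_completion)
  have [measurable]: "f \<in> borel_measurable lebesgue" "g \<in> borel_measurable lebesgue"
    using w by (auto simp: has_weak_gradient_def intro: locally_integrable_measurable)
  have [measurable]: "f' \<in> borel_measurable lebesgue" "g' \<in> borel_measurable lebesgue"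
    using m by (auto intro!: measurable_completion)
  have "(\<integral>x. f' x * frechet_derivative \<phi> (at x) b \<partial>lebesgue) = (\<integral>x. f x * frechet_derivative \<phi> (at x) b \<partial>lebesgue)"
    by (rule integral_cong_AE) (use AE_completion[OF f'(2)] in \<open>auto elim: eventually_mono\<close>)
  moreover have "(\<integral>x. (g' x \<bullet> b) * \<phi> x \<partial>lebesgue) = (\<integral>x. (g x \<bullet> b) * \<phi> x \<partial>lebesgue)"
    by (rule integral_cong_AE) (use AE_completion[OF g'(2)] in \<open>auto elim: eventually_mono\<close>)
  ultimately show "(\<integral>x. f' x * frechet_derivative \<phi> (at x) b \<partial>lebesgue) = - (\<integral>x. (g' x \<bullet> b) * \<phi> x \<partial>lebesgue)"
    using w \<phi> b by (auto simp: has_weak_gradient_def)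
qed

lemma has_weak_gradient_borel_version:
  fixes f :: "'a::euclidean_space \<Rightarrow> real"
  assumes w: "has_weak_gradient f g"
  obtains f' g' where "wgrad f' g'" "AE x in lborel. f x = f' x" "AE x in lborel. g x = g' x"
proof -
  have "locally_integrable f" "locally_integrable g" using w by (auto simp: has_weak_gradient_def)
  then obtain f' g' where "LI f'" "AE x in lborel. f x = f' x" "LI g'" "AE x in lborel. g x = g' x"
    using locally_integrable_borel_version by metis
  then show ?thesis using that has_weak_gradient_cong_AE[OF w] by blast
qed

lemma wgrad_unique:
  fixes f :: "'a::euclidean_space \<Rightarrow> real"
  assumes w: "wgrad f g1" "wgrad f g2"
  shows "AE x in lborel. g1 x = g2 x"
proof -
  note L1 = wgrad_LI[OF w(1)] and L2 = wgrad_LI[OF w(2)]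
  have "AE x in lborel. (g1 x - g2 x) \<bullet> b = 0" for b
  proof (rule fundamental_lemma)
    have L: "LI (\<lambda>x. (g1 x - g2 x) \<bullet> b)" by (intro LI_inner LI_diff L1 L2)
    then show "(\<lambda>x. (g1 x - g2 x) \<bullet> b) \<in> borel_measurable borel" "locally_integrable (\<lambda>x. (g1 x - g2 x) \<bullet> b)" by (auto simp: LI_def)
    fix \<phi> :: "'a \<Rightarrow> real" assume \<phi>: "test_function \<phi>"
    have "(\<integral>x. (g1 x \<bullet> b) * \<phi> x) = (\<integral>x. (g2 x \<bullet> b) * \<phi> x)"
      using wgrad_direction[OF w(1) \<phi>, of b] wgrad_direction[OF w(2) \<phi>, of b] by simp
    then show "(\<integral>x. (g1 x - g2 x) \<bullet> b * \<phi> x) = 0"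
      using LI_bounded_support_integrable[OF LI_inner[OF L1(2)] test_function_facts(1)[OF \<phi>], of b] LI_bounded_support_integrable[OF LI_inner[OF L2(2)] test_function_facts(1)[OF \<phi>], of b]
      by (simp add: inner_diff_left left_diff_distrib)
  qed
  then have "AE x in lborel. \<forall>b\<in>Basis. (g1 x - g2 x) \<bullet> b = 0" by (intro AE_finite_allI) auto
  then show ?thesis by eventually_elim (metis eq_iff_diff_eq_0 euclidean_all_zero_iff)
qed

section \<open>The weak gradient of the rearrangement\<close>

text \<open>The hypothesis \<open>ne\<close> keeps the infimum away from the empty set. If the
  superlevel set at \<open>t\<close> is too large, continuity of the measure from below along
  \<open>t + 1 / (j + 1)\<close> gives a slightly higher level that is still too large, so the
  infimum strictly exceeds \<open>t\<close>.\<close>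

lemma decr_rearr_greater:
  fixes f :: "'a::euclidean_space \<Rightarrow> real"
  assumes [measurable]: "f \<in> borel_measurable lebesgue" and t: "t \<ge> 0"
    and ne: "\<exists>M>0. emeasure lebesgue {x. \<bar>f x\<bar> > M} \<le> ennreal s"
  shows "t < decr_rearr f s \<longleftrightarrow> ennreal s < emeasure lebesgue {x. \<bar>f x\<bar> > t}"
proof -
  define S where "S = {c. c > 0 \<and> emeasure lebesgue {x. \<bar>f x\<bar> > c} \<le> ennreal s}"
  have S: "S \<noteq> {}" "bdd_below S" using ne by (auto simp: S_def intro!: bdd_belowI[of _ 0])
  have d: "decr_rearr f s = Inf S" by (simp add: decr_rearr_def S_def)
  have "{x \<in> space lebesgue. \<bar>f x\<bar> > c} \<in> sets lebesgue" for c by measurable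
  then have ms: "{x. \<bar>f x\<bar> > c} \<in> sets lebesgue" for c by simp
  have mono: "emeasure lebesgue {x. \<bar>f x\<bar> > c} \<le> emeasure lebesgue {x. \<bar>f x\<bar> > c'}" if "c' \<le> c" for c c'
    using that by (intro emeasure_mono ms) auto
  show ?thesis
  proof
    assume lt: "t < decr_rearr f s"
    show "ennreal s < emeasure lebesgue {x. \<bar>f x\<bar> > t}"
    proof (rule ccontr)
      assume "\<not> ?thesis"
      then have le: "emeasure lebesgue {x. \<bar>f x\<bar> > t} \<le> ennreal s" by simp
      have "Inf S \<le> t + e" if "e > 0" for e
      proof (rule cInf_lower[OF _ S(2)])
        show "t + e \<in> S" using t that mono[of t "t + e"] le by (auto simp: S_def)
      qed
      then have "Inf S \<le> t" by (rule field_le_epsilon)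
      then show False using lt d by simp
    qed
  next
    assume lt: "ennreal s < emeasure lebesgue {x. \<bar>f x\<bar> > t}"
    have "{x. \<bar>f x\<bar> > t} = (\<Union>j. {x. \<bar>f x\<bar> > t + 1 / real (Suc j)})"
    proof (intro equalityI subsetI)
      fix x assume "x \<in> {x. \<bar>f x\<bar> > t}"
      then obtain j where "1 / real (Suc j) < \<bar>f x\<bar> - t"
        using nat_approx_posE[of "\<bar>f x\<bar> - t"] by auto
      then show "x \<in> (\<Union>j. {x. \<bar>f x\<bar> > t + 1 / real (Suc j)})" by (intro UN_I[of j]) auto
    next
      fix x assume "x \<in> (\<Union>j. {x. \<bar>f x\<bar> > t + 1 / real (Suc j)})"
      then obtain j where "t + 1 / real (Suc j) < \<bar>f x\<bar>" by blast
      moreover have "0 < 1 / real (Suc j)" by simp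
      ultimately have "t < \<bar>f x\<bar>" by linarith
      then show "x \<in> {x. \<bar>f x\<bar> > t}" by simp
    qed
    moreover have "(SUP j. emeasure lebesgue {x. \<bar>f x\<bar> > t + 1 / real (Suc j)}) = emeasure lebesgue (\<Union>j. {x. \<bar>f x\<bar> > t + 1 / real (Suc j)})"
    proof (rule SUP_emeasure_incseq)
      show "incseq (\<lambda>j. {x. \<bar>f x\<bar> > t + 1 / real (Suc j)})"
      proof (rule incseq_SucI, safe)
        fix j x assume "t + 1 / real (Suc j) < \<bar>f x\<bar>"
        moreover have "1 / real (Suc (Suc j)) \<le> 1 / real (Suc j)" by (intro divide_left_mono) auto
        ultimately show "t + 1 / real (Suc (Suc j)) < \<bar>f x\<bar>" by linarith
      qed
      show "range (\<lambda>j. {x. \<bar>f x\<bar> > t + 1 / real (Suc j)}) \<subseteq> sets lebesgue"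
        by (rule image_subsetI) (rule ms)
    qed
    ultimately have "ennreal s < (SUP j. emeasure lebesgue {x. \<bar>f x\<bar> > t + 1 / real (Suc j)})" using lt by (simp only:)
    then obtain j where j: "ennreal s < emeasure lebesgue {x. \<bar>f x\<bar> > t + 1 / real (Suc j)}"
      unfolding less_SUP_iff by blast
    have "t + 1 / real (Suc j) \<le> Inf S"
    proof (rule cInf_greatest[OF S(1)])
      fix c assume "c \<in> S"
      then have "emeasure lebesgue {x. \<bar>f x\<bar> > c} \<le> ennreal s" by (simp add: S_def)
      then have "emeasure lebesgue {x. \<bar>f x\<bar> > c} < emeasure lebesgue {x. \<bar>f x\<bar> > t + 1 / real (Suc j)}"
        using j by (rule le_less_trans)
      then show "t + 1 / real (Suc j) \<le> c" using mono[of c "t + 1 / real (Suc j)"] by (meson leD less_imp_le not_le)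
    qed
    moreover have "0 < 1 / real (Suc j)" by simp
    ultimately show "t < decr_rearr f s" unfolding d by linarith
  qed
qed

lemma decr_rearr_nonneg:
  assumes "\<exists>M>0. emeasure lebesgue {x. \<bar>f x\<bar> > M} \<le> ennreal s"
  shows "0 \<le> decr_rearr f s"
  unfolding decr_rearr_def using assms by (intro cInf_greatest) auto

lemma ex_small_superlevel:
  fixes f :: "'a::euclidean_space \<Rightarrow> real"
  assumes [measurable]: "f \<in> borel_measurable borel" and fin: "\<And>t. t > 0 \<Longrightarrow> vol {x. \<bar>f x\<bar> > t} < \<infinity>" and s: "s > 0"
  shows "\<exists>M>0. emeasure lebesgue {x. \<bar>f x\<bar> > M} \<le> ennreal s"
proof -
  have "(\<lambda>j. vol {x. \<bar>f x\<bar> > real (Suc j)}) \<longlonglongrightarrow> vol (\<Inter>j. {x. \<bar>f x\<bar> > real (Suc j)})"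
  proof (rule Lim_emeasure_decseq)
    show "decseq (\<lambda>j. {x. \<bar>f x\<bar> > real (Suc j)})" by (auto simp: decseq_def)
    show "vol {x. \<bar>f x\<bar> > real (Suc i)} \<noteq> \<infinity>" for i using fin[of "real (Suc i)"] by simp
  qed auto
  moreover have "(\<Inter>j. {x. \<bar>f x\<bar> > real (Suc j)}) = {}"
  proof -
    have "\<exists>j. \<not> real (Suc j) < \<bar>f x\<bar>" for x using reals_Archimedean2[of "\<bar>f x\<bar>"] by (metis less_Suc_eq not_less_iff_gr_or_eq of_nat_less_iff order_less_trans)
    then show ?thesis by blast
  qed
  ultimately have "(\<lambda>j. vol {x. \<bar>f x\<bar> > real (Suc j)}) \<longlonglongrightarrow> 0" by simp
  then have "\<forall>\<^sub>F j in sequentially. vol {x. \<bar>f x\<bar> > real (Suc j)} < ennreal s"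
    by (rule order_tendstoD) (use s in simp)
  then obtain j where "vol {x. \<bar>f x\<bar> > real (Suc j)} < ennreal s" by (auto simp: eventually_sequentially)
  then show ?thesis by (intro exI[of _ "real (Suc j)"]) (auto simp: emeasure_completion)
qed

definition profile :: "('a::euclidean_space \<Rightarrow> real) \<Rightarrow> real \<Rightarrow> real" where
  "profile f r = decr_rearr f (unit_ball_vol (real DIM('a)) * r ^ DIM('a))"

lemma schwarz_rearr_eq_profile: "schwarz_rearr f x = profile f (norm x)"
  by (simp add: schwarz_rearr_def profile_def content_cball)

text \<open>The value at the origin is fixed to 0, since \<open>decr_rearr f 0\<close> may be the
  infimum of the empty set.\<close>

definition schwarz0 :: "('a::euclidean_space \<Rightarrow> real) \<Rightarrow> 'a \<Rightarrow> real" where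
  "schwarz0 f x = (if x = 0 then 0 else profile f (norm x))"

locale superlevel_finite =
  fixes f :: "'a::euclidean_space \<Rightarrow> real"
  assumes f_measurable[measurable]: "f \<in> borel_measurable borel"
    and fin: "\<And>t. t > 0 \<Longrightarrow> vol {x. \<bar>f x\<bar> > t} < \<infinity>"
begin

lemma omega_neq_0: "unit_ball_vol (real DIM('a)) \<noteq> 0"
  using unit_ball_vol_pos[of "real DIM('a)"] by linarith

lemma omega_pos: "unit_ball_vol (real DIM('a)) > 0" by simp

lemma emeasure_ball0: "r \<ge> 0 \<Longrightarrow> vol (ball (0::'a) r) = ennreal (unit_ball_vol (real DIM('a)) * r ^ DIM('a))"
  by (simp add: emeasure_ball)

lemma profile_greater:
  assumes r: "r > 0" and t: "t \<ge> 0"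
  shows "t < profile f r \<longleftrightarrow> ennreal (unit_ball_vol (real DIM('a)) * r ^ DIM('a)) < vol {x. \<bar>f x\<bar> > t}"
proof -
  have "t < profile f r \<longleftrightarrow> ennreal (unit_ball_vol (real DIM('a)) * r ^ DIM('a)) < emeasure lebesgue {x. \<bar>f x\<bar> > t}"
    unfolding profile_def
    by (intro decr_rearr_greater t ex_small_superlevel fin measurable_completion) (use r in simp_all)
  then show ?thesis by (simp add: emeasure_completion)
qed

lemma profile_nonneg: "r > 0 \<Longrightarrow> 0 \<le> profile f r"
  unfolding profile_def by (intro decr_rearr_nonneg ex_small_superlevel fin) simp_all

lemma superlevel_le: "r > 0 \<Longrightarrow> profile f r \<le> t \<Longrightarrow> vol {x. \<bar>f x\<bar> > t} \<le> ennreal (unit_ball_vol (real DIM('a)) * r ^ DIM('a))"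
  using profile_greater[of r t] profile_nonneg[of r] by (auto simp: not_less[symmetric])

lemma profile_antimono:
  assumes "0 < r" "r \<le> s" shows "profile f s \<le> profile f r"
proof (rule ccontr)
  assume "\<not> ?thesis"
  then have lt: "profile f r < profile f s" by simp
  then have "ennreal (unit_ball_vol (real DIM('a)) * s ^ DIM('a)) < vol {x. \<bar>f x\<bar> > profile f r}"
    using profile_greater[of s "profile f r"] profile_nonneg[of r] assms by simp
  also have "\<dots> \<le> ennreal (unit_ball_vol (real DIM('a)) * r ^ DIM('a))" using superlevel_le[of r "profile f r"] assms by simp
  also have "\<dots> \<le> ennreal (unit_ball_vol (real DIM('a)) * s ^ DIM('a))" using assms by (intro ennreal_leI mult_left_mono power_mono) auto
  finally show False by simp
qed

lemma rearrangement_of_schwarz0: "rearrangement_of f (schwarz0 f)"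
  unfolding rearrangement_of_def
proof (intro conjI allI impI)
  show nn: "0 \<le> schwarz0 f x" for x by (simp add: schwarz0_def profile_nonneg)
  have sup: "{x. t < schwarz0 f x} = {x. x \<noteq> 0 \<and> ennreal (unit_ball_vol (real DIM('a)) * norm x ^ DIM('a)) < vol {x. \<bar>f x\<bar> > t}}" if "t \<ge> 0" for t
    using profile_greater[OF _ that] that by (auto simp: schwarz0_def)
  show "schwarz0 f \<in> borel_measurable borel"
  proof (rule borel_measurable_iff_greater[THEN iffD2], rule allI)
    fix t
    show "{x \<in> space borel. t < schwarz0 f x} \<in> sets borel"
    proof (cases "t \<ge> 0")
      case True
      then show ?thesis by (simp add: sup)
    next
      case False
      then have "{x \<in> space borel. t < schwarz0 f x} = UNIV" using nn by (auto simp: not_le intro: less_le_trans[of t 0])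
      then show ?thesis by simp
    qed
  qed
  fix t :: real assume t: "t > 0"
  obtain \<rho> where \<rho>: "\<rho> \<ge> 0" "vol (ball (0::'a) \<rho>) = vol {x. \<bar>f x\<bar> > t}"
    using radius_exists[OF fin[OF t]] by blast
  have "t < schwarz0 f x \<longleftrightarrow> norm x < \<rho>" if "x \<noteq> 0" for x
  proof -
    have "t < schwarz0 f x \<longleftrightarrow> ennreal (unit_ball_vol (real DIM('a)) * norm x ^ DIM('a)) < ennreal (unit_ball_vol (real DIM('a)) * \<rho> ^ DIM('a))"
      using sup[of t] t that \<rho> emeasure_ball0[of \<rho>] by auto
    also have "\<dots> \<longleftrightarrow> norm x ^ DIM('a) < \<rho> ^ DIM('a)" by (simp add: ennreal_less_iff)
    also have "\<dots> \<longleftrightarrow> norm x < \<rho>" using \<rho>(1) by (simp add: not_le[symmetric] power_mono_iff)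
    finally show ?thesis .
  qed
  then show "\<exists>\<rho>\<ge>0. vol {x. t < \<bar>f x\<bar>} = vol (ball (0::'a) \<rho>) \<and> (\<forall>x. x \<noteq> 0 \<longrightarrow> (t < schwarz0 f x) = (norm x < \<rho>))"
    using \<rho> by (intro exI[of _ \<rho>]) auto
qed

end

section \<open>Shells of the rearrangement and slabs of values\<close>

text \<open>The consequences of membership in the Sobolev space on which the gradient of the
  rearrangement rests: superlevel sets of finite volume, and integrability of \<open>f\<close> and
  \<open>g\<close> over sets of finite volume. They do not mention \<open>p\<close>.\<close>

locale weakly_differentiable = superlevel_finite f for f :: "'a::euclidean_space \<Rightarrow> real" +
  fixes g :: "'a \<Rightarrow> 'a"
  assumes wg: "wgrad f g"
    and f_finite: "\<And>S. S \<in> sets borel \<Longrightarrow> vol S < \<infinity> \<Longrightarrow> (\<integral>\<^sup>+x. indicator S x * ennreal \<bar>f x\<bar>) < \<infinity>"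
    and g_finite: "\<And>S. S \<in> sets borel \<Longrightarrow> vol S < \<infinity> \<Longrightarrow> (\<integral>\<^sup>+x. indicator S x * ennreal (norm (g x))) < \<infinity>"
begin

lemma g_measurable[measurable]: "g \<in> borel_measurable borel" using wg by (simp add: wgrad_def)

text \<open>The counterpart, for \<open>f\<close> itself, of the shell between the radii
  \<open>r\<close> and \<open>s\<close> for the rearrangement.\<close>

definition slab :: "real \<Rightarrow> real \<Rightarrow> 'a set" where
  "slab r s = {x. profile f s < \<bar>f x\<bar> \<and> \<bar>f x\<bar> < profile f r}"

lemma slab_borel[measurable]: "slab r s \<in> sets borel" unfolding slab_def by measurable

text \<open>A crude isoperimetric inequality: averaging over translations by vectors of length up
  to \<open>2 s\<close> moves a fixed proportion of each superlevel set off itself.\<close>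

lemma profile_diff_le:
  assumes rs: "0 < r" "r < s"
  shows "ennreal ((profile f r - profile f s) * (unit_ball_vol (real DIM('a)) * r ^ DIM('a))) \<le> ennreal (2 ^ (DIM('a) + 1) * s) * (\<integral>\<^sup>+x. indicator (slab r s) x * ennreal (norm (g x)))"
proof -
  define a b where "a = profile f s" and "b = profile f r"
  have ab: "0 \<le> a" "a \<le> b" using rs profile_nonneg profile_antimono by (auto simp: a_def b_def)
  define \<gamma> where "\<gamma> = (\<integral>\<^sup>+x. indicator (slab r s) x * ennreal (norm (g x)))"
  let ?B = "ball (0::'a) (2 * s)"
  define Es where "Es t = {x. \<bar>f x\<bar> > t}" for t
  have [measurable]: "Es t \<in> sets borel" for t unfolding Es_def by measurable
  \<comment> \<open>The volume \<open>e\<close> of the superlevel set lies between those of the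
    balls of radii \<open>r\<close> and \<open>s\<close>, and its overlap with itself is at most
    \<open>e * e\<close>. The factor 2 in the radius of the ball \<open>?B\<close> makes its volume
    at least twice that of the ball of radius \<open>s\<close>, so what escapes is at least
    \<open>e\<close> times the volume of that ball.\<close>
  have escape_ge: "ennreal (unit_ball_vol (real DIM('a)) * r ^ DIM('a) * (unit_ball_vol (real DIM('a)) * s ^ DIM('a))) \<le> escape (Es t) (Es t) ?B" if t: "a \<le> t" "t < b" for t
  proof -
    have lo: "ennreal (unit_ball_vol (real DIM('a)) * r ^ DIM('a)) \<le> vol (Es t)"
      using profile_greater[of r t] t ab rs by (auto simp: b_def Es_def)
    have hi: "vol (Es t) \<le> ennreal (unit_ball_vol (real DIM('a)) * s ^ DIM('a))"
      using superlevel_le[of s t] t rs by (auto simp: a_def Es_def)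
    define e where "e = measure lborel (Es t)"
    have "vol (Es t) \<noteq> \<infinity>" using hi by (auto simp: top_unique)
    then have e: "vol (Es t) = ennreal e" "0 \<le> e" by (auto simp: e_def emeasure_eq_ennreal_measure)
    have e1: "unit_ball_vol (real DIM('a)) * r ^ DIM('a) \<le> e" using lo e by simp
    have e2: "e \<le> unit_ball_vol (real DIM('a)) * s ^ DIM('a)" using hi e rs by simp
    have B: "vol ?B = ennreal (unit_ball_vol (real DIM('a)) * (2 * s) ^ DIM('a))" using rs by (simp add: emeasure_ball0)
    have fin: "riesz (Es t) (Es t) ?B \<le> ennreal (e * e)"
      using riesz_le_12[of "Es t" "Es t" ?B] e by (simp add: ennreal_mult)
    have "2 ^ 1 \<le> (2::real) ^ DIM('a)" by (intro power_increasing) (auto simp: Suc_leI)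
    then have "2 * s ^ DIM('a) \<le> (2 * s) ^ DIM('a)" using rs by (simp add: power_mult_distrib)
    then have "unit_ball_vol (real DIM('a)) * (2 * s ^ DIM('a)) \<le> unit_ball_vol (real DIM('a)) * (2 * s) ^ DIM('a)" by (intro mult_left_mono) auto
    then have "unit_ball_vol (real DIM('a)) * s ^ DIM('a) + e \<le> unit_ball_vol (real DIM('a)) * (2 * s) ^ DIM('a)"
      using e2 by (simp only: mult.left_commute[of _ 2])
    then have "e * (unit_ball_vol (real DIM('a)) * s ^ DIM('a) + e) \<le> e * (unit_ball_vol (real DIM('a)) * (2 * s) ^ DIM('a))" using e by (intro mult_left_mono)
    moreover have "unit_ball_vol (real DIM('a)) * r ^ DIM('a) * (unit_ball_vol (real DIM('a)) * s ^ DIM('a)) \<le> e * (unit_ball_vol (real DIM('a)) * s ^ DIM('a))" using e1 rs by (intro mult_right_mono) auto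
    ultimately have "unit_ball_vol (real DIM('a)) * r ^ DIM('a) * (unit_ball_vol (real DIM('a)) * s ^ DIM('a)) + e * e \<le> e * (unit_ball_vol (real DIM('a)) * (2 * s) ^ DIM('a))"
      unfolding distrib_left by linarith
    then have "ennreal (unit_ball_vol (real DIM('a)) * r ^ DIM('a) * (unit_ball_vol (real DIM('a)) * s ^ DIM('a))) + ennreal (e * e) \<le> ennreal e * ennreal (unit_ball_vol (real DIM('a)) * (2 * s) ^ DIM('a))"
      using rs e by (simp add: ennreal_mult[symmetric] ennreal_plus[symmetric] ennreal_leI del: ennreal_plus)
    also have "\<dots> = escape (Es t) (Es t) ?B + riesz (Es t) (Es t) ?B"
      by (simp add: escape_add_riesz e B)
    also have "\<dots> \<le> escape (Es t) (Es t) ?B + ennreal (e * e)" using fin by (intro add_left_mono)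
    finally have "ennreal (e * e) + ennreal (unit_ball_vol (real DIM('a)) * r ^ DIM('a) * (unit_ball_vol (real DIM('a)) * s ^ DIM('a))) \<le> ennreal (e * e) + escape (Es t) (Es t) ?B" by (simp only: add.commute)
    then show ?thesis by (subst (asm) ennreal_add_left_cancel_le) auto
  qed
  define T where "T v = min (max v a) b" for v
  have layer: "ennreal (T V - T v) = (\<integral>\<^sup>+t. indicator {a..<b} t * (indicator {0<..} (V - t) * indicator {..0} (v - t)))" for V v
  proof -
    have "(\<integral>\<^sup>+t. indicator {a..<b} t * (indicator {0<..} (V - t) * indicator {..0} (v - t)))
       = (\<integral>\<^sup>+t. indicator {T v..<T V} t)"
      using ab by (intro nn_integral_cong) (auto simp: indicator_def T_def)
    also have "\<dots> = ennreal (T V - T v)" by (cases "T v \<le> T V") (auto simp: ennreal_neg)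
    finally show ?thesis by simp
  qed
  have "ennreal ((b - a) * (unit_ball_vol (real DIM('a)) * r ^ DIM('a) * (unit_ball_vol (real DIM('a)) * s ^ DIM('a)))) = (\<integral>\<^sup>+t. indicator {a..<b} t * ennreal (unit_ball_vol (real DIM('a)) * r ^ DIM('a) * (unit_ball_vol (real DIM('a)) * s ^ DIM('a))))"
    using ab rs by (subst nn_integral_multc) (auto simp: ennreal_mult[symmetric])
  also have "\<dots> \<le> (\<integral>\<^sup>+t. indicator {a..<b} t * escape (Es t) (Es t) ?B)"
    using escape_ge by (intro nn_integral_mono) (auto simp: indicator_def)
  also have "\<dots> = (\<integral>\<^sup>+t. \<integral>\<^sup>+z. \<integral>\<^sup>+x. indicator ?B z * (indicator {a..<b} t * (indicator {0<..} (\<bar>f (x + z)\<bar> - t) * indicator {..0} (\<bar>f x\<bar> - t))))"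
  proof (rule nn_integral_cong)
    fix t
    have "indicator {a..<b} t * escape (Es t) (Es t) ?B = (\<integral>\<^sup>+z. \<integral>\<^sup>+x. indicator {a..<b} t * (indicator ?B z * indicator (Es t) (x + z) * indicator (- Es t) x))"
      unfolding escape_def by (simp add: nn_integral_cmult)
    also have "\<dots> = (\<integral>\<^sup>+z. \<integral>\<^sup>+x. indicator ?B z * (indicator {a..<b} t * (indicator {0<..} (\<bar>f (x + z)\<bar> - t) * indicator {..0} (\<bar>f x\<bar> - t))))"
      by (intro nn_integral_cong) (auto simp: indicator_def Es_def)
    finally show "indicator {a..<b} t * escape (Es t) (Es t) ?B = (\<integral>\<^sup>+z. \<integral>\<^sup>+x. indicator ?B z * (indicator {a..<b} t * (indicator {0<..} (\<bar>f (x + z)\<bar> - t) * indicator {..0} (\<bar>f x\<bar> - t))))" .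
  qed
  also have "\<dots> = (\<integral>\<^sup>+z. \<integral>\<^sup>+t. \<integral>\<^sup>+x. indicator ?B z * (indicator {a..<b} t * (indicator {0<..} (\<bar>f (x + z)\<bar> - t) * indicator {..0} (\<bar>f x\<bar> - t))))"
    by (rule lborel_pair.Fubini') measurable
  also have "\<dots> = (\<integral>\<^sup>+z. \<integral>\<^sup>+x. \<integral>\<^sup>+t. indicator ?B z * (indicator {a..<b} t * (indicator {0<..} (\<bar>f (x + z)\<bar> - t) * indicator {..0} (\<bar>f x\<bar> - t))))"
    by (rule nn_integral_cong, rule lborel_pair.Fubini') measurable
  also have "\<dots> = (\<integral>\<^sup>+z. indicator ?B z * (\<integral>\<^sup>+x. ennreal (T \<bar>f (x + z)\<bar> - T \<bar>f x\<bar>)))"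
    unfolding layer by (simp add: nn_integral_cmult)
  also have "\<dots> \<le> (\<integral>\<^sup>+z. ennreal (2 * s) * \<gamma> * indicator ?B z)"
  proof (rule nn_integral_mono)
    fix z :: 'a
    have "(\<integral>\<^sup>+x. ennreal (T \<bar>f (x + z)\<bar> - T \<bar>f x\<bar>)) \<le> ennreal (norm z) * \<gamma>"
      unfolding T_def \<gamma>_def slab_def a_def b_def by (rule wgrad_slab[OF wg]) (use ab in \<open>simp add: a_def\<close>)
    also have "\<dots> \<le> ennreal (2 * s) * \<gamma>" if "z \<in> ?B" using that by (intro mult_right_mono ennreal_leI) auto
    finally show "indicator ?B z * (\<integral>\<^sup>+x. ennreal (T \<bar>f (x + z)\<bar> - T \<bar>f x\<bar>)) \<le> ennreal (2 * s) * \<gamma> * indicator ?B z"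
      by (auto simp: indicator_def)
  qed
  also have "\<dots> = ennreal (2 * s) * \<gamma> * ennreal (unit_ball_vol (real DIM('a)) * (2 * s) ^ DIM('a))"
    using rs by (subst nn_integral_cmult_indicator) (auto simp: emeasure_ball0)
  \<comment> \<open>The volume of the ball of radius \<open>s\<close> is split off to cancel against
    the lower bound. The length \<open>2 * s\<close> of the translations and the power
    \<open>2 ^ n\<close> from \<open>?B\<close> leave the factor
    \<open>2 ^ (n + 1) * s\<close>.\<close>
  also have "\<dots> = ennreal (unit_ball_vol (real DIM('a)) * s ^ DIM('a)) * (ennreal (2 ^ (DIM('a) + 1) * s) * \<gamma>)"
  proof -
    have "ennreal (2 * s) * ennreal (unit_ball_vol (real DIM('a)) * (2 * s) ^ DIM('a)) = ennreal (unit_ball_vol (real DIM('a)) * s ^ DIM('a)) * ennreal (2 ^ (DIM('a) + 1) * s)"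
      using rs by (simp add: ennreal_mult[symmetric] power_mult_distrib mult_ac)
    then show ?thesis by (metis mult.assoc mult.commute)
  qed
  finally have "ennreal (unit_ball_vol (real DIM('a)) * s ^ DIM('a)) * ennreal ((b - a) * (unit_ball_vol (real DIM('a)) * r ^ DIM('a))) \<le> ennreal (unit_ball_vol (real DIM('a)) * s ^ DIM('a)) * (ennreal (2 ^ (DIM('a) + 1) * s) * \<gamma>)"
    using rs ab by (simp add: ennreal_mult[symmetric] mult_ac)
  then show ?thesis
    using rs omega_neq_0 by (subst (asm) ennreal_mult_le_mult_iff) (auto simp: a_def b_def \<gamma>_def)
qed

text \<open>For \<open>t\<close> just below \<open>profile f r\<close> the set
  \<open>{x. \<bar>f x\<bar> > t}\<close> has more than the volume of the ball of radius
  \<open>r\<close> and is disjoint from the part of the slab up to \<open>t\<close>. Letting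
  \<open>t\<close> increase exhausts the slab, whose upper bound is strict.\<close>

lemma slab_measure_le:
  assumes rs: "0 < r" "r \<le> s"
  shows "vol (slab r s) \<le> ennreal (unit_ball_vol (real DIM('a)) * (s ^ DIM('a) - r ^ DIM('a)))"
proof -
  define a b where "a = profile f s" and "b = profile f r"
  have ab: "0 \<le> a" "a \<le> b" using rs profile_nonneg profile_antimono by (auto simp: a_def b_def)
  define X where "X j = {x. a < \<bar>f x\<bar> \<and> \<bar>f x\<bar> \<le> b - 1 / real (Suc j)}" for j
  have [measurable]: "X j \<in> sets borel" for j unfolding X_def by measurable
  have "slab r s = (\<Union>j. X j)"
  proof (intro equalityI subsetI)
    fix x assume x: "x \<in> slab r s"
    then have "0 < b - \<bar>f x\<bar>" by (simp add: slab_def b_def)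
    then obtain j where "1 / real (Suc j) < b - \<bar>f x\<bar>" using nat_approx_posE by blast
    then have "x \<in> X j" using x by (auto simp: X_def slab_def a_def simp del: of_nat_Suc)
    then show "x \<in> (\<Union>j. X j)" by blast
  next
    fix x assume "x \<in> (\<Union>j. X j)"
    then obtain j where "a < \<bar>f x\<bar>" "\<bar>f x\<bar> \<le> b - 1 / real (Suc j)" by (auto simp: X_def)
    moreover have "0 < 1 / real (Suc j)" by simp
    ultimately have "a < \<bar>f x\<bar>" "\<bar>f x\<bar> < b" by linarith+
    then show "x \<in> slab r s" by (simp add: slab_def a_def b_def)
  qed
  moreover have "(SUP j. vol (X j)) = vol (\<Union>j. X j)"
  proof (rule SUP_emeasure_incseq)
    show "incseq X"
    proof (rule incseq_SucI, safe)
      fix j x assume "x \<in> X j"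
      moreover have "1 / real (Suc (Suc j)) \<le> 1 / real (Suc j)" by (intro divide_left_mono) auto
      ultimately show "x \<in> X (Suc j)" unfolding X_def by auto
    qed
  qed auto
  moreover have "vol (X j) \<le> ennreal (unit_ball_vol (real DIM('a)) * (s ^ DIM('a) - r ^ DIM('a)))" for j
  proof (cases "a \<le> b - 1 / real (Suc j)")
    case False
    then have "X j = {}" by (auto simp: X_def)
    then show ?thesis by simp
  next
    case True
    define t where "t = b - 1 / real (Suc j)"
    have t: "a \<le> t" "t < b" using True by (auto simp: t_def)
    have Xt: "X j = {x. a < \<bar>f x\<bar> \<and> \<bar>f x\<bar> \<le> t}" unfolding X_def t_def ..
    have "vol (X j) + ennreal (unit_ball_vol (real DIM('a)) * r ^ DIM('a)) \<le> vol (X j) + vol {x. \<bar>f x\<bar> > t}"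
      using profile_greater[of r t] t ab rs by (intro add_left_mono) (auto simp: b_def)
    also have "\<dots> = vol {x. \<bar>f x\<bar> > a}"
      using t by (subst plus_emeasure) (auto simp: Xt intro!: arg_cong[where f="emeasure lborel"])
    also have "\<dots> \<le> ennreal (unit_ball_vol (real DIM('a)) * s ^ DIM('a))" using superlevel_le[of s a] rs by (auto simp: a_def)
    also have "\<dots> = ennreal (unit_ball_vol (real DIM('a)) * (s ^ DIM('a) - r ^ DIM('a))) + ennreal (unit_ball_vol (real DIM('a)) * r ^ DIM('a))"
      using rs power_mono[of r s "DIM('a)"] by (subst ennreal_plus[symmetric]) (auto simp: algebra_simps)
    finally have "ennreal (unit_ball_vol (real DIM('a)) * r ^ DIM('a)) + vol (X j) \<le> ennreal (unit_ball_vol (real DIM('a)) * r ^ DIM('a)) + ennreal (unit_ball_vol (real DIM('a)) * (s ^ DIM('a) - r ^ DIM('a)))"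
      by (simp only: add.commute)
    then show ?thesis by (subst (asm) ennreal_add_left_cancel_le) auto
  qed
  ultimately show ?thesis by (metis SUP_least)
qed

end

section \<open>Absolute continuity of the profile in the logarithm of the radius\<close>

text \<open>Absolute continuity of the integral: \<open>h\<close> is cut at a height
  \<open>j\<close> such that the part above \<open>j\<close> integrates to less than
  \<open>e / 2\<close>; the part below contributes at most \<open>j\<close> times the measure of the
  set.\<close>

lemma nn_integral_small_sets:
  fixes h :: "'a \<Rightarrow> real"
  assumes [measurable]: "h \<in> borel_measurable M" and nn: "\<And>x. 0 \<le> h x" and fin: "(\<integral>\<^sup>+x. ennreal (h x) \<partial>M) < \<infinity>" and e: "e > 0"
  shows "\<exists>\<delta>>0. \<forall>S\<in>sets M. emeasure M S \<le> ennreal \<delta> \<longrightarrow> (\<integral>\<^sup>+x. indicator S x * ennreal (h x) \<partial>M) \<le> ennreal e"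
proof -
  have int: "integrable M h" using fin nn by (intro integrableI_nonneg) auto
  have "(\<lambda>j. \<integral>x. max (h x - real j) 0 \<partial>M) \<longlonglongrightarrow> (\<integral>x. 0 \<partial>M)"
  proof (rule integral_dominated_convergence[where w = h])
    show "AE x in M. (\<lambda>j. max (h x - real j) 0) \<longlonglongrightarrow> 0"
    proof (intro AE_I2 tendsto_eventually)
      fix x
      obtain N :: nat where N: "h x < real N" using reals_Archimedean2 by blast
      show "\<forall>\<^sub>F j in sequentially. max (h x - real j) 0 = 0"
        using N by (intro eventually_sequentiallyI[of N]) auto
    qed
    show "AE x in M. norm (max (h x - real j) 0) \<le> h x" for j
      using nn by (intro AE_I2) (auto simp: max_def)
  qed (use int in auto)
  then have "(\<lambda>j. \<integral>x. max (h x - real j) 0 \<partial>M) \<longlonglongrightarrow> 0" by simp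
  then have "\<forall>\<^sub>F j in sequentially. (\<integral>x. max (h x - real j) 0 \<partial>M) < e / 2"
    by (rule order_tendstoD) (use e in simp)
  then obtain j where j: "(\<integral>x. max (h x - real j) 0 \<partial>M) < e / 2" by (auto simp: eventually_sequentially)
  have intj: "integrable M (\<lambda>x. max (h x - real j) 0)"
    by (rule Bochner_Integration.integrable_bound[OF int]) (use nn in \<open>auto simp: max_def\<close>)
  define \<delta> where "\<delta> = e / (2 * (real j + 1))"
  have d: "\<delta> > 0" using e by (simp add: \<delta>_def)
  have "(\<integral>\<^sup>+x. indicator S x * ennreal (h x) \<partial>M) \<le> ennreal e" if [measurable]: "S \<in> sets M" and S: "emeasure M S \<le> ennreal \<delta>" for S
  proof -
    have "(\<integral>\<^sup>+x. indicator S x * ennreal (h x) \<partial>M) \<le> (\<integral>\<^sup>+x. ennreal (max (h x - real j) 0) + ennreal (real j) * indicator S x \<partial>M)"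
    proof (rule nn_integral_mono)
      fix x
      have "ennreal (h x) \<le> ennreal (max (h x - real j) 0 + real j)" by (rule ennreal_leI) auto
      then show "indicator S x * ennreal (h x) \<le> ennreal (max (h x - real j) 0) + ennreal (real j) * indicator S x"
        by (auto simp: indicator_def)
    qed
    also have "\<dots> = ennreal (\<integral>x. max (h x - real j) 0 \<partial>M) + ennreal (real j) * emeasure M S"
      using nn_integral_eq_integral[OF intj] by (simp add: nn_integral_add nn_integral_cmult_indicator)
    also have "\<dots> \<le> ennreal (e / 2) + ennreal (real j) * ennreal \<delta>"
      using j S by (intro add_mono mult_left_mono ennreal_leI) auto
    also have "\<dots> = ennreal (e / 2 + real j * \<delta>)" using e d by (simp add: ennreal_mult)
    also have "\<dots> \<le> ennreal e"
    proof (rule ennreal_leI)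
      have "real j * \<delta> \<le> e / 2" using e by (simp add: \<delta>_def field_simps)
      then show "e / 2 + real j * \<delta> \<le> e" by simp
    qed
    finally show ?thesis .
  qed
  then show ?thesis using d by blast
qed

context weakly_differentiable
begin

text \<open>In the logarithm of the radius, and with reversed sign, the profile becomes an
  increasing function on the whole line, which has a Stieltjes measure. The origin is moved to
  infinity, and on \<open>{-M..M}\<close> the radii are bounded and bounded away from 0, so the
  constants in the estimates are uniform.\<close>

definition \<Phi> :: "real \<Rightarrow> real" where
  "\<Phi> y = - profile f (exp y)"

lemma Phi_mono: "y \<le> y' \<Longrightarrow> \<Phi> y \<le> \<Phi> y'"
  using profile_antimono[of "exp y" "exp y'"] by (simp add: \<Phi>_def)

lemma Phi_diff_le:
  assumes "- M \<le> c" "c < d" "d \<le> M"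
  shows "ennreal (\<Phi> d - \<Phi> c) \<le> ennreal (2 ^ (DIM('a) + 1) * exp M / (unit_ball_vol (real DIM('a)) * exp (- M) ^ DIM('a)))
    * (\<integral>\<^sup>+x. indicator (slab (exp c) (exp d)) x * ennreal (norm (g x)))"
proof -
  let ?\<gamma> = "\<integral>\<^sup>+x. indicator (slab (exp c) (exp d)) x * ennreal (norm (g x))"
  define w where "w = unit_ball_vol (real DIM('a)) * exp (- M) ^ DIM('a)"
  have w: "w > 0" using omega_pos by (simp add: w_def)
  have p: "0 \<le> \<Phi> d - \<Phi> c" using Phi_mono[of c d] assms by simp
  have "ennreal (\<Phi> d - \<Phi> c) = ennreal (1 / w) * ennreal ((\<Phi> d - \<Phi> c) * w)"
    using w p by (simp add: ennreal_mult[symmetric])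
  also have "ennreal ((\<Phi> d - \<Phi> c) * w) \<le> ennreal ((\<Phi> d - \<Phi> c) * (unit_ball_vol (real DIM('a)) * exp c ^ DIM('a)))"
    unfolding w_def using p assms by (intro ennreal_leI mult_left_mono power_mono) auto
  also have "\<dots> \<le> ennreal (2 ^ (DIM('a) + 1) * exp d) * ?\<gamma>"
    using profile_diff_le[of "exp c" "exp d"] assms by (simp add: \<Phi>_def)
  also have "\<dots> \<le> ennreal (2 ^ (DIM('a) + 1) * exp M) * ?\<gamma>"
    using assms by (intro mult_right_mono ennreal_leI mult_left_mono) auto
  finally have "ennreal (\<Phi> d - \<Phi> c) \<le> ennreal (1 / w) * (ennreal (2 ^ (DIM('a) + 1) * exp M) * ?\<gamma>)"
    by (simp add: mult_left_mono)
  also have "\<dots> = ennreal (2 ^ (DIM('a) + 1) * exp M / w) * ?\<gamma>"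
    using w by (simp add: mult.assoc[symmetric] ennreal_mult[symmetric])
  finally show ?thesis by (simp add: w_def)
qed

lemma slab_exp_measure_le:
  assumes "c \<le> d" "d \<le> M"
  shows "vol (slab (exp c) (exp d)) \<le> ennreal (unit_ball_vol (real DIM('a)) * real DIM('a) * exp (real DIM('a) * M) * (d - c))"
proof -
  let ?n = "real DIM('a)"
  have "exp (?n * d) * (1 + (?n * c - ?n * d)) \<le> exp (?n * d) * exp (?n * c - ?n * d)"
    using exp_ge_add_one_self[of "?n * c - ?n * d"] by (intro mult_left_mono) auto
  also have "\<dots> = exp (?n * c)" by (simp add: exp_add[symmetric])
  finally have "exp (?n * d) - exp (?n * c) \<le> exp (?n * d) * (?n * (d - c))" by (simp add: algebra_simps)
  also have "\<dots> \<le> exp (?n * M) * (?n * (d - c))" using assms by (intro mult_right_mono) auto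
  finally have *: "exp (?n * d) - exp (?n * c) \<le> ?n * exp (?n * M) * (d - c)" by (simp add: mult_ac)
  have "vol (slab (exp c) (exp d)) \<le> ennreal (unit_ball_vol ?n * (exp d ^ DIM('a) - exp c ^ DIM('a)))"
    using assms by (intro slab_measure_le) auto
  also have "\<dots> \<le> ennreal (unit_ball_vol ?n * (?n * exp (?n * M) * (d - c)))"
    using * by (intro ennreal_leI mult_left_mono) (auto simp: exp_of_nat_mult[symmetric])
  finally show ?thesis by (simp add: mult_ac)
qed

lemma slab_disjoint:
  assumes "{c<..d} \<inter> {c'<..d'} = {}" "c < d" "c' < d'"
  shows "slab (exp c) (exp d) \<inter> slab (exp c') (exp d') = {}"
proof -
  have "d \<le> c' \<or> d' \<le> c"
  proof (rule ccontr)
    assume "\<not> ?thesis"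
    then have "min d d' \<in> {c<..d} \<inter> {c'<..d'}" using assms(2,3) by auto
    then show False using assms(1) by blast
  qed
  then show ?thesis
    using profile_antimono[of "exp d" "exp c'"] profile_antimono[of "exp d'" "exp c"] by (auto simp: slab_def)
qed

text \<open>Disjoint intervals of logarithmic radii have disjoint slabs. The volume of their union
  is at most \<open>C2\<close> times the total length, and the increments of \<Phi> add up to at
  most \<open>C1\<close> times the integral of \<open>norm (g x)\<close> over that union. The
  families are countable, since the covers of null sets later on are infinite.\<close>

lemma Phi_absolutely_continuous:
  assumes M: "M > 0" and e: "e > 0"
  shows "\<exists>\<delta>>0. \<forall>I. countable I \<and> (\<forall>(c, d)\<in>I. - M \<le> c \<and> c < d \<and> d \<le> M) \<and> disjoint_family_on (\<lambda>(c, d). {c<..d}) I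
      \<and> (\<integral>\<^sup>+ (c, d). ennreal (d - c) \<partial>count_space I) \<le> ennreal \<delta>
    \<longrightarrow> (\<integral>\<^sup>+ (c, d). ennreal (\<Phi> d - \<Phi> c) \<partial>count_space I) \<le> ennreal e"
proof -
  \<comment> \<open>\<open>S0\<close> has finite volume and contains all the slabs in question,
    which makes \<open>norm (g x)\<close> integrable where absolute continuity is used.\<close>
  define S0 where "S0 = {x. profile f (exp M) < \<bar>f x\<bar>}"
  have [measurable]: "S0 \<in> sets borel" unfolding S0_def by measurable
  have "vol S0 \<le> ennreal (unit_ball_vol (real DIM('a)) * exp M ^ DIM('a))"
    unfolding S0_def by (rule superlevel_le) auto
  then have fS0: "vol S0 < \<infinity>" by (rule le_less_trans) simp
  define C1 where "C1 = 2 ^ (DIM('a) + 1) * exp M / (unit_ball_vol (real DIM('a)) * exp (- M) ^ DIM('a))"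
  define C2 where "C2 = unit_ball_vol (real DIM('a)) * real DIM('a) * exp (real DIM('a) * M)"
  have C: "C1 > 0" "C2 > 0" using omega_pos by (auto simp: C1_def C2_def)
  define h where "h x = indicator S0 x * norm (g x)" for x
  have hi: "ennreal (h x) = indicator S0 x * ennreal (norm (g x))" for x by (auto simp: h_def indicator_def)
  have "(\<integral>\<^sup>+x. ennreal (h x)) < \<infinity>" unfolding hi by (rule g_finite) (use fS0 in auto)
  moreover have "h \<in> borel_measurable lborel" unfolding h_def by measurable
  moreover have "0 \<le> h x" for x by (simp add: h_def)
  moreover have "e / C1 > 0" using e C by simp
  ultimately have "\<exists>\<delta>>0. \<forall>S\<in>sets lborel. vol S \<le> ennreal \<delta> \<longrightarrow> (\<integral>\<^sup>+x. indicator S x * ennreal (h x)) \<le> ennreal (e / C1)"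
    by (intro nn_integral_small_sets)
  then obtain \<delta>1 where \<delta>1: "\<delta>1 > 0" "\<And>S. S \<in> sets borel \<Longrightarrow> vol S \<le> ennreal \<delta>1 \<Longrightarrow> (\<integral>\<^sup>+x. indicator S x * ennreal (h x)) \<le> ennreal (e / C1)"
    by (auto simp only: sets_lborel)
  have "(\<integral>\<^sup>+ (c, d). ennreal (\<Phi> d - \<Phi> c) \<partial>count_space I) \<le> ennreal e"
    if I: "countable I" "\<And>c d. (c, d) \<in> I \<Longrightarrow> - M \<le> c \<and> c < d \<and> d \<le> M" "disjoint_family_on (\<lambda>(c, d). {c<..d}) I"
      "(\<integral>\<^sup>+ (c, d). ennreal (d - c) \<partial>count_space I) \<le> ennreal (\<delta>1 / C2)" for I
  proof -
    define sl where "sl = (\<lambda>(c, d). slab (exp c) (exp d))"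
    have [measurable]: "sl i \<in> sets borel" for i by (cases i) (simp add: sl_def)
    have disj: "disjoint_family_on sl I"
      unfolding disjoint_family_on_def
    proof (intro ballI impI)
      fix i j assume ij: "i \<in> I" "j \<in> I" "i \<noteq> j"
      obtain c d c' d' where eq: "i = (c, d)" "j = (c', d')" by (cases i, cases j) auto
      have "{c<..d} \<inter> {c'<..d'} = {}" using I(3) ij unfolding disjoint_family_on_def eq by fastforce
      then show "sl i \<inter> sl j = {}" using slab_disjoint[of c d c' d'] I(2) ij unfolding eq sl_def by auto
    qed
    have slS0: "sl i \<subseteq> S0" if "i \<in> I" for i
    proof -
      obtain c d where eq: "i = (c, d)" by (cases i)
      then have "profile f (exp M) \<le> profile f (exp d)" using I(2)[of c d] that by (intro profile_antimono) auto
      then show ?thesis by (auto simp: sl_def eq slab_def S0_def)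
    qed
    define U where "U = (\<Union>i\<in>I. sl i)"
    have [measurable]: "U \<in> sets borel" unfolding U_def using I(1) by (intro sets.countable_UN') auto
    have "vol U = (\<integral>\<^sup>+i. vol (sl i) \<partial>count_space I)"
      unfolding U_def by (rule emeasure_UN_countable) (use I(1) disj in auto)
    also have "\<dots> \<le> (\<integral>\<^sup>+i. ennreal C2 * (case i of (c, d) \<Rightarrow> ennreal (d - c)) \<partial>count_space I)"
    proof (rule nn_integral_mono)
      fix i assume "i \<in> space (count_space I)"
      then obtain c d where eq: "i = (c, d)" "(c, d) \<in> I" by (cases i) auto
      then have cd: "c < d" "d \<le> M" using I(2) by auto
      show "vol (sl i) \<le> ennreal C2 * (case i of (c, d) \<Rightarrow> ennreal (d - c))"
        using slab_exp_measure_le[of c d M] cd C by (simp add: eq sl_def C2_def[symmetric] ennreal_mult[symmetric])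
    qed
    also have "\<dots> = ennreal C2 * (\<integral>\<^sup>+ (c, d). ennreal (d - c) \<partial>count_space I)" by (rule nn_integral_cmult) simp
    also have "\<dots> \<le> ennreal C2 * ennreal (\<delta>1 / C2)" using I(4) by (rule mult_left_mono) simp
    also have "\<dots> = ennreal \<delta>1" using C \<delta>1 by (simp add: ennreal_mult[symmetric])
    finally have small: "(\<integral>\<^sup>+x. indicator U x * ennreal (h x)) \<le> ennreal (e / C1)" by (intro \<delta>1) auto
    have "(\<integral>\<^sup>+ (c, d). ennreal (\<Phi> d - \<Phi> c) \<partial>count_space I)
       \<le> (\<integral>\<^sup>+i. ennreal C1 * emeasure (density lborel (\<lambda>x. ennreal (h x))) (sl i) \<partial>count_space I)"
    proof (rule nn_integral_mono)
      fix i assume "i \<in> space (count_space I)"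
      then obtain c d where eq: "i = (c, d)" "(c, d) \<in> I" by (cases i) auto
      then have cd: "- M \<le> c" "c < d" "d \<le> M" using I(2) by auto
      have "emeasure (density lborel (\<lambda>x. ennreal (h x))) (sl i) = (\<integral>\<^sup>+x. indicator (slab (exp c) (exp d)) x * ennreal (norm (g x)))"
        using slS0[of i] eq by (subst emeasure_density) (auto simp: h_def sl_def indicator_def intro!: nn_integral_cong)
      then show "(case i of (c, d) \<Rightarrow> ennreal (\<Phi> d - \<Phi> c)) \<le> ennreal C1 * emeasure (density lborel (\<lambda>x. ennreal (h x))) (sl i)"
        using Phi_diff_le[OF cd] by (simp add: eq(1) C1_def)
    qed
    also have "\<dots> = ennreal C1 * (\<integral>\<^sup>+i. emeasure (density lborel (\<lambda>x. ennreal (h x))) (sl i) \<partial>count_space I)"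
      by (rule nn_integral_cmult) simp
    also have "(\<integral>\<^sup>+i. emeasure (density lborel (\<lambda>x. ennreal (h x))) (sl i) \<partial>count_space I) = emeasure (density lborel (\<lambda>x. ennreal (h x))) U"
      unfolding U_def by (rule emeasure_UN_countable[symmetric]) (use I(1) disj in auto)
    also have "\<dots> = (\<integral>\<^sup>+x. indicator U x * ennreal (h x))"
      by (subst emeasure_density) (auto simp: h_def mult.commute)
    also have "ennreal C1 * \<dots> \<le> ennreal C1 * ennreal (e / C1)" using small by (rule mult_left_mono) simp
    also have "\<dots> = ennreal e" using C e by (simp add: ennreal_mult[symmetric])
    finally show ?thesis .
  qed
  then show ?thesis using \<delta>1(1) C by (intro exI[of _ "\<delta>1 / C2"]) auto
qed

lemma isCont_Phi: "isCont \<Phi> y"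
proof -
  define M where "M = \<bar>y\<bar> + 1"
  have Mp: "M > 0" by (simp add: M_def)
  show ?thesis
    unfolding isCont_def LIM_def
  proof (intro allI impI)
    fix e :: real assume e: "e > 0"
    obtain \<delta> where \<delta>: "\<delta> > 0" "\<And>I. countable I \<Longrightarrow> (\<forall>(c, d)\<in>I. - M \<le> c \<and> c < d \<and> d \<le> M) \<Longrightarrow> disjoint_family_on (\<lambda>(c, d). {c<..d}) I
      \<Longrightarrow> (\<integral>\<^sup>+ (c, d). ennreal (d - c) \<partial>count_space I) \<le> ennreal \<delta> \<Longrightarrow> (\<integral>\<^sup>+ (c, d). ennreal (\<Phi> d - \<Phi> c) \<partial>count_space I) \<le> ennreal (e / 2)"
      using Phi_absolutely_continuous[OF Mp half_gt_zero[OF e]] by blast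
    have one: "\<Phi> d - \<Phi> c \<le> e / 2" if "- M \<le> c" "c < d" "d \<le> M" "d - c \<le> \<delta>" for c d
    proof -
      have "ennreal (\<Phi> d - \<Phi> c) \<le> ennreal (e / 2)"
        using \<delta>(2)[of "{(c, d)}"] that by (simp add: disjoint_family_on_def nn_integral_count_space_finite ennreal_leI)
      then show ?thesis using e by simp
    qed
    show "\<exists>s>0. \<forall>x. x \<noteq> y \<and> dist x y < s \<longrightarrow> dist (\<Phi> x) (\<Phi> y) < e"
    proof (intro exI[of _ "min \<delta> 1"] conjI allI impI)
      show "min \<delta> 1 > 0" using \<delta>(1) by simp
      fix x assume x': "x \<noteq> y \<and> dist x y < min \<delta> 1"
      then have x: "x \<noteq> y" "\<bar>x - y\<bar> < min \<delta> 1" by (auto simp: dist_real_def)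
      show "dist (\<Phi> x) (\<Phi> y) < e"
      proof (cases "x < y")
        case True
        then have "\<Phi> y - \<Phi> x \<le> e / 2" using x by (intro one) (auto simp: M_def)
        then show ?thesis using True e Phi_mono[of x y] by (simp add: dist_real_def)
      next
        case False
        then have "\<Phi> x - \<Phi> y \<le> e / 2" using x by (intro one) (auto simp: M_def)
        then show ?thesis using False e Phi_mono[of y x] by (simp add: dist_real_def)
      qed
    qed
  qed
qed

text \<open>A bounded null set is covered by countably many nonoverlapping closed intervals of small
  total length, to which absolute continuity of \<Phi> applies. An exhaustion by bounded intervals
  does the rest.\<close>

lemma Phi_measure_absolutely_continuous:
  "absolutely_continuous lborel (interval_measure \<Phi>)"
proof -
  have rc: "continuous (at_right a) \<Phi>" for a using isCont_Phi[of a] by (rule continuous_at_imp_continuous_at_within)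
  have Ioc: "emeasure (interval_measure \<Phi>) {a<..b} = ennreal (\<Phi> b - \<Phi> a)" if "a \<le> b" for a b
    by (rule emeasure_interval_measure_Ioc[OF that Phi_mono rc])
  have single: "emeasure (interval_measure \<Phi>) {a} = 0" for a
  proof -
    have "emeasure (interval_measure \<Phi>) {a..a} = ennreal (\<Phi> a - \<Phi> a)"
      by (rule emeasure_interval_measure_Icc) (auto intro: Phi_mono continuous_at_imp_continuous_on isCont_Phi)
    then show ?thesis by simp
  qed
  have zero: "emeasure (interval_measure \<Phi>) (N \<inter> {-M..M}) = 0" if N: "N \<in> null_sets lborel" and M: "M > 0" for N M
  proof -
    have [measurable]: "N \<in> sets borel" using N by (auto simp: null_sets_def)
    define N' where "N' = N \<inter> {-M..M}"
    have N': "N' \<in> sets borel" "vol N' = 0"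
      using N null_set_Int2[of N lborel "{-M..M}"] by (auto simp: N'_def Int_commute null_sets_def)
    have small: "emeasure (interval_measure \<Phi>) N' \<le> 0 + ennreal e" if e: "e > 0" for e
    proof -
      obtain \<delta> where \<delta>: "\<delta> > 0" "\<And>I. countable I \<Longrightarrow> (\<forall>(c, d)\<in>I. - M \<le> c \<and> c < d \<and> d \<le> M) \<Longrightarrow> disjoint_family_on (\<lambda>(c, d). {c<..d}) I
        \<Longrightarrow> (\<integral>\<^sup>+ (c, d). ennreal (d - c) \<partial>count_space I) \<le> ennreal \<delta> \<Longrightarrow> (\<integral>\<^sup>+ (c, d). ennreal (\<Phi> d - \<Phi> c) \<partial>count_space I) \<le> ennreal e"
        using Phi_absolutely_continuous[OF M e] by blast
      have lm: "N' \<in> lmeasurable" "measure lebesgue N' = 0"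
        using N' by (auto simp: fmeasurable_def measure_def)
      have NM: "N' \<subseteq> cbox (-M) M" by (auto simp: N'_def)
      have "\<exists>\<D>. countable \<D> \<and> (\<forall>K\<in>\<D>. K \<subseteq> cbox (-M) M \<and> K \<noteq> {} \<and> (\<exists>c d. K = cbox c d))
          \<and> pairwise (\<lambda>A B. interior A \<inter> interior B = {}) \<D> \<and> (\<forall>K\<in>\<D>. interior K \<noteq> {})
          \<and> N' \<subseteq> \<Union>\<D> \<and> \<Union>\<D> \<in> lmeasurable \<and> measure lebesgue (\<Union>\<D>) \<le> measure lebesgue N' + \<delta>"
      proof (rule measurable_outer_intervals_bounded[OF lm(1) NM \<delta>(1)])
        fix \<D> assume a: "countable \<D>" "\<And>K. K \<in> \<D> \<Longrightarrow> K \<subseteq> cbox (-M) M \<and> K \<noteq> {} \<and> (\<exists>c d. K = cbox c d)"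
          "pairwise (\<lambda>A B. interior A \<inter> interior B = {}) \<D>" "\<And>K. \<lbrakk>K \<in> \<D>; box (-M) M \<noteq> {}\<rbrakk> \<Longrightarrow> interior K \<noteq> {}"
          "N' \<subseteq> \<Union>\<D>" "\<Union>\<D> \<in> lmeasurable" "measure lebesgue (\<Union>\<D>) \<le> measure lebesgue N' + \<delta>"
        have "box (-M) M \<noteq> {}" using M by (simp add: box_real)
        then show ?thesis using a by (intro exI[of _ \<D>] conjI ballI) simp_all
      qed
      then obtain \<D> where \<D>: "countable \<D>" "\<forall>K\<in>\<D>. K \<subseteq> cbox (-M) M \<and> K \<noteq> {} \<and> (\<exists>c d. K = cbox c d)"
          "pairwise (\<lambda>A B. interior A \<inter> interior B = {}) \<D>" "\<forall>K\<in>\<D>. interior K \<noteq> {}"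
          "N' \<subseteq> \<Union>\<D>" "\<Union>\<D> \<in> lmeasurable" "measure lebesgue (\<Union>\<D>) \<le> measure lebesgue N' + \<delta>"
        by (elim exE conjE)
      define I where "I = {(c, d). {c..d} \<in> \<D>}"
      have Icd: "- M \<le> c \<and> c < d \<and> d \<le> M" if "(c, d) \<in> I" for c d
      proof -
        have D: "{c..d} \<in> \<D>" using that by (simp add: I_def)
        have "interior {c..d} \<noteq> {}" using \<D>(4) D by blast
        then have "c < d" by simp
        moreover have "{c..d} \<subseteq> {-M..M}" using bspec[OF \<D>(2) D] by simp
        ultimately show ?thesis by auto
      qed
      have cI: "countable I"
      proof (rule countable_subset)
        show "I \<subseteq> (\<lambda>K. (Inf K, Sup K)) ` \<D>"
        proof
          fix i assume "i \<in> I"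
          then obtain c d where "i = (c, d)" "(c, d) \<in> I" by (cases i) auto
          then show "i \<in> (\<lambda>K. (Inf K, Sup K)) ` \<D>" using Icd[of c d] by (intro image_eqI[of _ _ "{c..d}"]) (auto simp: I_def)
        qed
        show "countable ((\<lambda>K. (Inf K, Sup K)) ` \<D>)" using \<D>(1) by simp
      qed
      have disj: "disjoint_family_on (\<lambda>(c, d). {c<..d}) I"
        unfolding disjoint_family_on_def
      proof (intro ballI impI)
        fix i j assume ij: "i \<in> I" "j \<in> I" "i \<noteq> j"
        obtain c d c' d' where eq: "i = (c, d)" "j = (c', d')" by (cases i, cases j) auto
        have lt: "c < d" "c' < d'" using Icd ij eq by auto
        have "{c..d} \<noteq> {c'..d'}" using ij lt by (auto simp: eq Icc_eq_Icc)
        then have "interior {c..d} \<inter> interior {c'..d'} = {}" using \<D>(3) ij unfolding pairwise_def eq I_def by blast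
        then have i: "{c<..<d} \<inter> {c'<..<d'} = {}" by simp
        have "\<not> max c c' < min d d'"
        proof
          assume "max c c' < min d d'"
          then obtain x where "max c c' < x" "x < min d d'" using dense by blast
          then have "x \<in> {c<..<d} \<inter> {c'<..<d'}" by auto
          then show False using i by blast
        qed
        then show "(case i of (c, d) \<Rightarrow> {c<..d}) \<inter> (case j of (c, d) \<Rightarrow> {c<..d}) = {}" by (auto simp: eq)
      qed
      define U where "U = (\<Union>(c, d)\<in>I. {c<..d})"
      have sub: "U \<subseteq> \<Union>\<D>"
      proof
        fix x assume "x \<in> U"
        then obtain c d where "(c, d) \<in> I" "x \<in> {c<..d}" by (auto simp: U_def)
        then show "x \<in> \<Union>\<D>" by (intro UnionI[of "{c..d}"]) (simp_all add: I_def)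
      qed
      have mU[measurable]: "U \<in> sets borel" unfolding U_def using cI by (intro sets.countable_UN') auto
      have mP: "(case i of (c, d) \<Rightarrow> {c<..d}) \<in> sets borel" for i :: "real \<times> real" by (cases i) auto
      have "(\<integral>\<^sup>+ (c, d). ennreal (d - c) \<partial>count_space I) = (\<integral>\<^sup>+i. vol (case i of (c, d) \<Rightarrow> {c<..d}) \<partial>count_space I)"
      proof (rule nn_integral_cong)
        fix i assume "i \<in> space (count_space I)"
        then obtain c d where eq: "i = (c, d)" "(c, d) \<in> I" by (cases i) auto
        then have "c \<le> d" using Icd by force
        then show "(case i of (c, d) \<Rightarrow> ennreal (d - c)) = vol (case i of (c, d) \<Rightarrow> {c<..d})" by (simp add: eq)
      qed
      also have "\<dots> = vol U"
        unfolding U_def by (rule emeasure_UN_countable[symmetric]) (use cI disj mP in auto)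
      also have "\<dots> = emeasure lebesgue U" by (simp add: emeasure_completion)
      also have "\<dots> \<le> emeasure lebesgue (\<Union>\<D>)" using sub \<D>(6) by (intro emeasure_mono) auto
      also have "\<dots> \<le> ennreal \<delta>" using \<D>(6,7) lm by (simp add: emeasure_eq_measure2 ennreal_leI)
      finally have le: "(\<integral>\<^sup>+ (c, d). ennreal (\<Phi> d - \<Phi> c) \<partial>count_space I) \<le> ennreal e"
        using Icd by (intro \<delta>(2) cI disj) auto
      \<comment> \<open>The half-open intervals miss the left end points of the closed ones. There
        are countably many of them, and single points have measure 0 because \<Phi> is
        continuous.\<close>
      define L where "L = fst ` I"
      have cL: "countable L" using cI by (simp add: L_def)
      have "emeasure (interval_measure \<Phi>) L = 0"
      proof -
        have "L \<in> null_sets (interval_measure \<Phi>)"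
        proof -
          have "(\<Union>x\<in>L. {x}) \<in> null_sets (interval_measure \<Phi>)"
            using cL single by (intro null_sets_UN') auto
          then show ?thesis by simp
        qed
        then show ?thesis by auto
      qed
      moreover have "N' \<subseteq> U \<union> L"
      proof
        fix x assume "x \<in> N'"
        then obtain K where K: "K \<in> \<D>" "x \<in> K" using \<D>(5) by blast
        then obtain c d where "K = cbox c d" using \<D>(2) by blast
        then have "K = {c..d}" by simp
        then have "(c, d) \<in> I" "x \<in> {c..d}" using K unfolding I_def by auto
        show "x \<in> U \<union> L"
        proof (cases "x = c")
          case True
          then have "x \<in> L" using \<open>(c, d) \<in> I\<close> unfolding L_def by (intro image_eqI[of _ _ "(c, d)"]) auto
          then show ?thesis by blast
        next
          case False
          then have "x \<in> (case (c, d) of (c, d) \<Rightarrow> {c<..d})" using \<open>x \<in> {c..d}\<close> by auto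
          then have "x \<in> U" unfolding U_def using \<open>(c, d) \<in> I\<close> by blast
          then show ?thesis by blast
        qed
      qed
      moreover have [measurable]: "L \<in> sets borel" using cL by (simp add: countable_imp_null_set_lborel sets.countable)
      ultimately have "emeasure (interval_measure \<Phi>) N' \<le> emeasure (interval_measure \<Phi>) U + 0"
        using emeasure_mono[of N' "U \<union> L" "interval_measure \<Phi>"] emeasure_subadditive[of U "interval_measure \<Phi>" L] by (auto intro: order_trans)
      also have "emeasure (interval_measure \<Phi>) U = (\<integral>\<^sup>+i. emeasure (interval_measure \<Phi>) (case i of (c, d) \<Rightarrow> {c<..d}) \<partial>count_space I)"
        unfolding U_def by (rule emeasure_UN_countable) (use cI disj mP in auto)
      also have "\<dots> = (\<integral>\<^sup>+ (c, d). ennreal (\<Phi> d - \<Phi> c) \<partial>count_space I)"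
        using Icd by (intro nn_integral_cong) (auto split: prod.splits simp: Ioc less_imp_le)
      finally show ?thesis using le by simp
    qed
    have "emeasure (interval_measure \<Phi>) N' \<le> 0" by (rule ennreal_le_epsilon) (rule small)
    then show ?thesis by (simp add: N'_def)
  qed
  show ?thesis
    unfolding absolutely_continuous_def
  proof
    fix N assume N: "N \<in> null_sets (lborel :: real measure)"
    then have [measurable]: "N \<in> sets borel" by auto
    have "N = (\<Union>j. N \<inter> {- real (Suc j)..real (Suc j)})"
    proof -
      have "\<exists>j. x \<in> {- real (Suc j)..real (Suc j)}" for x
      proof -
        obtain j :: nat where "\<bar>x\<bar> < real j" using reals_Archimedean2 by blast
        then show ?thesis by (intro exI[of _ j]) auto
      qed
      then show ?thesis by blast
    qed
    moreover have "(\<Union>j. N \<inter> {- real (Suc j)..real (Suc j)}) \<in> null_sets (interval_measure \<Phi>)"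
    proof (rule null_sets_UN)
      fix j :: nat
      show "N \<inter> {- real (Suc j)..real (Suc j)} \<in> null_sets (interval_measure \<Phi>)"
        using zero[OF N, of "real (Suc j)"] by (simp add: null_sets_def del: of_nat_Suc)
    qed
    ultimately show "N \<in> null_sets (interval_measure \<Phi>)" by simp
  qed
qed

text \<open>The Radon-Nikodym density serves as the derivative of \<Phi>, so that no pointwise
  differentiation occurs. It is finite almost everywhere since the increments of \<Phi> are
  finite.\<close>

theorem Phi_density:
  obtains \<kappa> :: "real \<Rightarrow> real" where "\<kappa> \<in> borel_measurable borel" "\<And>y. 0 \<le> \<kappa> y"
    "\<And>a b. a \<le> b \<Longrightarrow> ennreal (\<Phi> b - \<Phi> a) = (\<integral>\<^sup>+y. indicator {a..b} y * ennreal (\<kappa> y))"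
proof -
  have rc: "continuous (at_right a) \<Phi>" for a using isCont_Phi[of a] by (rule continuous_at_imp_continuous_at_within)
  have Ioc: "emeasure (interval_measure \<Phi>) {a<..b} = ennreal (\<Phi> b - \<Phi> a)" if "a \<le> b" for a b
    by (rule emeasure_interval_measure_Ioc[OF that Phi_mono rc])
  define k where "k = RN_deriv lborel (interval_measure \<Phi>)"
  have km[measurable]: "k \<in> borel_measurable borel" using borel_measurable_RN_deriv[of lborel] by (simp add: k_def)
  have dk: "density lborel k = interval_measure \<Phi>"
    unfolding k_def by (rule sigma_finite_measure.density_RN_deriv[OF sigma_finite_lborel Phi_measure_absolutely_continuous]) simp
  have kI: "ennreal (\<Phi> b - \<Phi> a) = (\<integral>\<^sup>+y. indicator {a..b} y * k y)" if "a \<le> b" for a b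
  proof -
    have "ennreal (\<Phi> b - \<Phi> a) = emeasure (density lborel k) {a<..b}" unfolding dk by (rule Ioc[OF that, symmetric])
    also have "\<dots> = (\<integral>\<^sup>+y. indicator {a..b} y * k y)"
      by (subst emeasure_density) (auto intro!: nn_integral_cong_AE eventually_mono[OF AE_lborel_singleton[of a]] simp: indicator_def)
    finally show ?thesis .
  qed
  have "AE y in lborel. k y \<noteq> \<infinity>"
  proof -
    have "AE y in lborel. indicator {- real j..real j} y * k y \<noteq> \<infinity>" for j :: nat
      using kI[of "- real j" "real j"] by (intro nn_integral_PInf_AE) (auto simp: )
    then have "AE y in lborel. \<forall>j::nat. indicator {- real j..real j} y * k y \<noteq> \<infinity>" unfolding AE_all_countable ..
    then show ?thesis
    proof eventually_elim
      case (elim y)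
      obtain j :: nat where "\<bar>y\<bar> < real j" using reals_Archimedean2 by blast
      then have "y \<in> {- real j..real j}" by auto
      then show ?case using elim[rule_format, of j] by simp
    qed
  qed
  then have ae: "AE y in lborel. ennreal (enn2real (k y)) = k y" by eventually_elim (simp add: less_top)
  show ?thesis
  proof (rule that[of "\<lambda>y. enn2real (k y)"])
    fix a b :: real assume "a \<le> b"
    show "ennreal (\<Phi> b - \<Phi> a) = (\<integral>\<^sup>+y. indicator {a..b} y * ennreal (enn2real (k y)))"
      unfolding kI[OF \<open>a \<le> b\<close>] by (rule nn_integral_cong_AE) (use ae in \<open>auto elim: eventually_mono\<close>)
  qed auto
qed

end

section \<open>Radial integration in the logarithm of the radius\<close>

lemma emeasure_log_shell:
  assumes "a \<le> b"
  shows "vol {x::'a::euclidean_space. x \<noteq> 0 \<and> a < ln (norm x) \<and> ln (norm x) \<le> b}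
    = ennreal (unit_ball_vol (real DIM('a)) * (exp b ^ DIM('a) - exp a ^ DIM('a)))"
proof -
  have "{x::'a. x \<noteq> 0 \<and> a < ln (norm x) \<and> ln (norm x) \<le> b} = cball 0 (exp b) - cball 0 (exp a)"
  proof -
    have "x \<noteq> 0 \<and> a < ln (norm x) \<and> ln (norm x) \<le> b \<longleftrightarrow> norm x \<le> exp b \<and> \<not> norm x \<le> exp a" for x :: 'a
    proof (cases "x = 0")
      case False
      define y where "y = ln (norm x)"
      have "norm x = exp y" using False by (simp add: y_def)
      then show ?thesis using False by (auto simp: not_le)
    qed simp
    then show ?thesis by (intro set_eqI) (simp only: mem_Collect_eq Diff_iff mem_cball_0)
  qed
  then have "vol {x::'a. x \<noteq> 0 \<and> a < ln (norm x) \<and> ln (norm x) \<le> b} = vol (cball 0 (exp b) - cball 0 (exp a) :: 'a set)"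
    by (simp only:)
  also have "\<dots> = vol (cball 0 (exp b) :: 'a set) - vol (cball 0 (exp a) :: 'a set)"
    using assms emeasure_lborel_cball_finite[of "0::'a" "exp a"] by (intro emeasure_Diff) (auto intro: order_trans)
  finally have "vol {x::'a. x \<noteq> 0 \<and> a < ln (norm x) \<and> ln (norm x) \<le> b} = vol (cball 0 (exp b) :: 'a set) - vol (cball 0 (exp a) :: 'a set)" .
  then show ?thesis
    using assms power_mono[of "exp a" "exp b" "DIM('a)"]
    by (simp add: emeasure_cball ennreal_minus right_diff_distrib mult_left_mono)
qed

text \<open>Both measures give \<open>{a<..b}\<close> the volume of the shell between the radii
  \<open>exp a\<close> and \<open>exp b\<close>, and such intervals generate the Borel sets.\<close>

lemma distr_ln_norm:
  "distr (lborel :: 'a::euclidean_space measure) borel (\<lambda>x. ln (norm x))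
    = density lborel (\<lambda>y. ennreal (real DIM('a) * unit_ball_vol (real DIM('a)) * exp y ^ DIM('a)))"
proof (rule measure_eqI_generator_eq)
  let ?E = "range (\<lambda>(a, b). {a<..b::real})"
  let ?D = "density lborel (\<lambda>y. ennreal (real DIM('a) * unit_ball_vol (real DIM('a)) * exp y ^ DIM('a)))"
  have D: "emeasure (distr (lborel :: 'a measure) borel (\<lambda>x. ln (norm x))) {a<..b} = ennreal (unit_ball_vol (real DIM('a)) * (exp b ^ DIM('a) - exp a ^ DIM('a)))"
    if "a \<le> b" for a b
  proof -
    have [measurable]: "{x::'a. x \<noteq> 0 \<and> a < ln (norm x) \<and> ln (norm x) \<le> b} \<in> sets borel" by measurable
    have "emeasure (distr (lborel :: 'a measure) borel (\<lambda>x. ln (norm x))) {a<..b} = vol ((\<lambda>x::'a. ln (norm x)) -` {a<..b})"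
      by (subst emeasure_distr) auto
    \<comment> \<open>At the origin \<open>ln (norm x)\<close> is a default value, which may fall
      into the interval; excluding this one point does not change the volume.\<close>
    also have "\<dots> = vol {x::'a. x \<noteq> 0 \<and> a < ln (norm x) \<and> ln (norm x) \<le> b}"
    proof (rule emeasure_eq_AE)
      show "AE x in lborel. (x \<in> (\<lambda>x::'a. ln (norm x)) -` {a<..b}) = (x \<in> {x. x \<noteq> 0 \<and> a < ln (norm x) \<and> ln (norm x) \<le> b})"
        using AE_lborel_singleton[of "0::'a"] by eventually_elim auto
      have "(\<lambda>x::'a. ln (norm x)) -` {a<..b} \<inter> space borel \<in> sets borel" by measurable
      then show "(\<lambda>x::'a. ln (norm x)) -` {a<..b} \<in> sets lborel" by simp
    qed simp
    finally show ?thesis using emeasure_log_shell[OF that] by simp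
  qed
  show "Int_stable ?E"
    unfolding Int_stable_def
  proof safe
    fix a b c d :: real
    have "{a<..b} \<inter> {c<..d} = {max a c<..min b d}" by auto
    then show "{a<..b} \<inter> {c<..d} \<in> ?E" by auto
  qed
  show "?E \<subseteq> Pow UNIV" by auto
  show "sets (distr (lborel :: 'a measure) borel (\<lambda>x. ln (norm x))) = sigma_sets UNIV ?E" "sets ?D = sigma_sets UNIV ?E"
    by (simp_all add: borel_sigma_sets_Ioc)
  let ?A = "\<lambda>n::nat. {- real n<..real n}"
  show "range ?A \<subseteq> ?E" by auto
  show "(\<Union>i. ?A i) = UNIV"
  proof -
    have "\<exists>i. x \<in> ?A i" for x
    proof -
      obtain j :: nat where "\<bar>x\<bar> < real j" using reals_Archimedean2 by blast
      then show ?thesis by (intro exI[of _ j]) auto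
    qed
    then show ?thesis by blast
  qed
  show "emeasure (distr (lborel :: 'a measure) borel (\<lambda>x. ln (norm x))) (?A i) \<noteq> \<infinity>" for i
    by (subst D) auto
  fix X assume XE: "X \<in> ?E"
  then obtain a b where X: "X = {a<..b}" by auto
  show "emeasure (distr (lborel :: 'a measure) borel (\<lambda>x. ln (norm x))) X = emeasure ?D X"
  proof (cases "a \<le> b")
    case True
    let ?n = "real DIM('a)"
    have "emeasure ?D {a<..b} = (\<integral>\<^sup>+y. ennreal (?n * unit_ball_vol ?n * exp y ^ DIM('a)) * indicator {a..b} y)"
      by (subst emeasure_density) (auto intro!: nn_integral_cong_AE eventually_mono[OF AE_lborel_singleton[of a]] simp: indicator_def)
    also have "\<dots> = ennreal (unit_ball_vol ?n * exp b ^ DIM('a) - unit_ball_vol ?n * exp a ^ DIM('a))"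
    proof (rule nn_integral_FTC_Icc[OF _ _ _ True])
      fix y :: real
      have "((\<lambda>y. unit_ball_vol ?n * exp (?n * y)) has_real_derivative ?n * unit_ball_vol ?n * exp (?n * y)) (at y)"
        by (auto intro!: derivative_eq_intros)
      then have "((\<lambda>y. unit_ball_vol ?n * exp y ^ DIM('a)) has_real_derivative ?n * unit_ball_vol ?n * exp y ^ DIM('a)) (at y)"
        by (simp add: exp_of_nat_mult)
      then show "((\<lambda>y. unit_ball_vol ?n * exp y ^ DIM('a)) has_real_derivative ?n * unit_ball_vol ?n * exp y ^ DIM('a)) (at y)" .
    qed auto
    finally show ?thesis using D[OF True] by (simp add: X right_diff_distrib)
  next
    case False
    then have "X = {}" by (simp add: X)
    then show ?thesis by simp
  qed
qed

lemma nn_integral_radial: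
  fixes k :: "real \<Rightarrow> ennreal"
  assumes [measurable]: "k \<in> borel_measurable borel"
  shows "(\<integral>\<^sup>+x. k (ln (norm (x::'a::euclidean_space))))
    = (\<integral>\<^sup>+y. ennreal (real DIM('a) * unit_ball_vol (real DIM('a)) * exp y ^ DIM('a)) * k y)"
proof -
  have "(\<integral>\<^sup>+x. k (ln (norm (x::'a)))) = (\<integral>\<^sup>+y. k y \<partial>distr (lborel :: 'a measure) borel (\<lambda>x. ln (norm x)))"
    by (subst nn_integral_distr) auto
  also have "\<dots> = (\<integral>\<^sup>+y. ennreal (real DIM('a) * unit_ball_vol (real DIM('a)) * exp y ^ DIM('a)) * k y)"
    unfolding distr_ln_norm by (subst nn_integral_density) auto
  finally show ?thesis .
qed

text \<open>Along a line at distance \<open>sqrt D > 0\<close> from the origin, \<open>ln (norm x)\<close> is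
  \<open>ln ((q + \<sigma>)\<^sup>2 + D) / 2\<close>, decreasing and then increasing.\<close>

lemma log_distance_substitution:
  fixes \<Phi> \<kappa> :: "real \<Rightarrow> real" and q D :: real
  assumes \<kappa>[measurable]: "\<kappa> \<in> borel_measurable borel" and nn: "\<And>y. 0 \<le> \<kappa> y" and mono: "\<And>a b. a \<le> b \<Longrightarrow> \<Phi> a \<le> \<Phi> b"
    and dens: "\<And>a b. a \<le> b \<Longrightarrow> ennreal (\<Phi> b - \<Phi> a) = (\<integral>\<^sup>+y. indicator {a..b} y * ennreal (\<kappa> y))"
    and D: "D > 0" and le: "\<alpha> \<le> \<beta>"
  defines "l \<equiv> \<lambda>\<sigma>. ln ((q + \<sigma>)\<^sup>2 + D) / 2"
  shows "has_bochner_integral lborel (\<lambda>\<sigma>. indicator {\<alpha>..\<beta>} \<sigma> * (\<kappa> (l \<sigma>) * ((q + \<sigma>) / ((q + \<sigma>)\<^sup>2 + D)))) (\<Phi> (l \<beta>) - \<Phi> (l \<alpha>))"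
proof -
  define l' where "l' \<sigma> = (q + \<sigma>) / ((q + \<sigma>)\<^sup>2 + D)" for \<sigma>
  have pos: "(q + \<sigma>)\<^sup>2 + D > 0" for \<sigma> using D by (simp add: add_nonneg_pos)
  have der: "(l has_real_derivative l' \<sigma>) (at \<sigma>)" for \<sigma>
    unfolding l_def l'_def using pos[of \<sigma>] by (auto intro!: derivative_eq_intros simp: field_simps power2_eq_square)
  have cont: "continuous_on UNIV l'" unfolding l'_def using pos by (intro continuous_intros) (auto simp: less_imp_neq[THEN not_sym])
  have [measurable]: "l \<in> borel_measurable borel" "l' \<in> borel_measurable borel"
    unfolding l_def l'_def by measurable
  have l'0: "0 \<le> l' \<sigma> \<longleftrightarrow> 0 \<le> q + \<sigma>" for \<sigma> using pos[of \<sigma>] by (simp add: l'_def zero_le_divide_iff)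
  have lmono: "l a \<le> l b" if "0 \<le> q + a" "a \<le> b" for a b
  proof -
    have "(q + a)\<^sup>2 \<le> (q + b)\<^sup>2" using that by (intro power_mono) auto
    then show ?thesis unfolding l_def using pos[of a] by simp
  qed
  have lanti: "l b \<le> l a" if "q + b \<le> 0" "a \<le> b" for a b
  proof -
    have "(- (q + b))\<^sup>2 \<le> (- (q + a))\<^sup>2" using that by (intro power_mono) auto
    then have "(q + b)\<^sup>2 \<le> (q + a)\<^sup>2" by (simp only: power2_minus)
    then show ?thesis unfolding l_def using pos[of b] by simp
  qed
  have up: "has_bochner_integral lborel (\<lambda>\<sigma>. indicator {a..b} \<sigma> * (\<kappa> (l \<sigma>) * l' \<sigma>)) (\<Phi> (l b) - \<Phi> (l a))"
    if ab: "0 \<le> q + a" "a \<le> b" for a b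
  proof (rule has_bochner_integral_nn_integral)
    have "(\<integral>\<^sup>+x. \<kappa> x * indicator {l a..l b} x) = (\<integral>\<^sup>+x. \<kappa> (l x) * l' x * indicator {a..b} x)"
      by (rule nn_integral_substitution) (use ab l'0 der cont in \<open>auto simp: set_borel_measurable_def intro: continuous_on_subset\<close>)
    moreover have "(\<integral>\<^sup>+x. \<kappa> x * indicator {l a..l b} x) = ennreal (\<Phi> (l b) - \<Phi> (l a))"
      unfolding dens[OF lmono[OF ab]] by (intro nn_integral_cong) (auto simp: indicator_def)
    moreover have "(\<integral>\<^sup>+x. \<kappa> (l x) * l' x * indicator {a..b} x) = (\<integral>\<^sup>+\<sigma>. ennreal (indicator {a..b} \<sigma> * (\<kappa> (l \<sigma>) * l' \<sigma>)))"
      by (intro nn_integral_cong) (auto simp: indicator_def)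
    ultimately show "(\<integral>\<^sup>+\<sigma>. ennreal (indicator {a..b} \<sigma> * (\<kappa> (l \<sigma>) * l' \<sigma>))) = ennreal (\<Phi> (l b) - \<Phi> (l a))" by simp
    show "AE \<sigma> in lborel. 0 \<le> indicator {a..b} \<sigma> * (\<kappa> (l \<sigma>) * l' \<sigma>)"
      using ab l'0 nn by (intro AE_I2) (auto simp: indicator_def)
    show "0 \<le> \<Phi> (l b) - \<Phi> (l a)" using mono[OF lmono[OF ab]] by simp
  qed simp
  \<comment> \<open>On the decreasing branch the variable is reflected, so that the substitution
    rule for increasing functions applies, and the sign of the derivative is absorbed into the
    integrand.\<close>
  have down: "has_bochner_integral lborel (\<lambda>\<sigma>. indicator {a..b} \<sigma> * (\<kappa> (l \<sigma>) * l' \<sigma>)) (\<Phi> (l b) - \<Phi> (l a))"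
    if ab: "q + b \<le> 0" "a \<le> b" for a b
  proof -
    have "has_bochner_integral lborel (\<lambda>\<sigma>. indicator {a..b} \<sigma> * (\<kappa> (l \<sigma>) * - l' \<sigma>)) (\<Phi> (l a) - \<Phi> (l b))"
    proof (rule has_bochner_integral_nn_integral)
      have l'm: "0 \<le> - l' \<sigma>" if "\<sigma> \<le> b" for \<sigma>
        using pos[of \<sigma>] that ab by (simp add: l'_def divide_nonpos_pos)
      have "((\<lambda>s. l (- s)) has_real_derivative - l' (- s)) (at s)" for s
      proof -
        have "((\<lambda>s. - s) has_real_derivative - 1) (at s)" by (auto intro!: derivative_eq_intros)
        from DERIV_chain2[OF der this] show ?thesis by simp
      qed
      moreover have "continuous_on {- b..- a} (\<lambda>s. - l' (- s))"
        by (intro continuous_intros continuous_on_compose2[OF cont]) auto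
      ultimately have "(\<integral>\<^sup>+x. \<kappa> x * indicator {l (- (- b))..l (- (- a))} x) = (\<integral>\<^sup>+x. \<kappa> (l (- x)) * - l' (- x) * indicator {- b..- a} x)"
        using ab l'm by (intro nn_integral_substitution) (auto simp: set_borel_measurable_def)
      moreover have "(\<integral>\<^sup>+x. \<kappa> x * indicator {l (- (- b))..l (- (- a))} x) = ennreal (\<Phi> (l a) - \<Phi> (l b))"
        unfolding dens[OF lanti[OF ab]] by (intro nn_integral_cong) (auto simp: indicator_def)
      moreover have "(\<integral>\<^sup>+x. \<kappa> (l (- x)) * - l' (- x) * indicator {- b..- a} x) = (\<integral>\<^sup>+\<sigma>. ennreal (indicator {a..b} (0 - \<sigma>) * (\<kappa> (l (0 - \<sigma>)) * - l' (0 - \<sigma>))))"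
        by (intro nn_integral_cong) (auto simp: indicator_def)
      moreover have "\<dots> = (\<integral>\<^sup>+\<sigma>. ennreal (indicator {a..b} \<sigma> * (\<kappa> (l \<sigma>) * - l' \<sigma>)))"
        by (rule nn_integral_lborel_reflect) measurable
      ultimately show "(\<integral>\<^sup>+\<sigma>. ennreal (indicator {a..b} \<sigma> * (\<kappa> (l \<sigma>) * - l' \<sigma>))) = ennreal (\<Phi> (l a) - \<Phi> (l b))" by simp
      show "AE \<sigma> in lborel. 0 \<le> indicator {a..b} \<sigma> * (\<kappa> (l \<sigma>) * - l' \<sigma>)"
      proof (rule AE_I2)
        fix \<sigma>
        show "0 \<le> indicator {a..b} \<sigma> * (\<kappa> (l \<sigma>) * - l' \<sigma>)"
        proof (cases "\<sigma> \<in> {a..b}")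
          case True
          then have "0 \<le> \<kappa> (l \<sigma>) * - l' \<sigma>" by (intro mult_nonneg_nonneg nn l'm) auto
          then show ?thesis using True by simp
        qed simp
      qed
      show "0 \<le> \<Phi> (l a) - \<Phi> (l b)" using mono[OF lanti[OF ab]] by simp
    qed simp
    from has_bochner_integral_minus[OF this] show ?thesis by simp
  qed
  \<comment> \<open>\<open>m\<close> is the turning point \<open>- q\<close> clipped to
    \<open>{\<alpha>..\<beta>}\<close>. If it is clipped, one of the two pieces is a single
    point.\<close>
  define m where "m = max \<alpha> (min \<beta> (- q))"
  have m: "\<alpha> \<le> m" "m \<le> \<beta>" using le by (auto simp: m_def)
  have "has_bochner_integral lborel (\<lambda>\<sigma>. indicator {\<alpha>..m} \<sigma> * (\<kappa> (l \<sigma>) * l' \<sigma>)) (\<Phi> (l m) - \<Phi> (l \<alpha>))"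
  proof (cases "m = \<alpha>")
    case True
    have "has_bochner_integral lborel (\<lambda>\<sigma>. indicator {\<alpha>..m} \<sigma> * (\<kappa> (l \<sigma>) * l' \<sigma>)) 0"
    proof (subst has_bochner_integral_cong_AE[where g = "\<lambda>_. 0"])
      show "AE \<sigma> in lborel. indicator {\<alpha>..m} \<sigma> * (\<kappa> (l \<sigma>) * l' \<sigma>) = 0"
        using AE_lborel_singleton[of \<alpha>] by eventually_elim (use True in \<open>auto simp: indicator_def\<close>)
    qed (simp_all add: has_bochner_integral_zero)
    then show ?thesis using True by simp
  next
    case False
    then have "q + m \<le> 0" by (auto simp: m_def max_def min_def split: if_splits)
    then show ?thesis using m by (intro down)
  qed
  moreover have "has_bochner_integral lborel (\<lambda>\<sigma>. indicator {m..\<beta>} \<sigma> * (\<kappa> (l \<sigma>) * l' \<sigma>)) (\<Phi> (l \<beta>) - \<Phi> (l m))"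
  proof (cases "m = \<beta>")
    case True
    have "has_bochner_integral lborel (\<lambda>\<sigma>. indicator {m..\<beta>} \<sigma> * (\<kappa> (l \<sigma>) * l' \<sigma>)) 0"
    proof (subst has_bochner_integral_cong_AE[where g = "\<lambda>_. 0"])
      show "AE \<sigma> in lborel. indicator {m..\<beta>} \<sigma> * (\<kappa> (l \<sigma>) * l' \<sigma>) = 0"
        using AE_lborel_singleton[of \<beta>] by eventually_elim (use True in \<open>auto simp: indicator_def\<close>)
    qed (simp_all add: has_bochner_integral_zero)
    then show ?thesis using True by simp
  next
    case False
    then have "0 \<le> q + m" using m by (auto simp: m_def max_def min_def split: if_splits)
    then show ?thesis using m by (intro up)
  qed
  ultimately have "has_bochner_integral lborel (\<lambda>\<sigma>. indicator {\<alpha>..m} \<sigma> * (\<kappa> (l \<sigma>) * l' \<sigma>) + indicator {m..\<beta>} \<sigma> * (\<kappa> (l \<sigma>) * l' \<sigma>)) ((\<Phi> (l m) - \<Phi> (l \<alpha>)) + (\<Phi> (l \<beta>) - \<Phi> (l m)))"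
    by (rule has_bochner_integral_add)
  then have "has_bochner_integral lborel (\<lambda>\<sigma>. indicator {\<alpha>..m} \<sigma> * (\<kappa> (l \<sigma>) * l' \<sigma>) + indicator {m..\<beta>} \<sigma> * (\<kappa> (l \<sigma>) * l' \<sigma>)) (\<Phi> (l \<beta>) - \<Phi> (l \<alpha>))" by simp
  then have "has_bochner_integral lborel (\<lambda>\<sigma>. indicator {\<alpha>..\<beta>} \<sigma> * (\<kappa> (l \<sigma>) * l' \<sigma>)) (\<Phi> (l \<beta>) - \<Phi> (l \<alpha>))"
    using m by (subst (asm) has_bochner_integral_cong_AE) (auto intro!: eventually_mono[OF AE_lborel_singleton[of m]] simp: indicator_def)
  then show ?thesis by (simp add: l'_def)
qed

section \<open>The radial weak gradient\<close>

context weakly_differentiable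
begin

definition \<kappa> :: "real \<Rightarrow> real" where
  "\<kappa> = (SOME k. k \<in> borel_measurable borel \<and> (\<forall>y. 0 \<le> k y) \<and>
     (\<forall>a b. a \<le> b \<longrightarrow> ennreal (\<Phi> b - \<Phi> a) = (\<integral>\<^sup>+y. indicator {a..b} y * ennreal (k y))))"

lemma kappa: "\<kappa> \<in> borel_measurable borel" "0 \<le> \<kappa> y"
  "a \<le> b \<Longrightarrow> ennreal (\<Phi> b - \<Phi> a) = (\<integral>\<^sup>+y. indicator {a..b} y * ennreal (\<kappa> y))"
proof -
  have "\<exists>k. k \<in> borel_measurable borel \<and> (\<forall>y. 0 \<le> k y) \<and>
     (\<forall>a b. a \<le> b \<longrightarrow> ennreal (\<Phi> b - \<Phi> a) = (\<integral>\<^sup>+y. indicator {a..b} y * ennreal (k y)))"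
    using Phi_density by metis
  from someI_ex[OF this, folded \<kappa>_def]
  show "\<kappa> \<in> borel_measurable borel" "0 \<le> \<kappa> y"
    "a \<le> b \<Longrightarrow> ennreal (\<Phi> b - \<Phi> a) = (\<integral>\<^sup>+y. indicator {a..b} y * ennreal (\<kappa> y))" by auto
qed

declare kappa(1)[measurable]

text \<open>The formal gradient of \<open>- \<Phi> (ln (norm x))\<close>, with the density \<kappa>
  in the role of the derivative of \<Phi>.\<close>

definition \<Gamma> :: "'a \<Rightarrow> 'a" where
  "\<Gamma> x = - (\<kappa> (ln (norm x)) / (norm x)\<^sup>2) *\<^sub>R x"

lemma Gamma_measurable[measurable]: "\<Gamma> \<in> borel_measurable borel"
  unfolding \<Gamma>_def by measurable

lemma norm_Gamma: "norm (\<Gamma> x) = \<kappa> (ln (norm x)) / norm x"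
  using kappa(2) by (simp add: \<Gamma>_def power2_eq_square)

lemma schwarz0_measurable[measurable]: "schwarz0 f \<in> borel_measurable borel"
  using rearrangement_of_schwarz0 by (simp add: rearrangement_of_def)

lemma schwarz0_eq_Phi: "x \<noteq> 0 \<Longrightarrow> schwarz0 f x = - \<Phi> (ln (norm x))"
  by (simp add: schwarz0_def \<Phi>_def)

lemma norm_line:
  fixes b :: 'a
  assumes b: "norm b = 1"
  shows "(norm (x + \<sigma> *\<^sub>R b))\<^sup>2 = (x \<bullet> b + \<sigma>)\<^sup>2 + ((norm x)\<^sup>2 - (x \<bullet> b)\<^sup>2)"
proof -
  have bb: "b \<bullet> b = 1" using b by (simp add: dot_square_norm)
  show ?thesis
    unfolding power2_norm_eq_inner
    by (simp add: inner_add_left inner_add_right bb inner_commute power2_eq_square algebra_simps)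
qed

text \<open>\<open>(norm x)\<^sup>2 - (x \<bullet> b)\<^sup>2\<close> is the squared distance of the
  line from the origin. Being positive, it keeps \<open>ln (norm x)\<close> smooth along the line,
  and the substitution in the logarithmic distance applies.\<close>

lemma schwarz0_line:
  fixes b x :: 'a
  assumes b: "norm b = 1" and D: "(norm x)\<^sup>2 - (x \<bullet> b)\<^sup>2 > 0" and t: "t \<ge> 0"
  shows "schwarz0 f (x + t *\<^sub>R b) - schwarz0 f x = sweep t b (\<lambda>x. \<Gamma> x \<bullet> b) x"
proof -
  define D q where "D = (norm x)\<^sup>2 - (x \<bullet> b)\<^sup>2" and "q = x \<bullet> b"
  have Dp: "D > 0" using D by (simp add: D_def)
  define l where "l \<sigma> = ln ((q + \<sigma>)\<^sup>2 + D) / 2" for \<sigma>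
  have nsq: "(norm (x + \<sigma> *\<^sub>R b))\<^sup>2 = (q + \<sigma>)\<^sup>2 + D" for \<sigma> using norm_line[OF b] by (simp add: D_def q_def)
  have ne: "x + \<sigma> *\<^sub>R b \<noteq> 0" for \<sigma>
  proof
    assume "x + \<sigma> *\<^sub>R b = 0"
    then have "(q + \<sigma>)\<^sup>2 + D = 0" using nsq[of \<sigma>] by simp
    then show False using Dp zero_le_power2[of "q + \<sigma>"] by linarith
  qed
  have lln: "ln (norm (x + \<sigma> *\<^sub>R b)) = l \<sigma>" for \<sigma>
    unfolding l_def nsq[symmetric] using ne[of \<sigma>] by (simp add: ln_realpow)
  have bb: "b \<bullet> b = 1" using b by (simp add: dot_square_norm)
  have Gb: "\<Gamma> (x + \<sigma> *\<^sub>R b) \<bullet> b = - (\<kappa> (l \<sigma>) * ((q + \<sigma>) / ((q + \<sigma>)\<^sup>2 + D)))" for \<sigma>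
    by (simp add: \<Gamma>_def lln nsq inner_add_left bb q_def)
  have hb: "has_bochner_integral lborel (\<lambda>\<sigma>. indicator {0..t} \<sigma> * (\<kappa> (l \<sigma>) * ((q + \<sigma>) / ((q + \<sigma>)\<^sup>2 + D)))) (\<Phi> (l t) - \<Phi> (l 0))"
    unfolding l_def by (rule log_distance_substitution) (use kappa Phi_mono Dp t in auto)
  have "sweep t b (\<lambda>x. \<Gamma> x \<bullet> b) x = - (\<Phi> (l t) - \<Phi> (l 0))"
    using has_bochner_integral_integral_eq[OF hb] by (simp add: sweep_def Gb)
  moreover have "schwarz0 f (x + t *\<^sub>R b) = - \<Phi> (l t)" using schwarz0_eq_Phi[OF ne] lln by simp
  moreover have "schwarz0 f x = - \<Phi> (l 0)" using schwarz0_eq_Phi[OF ne[of 0]] lln[of 0] by simp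
  ultimately show ?thesis by simp
qed

text \<open>The shells of logarithmic width 1 below \<open>exp J\<close> have disjoint slabs, all
  inside one superlevel set. This makes the contributions near the origin summable.\<close>

lemma integral_slabs_le:
  fixes J :: real
  shows "(\<Sum>i. \<integral>\<^sup>+x. indicator (slab (exp (J - real i - 1)) (exp (J - real i))) x * ennreal (norm (g x)) \<partial>lborel)
     \<le> (\<integral>\<^sup>+x. indicator {x. profile f (exp J) < \<bar>f x\<bar>} x * ennreal (norm (g x)))"
proof -
  let ?N = "density lborel (\<lambda>x. ennreal (norm (g x)))"
  define s where "s i = slab (exp (J - real i - 1)) (exp (J - real i))" for i
  have [measurable]: "s i \<in> sets borel" for i by (simp add: s_def)
  have em: "emeasure ?N S = (\<integral>\<^sup>+x. indicator S x * ennreal (norm (g x)))" if "S \<in> sets borel" for S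
    using that by (subst emeasure_density) (auto simp: mult.commute)
  have "disjoint_family s"
    unfolding disjoint_family_on_def
  proof (intro ballI impI)
    fix i j :: nat assume "i \<noteq> j"
    then have "real i + 1 \<le> real j \<or> real j + 1 \<le> real i" by linarith
    then have "{J - real i - 1<..J - real i} \<inter> {J - real j - 1<..J - real j} = {}" by auto
    then show "s i \<inter> s j = {}" unfolding s_def by (rule slab_disjoint) auto
  qed
  then have "(\<Sum>i. emeasure ?N (s i)) = emeasure ?N (\<Union>i. s i)"
    by (intro suminf_emeasure) auto
  also have "\<dots> \<le> emeasure ?N {x. profile f (exp J) < \<bar>f x\<bar>}"
  proof (rule emeasure_mono)
    show "(\<Union>i. s i) \<subseteq> {x. profile f (exp J) < \<bar>f x\<bar>}"
    proof (rule UN_least)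
      fix i :: nat
      have "profile f (exp J) \<le> profile f (exp (J - real i))" by (intro profile_antimono) auto
      then show "s i \<subseteq> {x. profile f (exp J) < \<bar>f x\<bar>}" by (auto simp: s_def slab_def)
    qed
  qed simp
  finally show ?thesis by (simp add: em s_def)
qed

text \<open>The ball is cut into shells of logarithmic width 1. In a shell at radius
  \<open>exp c\<close> the volume element contributes \<open>exp c ^ n\<close>, the factor
  \<open>1 / norm x\<close> contributes \<open>exp (- c)\<close>, and \<kappa> integrates to an
  increment of \<Phi>. Up to constants this is the combination that \<open>profile_diff_le\<close>
  bounds by the integral of \<open>norm (g x)\<close> over the slab, with a constant independent of
  the shell.\<close>

lemma LI_Gamma: "LI \<Gamma>"
  unfolding LI_iff
proof (intro conjI allI Gamma_measurable)
  fix R :: real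
  let ?n = "real DIM('a)"
  define w where "w = unit_ball_vol ?n"
  have w: "w > 0" using omega_pos by (simp add: w_def)
  obtain J' :: nat where J': "R < exp (real J')"
  proof -
    obtain N :: nat where "R < real N" using reals_Archimedean2 by blast
    also have "real N \<le> exp (real N)" using exp_ge_add_one_self[of "real N"] by linarith
    finally show ?thesis using that by blast
  qed
  define J where "J = real J'"
  have J: "R < exp J" using J' by (simp add: J_def)
  define \<gamma> where "\<gamma> i = (\<integral>\<^sup>+x. indicator (slab (exp (J - real i - 1)) (exp (J - real i))) x * ennreal (norm (g x)))" for i
  have fin: "(\<Sum>i. \<gamma> i) < \<infinity>"
  proof -
    have "vol {x. profile f (exp J) < \<bar>f x\<bar>} \<le> ennreal (w * exp J ^ DIM('a))"
      unfolding w_def by (rule superlevel_le) auto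
    then have "vol {x. profile f (exp J) < \<bar>f x\<bar>} < \<infinity>" by (rule le_less_trans) simp
    then have "(\<integral>\<^sup>+x. indicator {x. profile f (exp J) < \<bar>f x\<bar>} x * ennreal (norm (g x))) < \<infinity>"
      by (intro g_finite) measurable
    then show ?thesis using integral_slabs_le[of J] unfolding \<gamma>_def by (rule le_less_trans[rotated])
  qed
  define k where "k y = indicator {..J} y * ennreal (\<kappa> y * exp (- y))" for y
  have [measurable]: "k \<in> borel_measurable borel" unfolding k_def by measurable
  have "(\<integral>\<^sup>+x. ennreal (norm (indicator (cball 0 R) x *\<^sub>R \<Gamma> x))) \<le> (\<integral>\<^sup>+x. k (ln (norm (x::'a))))"
  proof (rule nn_integral_mono_AE)
    show "AE x in lborel. ennreal (norm (indicator (cball 0 R) x *\<^sub>R \<Gamma> x)) \<le> k (ln (norm (x::'a)))"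
      using AE_lborel_singleton[of 0]
    proof eventually_elim
      case (elim x)
      show ?case
      proof (cases "norm x \<le> R")
        case True
        have "ln (norm x) \<le> ln (exp J)" using True J elim by (subst ln_le_cancel_iff) auto
        then have "ln (norm x) \<le> J" by simp
        moreover have "exp (- ln (norm x)) = 1 / norm x" using elim by (simp add: exp_minus inverse_eq_divide)
        ultimately show ?thesis using True by (simp add: k_def norm_Gamma)
      qed simp
    qed
  qed
  also have "\<dots> = (\<integral>\<^sup>+y. ennreal (?n * w * exp y ^ DIM('a)) * k y)"
    unfolding w_def by (rule nn_integral_radial) simp
  also have "\<dots> \<le> (\<integral>\<^sup>+y. (\<Sum>i. ennreal (?n * w * exp (J - real i) ^ DIM('a) * exp (- (J - real i - 1))) * (indicator {J - real i - 1..J - real i} y * ennreal (\<kappa> y))))"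
  proof (rule nn_integral_mono)
    fix y
    show "ennreal (?n * w * exp y ^ DIM('a)) * k y \<le> (\<Sum>i. ennreal (?n * w * exp (J - real i) ^ DIM('a) * exp (- (J - real i - 1))) * (indicator {J - real i - 1..J - real i} y * ennreal (\<kappa> y)))"
    proof (cases "y \<le> J")
      case True
      define i where "i = nat \<lfloor>J - y\<rfloor>"
      have i: "real i \<le> J - y" "J - y < real i + 1" using True by (auto simp: i_def)
      have "exp y ^ DIM('a) * exp (- y) \<le> exp (J - real i) ^ DIM('a) * exp (- (J - real i - 1))"
        using i by (intro mult_mono power_mono) auto
      then have "(?n * w * \<kappa> y) * (exp y ^ DIM('a) * exp (- y)) \<le> (?n * w * \<kappa> y) * (exp (J - real i) ^ DIM('a) * exp (- (J - real i - 1)))"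
        using w kappa(2)[of y] by (intro mult_left_mono) auto
      then have "ennreal (?n * w * exp y ^ DIM('a)) * k y \<le> ennreal (?n * w * exp (J - real i) ^ DIM('a) * exp (- (J - real i - 1))) * (indicator {J - real i - 1..J - real i} y * ennreal (\<kappa> y))"
        using True i w kappa(2)[of y] by (simp add: k_def ennreal_mult[symmetric] mult_ac ennreal_leI)
      also have "\<dots> \<le> (\<Sum>i. ennreal (?n * w * exp (J - real i) ^ DIM('a) * exp (- (J - real i - 1))) * (indicator {J - real i - 1..J - real i} y * ennreal (\<kappa> y)))"
        using sum_le_suminf[of "\<lambda>i. ennreal (?n * w * exp (J - real i) ^ DIM('a) * exp (- (J - real i - 1))) * (indicator {J - real i - 1..J - real i} y * ennreal (\<kappa> y))" "{i}"] by simp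
      finally show ?thesis .
    qed (simp add: k_def)
  qed
  also have "\<dots> = (\<Sum>i. ennreal (?n * w * exp (J - real i) ^ DIM('a) * exp (- (J - real i - 1))) * ennreal (\<Phi> (J - real i) - \<Phi> (J - real i - 1)))"
    by (subst nn_integral_suminf) (auto simp: nn_integral_cmult kappa(3))
  also have "\<dots> \<le> (\<Sum>i. ennreal (?n * 2 ^ (DIM('a) + 1) * exp (?n + 1)) * \<gamma> i)"
  proof (rule suminf_le)
    fix i
    define c where "c = J - real i - 1"
    have cd: "J - real i = c + 1" by (simp add: c_def)
    have p: "0 \<le> \<Phi> (c + 1) - \<Phi> c" using Phi_mono[of c "c + 1"] by simp
    have F1: "ennreal ((\<Phi> (c + 1) - \<Phi> c) * (w * exp c ^ DIM('a))) \<le> ennreal (2 ^ (DIM('a) + 1) * exp (c + 1)) * \<gamma> i"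
      using profile_diff_le[of "exp c" "exp (c + 1)"] by (simp add: \<Phi>_def w_def \<gamma>_def cd c_def[symmetric])
    have e1: "exp (c + 1) ^ DIM('a) = exp c ^ DIM('a) * exp ?n"
      by (simp add: exp_of_nat_mult[symmetric] exp_add[symmetric] distrib_left)
    have "ennreal (?n * w * exp (c + 1) ^ DIM('a) * exp (- c)) * ennreal (\<Phi> (c + 1) - \<Phi> c)
      = ennreal (?n * exp ?n * exp (- c)) * ennreal ((\<Phi> (c + 1) - \<Phi> c) * (w * exp c ^ DIM('a)))"
      using w p by (simp add: ennreal_mult[symmetric] e1 mult_ac)
    also have "\<dots> \<le> ennreal (?n * exp ?n * exp (- c)) * (ennreal (2 ^ (DIM('a) + 1) * exp (c + 1)) * \<gamma> i)"
      using F1 by (rule mult_left_mono) simp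
    also have "\<dots> = ennreal (?n * 2 ^ (DIM('a) + 1) * exp (?n + 1)) * \<gamma> i"
    proof -
      have eq: "(?n * exp ?n * exp (- c)) * (2 ^ (DIM('a) + 1) * exp (c + 1)) = ?n * 2 ^ (DIM('a) + 1) * exp (?n + 1)"
        by (simp add: exp_add exp_minus field_simps)
      have "ennreal (?n * exp ?n * exp (- c)) * ennreal (2 ^ (DIM('a) + 1) * exp (c + 1)) = ennreal (?n * 2 ^ (DIM('a) + 1) * exp (?n + 1))"
        unfolding eq[symmetric] by (rule ennreal_mult[symmetric]) simp_all
      then show ?thesis by (simp only: mult.assoc[symmetric])
    qed
    finally show "ennreal (?n * w * exp (J - real i) ^ DIM('a) * exp (- (J - real i - 1))) * ennreal (\<Phi> (J - real i) - \<Phi> (J - real i - 1))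
       \<le> ennreal (?n * 2 ^ (DIM('a) + 1) * exp (?n + 1)) * \<gamma> i"
      unfolding cd by simp
  qed auto
  also have "\<dots> = ennreal (?n * 2 ^ (DIM('a) + 1) * exp (?n + 1)) * (\<Sum>i. \<gamma> i)" by simp
  also have "\<dots> < \<infinity>" using fin by (simp add: ennreal_mult_less_top)
  finally have "(\<integral>\<^sup>+x. ennreal (norm (indicator (cball 0 R) x *\<^sub>R \<Gamma> x))) < \<infinity>" .
  then show "integrable lborel (\<lambda>x. indicator (cball 0 R) x *\<^sub>R \<Gamma> x)"
    by (intro integrableI_bounded) auto
qed

text \<open>The parts of \<open>schwarz0 f\<close> and \<open>\<bar>f\<bar>\<close> above height 1
  have equal integrals by equimeasurability. For \<open>\<bar>f\<bar>\<close> that integral is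
  finite because \<open>{x. \<bar>f x\<bar> > 1}\<close> has finite volume; below height 1 a ball
  contributes at most its volume.\<close>

lemma LI_schwarz0: "LI (schwarz0 f)"
  unfolding LI_iff
proof (intro conjI allI schwarz0_measurable)
  fix R :: real
  have h0: "0 \<le> schwarz0 f x" for x using rearrangement_of_schwarz0 by (simp add: rearrangement_of_def)
  have layers: "(\<integral>\<^sup>+x. ennreal (u x - 1)) = (\<integral>\<^sup>+t. indicator {1..} t * vol {x. u x > t})"
    if [measurable]: "u \<in> borel_measurable borel" for u :: "'a \<Rightarrow> real"
  proof -
    have "(\<integral>\<^sup>+t. indicator {1..} t * indicator {0<..} (v - t)) = ennreal (v - 1)" for v :: real
    proof -
      have "(\<integral>\<^sup>+t. indicator {1..} t * indicator {0<..} (v - t)) = (\<integral>\<^sup>+t. indicator {1..<v} t)"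
        by (intro nn_integral_cong) (auto simp: indicator_def)
      then show ?thesis by (cases "1 \<le> v") (auto simp: ennreal_neg)
    qed
    then have "(\<integral>\<^sup>+x. ennreal (u x - 1)) = (\<integral>\<^sup>+x. \<integral>\<^sup>+t. indicator {1..} t * indicator {0<..} (u x - t))" by simp
    also have "\<dots> = (\<integral>\<^sup>+t. \<integral>\<^sup>+x. indicator {1..} t * indicator {0<..} (u x - t))"
      by (rule lborel_pair.Fubini') measurable
    also have "\<dots> = (\<integral>\<^sup>+t. indicator {1..} t * vol {x. u x > t})"
    proof (rule nn_integral_cong)
      fix t
      have "(\<integral>\<^sup>+x. indicator {0<..} (u x - t)) = (\<integral>\<^sup>+x. indicator {x. u x > t} x)"
        by (intro nn_integral_cong) (auto simp: indicator_def)
      then show "(\<integral>\<^sup>+x. indicator {1..} t * indicator {0<..} (u x - t)) = indicator {1..} t * vol {x. u x > t}"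
        by (simp add: nn_integral_cmult)
    qed
    finally show ?thesis .
  qed
  have eqm: "vol {x. schwarz0 f x > t} = vol {x. \<bar>f x\<bar> > t}" if t: "t > 0" for t
  proof -
    obtain \<rho> where \<rho>: "vol {x. \<bar>f x\<bar> > t} = vol (ball (0::'a) \<rho>)" "\<And>x. x \<noteq> 0 \<Longrightarrow> (schwarz0 f x > t \<longleftrightarrow> norm x < \<rho>)"
      using rearrangement_of_schwarz0 t by (auto simp: rearrangement_of_def)
    have "vol {x. schwarz0 f x > t} = vol (ball (0::'a) \<rho>)"
      by (rule emeasure_eq_AE) (use \<rho>(2) in \<open>auto intro!: eventually_mono[OF AE_lborel_singleton[of 0]]\<close>)
    then show ?thesis using \<rho>(1) by simp
  qed
  have "(\<integral>\<^sup>+x. ennreal (norm (indicator (cball 0 R) x *\<^sub>R schwarz0 f x))) \<le> (\<integral>\<^sup>+x. indicator (cball 0 R) x + ennreal (schwarz0 f x - 1))"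
  proof (rule nn_integral_mono)
    fix x
    have "ennreal (schwarz0 f x) \<le> 1 + ennreal (schwarz0 f x - 1)"
      using h0[of x] by (cases "schwarz0 f x \<le> 1") (auto simp: ennreal_neg ennreal_plus[symmetric] ennreal_1[symmetric] simp del: ennreal_plus ennreal_1)
    then show "ennreal (norm (indicator (cball 0 R) x *\<^sub>R schwarz0 f x)) \<le> indicator (cball 0 R) x + ennreal (schwarz0 f x - 1)"
      using h0[of x] by (auto simp: indicator_def)
  qed
  also have "\<dots> = vol (cball (0::'a) R) + (\<integral>\<^sup>+x. ennreal (\<bar>f x\<bar> - 1))"
    using eqm by (subst nn_integral_add) (auto simp: layers indicator_def intro!: nn_integral_cong)
  also have "(\<integral>\<^sup>+x. ennreal (\<bar>f x\<bar> - 1)) \<le> (\<integral>\<^sup>+x. indicator {x. \<bar>f x\<bar> > 1} x * ennreal \<bar>f x\<bar>)"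
    by (intro nn_integral_mono) (auto simp: indicator_def ennreal_neg intro!: ennreal_leI)
  finally have "(\<integral>\<^sup>+x. ennreal (norm (indicator (cball 0 R) x *\<^sub>R schwarz0 f x)))
     \<le> vol (cball (0::'a) R) + (\<integral>\<^sup>+x. indicator {x. \<bar>f x\<bar> > 1} x * ennreal \<bar>f x\<bar>)" by (simp add: add_left_mono)
  also have "\<dots> < \<infinity>" using f_finite[of "{x. \<bar>f x\<bar> > 1}"] fin[of 1] emeasure_lborel_cball_finite[of "0::'a" R] by simp
  finally show "integrable lborel (\<lambda>x. indicator (cball 0 R) x *\<^sub>R schwarz0 f x)"
    by (intro integrableI_bounded) auto
qed

theorem wgrad_schwarz0:
  assumes n: "DIM('a) \<ge> 2"
  shows "wgrad (schwarz0 f) \<Gamma>"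
proof (rule wgradI_difference[OF LI_schwarz0 LI_Gamma])
  fix b :: 'a and t :: real assume b: "b \<in> Basis" and t: "0 < t" "t \<le> 1"
  have nb: "norm b = 1" using b by simp
  have bb: "b \<bullet> b = 1" using b by simp
  \<comment> \<open>This is where the dimension enters: for \<open>n \<ge> 2\<close> the line
    through the origin in direction \<open>b\<close> is a null set, so almost every \<open>x\<close>
    lies on a line parallel to \<open>b\<close> that avoids the origin.\<close>
  have "negligible (span {b})"
  proof (rule negligible_lowdim)
    have "dim (span {b}) \<le> card {b}" unfolding dim_span by (rule dim_le_card') simp
    then show "dim (span {b}) < DIM('a)" using n by simp
  qed
  then have "span {b} \<in> null_sets lborel"
    by (simp add: negligible_iff_null_sets null_sets_completion_iff closed_subspace[THEN borel_closed])
  then have "AE x in lborel. x \<notin> span {b}" by (rule AE_not_in)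
  then show "AE x in lborel. schwarz0 f (x + t *\<^sub>R b) - schwarz0 f x = sweep t b (\<lambda>x. \<Gamma> x \<bullet> b) x"
  proof eventually_elim
    case (elim x)
    have "(norm (x - (x \<bullet> b) *\<^sub>R b))\<^sup>2 = (norm x)\<^sup>2 - (x \<bullet> b)\<^sup>2"
      using norm_line[OF nb, of x "- (x \<bullet> b)"] by simp
    moreover have "x - (x \<bullet> b) *\<^sub>R b \<noteq> 0"
    proof
      assume "x - (x \<bullet> b) *\<^sub>R b = 0"
      then have "x = (x \<bullet> b) *\<^sub>R b" by simp
      then have "x \<in> span {b}" by (metis span_base span_scale singletonI)
      then show False using elim by simp
    qed
    then have "0 < (norm (x - (x \<bullet> b) *\<^sub>R b))\<^sup>2" by simp
    ultimately show ?case using t by (intro schwarz0_line nb) auto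
  qed
qed

end

section \<open>Difference quotients\<close>

text \<open>For open \<open>U\<close> a point of \<open>U\<close> stays in \<open>U\<close> under
  small shifts, which controls one half of the symmetric difference by dominated convergence. The
  other half has the same volume, since a set and its translate do.\<close>

lemma integral_indicator_shift_tendsto:
  fixes U :: "'a::euclidean_space set" and y :: "nat \<Rightarrow> 'a"
  assumes U: "open U" "vol U < \<infinity>" and y: "y \<longlonglongrightarrow> 0"
  shows "(\<lambda>j. \<integral>x. \<bar>indicator U (x + y j) - indicator U x\<bar>) \<longlonglongrightarrow> (0::real)"
proof -
  have [measurable]: "U \<in> sets borel" using U by simp
  have iU: "integrable lborel (indicator U :: 'a \<Rightarrow> real)" using U by simp
  have "(\<lambda>j. \<integral>x. indicator U x * (1 - indicator U (x + y j))) \<longlonglongrightarrow> (\<integral>x. (0::real) \<partial>(lborel :: 'a measure))"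
  proof (rule integral_dominated_convergence[where w = "indicator U"])
    show "AE x in lborel. (\<lambda>j. indicator U x * (1 - indicator U (x + y j))) \<longlonglongrightarrow> (0::real)"
    proof (rule AE_I2)
      fix x
      show "(\<lambda>j. indicator U x * (1 - indicator U (x + y j))) \<longlonglongrightarrow> (0::real)"
      proof (cases "x \<in> U")
        case True
        have "(\<lambda>j. x + y j) \<longlonglongrightarrow> x + 0" by (intro tendsto_intros y)
        then have "\<forall>\<^sub>F j in sequentially. x + y j \<in> U" using topological_tendstoD[OF _ U(1)] True by fastforce
        then show ?thesis by (intro tendsto_eventually) (auto elim: eventually_mono simp: True)
      qed simp
    qed
    show "AE x in lborel. norm (indicator U x * (1 - indicator U (x + y j)) :: real) \<le> indicator U x" for j
      by (intro AE_I2) (auto simp: indicator_def)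
  qed (use iU in auto)
  then have lim: "(\<lambda>j. 2 * (\<integral>x. indicator U x * (1 - indicator U (x + y j)))) \<longlonglongrightarrow> 2 * (0::real)"
    by (intro tendsto_mult_left) simp
  have "(\<integral>x. \<bar>indicator U (x + y j) - indicator U x\<bar>) = 2 * (\<integral>x. indicator U x * (1 - indicator U (x + y j)) \<partial>lborel :: real)" for j
  proof -
    have iUy: "integrable lborel (\<lambda>x. indicator U (x + y j) :: real)" by (rule integrable_lborel_translate(1)[OF iU])
    have i2: "integrable lborel (\<lambda>x. indicator U x * (1 - indicator U (x + y j)) :: real)"
      by (rule Bochner_Integration.integrable_bound[OF iU]) (auto simp: indicator_def)
    have "(\<integral>x. \<bar>indicator U (x + y j) - indicator U x\<bar>) = (\<integral>x. (indicator U (x + y j) - indicator U x) + 2 * (indicator U x * (1 - indicator U (x + y j))) \<partial>lborel :: real)"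
      by (intro Bochner_Integration.integral_cong) (auto simp: indicator_def)
    also have "\<dots> = ((\<integral>x. indicator U (x + y j)) - (\<integral>x. indicator U x)) + 2 * (\<integral>x. indicator U x * (1 - indicator U (x + y j)))"
      using iU iUy i2 by simp
    also have "(\<integral>x. indicator U (x + y j)) = (\<integral>x. indicator U x \<partial>lborel :: real)"
      by (rule integrable_lborel_translate(2)) simp
    finally show ?thesis by simp
  qed
  then show ?thesis using lim by simp
qed

text \<open>Sets of finite measure are approximated from outside by open sets; sums and limits then
  follow by the triangle inequality, with translation invariance for the error terms.\<close>

theorem L1_translation_continuous:
  fixes v :: "'a::euclidean_space \<Rightarrow> 'b::euclidean_space"
  assumes "integrable lborel v" and y: "y \<longlonglongrightarrow> (0::'a)"
  shows "(\<lambda>j. \<integral>x. norm (v (x + y j) - v x)) \<longlonglongrightarrow> 0"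
  using assms(1)
proof (induction v rule: integrable_induct)
  case (base A c)
  have [measurable]: "A \<in> sets borel" using base by simp
  have iA: "integrable lborel (indicator A :: 'a \<Rightarrow> real)" using base by simp
  have "(\<lambda>j. \<integral>x. \<bar>indicator A (x + y j) - indicator A x\<bar>) \<longlonglongrightarrow> (0::real)"
  proof (rule LIMSEQ_I)
    fix e :: real assume e: "e > 0"
    obtain U where U: "open U" "A \<subseteq> U" "vol (U - A) < ennreal (e / 4)"
      using outer_regular_lborel[of A "e / 4"] e by auto
    have [measurable]: "U \<in> sets borel" using U by simp
    have fU: "vol U < \<infinity>"
    proof -
      have "vol U \<le> vol A + vol (U - A)"
        using U(2) emeasure_subadditive[of A lborel "U - A"] by (simp add: Un_absorb1 Un_Diff_cancel)
      moreover have "vol (U - A) < \<infinity>" by (rule less_trans[OF U(3)]) simp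
      ultimately show ?thesis using base(2) by (simp add: order_le_less_trans)
    qed
    have iU: "integrable lborel (indicator U :: 'a \<Rightarrow> real)" using fU by simp
    have iD: "integrable lborel (indicator (U - A) :: 'a \<Rightarrow> real)"
      by (rule Bochner_Integration.integrable_bound[OF iU]) (auto simp: indicator_def)
    have mD: "(\<integral>x. indicator (U - A) x) < e / 4"
    proof -
      have "vol (U - A) \<noteq> \<infinity>" using U(3) by auto
      then have "ennreal (measure lborel (U - A)) < ennreal (e / 4)" using U(3) emeasure_eq_ennreal_measure[of lborel "U - A"] by simp
      then have "measure lborel (U - A) < e / 4" by (simp add: ennreal_less_iff)
      then show ?thesis by simp
    qed
    obtain N where N: "\<And>j. j \<ge> N \<Longrightarrow> \<bar>\<integral>x. \<bar>indicator U (x + y j) - indicator U x\<bar> \<partial>lborel\<bar> < e / 2"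
      using LIMSEQ_D[OF integral_indicator_shift_tendsto[OF U(1) fU y], of "e / 2"] e by auto
    show "\<exists>N. \<forall>j\<ge>N. norm ((\<integral>x. \<bar>indicator A (x + y j) - indicator A x\<bar>) - (0::real)) < e"
    proof (intro exI[of _ N] allI impI)
      fix j assume j: "j \<ge> N"
      have sh: "integrable lborel (\<lambda>x. indicator S (x + y j) :: real)" if "integrable lborel (indicator S :: 'a \<Rightarrow> real)" for S
        by (rule integrable_lborel_translate(1)[OF that])
      have "(\<integral>x. \<bar>indicator A (x + y j) - indicator A x\<bar>)
        \<le> (\<integral>x. (indicator (U - A) (x + y j) + indicator (U - A) x) + \<bar>indicator U (x + y j) - indicator U x\<bar> \<partial>lborel :: real)"
      proof (rule integral_mono')
        show "integrable lborel (\<lambda>x. (indicator (U - A) (x + y j) + indicator (U - A) x) + \<bar>indicator U (x + y j) - indicator U x\<bar> :: real)"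
          using iU iD sh by (intro Bochner_Integration.integrable_add integrable_abs Bochner_Integration.integrable_diff)
      qed (use U(2) in \<open>auto simp: indicator_def\<close>)
      also have "\<dots> = ((\<integral>x. indicator (U - A) (x + y j)) + (\<integral>x. indicator (U - A) x)) + (\<integral>x. \<bar>indicator U (x + y j) - indicator U x\<bar>)"
        using iU iD sh by (subst Bochner_Integration.integral_add; (subst Bochner_Integration.integral_add)?; auto)
      also have "(\<integral>x. indicator (U - A) (x + y j)) = (\<integral>x. indicator (U - A) x \<partial>lborel :: real)"
        by (rule integrable_lborel_translate(2)) simp
      finally have "(\<integral>x. \<bar>indicator A (x + y j) - indicator A x\<bar>) < e" using mD N[OF j] by linarith
      moreover have "0 \<le> (\<integral>x. \<bar>indicator A (x + y j) - indicator A x\<bar> \<partial>lborel :: real)" by simp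
      ultimately show "norm ((\<integral>x. \<bar>indicator A (x + y j) - indicator A x\<bar>) - (0::real)) < e" by simp
    qed
  qed
  then have "(\<lambda>j. (\<integral>x. \<bar>indicator A (x + y j) - indicator A x\<bar>) * norm c) \<longlonglongrightarrow> 0 * norm c"
    by (rule tendsto_mult_right)
  then show ?case by (simp add: scaleR_left_diff_distrib[symmetric])
next
  case (add f g)
  have sh: "integrable lborel (\<lambda>x. u (x + y j) - u x)" if "integrable lborel u" for u :: "'a \<Rightarrow> 'b" and j
    by (intro Bochner_Integration.integrable_diff integrable_lborel_translate(1) that)
  have lim: "(\<lambda>j. (\<integral>x. norm (f (x + y j) - f x)) + (\<integral>x. norm (g (x + y j) - g x))) \<longlonglongrightarrow> 0 + 0"
    by (intro tendsto_add add)
  show ?case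
  proof (rule tendsto_sandwich[OF _ _ tendsto_const])
    show "(\<lambda>j. (\<integral>x. norm (f (x + y j) - f x)) + (\<integral>x. norm (g (x + y j) - g x))) \<longlonglongrightarrow> 0" using lim by simp
    show "\<forall>\<^sub>F j in sequentially. (\<integral>x. norm (f (x + y j) + g (x + y j) - (f x + g x)))
       \<le> (\<integral>x. norm (f (x + y j) - f x)) + (\<integral>x. norm (g (x + y j) - g x))"
    proof (rule always_eventually, rule allI)
      fix j
      have "(\<integral>x. norm (f (x + y j) + g (x + y j) - (f x + g x))) \<le> (\<integral>x. norm (f (x + y j) - f x) + norm (g (x + y j) - g x))"
      proof (rule integral_mono')
        show "integrable lborel (\<lambda>x. norm (f (x + y j) - f x) + norm (g (x + y j) - g x))"
          using sh[OF add(1)] sh[OF add(2)] by auto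
        show "norm (f (x + y j) + g (x + y j) - (f x + g x)) \<le> norm (f (x + y j) - f x) + norm (g (x + y j) - g x)" for x
          using norm_triangle_ineq[of "f (x + y j) - f x" "g (x + y j) - g x"] by (simp add: algebra_simps)
      qed auto
      also have "\<dots> = (\<integral>x. norm (f (x + y j) - f x)) + (\<integral>x. norm (g (x + y j) - g x))"
        using sh[OF add(1)] sh[OF add(2)] by (intro Bochner_Integration.integral_add) auto
      finally show "(\<integral>x. norm (f (x + y j) + g (x + y j) - (f x + g x)))
       \<le> (\<integral>x. norm (f (x + y j) - f x)) + (\<integral>x. norm (g (x + y j) - g x))" .
    qed
    show "\<forall>\<^sub>F j in sequentially. 0 \<le> (\<integral>x. norm (f (x + y j) + g (x + y j) - (f x + g x)))" by simp
  qed
next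
  case (lim f s)
  have ms: "s i \<in> borel_measurable borel" for i using borel_measurable_integrable[OF lim.hyps(1)] by simp
  have mf: "f \<in> borel_measurable borel" using borel_measurable_integrable[OF lim.hyps(4)] by simp
  have "(\<lambda>i. \<integral>x. norm (f x - s i x)) \<longlonglongrightarrow> (\<integral>x. (0::real) \<partial>(lborel :: 'a measure))"
  proof (rule integral_dominated_convergence[where w = "\<lambda>x. 3 * norm (f x)"])
    show "AE x in lborel. (\<lambda>i. norm (f x - s i x)) \<longlonglongrightarrow> 0"
    proof (rule AE_I2)
      fix x
      have "(\<lambda>i. norm (f x - s i x)) \<longlonglongrightarrow> norm (f x - f x)" using lim.hyps(2)[of x] by (intro tendsto_intros) auto
      then show "(\<lambda>i. norm (f x - s i x)) \<longlonglongrightarrow> 0" by simp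
    qed
    show "AE x in lborel. norm (norm (f x - s i x)) \<le> 3 * norm (f x)" for i
    proof (rule AE_I2)
      fix x
      have "norm (f x - s i x) \<le> norm (f x) + norm (s i x)" by (rule norm_triangle_ineq4)
      then show "norm (norm (f x - s i x)) \<le> 3 * norm (f x)" using lim.hyps(3)[of x i] by simp
    qed
  qed (use ms mf lim.hyps(4) in auto)
  then have conv: "(\<lambda>i. \<integral>x. norm (f x - s i x)) \<longlonglongrightarrow> 0" by simp
  show ?case
  proof (rule LIMSEQ_I)
    fix e :: real assume e: "e > 0"
    obtain i where i: "\<bar>\<integral>x. norm (f x - s i x) \<partial>lborel\<bar> < e / 4"
      using LIMSEQ_D[OF conv, of "e / 4"] e by auto
    obtain N where N: "\<And>j. j \<ge> N \<Longrightarrow> \<bar>\<integral>x. norm (s i (x + y j) - s i x) \<partial>lborel\<bar> < e / 2"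
      using LIMSEQ_D[OF lim.IH[of i], of "e / 2"] e by auto
    show "\<exists>N. \<forall>j\<ge>N. norm ((\<integral>x. norm (f (x + y j) - f x)) - 0) < e"
    proof (intro exI[of _ N] allI impI)
      fix j assume j: "j \<ge> N"
      have d: "integrable lborel (\<lambda>x. norm (f x - s i x))" using lim.hyps(1)[of i] lim.hyps(4) by auto
      have d': "integrable lborel (\<lambda>x. norm (f (x + y j) - s i (x + y j)))"
        using integrable_lborel_translate(1)[OF d, of "y j"] by simp
      have ds: "integrable lborel (\<lambda>x. norm (s i (x + y j) - s i x))"
        by (intro Bochner_Integration.integrable_norm Bochner_Integration.integrable_diff integrable_lborel_translate(1) lim.hyps(1))
      have "(\<integral>x. norm (f (x + y j) - f x))
        \<le> (\<integral>x. (norm (f (x + y j) - s i (x + y j)) + norm (f x - s i x)) + norm (s i (x + y j) - s i x))"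
      proof (rule integral_mono')
        show "integrable lborel (\<lambda>x. (norm (f (x + y j) - s i (x + y j)) + norm (f x - s i x)) + norm (s i (x + y j) - s i x))"
          using d d' ds by auto
        fix x
        have "f (x + y j) - f x = (f (x + y j) - s i (x + y j)) + (s i x - f x) + (s i (x + y j) - s i x)" by simp
        also have "norm \<dots> \<le> norm (f (x + y j) - s i (x + y j)) + norm (s i x - f x) + norm (s i (x + y j) - s i x)"
          by (intro order_trans[OF norm_triangle_ineq] add_right_mono norm_triangle_ineq)
        finally show "norm (f (x + y j) - f x) \<le> (norm (f (x + y j) - s i (x + y j)) + norm (f x - s i x)) + norm (s i (x + y j) - s i x)"
          by (simp add: norm_minus_commute)
      qed auto
      also have "\<dots> = (\<integral>x. norm (f (x + y j) - s i (x + y j))) + (\<integral>x. norm (f x - s i x)) + (\<integral>x. norm (s i (x + y j) - s i x))"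
        using d d' ds by (subst Bochner_Integration.integral_add; (subst Bochner_Integration.integral_add)?; auto)
      also have "(\<integral>x. norm (f (x + y j) - s i (x + y j))) = (\<integral>x. norm (f x - s i x))"
        using integrable_lborel_translate(2)[of "\<lambda>x. norm (f x - s i x)" "y j"] mf ms by simp
      finally have "(\<integral>x. norm (f (x + y j) - f x)) < e" using i N[OF j] by linarith
      moreover have "0 \<le> (\<integral>x. norm (f (x + y j) - f x))" by simp
      ultimately show "norm ((\<integral>x. norm (f (x + y j) - f x)) - 0) < e" by simp
    qed
  qed
qed

text \<open>The error is the average over \<sigma> in \<open>{0..t}\<close> of
  \<open>(G (x + \<sigma> *\<^sub>R z) - G x) \<bullet> z\<close>, so continuity of translations
  bounds it uniformly for small \<open>t\<close>.\<close>

lemma difference_quotient_L1: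
  fixes h :: "'a::euclidean_space \<Rightarrow> real"
  assumes w: "wgrad h G" and \<delta>: "\<delta> > 0"
  shows "\<exists>\<eta>>0. \<forall>t. 0 < t \<and> t < \<eta> \<longrightarrow>
    (\<integral>\<^sup>+x. indicator (cball 0 R) x * ennreal \<bar>(h (x + t *\<^sub>R z) - h x) / t - G x \<bullet> z\<bar>) \<le> ennreal \<delta>"
proof -
  note LI = wgrad_LI[OF w]
  have [measurable]: "h \<in> borel_measurable borel" "G \<in> borel_measurable borel" using w by (auto simp: wgrad_def)
  \<comment> \<open>For \<open>x\<close> in \<open>cball 0 R\<close> and \<open>t \<le> 1\<close>
    the segments stay in the larger ball, where \<open>v\<close> equals \<open>G\<close>; unlike
    \<open>G\<close>, the cut-off field is integrable over the whole space. The bound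
    \<open>\<delta> / (1 + norm z)\<close> chosen below absorbs the factor \<open>norm z\<close> and
    allows \<open>z = 0\<close>.\<close>
  define v where "v x = indicator (cball 0 (R + norm z)) x *\<^sub>R G x" for x
  have v: "integrable lborel v" unfolding v_def by (rule LI_integrable[OF LI(2)])
  have [measurable]: "v \<in> borel_measurable borel" unfolding v_def by measurable
  define W where "W y = (\<integral>x. norm (v (x + y) - v x))" for y
  have "isCont W 0"
    unfolding continuous_at_sequentially o_def
  proof (intro allI impI)
    fix y :: "nat \<Rightarrow> 'a" assume "y \<longlonglongrightarrow> 0"
    then show "(\<lambda>j. W (y j)) \<longlonglongrightarrow> W 0" using L1_translation_continuous[OF v] by (simp add: W_def)
  qed
  moreover have d: "0 < \<delta> / (1 + norm z)" using \<delta> by (simp add: add_pos_nonneg)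
  ultimately obtain e where e: "e > 0" "\<And>y. norm y < e \<Longrightarrow> W y < \<delta> / (1 + norm z)"
    unfolding continuous_at_eps_delta by (force simp: W_def dist_norm)
  have Wn: "(\<integral>\<^sup>+x. ennreal (norm (v (x + y) - v x))) \<le> ennreal (\<delta> / (1 + norm z))" if "norm y < e" for y
  proof -
    have "integrable lborel (\<lambda>x. v (x + y) - v x)" by (intro Bochner_Integration.integrable_diff integrable_lborel_translate(1) v)
    then have "(\<integral>\<^sup>+x. ennreal (norm (v (x + y) - v x))) = ennreal (W y)"
      unfolding W_def by (intro nn_integral_eq_integral) auto
    then show ?thesis using e(2)[OF that] by (simp add: ennreal_leI less_imp_le)
  qed
  show ?thesis
  proof (intro exI[of _ "min 1 (e / (1 + norm z))"] conjI allI impI)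
    show "0 < min 1 (e / (1 + norm z))" using e by (simp add: add_pos_nonneg)
    fix t assume t: "0 < t \<and> t < min 1 (e / (1 + norm z))"
    then have t0: "0 \<le> t" by simp
    have te: "norm (\<sigma> *\<^sub>R z) < e" "norm (\<sigma> *\<^sub>R z) \<le> norm z" if "\<sigma> \<in> {0..t}" for \<sigma>
    proof -
      have "\<sigma> * norm z \<le> t * norm z" using that by (auto intro!: mult_right_mono)
      moreover have "\<sigma> * norm z \<le> 1 * norm z" using that t by (intro mult_right_mono) auto
      moreover have "t * (1 + norm z) < e" using t by (auto simp: pos_less_divide_eq add_pos_nonneg)
      ultimately show "norm (\<sigma> *\<^sub>R z) < e" "norm (\<sigma> *\<^sub>R z) \<le> norm z" using that t by (auto simp: algebra_simps)
    qed
    have "AE x in lborel. indicator (cball 0 R) x * ennreal \<bar>(h (x + t *\<^sub>R z) - h x) / t - G x \<bullet> z\<bar>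
       \<le> (\<integral>\<^sup>+\<sigma>. ennreal (indicator {0..t} \<sigma> * (norm (v (x + \<sigma> *\<^sub>R z) - v x) * norm z / t)))"
      using wgrad_difference[OF w t0, of z] AE_integrable_sweep[OF LI_inner[OF LI(2), of z] t0, of z]
    proof (eventually_elim, goal_cases)
      case (1 x)
      show ?case
      proof (cases "x \<in> cball 0 R")
        case True
        have ic: "integrable lborel (\<lambda>\<sigma>. indicator {0..t} \<sigma> * (G x \<bullet> z) :: real)" using t0 by (intro integrable_mult_left impI integrable_real_indicator) auto
        have "(h (x + t *\<^sub>R z) - h x) / t - G x \<bullet> z
          = ((\<integral>\<sigma>. indicator {0..t} \<sigma> * (G (x + \<sigma> *\<^sub>R z) \<bullet> z)) - (\<integral>\<sigma>. indicator {0..t} \<sigma> * (G x \<bullet> z))) / t"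
          using 1(1) t by (simp add: sweep_def field_simps)
        also have "\<dots> = (\<integral>\<sigma>. (indicator {0..t} \<sigma> * (G (x + \<sigma> *\<^sub>R z) \<bullet> z) - indicator {0..t} \<sigma> * (G x \<bullet> z)) / t)"
          by (simp only: Bochner_Integration.integral_diff[OF 1(2) ic] Bochner_Integration.integral_divide_zero)
        also have "\<dots> = (\<integral>\<sigma>. indicator {0..t} \<sigma> * (((G (x + \<sigma> *\<^sub>R z) - G x) \<bullet> z) / t))"
          by (simp add: right_diff_distrib inner_diff_left)
        finally have eq: "\<bar>(h (x + t *\<^sub>R z) - h x) / t - G x \<bullet> z\<bar> = norm (\<integral>\<sigma>. indicator {0..t} \<sigma> * (((G (x + \<sigma> *\<^sub>R z) - G x) \<bullet> z) / t))" by simp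
        have "ennreal \<bar>(h (x + t *\<^sub>R z) - h x) / t - G x \<bullet> z\<bar> \<le> (\<integral>\<^sup>+\<sigma>. ennreal (norm (indicator {0..t} \<sigma> * (((G (x + \<sigma> *\<^sub>R z) - G x) \<bullet> z) / t))))"
          unfolding eq
        proof (rule integral_norm_bound_ennreal)
          have "integrable lborel (\<lambda>\<sigma>. (indicator {0..t} \<sigma> * (G (x + \<sigma> *\<^sub>R z) \<bullet> z) - indicator {0..t} \<sigma> * (G x \<bullet> z)) / t)"
            by (intro Bochner_Integration.integrable_divide_zero Bochner_Integration.integrable_diff 1(2) ic)
          then show "integrable lborel (\<lambda>\<sigma>. indicator {0..t} \<sigma> * (((G (x + \<sigma> *\<^sub>R z) - G x) \<bullet> z) / t))"
            by (simp add: right_diff_distrib inner_diff_left)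
        qed
        also have "\<dots> \<le> (\<integral>\<^sup>+\<sigma>. ennreal (indicator {0..t} \<sigma> * (norm (v (x + \<sigma> *\<^sub>R z) - v x) * norm z / t)))"
        proof (rule nn_integral_mono)
          fix \<sigma> :: real
          show "ennreal (norm (indicator {0..t} \<sigma> * (((G (x + \<sigma> *\<^sub>R z) - G x) \<bullet> z) / t))) \<le> ennreal (indicator {0..t} \<sigma> * (norm (v (x + \<sigma> *\<^sub>R z) - v x) * norm z / t))"
          proof (cases "\<sigma> \<in> {0..t}")
            case \<sigma>: True
            have "x + \<sigma> *\<^sub>R z \<in> cball 0 (R + norm z)" using True te(2)[OF \<sigma>] norm_triangle_ineq[of x "\<sigma> *\<^sub>R z"] by auto
            moreover have "x \<in> cball 0 (R + norm z)" using True norm_ge_zero[of z] unfolding mem_cball_0 by linarith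
            ultimately have "G (x + \<sigma> *\<^sub>R z) - G x = v (x + \<sigma> *\<^sub>R z) - v x" by (simp add: v_def)
            then show ?thesis using \<sigma> t Cauchy_Schwarz_ineq2[of "v (x + \<sigma> *\<^sub>R z) - v x" z]
              by (auto intro!: ennreal_leI divide_right_mono simp: abs_divide)
          qed simp
        qed
        finally show ?thesis using True by simp
      qed simp
    qed
    then have "(\<integral>\<^sup>+x. indicator (cball 0 R) x * ennreal \<bar>(h (x + t *\<^sub>R z) - h x) / t - G x \<bullet> z\<bar>)
      \<le> (\<integral>\<^sup>+x. \<integral>\<^sup>+\<sigma>. ennreal (indicator {0..t} \<sigma> * (norm (v (x + \<sigma> *\<^sub>R z) - v x) * norm z / t)))"
      by (rule nn_integral_mono_AE)
    also have "\<dots> = (\<integral>\<^sup>+\<sigma>. \<integral>\<^sup>+x. ennreal (indicator {0..t} \<sigma> * (norm (v (x + \<sigma> *\<^sub>R z) - v x) * norm z / t)))"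
      by (rule lborel_pair.Fubini') simp
    also have "\<dots> \<le> (\<integral>\<^sup>+\<sigma>. ennreal (\<delta> / t) * indicator {0..t} \<sigma>)"
    proof (rule nn_integral_mono)
      fix \<sigma> :: real
      show "(\<integral>\<^sup>+x. ennreal (indicator {0..t} \<sigma> * (norm (v (x + \<sigma> *\<^sub>R z) - v x) * norm z / t))) \<le> ennreal (\<delta> / t) * indicator {0..t} \<sigma>"
      proof (cases "\<sigma> \<in> {0..t}")
        case True
        have "(\<integral>\<^sup>+x. ennreal (indicator {0..t} \<sigma> * (norm (v (x + \<sigma> *\<^sub>R z) - v x) * norm z / t)))
          = (\<integral>\<^sup>+x. ennreal (norm z / t) * ennreal (norm (v (x + \<sigma> *\<^sub>R z) - v x)))"
          using True t by (intro nn_integral_cong) (simp add: ennreal_mult[symmetric] mult.commute)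
        also have "\<dots> = ennreal (norm z / t) * (\<integral>\<^sup>+x. ennreal (norm (v (x + \<sigma> *\<^sub>R z) - v x)))"
          by (rule nn_integral_cmult) simp
        also have "\<dots> \<le> ennreal (norm z / t) * ennreal (\<delta> / (1 + norm z))"
          by (intro mult_left_mono Wn te True) simp
        also have "\<dots> = ennreal ((norm z / t) * (\<delta> / (1 + norm z)))"
          using t \<delta> by (subst ennreal_mult) (auto simp: add_nonneg_nonneg)
        also have "\<dots> \<le> ennreal (\<delta> / t)"
        proof (rule ennreal_leI)
          have "(norm z / t) * (\<delta> / (1 + norm z)) = (norm z / (1 + norm z)) * (\<delta> / t)" by simp
          also have "\<dots> \<le> 1 * (\<delta> / t)" using t \<delta> by (intro mult_right_mono) (auto simp: divide_le_eq_1 add_pos_nonneg)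
          finally show "(norm z / t) * (\<delta> / (1 + norm z)) \<le> \<delta> / t" by simp
        qed
        finally show ?thesis using True by simp
      qed simp
    qed
    also have "\<dots> = ennreal \<delta>" using t \<delta> by (simp add: nn_integral_cmult_indicator ennreal_mult[symmetric])
    finally show "(\<integral>\<^sup>+x. indicator (cball 0 R) x * ennreal \<bar>(h (x + t *\<^sub>R z) - h x) / t - G x \<bullet> z\<bar>) \<le> ennreal \<delta>" .
  qed
qed

section \<open>Passing to the limit in difference quotients\<close>

text \<open>A subsequence \<open>r\<close> realizes the limes inferior, a further one converges
  almost everywhere, and Fatou applies to it. Discarding \<open>N\<close> terms makes the L1
  distances finite, so that they can be treated as Bochner integrals.\<close>

lemma nn_integral_le_liminf_of_L1:
  fixes u :: "'b \<Rightarrow> real" and q :: "nat \<Rightarrow> 'b \<Rightarrow> real"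
  assumes [measurable]: "u \<in> borel_measurable M" "\<And>j. q j \<in> borel_measurable M"
    and lim: "(\<lambda>j. \<integral>\<^sup>+x. ennreal \<bar>q j x - u x\<bar> \<partial>M) \<longlonglongrightarrow> 0"
    and \<phi>: "continuous_on UNIV \<phi>" "\<And>y. 0 \<le> \<phi> y"
  shows "(\<integral>\<^sup>+x. ennreal (\<phi> (u x)) \<partial>M) \<le> liminf (\<lambda>j. \<integral>\<^sup>+x. ennreal (\<phi> (q j x)) \<partial>M)"
proof -
  have [measurable]: "\<phi> \<in> borel_measurable borel" by (rule borel_measurable_continuous_onI[OF \<phi>(1)])
  define a where "a j = (\<integral>\<^sup>+x. ennreal (\<phi> (q j x)) \<partial>M)" for j
  obtain r where r: "strict_mono r" "(a \<circ> r) \<longlonglongrightarrow> liminf a" using liminf_subseq_lim by blast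
  have "(\<lambda>j. \<integral>\<^sup>+x. ennreal \<bar>q (r j) x - u x\<bar> \<partial>M) \<longlonglongrightarrow> 0"
    using LIMSEQ_subseq_LIMSEQ[OF lim r(1)] by (simp add: o_def)
  then have "\<forall>\<^sub>F j in sequentially. (\<integral>\<^sup>+x. ennreal \<bar>q (r j) x - u x\<bar> \<partial>M) < 1" by (rule order_tendstoD) simp
  then obtain N where N: "\<And>j. j \<ge> N \<Longrightarrow> (\<integral>\<^sup>+x. ennreal \<bar>q (r j) x - u x\<bar> \<partial>M) < 1" by (auto simp: eventually_sequentially)
  define d where "d j x = q (r (j + N)) x - u x" for j x
  have [measurable]: "d j \<in> borel_measurable M" for j unfolding d_def by measurable
  have id: "integrable M (d j)" for j
  proof (rule integrableI_bounded)
    show "(\<integral>\<^sup>+x. ennreal (norm (d j x)) \<partial>M) < \<infinity>" using N[of "j + N"] unfolding d_def by (auto intro: less_trans)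
  qed simp
  have "(\<lambda>j. \<integral>\<^sup>+x. ennreal (norm (d j x)) \<partial>M) \<longlonglongrightarrow> 0"
    unfolding d_def using LIMSEQ_ignore_initial_segment[OF \<open>(\<lambda>j. \<integral>\<^sup>+x. ennreal \<bar>q (r j) x - u x\<bar> \<partial>M) \<longlonglongrightarrow> 0\<close>, of N] by simp
  moreover have "(\<integral>\<^sup>+x. ennreal (norm (d j x)) \<partial>M) = ennreal (\<integral>x. norm (d j x) \<partial>M)" for j
    using id by (intro nn_integral_eq_integral) auto
  ultimately have "(\<lambda>j. ennreal (\<integral>x. norm (d j x) \<partial>M)) \<longlonglongrightarrow> ennreal 0" by simp
  then have "(\<lambda>j. \<integral>x. norm (d j x) \<partial>M) \<longlonglongrightarrow> 0" by (subst (asm) tendsto_ennreal_iff) auto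
  from tendsto_L1_AE_subseq[OF id this] obtain s where s: "strict_mono s" "AE x in M. (\<lambda>j. d (s j) x) \<longlonglongrightarrow> 0" by auto
  define m where "m j = r (s j + N)" for j
  have "(\<integral>\<^sup>+x. ennreal (\<phi> (u x)) \<partial>M) \<le> (\<integral>\<^sup>+x. liminf (\<lambda>j. ennreal (\<phi> (q (m j) x))) \<partial>M)"
  proof (rule nn_integral_mono_AE, use s(2) in eventually_elim)
    case (elim x)
    have "(\<lambda>j. d (s j) x + u x) \<longlonglongrightarrow> 0 + u x" by (intro tendsto_intros elim)
    then have "(\<lambda>j. q (m j) x) \<longlonglongrightarrow> u x" by (simp add: d_def m_def)
    then have "(\<lambda>j. ennreal (\<phi> (q (m j) x))) \<longlonglongrightarrow> ennreal (\<phi> (u x))"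
      by (intro tendsto_ennrealI isCont_tendsto_compose[of _ \<phi>]) (use \<phi>(1) continuous_on_eq_continuous_at in auto)
    then show ?case using lim_imp_Liminf[OF sequentially_bot] by fastforce
  qed
  also have "\<dots> \<le> liminf (\<lambda>j. a (m j))" unfolding a_def by (rule nn_integral_liminf) simp
  also have "\<dots> = liminf a"
  proof (rule lim_imp_Liminf[OF sequentially_bot])
    have "strict_mono (\<lambda>j. s j + N)" using s(1) by (simp add: strict_mono_def)
    from LIMSEQ_subseq_LIMSEQ[OF r(2) this] show "(\<lambda>j. a (m j)) \<longlonglongrightarrow> liminf a" by (simp add: o_def m_def)
  qed
  finally show ?thesis unfolding a_def .
qed

text \<open>\<open>G\<close> is known to be locally integrable and nothing more, so the convergence
  takes place on balls. Fatou in \<open>x\<close> on each ball, exhaustion by balls, and Fatou in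
  \<open>z\<close> give the bound, and finiteness of the energy of \<open>G\<close> comes with it
  whenever \<open>M\<close> is finite.\<close>

theorem gradient_lower_bound:
  fixes h :: "'a::euclidean_space \<Rightarrow> real" and \<epsilon> :: "nat \<Rightarrow> real"
  assumes w: "wgrad h G" and p: "0 < p" and B[measurable]: "B \<in> sets borel" and \<epsilon>: "\<And>j. 0 < \<epsilon> j" "\<epsilon> \<longlonglongrightarrow> 0"
    and M: "\<And>j. (\<integral>\<^sup>+z. indicator B z * (\<integral>\<^sup>+x. ennreal (max ((h (x + \<epsilon> j *\<^sub>R z) - h x) / \<epsilon> j) 0 powr p))) \<le> M"
  shows "(\<integral>\<^sup>+z. indicator B z * (\<integral>\<^sup>+x. ennreal (max (G x \<bullet> z) 0 powr p))) \<le> M"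
proof -
  have [measurable]: "h \<in> borel_measurable borel" "G \<in> borel_measurable borel" using w by (auto simp: wgrad_def)
  define \<phi> :: "real \<Rightarrow> real" where "\<phi> y = max y 0 powr p" for y
  have c\<phi>: "continuous_on UNIV \<phi>" unfolding \<phi>_def using p by (intro continuous_on_powr' continuous_intros) auto
  have [measurable]: "\<phi> \<in> borel_measurable borel" by (rule borel_measurable_continuous_onI[OF c\<phi>])
  define q where "q z j x = (h (x + \<epsilon> j *\<^sub>R z) - h x) / \<epsilon> j" for z j x
  have [measurable]: "(\<lambda>w. q (fst w) j (snd w)) \<in> borel_measurable (borel \<Otimes>\<^sub>M borel)" for j unfolding q_def by measurable
  have loc: "(\<integral>\<^sup>+x. indicator (cball 0 (real R)) x * ennreal (\<phi> (G x \<bullet> z))) \<le> liminf (\<lambda>j. \<integral>\<^sup>+x. ennreal (\<phi> (q z j x)))" for z and R :: nat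
  proof -
    have lim: "(\<lambda>j. \<integral>\<^sup>+x. ennreal \<bar>indicator (cball 0 (real R)) x * q z j x - indicator (cball 0 (real R)) x * (G x \<bullet> z)\<bar>) \<longlonglongrightarrow> 0"
    proof (rule order_tendstoI)
      fix a :: ennreal assume "0 < a"
      then obtain \<delta> where \<delta>: "0 < \<delta>" "ennreal \<delta> < a"
        using dense[of 0 a] by (metis ennreal_cases ennreal_less_zero_iff not_less_iff_gr_or_eq top.extremum_strict)
      obtain \<eta> where \<eta>: "\<eta> > 0" and le: "\<And>t. 0 < t \<Longrightarrow> t < \<eta> \<Longrightarrow>
        (\<integral>\<^sup>+x. indicator (cball 0 (real R)) x * ennreal \<bar>(h (x + t *\<^sub>R z) - h x) / t - G x \<bullet> z\<bar>) \<le> ennreal \<delta>"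
        using difference_quotient_L1[OF w \<delta>(1), of "real R" z] by blast
      have "\<forall>\<^sub>F j in sequentially. \<epsilon> j < \<eta>" by (rule order_tendstoD(2)[OF \<epsilon>(2) \<eta>])
      then show "\<forall>\<^sub>F j in sequentially. (\<integral>\<^sup>+x. ennreal \<bar>indicator (cball 0 (real R)) x * q z j x - indicator (cball 0 (real R)) x * (G x \<bullet> z)\<bar>) < a"
      proof eventually_elim
        case (elim j)
        have "(\<integral>\<^sup>+x. ennreal \<bar>indicator (cball 0 (real R)) x * q z j x - indicator (cball 0 (real R)) x * (G x \<bullet> z)\<bar>)
          = (\<integral>\<^sup>+x. indicator (cball 0 (real R)) x * ennreal \<bar>q z j x - G x \<bullet> z\<bar>)"
          by (rule nn_integral_cong) (simp add: indicator_def)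
        also have "\<dots> < a" using le[OF \<epsilon>(1) elim] \<delta>(2) unfolding q_def by (rule order.strict_trans1)
        finally show ?case .
      qed
    qed simp
    have "(\<integral>\<^sup>+x. indicator (cball 0 (real R)) x * ennreal (\<phi> (G x \<bullet> z))) = (\<integral>\<^sup>+x. ennreal (\<phi> (indicator (cball 0 (real R)) x * (G x \<bullet> z))))"
      by (intro nn_integral_cong) (auto simp: indicator_def \<phi>_def)
    also have "\<dots> \<le> liminf (\<lambda>j. \<integral>\<^sup>+x. ennreal (\<phi> (indicator (cball 0 (real R)) x * q z j x)))"
      by (rule nn_integral_le_liminf_of_L1[OF _ _ lim c\<phi>]) (auto simp: \<phi>_def q_def)
    also have "\<dots> \<le> liminf (\<lambda>j. \<integral>\<^sup>+x. ennreal (\<phi> (q z j x)))"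
      by (intro Liminf_mono always_eventually allI nn_integral_mono) (auto simp: indicator_def \<phi>_def)
    finally show ?thesis .
  qed
  have "(\<integral>\<^sup>+x. ennreal (\<phi> (G x \<bullet> z))) \<le> liminf (\<lambda>j. \<integral>\<^sup>+x. ennreal (\<phi> (q z j x)))" for z
  proof (rule LIMSEQ_le_const2)
    show "(\<lambda>R. \<integral>\<^sup>+x. indicator (cball 0 (real R)) x * ennreal (\<phi> (G x \<bullet> z))) \<longlonglongrightarrow> (\<integral>\<^sup>+x. ennreal (\<phi> (G x \<bullet> z)))"
    proof (rule nn_integral_LIMSEQ)
      show "incseq (\<lambda>R x. indicator (cball 0 (real R)) x * ennreal (\<phi> (G x \<bullet> z)))"
        by (auto simp: incseq_def le_fun_def indicator_def)
      fix x :: 'a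
      obtain N :: nat where "norm x \<le> real N" using real_arch_simple by blast
      then show "(\<lambda>R. indicator (cball 0 (real R)) x * ennreal (\<phi> (G x \<bullet> z))) \<longlonglongrightarrow> ennreal (\<phi> (G x \<bullet> z))"
        by (intro tendsto_eventually eventually_sequentiallyI[of N]) (auto simp: indicator_def)
    qed simp
    show "\<exists>N. \<forall>R\<ge>N. (\<integral>\<^sup>+x. indicator (cball 0 (real R)) x * ennreal (\<phi> (G x \<bullet> z))) \<le> liminf (\<lambda>j. \<integral>\<^sup>+x. ennreal (\<phi> (q z j x)))"
      using loc by blast
  qed
  then have "(\<integral>\<^sup>+z. indicator B z * (\<integral>\<^sup>+x. ennreal (\<phi> (G x \<bullet> z))))
    \<le> (\<integral>\<^sup>+z. liminf (\<lambda>j. indicator B z * (\<integral>\<^sup>+x. ennreal (\<phi> (q z j x)))))"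
    by (intro nn_integral_mono) (auto simp: indicator_def)
  also have "\<dots> \<le> liminf (\<lambda>j. \<integral>\<^sup>+z. indicator B z * (\<integral>\<^sup>+x. ennreal (\<phi> (q z j x))))"
    by (rule nn_integral_liminf) simp
  also have "\<dots> \<le> liminf (\<lambda>j::nat. M)"
    using M unfolding \<phi>_def q_def by (intro Liminf_mono always_eventually allI) auto
  also have "\<dots> = M" by (simp add: Liminf_const)
  finally show ?thesis unfolding \<phi>_def .
qed

lemma emeasure_lborel_scale:
  fixes C :: "'a::euclidean_space set"
  assumes [measurable]: "C \<in> sets borel" and c: "c > 0"
  shows "vol {x. (1 / c) *\<^sub>R x \<in> C} = ennreal (c ^ DIM('a)) * vol C"
proof -
  have [measurable]: "{x. (1 / c) *\<^sub>R x \<in> C} \<in> sets borel" by measurable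
  have "vol {x. (1 / c) *\<^sub>R x \<in> C} = (\<integral>\<^sup>+x. indicator {x. (1 / c) *\<^sub>R x \<in> C} x)" by simp
  also have "\<dots> = ennreal (c ^ DIM('a)) * (\<integral>\<^sup>+x. indicator {x. (1 / c) *\<^sub>R x \<in> C} (c *\<^sub>R x))"
    by (rule nn_integral_lborel_scale[OF _ c]) simp
  also have "(\<integral>\<^sup>+x. indicator {x. (1 / c) *\<^sub>R x \<in> C} (c *\<^sub>R x)) = (\<integral>\<^sup>+x. indicator C x \<partial>(lborel :: 'a measure))"
    using c by (intro nn_integral_cong) (simp add: indicator_def)
  finally show ?thesis by simp
qed

lemma excess_p_scaled:
  fixes u :: "'a::euclidean_space \<Rightarrow> real"
  assumes [measurable]: "u \<in> borel_measurable borel" "C \<in> sets borel" and \<epsilon>: "\<epsilon> > 0"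
  shows "excess_p p u {x. (1 / \<epsilon>) *\<^sub>R x \<in> C}
    = ennreal (\<epsilon> ^ DIM('a)) * (\<integral>\<^sup>+z. indicator C z * (\<integral>\<^sup>+x. ennreal (max (u (x + \<epsilon> *\<^sub>R z) - u x) 0 powr p)))"
proof -
  have [measurable]: "{x. (1 / \<epsilon>) *\<^sub>R x \<in> C} \<in> sets borel" by measurable
  show ?thesis
    unfolding excess_p_def
    by (subst nn_integral_lborel_scale[OF _ \<epsilon>]) (use \<epsilon> in \<open>simp_all add: indicator_def\<close>)
qed

lemma powr_max_mult:
  fixes c y p :: real assumes "c > 0"
  shows "max (c * y) 0 powr p = c powr p * max y 0 powr p"
proof -
  have "max (c * y) 0 = c * max y 0" using assms by (simp add: max_mult_distrib_left)
  then show ?thesis using assms by (simp add: powr_mult)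
qed

context weakly_differentiable
begin

text \<open>\<open>K\<close> and the ball are dilated by the same \<epsilon>, and the Jacobians
  cancel. The quotients of \<open>f\<close> are bounded by its gradient at every \<epsilon>, so only
  the side of \<open>schwarz0 f\<close> passes to a limit.\<close>

theorem directional_energy_rearrangement:
  assumes n: "DIM('a) \<ge> 2" and p: "1 \<le> p"
    and K[measurable]: "K \<in> sets borel" "convex K" "bounded K"
    and k: "0 \<le> k" "vol K = vol (ball (0::'a) k)"
  shows "(\<integral>\<^sup>+z. indicator (ball 0 k) z * (\<integral>\<^sup>+x. ennreal (max (\<Gamma> x \<bullet> z) 0 powr p)))
    \<le> (\<integral>\<^sup>+z. indicator K z * (\<integral>\<^sup>+x. ennreal (max (g x \<bullet> z) 0 powr p)))"
proof (rule gradient_lower_bound[where \<epsilon> = "\<lambda>j. 1 / real (Suc j)"])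
  show "wgrad (schwarz0 f) \<Gamma>" by (rule wgrad_schwarz0[OF n])
  then have h[measurable]: "schwarz0 f \<in> borel_measurable borel" by (simp add: wgrad_def)
  show "0 < p" using p by simp
  show "(\<lambda>j. 1 / real (Suc j)) \<longlonglongrightarrow> 0" by (rule LIMSEQ_Suc[OF lim_1_over_n])
  show "(\<integral>\<^sup>+z. indicator (ball 0 k) z * (\<integral>\<^sup>+x. ennreal (max ((schwarz0 f (x + (1 / real (Suc j)) *\<^sub>R z) - schwarz0 f x) / (1 / real (Suc j))) 0 powr p)))
    \<le> (\<integral>\<^sup>+z. indicator K z * (\<integral>\<^sup>+x. ennreal (max (g x \<bullet> z) 0 powr p)))" for j
  proof -
    define \<epsilon> where "\<epsilon> = 1 / real (Suc j)"
    have \<epsilon>: "\<epsilon> > 0" by (simp add: \<epsilon>_def)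
    have sc: "{x. (1 / \<epsilon>) *\<^sub>R x \<in> C} = (\<lambda>x. \<epsilon> *\<^sub>R x) ` C" for C :: "'a set"
      using \<epsilon> by (auto simp: image_iff intro!: bexI[of _ "(1 / \<epsilon>) *\<^sub>R _"])
    define A where "A u C = (\<integral>\<^sup>+z. indicator C z * (\<integral>\<^sup>+x. ennreal (max (u (x + \<epsilon> *\<^sub>R z) - u x) 0 powr p)))" for u :: "'a \<Rightarrow> real" and C
    have ball: "{x. (1 / \<epsilon>) *\<^sub>R x \<in> ball (0::'a) k} = ball 0 (\<epsilon> * k)"
      using \<epsilon> by (auto simp: pos_divide_less_eq mult.commute)
    have "ennreal (\<epsilon> ^ DIM('a)) * A (schwarz0 f) (ball 0 k) = excess_p p (schwarz0 f) (ball 0 (\<epsilon> * k))"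
      unfolding A_def ball[symmetric] by (rule excess_p_scaled[symmetric]) (use \<epsilon> in auto)
    also have "\<dots> \<le> excess_p p f {x. (1 / \<epsilon>) *\<^sub>R x \<in> K}"
    proof (rule excess_p_rearrangement[OF f_measurable rearrangement_of_schwarz0 p])
      show "{x. (1 / \<epsilon>) *\<^sub>R x \<in> K} \<in> sets borel" by measurable
      show "convex {x. (1 / \<epsilon>) *\<^sub>R x \<in> K}" "bounded {x. (1 / \<epsilon>) *\<^sub>R x \<in> K}"
        unfolding sc using K by (auto intro: convex_scaling bounded_scaling)
      show "vol {x. (1 / \<epsilon>) *\<^sub>R x \<in> K} = vol (ball (0::'a) (\<epsilon> * k))"
        unfolding ball[symmetric] by (subst (1 2) emeasure_lborel_scale) (simp_all add: k(2) \<epsilon>)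
      show "0 \<le> \<epsilon> * k" using \<epsilon> k by simp
    qed
    also have "\<dots> = ennreal (\<epsilon> ^ DIM('a)) * A f K"
      unfolding A_def by (rule excess_p_scaled) (use \<epsilon> in auto)
    finally have AA: "A (schwarz0 f) (ball 0 k) \<le> A f K"
      using \<epsilon> by (subst (asm) ennreal_mult_le_mult_iff) auto
    have "(\<integral>\<^sup>+z. indicator (ball 0 k) z * (\<integral>\<^sup>+x. ennreal (max ((schwarz0 f (x + \<epsilon> *\<^sub>R z) - schwarz0 f x) / \<epsilon>) 0 powr p)))
      = (\<integral>\<^sup>+z. ennreal ((1 / \<epsilon>) powr p) * (indicator (ball 0 k) z * (\<integral>\<^sup>+x. ennreal (max (schwarz0 f (x + \<epsilon> *\<^sub>R z) - schwarz0 f x) 0 powr p))))"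
    proof (rule nn_integral_cong)
      fix z :: 'a
      have "(\<integral>\<^sup>+x. ennreal (max ((schwarz0 f (x + \<epsilon> *\<^sub>R z) - schwarz0 f x) / \<epsilon>) 0 powr p))
        = (\<integral>\<^sup>+x. ennreal ((1 / \<epsilon>) powr p) * ennreal (max (schwarz0 f (x + \<epsilon> *\<^sub>R z) - schwarz0 f x) 0 powr p))"
        using \<epsilon> powr_max_mult[of "1 / \<epsilon>"] by (intro nn_integral_cong) (simp add: ennreal_mult[symmetric])
      also have "\<dots> = ennreal ((1 / \<epsilon>) powr p) * (\<integral>\<^sup>+x. ennreal (max (schwarz0 f (x + \<epsilon> *\<^sub>R z) - schwarz0 f x) 0 powr p))"
        by (rule nn_integral_cmult) simp
      finally show "indicator (ball 0 k) z * (\<integral>\<^sup>+x. ennreal (max ((schwarz0 f (x + \<epsilon> *\<^sub>R z) - schwarz0 f x) / \<epsilon>) 0 powr p))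
        = ennreal ((1 / \<epsilon>) powr p) * (indicator (ball 0 k) z * (\<integral>\<^sup>+x. ennreal (max (schwarz0 f (x + \<epsilon> *\<^sub>R z) - schwarz0 f x) 0 powr p)))"
        by (simp add: mult.left_commute)
    qed
    also have "\<dots> = ennreal ((1 / \<epsilon>) powr p) * A (schwarz0 f) (ball 0 k)"
      unfolding A_def by (rule nn_integral_cmult) measurable
    also have "\<dots> \<le> ennreal ((1 / \<epsilon>) powr p) * A f K" by (rule mult_left_mono[OF AA]) simp
    also have "\<dots> = (\<integral>\<^sup>+z. ennreal ((1 / \<epsilon>) powr p) * (indicator K z * (\<integral>\<^sup>+x. ennreal (max (f (x + \<epsilon> *\<^sub>R z) - f x) 0 powr p))))"
      unfolding A_def by (rule nn_integral_cmult[symmetric]) measurable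
    also have "\<dots> \<le> (\<integral>\<^sup>+z. indicator K z * (\<integral>\<^sup>+x. ennreal (max (g x \<bullet> z) 0 powr p)))"
    proof (rule nn_integral_mono)
      fix z :: 'a
      have "(\<integral>\<^sup>+x. ennreal (max (f (x + \<epsilon> *\<^sub>R z) - f x) 0 powr p)) \<le> (\<integral>\<^sup>+x. ennreal (max (g x \<bullet> (\<epsilon> *\<^sub>R z)) 0 powr p))"
        by (rule wgrad_difference_powr_le[OF wg p])
      also have "\<dots> = (\<integral>\<^sup>+x. ennreal (\<epsilon> powr p) * ennreal (max (g x \<bullet> z) 0 powr p))"
        using \<epsilon> by (intro nn_integral_cong) (simp add: powr_max_mult ennreal_mult[symmetric])
      also have "\<dots> = ennreal (\<epsilon> powr p) * (\<integral>\<^sup>+x. ennreal (max (g x \<bullet> z) 0 powr p))"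
        by (rule nn_integral_cmult) simp
      finally have "ennreal ((1 / \<epsilon>) powr p) * (\<integral>\<^sup>+x. ennreal (max (f (x + \<epsilon> *\<^sub>R z) - f x) 0 powr p))
        \<le> ennreal ((1 / \<epsilon>) powr p) * (ennreal (\<epsilon> powr p) * (\<integral>\<^sup>+x. ennreal (max (g x \<bullet> z) 0 powr p)))"
        by (rule mult_left_mono) simp
      also have "\<dots> = ennreal ((1 / \<epsilon>) powr p * \<epsilon> powr p) * (\<integral>\<^sup>+x. ennreal (max (g x \<bullet> z) 0 powr p))"
        by (simp add: ennreal_mult mult.assoc)
      also have "(1 / \<epsilon>) powr p * \<epsilon> powr p = 1" using \<epsilon> by (simp add: powr_mult[symmetric])
      finally show "ennreal ((1 / \<epsilon>) powr p) * (indicator K z * (\<integral>\<^sup>+x. ennreal (max (f (x + \<epsilon> *\<^sub>R z) - f x) 0 powr p)))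
        \<le> indicator K z * (\<integral>\<^sup>+x. ennreal (max (g x \<bullet> z) 0 powr p))"
        by (simp add: indicator_def)
    qed
    finally show ?thesis unfolding \<epsilon>_def .
  qed
qed auto

lemma Gamma_radial: "\<exists>\<psi>. \<forall>x. \<Gamma> x = \<psi> (norm x) *\<^sub>R x"
  unfolding \<Gamma>_def by (intro exI[of _ "\<lambda>r. - (\<kappa> (ln r) / r\<^sup>2)"]) simp

end

section \<open>Sublevel sets of the directional energy\<close>

lemma epowr_ennreal: "r > 0 \<Longrightarrow> epowr (ennreal r) a = ennreal (r powr a)"
  by (simp add: epowr_def)

lemma epowr_1 [simp]: "epowr x 1 = x"
  by (auto simp: epowr_def less_top[symmetric] zero_less_iff_neq_zero enn2real_positive_iff)

lemma epowr_epowr: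
  assumes "a \<noteq> 0" "b \<noteq> 0"
  shows "epowr (epowr x a) b = epowr x (a * b)"
proof (cases "x = 0 \<or> x = \<infinity>")
  case True
  then show ?thesis using assms by (auto simp: epowr_def zero_less_mult_iff)
next
  case False
  then obtain r where "x = ennreal r" "r > 0" by (cases x) (auto simp: less_le)
  then show ?thesis by (simp add: epowr_ennreal powr_powr)
qed

lemma epowr_antimono:
  assumes "x \<le> y" "a < 0"
  shows "epowr y a \<le> epowr x a"
proof (cases "x = 0 \<or> y = \<infinity>")
  case True
  then show ?thesis using assms by (auto simp: epowr_def)
next
  case False
  then have "y \<noteq> 0" using assms(1) by auto
  then obtain s where s: "y = ennreal s" "s > 0" using False by (cases y) (auto simp: less_le)
  then obtain r where "x = ennreal r" "r > 0" using assms(1) False by (cases x) (auto simp: less_le top_unique)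
  then show ?thesis using s assms by (simp add: epowr_ennreal powr_mono2' ennreal_leI)
qed

lemma epowr_measurable [measurable (raw)]:
  assumes [measurable]: "F \<in> borel_measurable M"
  shows "(\<lambda>x. epowr (F x) a) \<in> borel_measurable M"
  unfolding epowr_def by measurable

section \<open>Layer cake, polar coordinates and the volume bound\<close>

lemma nn_integral_layer_cake:
  fixes F :: "'a \<Rightarrow> ennreal"
  assumes [measurable]: "F \<in> borel_measurable M" and M: "sigma_finite_measure M"
  shows "(\<integral>\<^sup>+x. F x \<partial>M) = (\<integral>\<^sup>+s. indicator {0..} s * emeasure M {x \<in> space M. ennreal s < F x})"
proof -
  interpret M: sigma_finite_measure M by (rule M)
  interpret pair_sigma_finite M lborel ..
  have layer: "y = (\<integral>\<^sup>+s. indicator {s. 0 \<le> s \<and> ennreal s < y} s)" for y :: ennreal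
  proof (cases y)
    case (real r)
    then have "{s. 0 \<le> s \<and> ennreal s < y} = {0..<r}" by (auto simp: ennreal_less_iff)
    then show ?thesis using real by simp
  next
    case top
    then have "{s. 0 \<le> s \<and> ennreal s < y} = {0..}" by auto
    moreover have "vol {0::real..} = \<infinity>"
    proof -
      have "ennreal (real n) \<le> vol {0::real..}" for n
        using emeasure_mono[of "{0..real n}" "{0..}" lborel] by auto
      then show ?thesis by (metis ennreal_Ex_less_of_nat ennreal_of_nat_eq_real_of_nat infinity_ennreal_def less_top not_less)
    qed
    ultimately show ?thesis using top by simp
  qed
  have "(\<integral>\<^sup>+x. F x \<partial>M) = (\<integral>\<^sup>+x. \<integral>\<^sup>+s. (if 0 \<le> s \<and> ennreal s < F x then 1 else 0) \<partial>lborel \<partial>M)"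
    by (rule nn_integral_cong, rule trans[OF layer]) (simp add: indicator_def of_bool_def)
  also have "\<dots> = (\<integral>\<^sup>+s. \<integral>\<^sup>+x. (if 0 \<le> s \<and> ennreal s < F x then 1 else 0) \<partial>M)"
    by (rule Fubini'[symmetric]) measurable
  also have "\<dots> = (\<integral>\<^sup>+s. indicator {0..} s * emeasure M {x \<in> space M. ennreal s < F x})"
  proof (rule nn_integral_cong)
    fix s :: real
    have "(\<integral>\<^sup>+x. (if 0 \<le> s \<and> ennreal s < F x then 1 else 0) \<partial>M) = (\<integral>\<^sup>+x. indicator {0..} s * indicator {x \<in> space M. ennreal s < F x} x \<partial>M)"
      by (intro nn_integral_cong) (auto simp: indicator_def)
    also have "\<dots> = indicator {0..} s * (\<integral>\<^sup>+x. indicator {x \<in> space M. ennreal s < F x} x \<partial>M)"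
      by (rule nn_integral_cmult) measurable
    also have "(\<integral>\<^sup>+x. indicator {x \<in> space M. ennreal s < F x} x \<partial>M) = emeasure M {x \<in> space M. ennreal s < F x}"
      by (rule nn_integral_indicator) measurable
    finally show "(\<integral>\<^sup>+x. (if 0 \<le> s \<and> ennreal s < F x then 1 else 0) \<partial>M) = indicator {0..} s * emeasure M {x \<in> space M. ennreal s < F x}" .
  qed
  finally show ?thesis .
qed

text \<open>The set on the right is star-shaped, and the n-th power of its radial function is
  \<open>F\<close>. A finite simple function below \<open>F\<close> decomposes the inner part of the
  set into pieces of cones, whose volumes follow from the definition of
  \<open>sphere_measure\<close> by scaling.\<close>

lemma nn_integral_sphere_le_emeasure:
  fixes F :: "'a::euclidean_space \<Rightarrow> ennreal"
  assumes [measurable]: "F \<in> borel_measurable borel"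
  shows "vol (ball (0::'a) 1) * (\<integral>\<^sup>+u. F u \<partial>sphere_measure) \<le> vol {x. ennreal (norm x ^ DIM('a)) \<le> F (sgn x)}"
proof -
  let ?\<omega> = "vol (ball (0::'a) 1)"
  have \<omega>: "?\<omega> \<noteq> 0" "?\<omega> \<noteq> \<infinity>" using unit_ball_vol_pos[of "real DIM('a)"] by (simp_all add: emeasure_ball less_le)
  have "?\<omega> * integral\<^sup>S sphere_measure G \<le> vol {x. ennreal (norm x ^ DIM('a)) \<le> F (sgn x)}"
    if G: "simple_function sphere_measure G" "G \<le> F" "\<And>x. G x < \<infinity>" for G :: "'a \<Rightarrow> ennreal"
  proof -
    have [measurable]: "G \<in> borel_measurable borel" using borel_measurable_simple_function[OF G(1)] by simp
    have [measurable]: "G -` {y} \<in> sets borel" for y using measurable_sets[of G borel borel "{y}"] by simp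
    have fin: "finite (range G)" using G(1) by (simp add: simple_function_def)
    \<comment> \<open>The part of the cone over the level set of \<open>G\<close> at
      \<open>y\<close> within the radius whose n-th power is \<open>y\<close>. The strict inequality
      makes it empty for \<open>y = 0\<close>, so the origin causes no overlap.\<close>
    define S where "S y = {x. ennreal (norm x ^ DIM('a)) < y \<and> G (sgn x) = y}" for y
    have [measurable]: "S y \<in> sets borel" for y unfolding S_def by measurable
    have S: "?\<omega> * (y * emeasure sphere_measure (G -` {y})) = vol (S y)" if "y \<in> range G" for y
    proof (cases "y = 0")
      case True
      then show ?thesis by (simp add: S_def)
    next
      case False
      obtain \<rho> where \<rho>: "\<rho> > 0" "y = ennreal (\<rho> ^ DIM('a))"
      proof -
        obtain r where r: "y = ennreal r" "r > 0" using G(3) \<open>y \<in> range G\<close> False by (cases y) (auto simp: less_le, metis)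
        show thesis
          by (rule that[of "root DIM('a) r"]) (use r in \<open>auto simp: real_root_pow_pos\<close>)
      qed
      have pow: "norm x ^ DIM('a) < \<rho> ^ DIM('a) \<longleftrightarrow> norm x < \<rho>" for x :: 'a
        using \<rho>(1) power_mono_iff[of \<rho> "norm x" "DIM('a)"] by (simp flip: not_le)
      have "S y = {x. (1 / \<rho>) *\<^sub>R x \<in> ball 0 1 \<inter> sgn -` (G -` {y})}"
        using \<rho> by (auto simp: S_def ennreal_less_iff pow sgn_scaleR)
      moreover have "sgn -` (G -` {y}) \<in> sets (borel :: 'a measure)"
        using measurable_sets[OF measurable_sgn_euclidean, of "G -` {y}"] by simp
      ultimately have "vol (S y) = y * vol (ball 0 1 \<inter> sgn -` (G -` {y}))"
        using emeasure_lborel_scale[of "ball 0 1 \<inter> sgn -` (G -` {y})" \<rho>] \<rho> by simp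
      also have "vol (ball 0 1 \<inter> sgn -` (G -` {y})) = ?\<omega> * emeasure sphere_measure (G -` {y})"
        using \<omega> by (simp add: emeasure_sphere_measure ennreal_times_divide mult.commute[of ?\<omega>] mult_divide_eq_ennreal)
      finally show ?thesis by (simp add: mult_ac)
    qed
    have "?\<omega> * integral\<^sup>S sphere_measure G = (\<Sum>y\<in>range G. vol (S y))"
      unfolding simple_integral_def space_sphere_measure Int_UNIV_right sum_distrib_left
      by (rule sum.cong[OF refl S])
    also have "\<dots> = vol (\<Union>y\<in>range G. S y)"
      by (rule sum_emeasure) (auto simp: disjoint_family_on_def S_def fin)
    also have "\<dots> \<le> vol {x. ennreal (norm x ^ DIM('a)) \<le> F (sgn x)}"
    proof (rule emeasure_mono)
      show "(\<Union>y\<in>range G. S y) \<subseteq> {x. ennreal (norm x ^ DIM('a)) \<le> F (sgn x)}"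
        using G(2) unfolding S_def le_fun_def by (clarsimp, metis order.strict_trans2 less_imp_le)
    qed measurable
    finally show ?thesis .
  qed
  then show ?thesis
    unfolding nn_integral_def_finite SUP_mult_left_ennreal by (intro SUP_least) auto
qed

text \<open>At a level \<open>s < 1\<close> put \<open>c = s powr (1 / p)\<close>. The dilate of
  \<open>K\<close> by \<open>c\<close> lies in \<open>K \<inter> {z. N z \<le> s}\<close>, so
  \<open>{z. N z > s}\<close> takes at most the share \<open>1 - c ^ n\<close> of the volume of
  \<open>K\<close>. For the ball and \<open>(norm z / r) powr p\<close> this share is attained at
  every level, and the two volumes agree.\<close>

lemma sublevel_integral_le:
  fixes N :: "'a::euclidean_space \<Rightarrow> ennreal"
  assumes [measurable]: "N \<in> borel_measurable borel"
    and hom: "\<And>c z. 0 < c \<Longrightarrow> N (c *\<^sub>R z) = ennreal (c powr p) * N z" and p: "0 < p"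
    and r: "0 < r" "vol ({z. N z \<le> 1} \<inter> ball 0 R) = vol (ball (0::'a) r)"
  shows "(\<integral>\<^sup>+z. indicator ({z. N z \<le> 1} \<inter> ball 0 R) z * N z) \<le> (\<integral>\<^sup>+z. indicator (ball (0::'a) r) z * ennreal ((norm z / r) powr p))"
proof -
  define K where "K = {z. N z \<le> 1} \<inter> ball 0 R"
  have [measurable]: "K \<in> sets borel" unfolding K_def by measurable
  have lc: "(\<integral>\<^sup>+z. F z) = (\<integral>\<^sup>+s. indicator {0..} s * vol {z. ennreal s < F z})"
    if "F \<in> borel_measurable borel" for F :: "'a \<Rightarrow> ennreal"
    using nn_integral_layer_cake[of F lborel] that sigma_finite_lborel by simp
  have "vol {z. ennreal s < indicator K z * N z} \<le> vol {z. ennreal s < indicator (ball (0::'a) r) z * ennreal ((norm z / r) powr p)}"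
    if s: "0 \<le> s" for s
  proof (cases "s < 1")
    case False
    then have "\<not> ennreal s < indicator K z * N z" for z
      by (auto simp: K_def indicator_def not_less intro: order_trans[of _ 1])
    then show ?thesis by simp
  next
    case True
    define c where "c = s powr (1 / p)"
    have c: "0 \<le> c" "c \<le> 1" "c powr p = s"
      using s True p by (auto simp: c_def powr_powr powr_le1)
    have cK: "ennreal (c ^ DIM('a)) * vol K \<le> vol (K \<inter> {z. N z \<le> ennreal s})"
    proof (cases "c = 0")
      case False
      then have c0: "c > 0" using c by simp
      have "{x. (1 / c) *\<^sub>R x \<in> K} \<subseteq> K \<inter> {z. N z \<le> ennreal s}"
      proof safe
        fix x assume x: "(1 / c) *\<^sub>R x \<in> K"
        have "N x = N (c *\<^sub>R ((1 / c) *\<^sub>R x))" using c0 by simp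
        also have "\<dots> = ennreal s * N ((1 / c) *\<^sub>R x)" by (subst hom[OF c0]) (simp add: c)
        also have "\<dots> \<le> ennreal s * 1" using x by (intro mult_left_mono) (auto simp: K_def)
        finally show Ns: "N x \<le> ennreal s" by simp
        have "norm x < c * R" using x c0 by (simp add: K_def pos_divide_less_eq mult.commute)
        also have "\<dots> \<le> R"
        proof -
          have "0 < c * R" using \<open>norm x < c * R\<close> norm_ge_zero[of x] by linarith
          then show ?thesis using c c0 by (simp add: zero_less_mult_iff mult_left_le_one_le)
        qed
        finally show "x \<in> K" using order_trans[OF Ns, of 1] True s by (simp add: K_def)
      qed
      then have "vol {x. (1 / c) *\<^sub>R x \<in> K} \<le> vol (K \<inter> {z. N z \<le> ennreal s})"
        by (rule emeasure_mono) measurable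
      then show ?thesis by (simp add: emeasure_lborel_scale c0)
    qed (simp add: power_0_left)
    have Kfin: "vol K \<noteq> \<infinity>" using r(2) emeasure_lborel_ball_finite[of "0::'a" r] by (simp add: K_def)
    have bfin: "vol (cball (0::'a) (c * r)) \<noteq> \<infinity>" using emeasure_lborel_cball_finite[of "0::'a" "c * r"] by simp
    have "c \<noteq> 1" using c(3) True by auto
    then have cr: "c * r < r" using c r by simp
    have "{z. ennreal s < indicator K z * N z} = K - (K \<inter> {z. N z \<le> ennreal s})"
      using s by (auto simp: indicator_def not_le split: if_splits)
    then have "vol {z. ennreal s < indicator K z * N z} = vol K - vol (K \<inter> {z. N z \<le> ennreal s})"
      using Kfin by (simp only:) (rule emeasure_Diff, use emeasure_mono[of "K \<inter> {z. N z \<le> ennreal s}" K lborel] in \<open>auto simp: top_unique\<close>)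
    also have "\<dots> \<le> vol K - ennreal (c ^ DIM('a)) * vol K" by (rule ennreal_minus_mono[OF order_refl cK])
    also have "\<dots> = vol (ball (0::'a) r) - vol (cball (0::'a) (c * r))"
      using r c by (simp add: K_def emeasure_ball emeasure_cball ennreal_mult[symmetric] power_mult_distrib mult_ac)
    also have "\<dots> = vol (ball (0::'a) r - cball 0 (c * r))"
      using bfin cr by (subst emeasure_Diff) auto
    also have "\<dots> \<le> vol {z. ennreal s < indicator (ball (0::'a) r) z * ennreal ((norm z / r) powr p)}"
    proof (rule emeasure_mono)
      show "ball 0 r - cball 0 (c * r) \<subseteq> {z::'a. ennreal s < indicator (ball 0 r) z * ennreal ((norm z / r) powr p)}"
      proof safe
        fix z :: 'a assume z: "z \<in> ball 0 r" "z \<notin> cball 0 (c * r)"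
        then have "c < norm z / r" using r by (simp add: pos_less_divide_eq)
        then have "s < (norm z / r) powr p" using powr_less_mono2[OF p c(1), of "norm z / r"] c by simp
        then show "ennreal s < indicator (ball 0 r) z * ennreal ((norm z / r) powr p)" using z s by (simp add: ennreal_less_iff)
      qed
    qed measurable
    finally show ?thesis .
  qed
  then have "(\<integral>\<^sup>+s. indicator {0..} s * vol {z. ennreal s < indicator K z * N z})
    \<le> (\<integral>\<^sup>+s. indicator {0..} s * vol {z. ennreal s < indicator (ball (0::'a) r) z * ennreal ((norm z / r) powr p)})"
    by (intro nn_integral_mono) (auto simp: indicator_def)
  then show ?thesis unfolding K_def[symmetric] by (subst (1 2) lc) auto
qed

text \<open>With \<open>J\<close> the integral of \<open>(norm z / r) powr p\<close> over the ball,
  the assumptions combine to \<open>C * ennreal (r powr p) * J \<le> J\<close>, and \<open>J\<close>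
  is positive and finite.\<close>

lemma sublevel_radius_bound:
  fixes N :: "'a::euclidean_space \<Rightarrow> ennreal"
  assumes N: "N \<in> borel_measurable borel"
    and hom: "\<And>c z. 0 < c \<Longrightarrow> N (c *\<^sub>R z) = ennreal (c powr p) * N z" and p: "0 < p"
    and r: "0 < r" "vol ({z. N z \<le> 1} \<inter> ball 0 R) = vol (ball (0::'a) r)"
    and le: "C * (\<integral>\<^sup>+z. indicator (ball (0::'a) r) z * ennreal (norm z powr p))
       \<le> (\<integral>\<^sup>+z. indicator ({z. N z \<le> 1} \<inter> ball 0 R) z * N z)"
  shows "C * ennreal (r powr p) \<le> 1"
proof -
  define J where "J = (\<integral>\<^sup>+z. indicator (ball (0::'a) r) z * ennreal ((norm z / r) powr p))"
  have "(\<integral>\<^sup>+z. indicator (ball (0::'a) r) z * ennreal (norm z powr p))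
    = (\<integral>\<^sup>+z. ennreal (r powr p) * (indicator (ball (0::'a) r) z * ennreal ((norm z / r) powr p)))"
    using r(1) by (intro nn_integral_cong) (auto simp: indicator_def ennreal_mult[symmetric] powr_mult[symmetric])
  also have "\<dots> = ennreal (r powr p) * J" unfolding J_def by (rule nn_integral_cmult) measurable
  finally have "C * ennreal (r powr p) * J \<le> J"
    using order_trans[OF le sublevel_integral_le[OF N hom p r]] by (simp add: J_def mult.assoc)
  moreover have "J < \<infinity>"
  proof -
    have "J \<le> (\<integral>\<^sup>+z. indicator (ball (0::'a) r) z)"
      unfolding J_def using r(1) p by (intro nn_integral_mono) (auto simp: indicator_def powr_le1)
    then show ?thesis using emeasure_lborel_ball_finite[of "0::'a" r] by (auto simp: less_top[symmetric] top_unique)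
  qed
  moreover have "0 < J"
  proof (rule ccontr)
    assume "\<not> 0 < J"
    then have "AE z in lborel. indicator (ball (0::'a) r) z * ennreal ((norm z / r) powr p) = 0"
      unfolding J_def zero_less_iff_neq_zero not_not by (subst (asm) nn_integral_0_iff_AE) auto
    then have "AE z in lborel. z \<notin> ball (0::'a) r"
      using AE_lborel_singleton[of "0::'a"] by eventually_elim (use r(1) in \<open>auto simp: indicator_def ennreal_eq_0_iff split: if_splits\<close>)
    then have "vol (ball (0::'a) r) = 0" by (subst (asm) AE_iff_measurable[OF _ refl]) (auto simp: ball_def dist_norm)
    moreover have "unit_ball_vol (real DIM('a)) * r ^ DIM('a) > 0" using r(1) by simp
    ultimately show False using r(1) by (simp add: emeasure_ball ennreal_eq_0_iff)
  qed
  ultimately show ?thesis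
    using ennreal_mult_strict_right_mono[of 1 "C * ennreal (r powr p)" J] by (simp add: not_less[symmetric]) (metis linorder_not_le)
qed

text \<open>In direction \<open>u\<close> the set \<open>{z. N z \<le> 1}\<close> has radius
  \<open>N u\<close> to the power \<open>- 1 / p\<close>, so the integrand is the n-th power of its
  radial function. The bound on radii limits the volume inside each ball \<open>ball 0 R\<close>,
  uniformly in \<open>R\<close>. For \<open>C = 0\<close> the right side is infinite; directions
  with \<open>N u = 0\<close> contribute whole rays, in accordance with the convention of
  \<open>epowr\<close>.\<close>

theorem sphere_integral_bound:
  fixes N :: "'a::euclidean_space \<Rightarrow> ennreal"
  assumes N[measurable]: "N \<in> borel_measurable borel" and N0: "N 0 = 0"
    and hom: "\<And>c z. 0 < c \<Longrightarrow> N (c *\<^sub>R z) = ennreal (c powr p) * N z" and p: "0 < p"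
    and le: "\<And>R r. 0 \<le> r \<Longrightarrow> vol ({z. N z \<le> 1} \<inter> ball 0 R) = vol (ball (0::'a) r) \<Longrightarrow>
      C * (\<integral>\<^sup>+z. indicator (ball (0::'a) r) z * ennreal (norm z powr p))
       \<le> (\<integral>\<^sup>+z. indicator ({z. N z \<le> 1} \<inter> ball 0 R) z * N z)"
  shows "(\<integral>\<^sup>+u. epowr (N u) (- real DIM('a) / p) \<partial>sphere_measure) \<le> epowr C (- real DIM('a) / p)"
proof (cases "C = 0")
  case True
  then show ?thesis using p by (simp add: epowr_def divide_less_0_iff)
next
  case C0: False
  let ?\<omega> = "vol (ball (0::'a) 1)" and ?a = "- real DIM('a) / p"
  have \<omega>: "?\<omega> \<noteq> 0" "?\<omega> \<noteq> \<infinity>" using unit_ball_vol_pos[of "real DIM('a)"] by (simp_all add: emeasure_ball less_le)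
  have K: "vol ({z. N z \<le> 1} \<inter> ball 0 R) \<le> ?\<omega> * epowr C ?a" for R
  proof -
    have "vol ({z. N z \<le> 1} \<inter> ball 0 R) \<le> vol (ball (0::'a) R)"
      by (rule emeasure_mono) auto
    then have "vol ({z. N z \<le> 1} \<inter> ball 0 R) < \<infinity>"
      using emeasure_lborel_ball_finite[of "0::'a" R] by (simp add: order_le_less_trans)
    then obtain r where r: "0 \<le> r" "vol (ball (0::'a) r) = vol ({z. N z \<le> 1} \<inter> ball 0 R)"
      using radius_exists by blast
    show ?thesis
    proof (cases "r = 0")
      case True
      then show ?thesis by (simp add: r(2)[symmetric])
    next
      case False
      then have r0: "r > 0" using r by simp
      have Cr: "C * ennreal (r powr p) \<le> 1"
        by (rule sublevel_radius_bound[OF N hom p r0 r(2)[symmetric] le[OF r(1) r(2)[symmetric]]])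
      have "C \<noteq> \<infinity>" using Cr r0 by (auto simp: ennreal_top_mult top_unique split: if_splits)
      then obtain c where c: "C = ennreal c" "c > 0" using C0 by (cases C) (auto simp: less_le)
      have "c * r powr p \<le> 1" using Cr c r0 by (simp add: ennreal_mult[symmetric])
      then have "r powr p \<le> c powr (-1)" using c by (simp add: powr_minus field_simps)
      then have "(r powr p) powr (real DIM('a) / p) \<le> (c powr (-1)) powr (real DIM('a) / p)"
        using p by (intro powr_mono2) auto
      moreover have "(c powr (-1)) powr (real DIM('a) / p) = c powr ?a" by (simp only: powr_powr) simp
      ultimately have "r ^ DIM('a) \<le> c powr ?a" using p r0 by (simp only: powr_powr) (simp add: powr_realpow)
      then have "ennreal (r ^ DIM('a)) \<le> epowr C ?a" using c by (simp add: epowr_ennreal ennreal_leI)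
      then have "?\<omega> * ennreal (r ^ DIM('a)) \<le> ?\<omega> * epowr C ?a" by (rule mult_left_mono) simp
      then show ?thesis using r0 by (simp add: r(2)[symmetric] emeasure_ball ennreal_mult)
    qed
  qed
  have "?\<omega> * (\<integral>\<^sup>+u. epowr (N u) ?a \<partial>sphere_measure) \<le> vol {x. ennreal (norm x ^ DIM('a)) \<le> epowr (N (sgn x)) ?a}"
    by (rule nn_integral_sphere_le_emeasure) measurable
  also have "\<dots> \<le> vol {z. N z \<le> 1}"
  proof (rule emeasure_mono)
    show "{x. ennreal (norm x ^ DIM('a)) \<le> epowr (N (sgn x)) ?a} \<subseteq> {z. N z \<le> 1}"
    proof safe
      fix x assume x: "ennreal (norm x ^ DIM('a)) \<le> epowr (N (sgn x)) ?a"
      show "N x \<le> 1"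
      proof (cases "x = 0 \<or> N (sgn x) = 0")
        case True
        have "x = norm x *\<^sub>R sgn x" by (cases "x = 0") (auto simp: sgn_div_norm)
        then show ?thesis using True N0 hom[of "norm x" "sgn x"] by (cases "x = 0") auto
      next
        case False
        then have x0: "norm x > 0" by simp
        have "norm x ^ DIM('a) > 0" using x0 by simp
        then have "epowr (N (sgn x)) ?a \<noteq> 0" using x by (metis ennreal_eq_0_iff le_zero_eq not_le)
        then have "N (sgn x) \<noteq> \<infinity>" using p by (auto simp: epowr_def divide_less_0_iff split: if_splits)
        then obtain c where c: "N (sgn x) = ennreal c" "c > 0" using False by (cases "N (sgn x)") (auto simp: less_le)
        have "norm x ^ DIM('a) \<le> c powr ?a" using x c by (simp add: epowr_ennreal)
        then have "(norm x powr real DIM('a)) powr (p / real DIM('a)) \<le> (c powr ?a) powr (p / real DIM('a))"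
          using p x0 by (intro powr_mono2) (auto simp: powr_realpow)
        then have "norm x powr p \<le> c powr (-1)" using p by (simp add: powr_powr)
        then have "norm x powr p * c \<le> 1" using c by (simp add: powr_minus field_simps)
        moreover have "N x = ennreal (norm x powr p * c)"
        proof -
          have "x = norm x *\<^sub>R sgn x" by (cases "x = 0") (auto simp: sgn_div_norm)
          then have "N x = ennreal (norm x powr p) * N (sgn x)" using hom[OF x0, of "sgn x"] by simp
          then show ?thesis using c by (simp add: ennreal_mult)
        qed
        ultimately show ?thesis by simp
      qed
    qed
  qed measurable
  also have "\<dots> = (SUP R. vol ({z. N z \<le> 1} \<inter> ball (0::'a) (real R)))"
  proof (subst SUP_emeasure_incseq)
    show "incseq (\<lambda>R. {z. N z \<le> 1} \<inter> ball (0::'a) (real R))" by (auto simp: incseq_def)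
    have "(\<Union>R. ball (0::'a) (real R)) = UNIV" using reals_Archimedean2 by auto
    then show "vol {z. N z \<le> 1} = vol (\<Union>R. {z. N z \<le> 1} \<inter> ball (0::'a) (real R))"
      by (simp flip: Int_UN_distrib)
  qed (auto intro!: sets.Int)
  also have "\<dots> \<le> ?\<omega> * epowr C ?a" by (rule SUP_least) (rule K)
  finally show ?thesis using \<omega> by (simp add: ennreal_mult_le_mult_iff)
qed

lemma powr_convex_nonneg:
  fixes u v a b p :: real
  assumes u: "0 \<le> u" "0 \<le> v" "u + v = 1" and a: "0 \<le> a" "0 \<le> b" and p: "1 \<le> p"
  shows "(u * a + v * b) powr p \<le> u * a powr p + v * b powr p"
proof (cases "a = 0 \<or> b = 0")
  case False
  have "u = 1 - v" using u by simp
  with False show ?thesis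
    using convex_onD[OF powr_convex[OF p], of v a b] u a by (simp add: \<open>u = 1 - v\<close>)
next
  case True
  have *: "(w * c) powr p \<le> w * c powr p" if "0 \<le> w" "w \<le> 1" "0 \<le> c" for w c
  proof -
    have "w powr p \<le> w powr 1" using that p by (intro powr_mono')
    then show ?thesis using that by (simp add: powr_mult mult_right_mono)
  qed
  show ?thesis using True *[of u a] *[of v b] u a by auto
qed

lemma convex_sublevel_nn_integral:
  fixes G :: "'b \<Rightarrow> 'a::euclidean_space" and \<phi> :: "real \<Rightarrow> real"
  assumes [measurable]: "G \<in> borel_measurable M" "\<phi> \<in> borel_measurable borel"
    and \<phi>: "\<And>y. 0 \<le> \<phi> y" "\<And>u v a b. 0 \<le> u \<Longrightarrow> 0 \<le> v \<Longrightarrow> u + v = 1 \<Longrightarrow> \<phi> (u * a + v * b) \<le> u * \<phi> a + v * \<phi> b"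
  shows "convex {z. (\<integral>\<^sup>+x. ennreal (\<phi> (G x \<bullet> z)) \<partial>M) \<le> 1}"
proof (rule convexI, safe)
  fix y z :: 'a and u v :: real
  assume y: "(\<integral>\<^sup>+x. ennreal (\<phi> (G x \<bullet> y)) \<partial>M) \<le> 1" and z: "(\<integral>\<^sup>+x. ennreal (\<phi> (G x \<bullet> z)) \<partial>M) \<le> 1"
    and u: "0 \<le> u" "0 \<le> v" "u + v = 1"
  have "(\<integral>\<^sup>+x. ennreal (\<phi> (G x \<bullet> (u *\<^sub>R y + v *\<^sub>R z))) \<partial>M)
    \<le> (\<integral>\<^sup>+x. ennreal u * ennreal (\<phi> (G x \<bullet> y)) + ennreal v * ennreal (\<phi> (G x \<bullet> z)) \<partial>M)"
    using u \<phi> by (intro nn_integral_mono) (simp add: inner_add_right ennreal_mult[symmetric] ennreal_plus[symmetric] ennreal_leI del: ennreal_plus)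
  also have "\<dots> = ennreal u * (\<integral>\<^sup>+x. ennreal (\<phi> (G x \<bullet> y)) \<partial>M) + ennreal v * (\<integral>\<^sup>+x. ennreal (\<phi> (G x \<bullet> z)) \<partial>M)"
    by (simp add: nn_integral_add nn_integral_cmult)
  also have "\<dots> \<le> ennreal u * 1 + ennreal v * 1" by (intro add_mono mult_left_mono y z) auto
  also have "\<dots> = 1" using u by (simp add: ennreal_plus[symmetric] del: ennreal_plus)
  finally show "(\<integral>\<^sup>+x. ennreal (\<phi> (G x \<bullet> (u *\<^sub>R y + v *\<^sub>R z))) \<partial>M) \<le> 1" .
qed

section \<open>Directional energies and their rearrangement\<close>

text \<open>The function called \<open>N\<close> in the overview, for a field \<open>G\<close> in
  place of the gradient of \<open>f\<close>.\<close>

definition dir_energy :: "real \<Rightarrow> ('a::euclidean_space \<Rightarrow> 'a) \<Rightarrow> 'a \<Rightarrow> ennreal" where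
  "dir_energy p G z = (\<integral>\<^sup>+x. ennreal (max (G x \<bullet> z) 0 powr p))"

context
  fixes p :: real and G :: "'a::euclidean_space \<Rightarrow> 'a"
  assumes p: "1 \<le> p" and G[measurable]: "G \<in> borel_measurable borel"
begin

lemma dir_energy_measurable [measurable]: "dir_energy p G \<in> borel_measurable borel"
  unfolding dir_energy_def by measurable

lemma dir_energy_0 [simp]: "dir_energy p G 0 = 0"
  by (simp add: dir_energy_def)

lemma dir_energy_scaleR: "0 < c \<Longrightarrow> dir_energy p G (c *\<^sub>R z) = ennreal (c powr p) * dir_energy p G z"
  unfolding dir_energy_def by (simp add: powr_max_mult ennreal_mult nn_integral_cmult)

lemma dir_energy_symmetrized:
  "dir_energy p G z + dir_energy p G (- z) = (\<integral>\<^sup>+x. ennreal (\<bar>G x \<bullet> z\<bar> powr p))"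
  unfolding dir_energy_def using p
  by (subst nn_integral_add[symmetric]) (auto intro!: nn_integral_cong simp: max_def)

lemma convex_dir_energy_sublevel: "convex {z. dir_energy p G z \<le> 1}"
  unfolding dir_energy_def
proof (rule convex_sublevel_nn_integral)
  fix u v a b :: real assume u: "0 \<le> u" "0 \<le> v" "u + v = 1"
  have "max (u * a + v * b) 0 \<le> u * max a 0 + v * max b 0"
    using u mult_left_mono[of a "max a 0" u] mult_left_mono[of b "max b 0" v] by (auto intro!: add_mono add_nonneg_nonneg)
  then have "max (u * a + v * b) 0 powr p \<le> (u * max a 0 + v * max b 0) powr p" using p by (intro powr_mono2) auto
  also have "\<dots> \<le> u * max a 0 powr p + v * max b 0 powr p" using u p by (intro powr_convex_nonneg) auto
  finally show "max (u * a + v * b) 0 powr p \<le> u * max a 0 powr p + v * max b 0 powr p" .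
qed auto

lemma convex_symmetrized_sublevel: "convex {z. dir_energy p G z + dir_energy p G (- z) \<le> 1}"
  unfolding dir_energy_symmetrized
proof (rule convex_sublevel_nn_integral)
  fix u v a b :: real assume u: "0 \<le> u" "0 \<le> v" "u + v = 1"
  have "\<bar>u * a + v * b\<bar> \<le> u * \<bar>a\<bar> + v * \<bar>b\<bar>" using u abs_triangle_ineq[of "u * a" "v * b"] by (simp add: abs_mult)
  then have "\<bar>u * a + v * b\<bar> powr p \<le> (u * \<bar>a\<bar> + v * \<bar>b\<bar>) powr p" using p by (intro powr_mono2) auto
  also have "\<dots> \<le> u * \<bar>a\<bar> powr p + v * \<bar>b\<bar> powr p" using u p by (intro powr_convex_nonneg) auto
  finally show "\<bar>u * a + v * b\<bar> powr p \<le> u * \<bar>a\<bar> powr p + v * \<bar>b\<bar> powr p" .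
qed auto

end

lemma distr_lborel_orthogonal:
  fixes T :: "real^'n::{finite,wellorder} \<Rightarrow> real^'n::_"
  assumes T: "orthogonal_transformation T"
  shows "distr lborel borel T = lborel"
proof (rule sym, rule lborel_eqI)
  have [measurable]: "T \<in> borel_measurable borel"
    using orthogonal_transformation_linear[OF T] by (intro borel_measurable_continuous_onI linear_continuous_on) (simp add: linear_conv_bounded_linear)
  have T': "orthogonal_transformation (inv T)" using T by (rule orthogonal_transformation_inv)
  fix l u :: "real^'n::_" assume lu: "\<And>b. b \<in> Basis \<Longrightarrow> l \<bullet> b \<le> u \<bullet> b"
  have eq: "T -` box l u = inv T ` box l u" using orthogonal_transformation_bij[OF T] by (simp add: bij_vimage_eq_inv_image)
  have box: "box l u \<in> lmeasurable" by (rule bounded_set_imp_lmeasurable) auto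
  have [measurable]: "T -` box l u \<in> sets borel" using measurable_sets[of T borel borel "box l u"] by simp
  have "emeasure (distr lborel borel T) (box l u) = emeasure lebesgue (T -` box l u)"
    by (simp add: emeasure_distr)
  also have "\<dots> = emeasure lebesgue (box l u)"
    unfolding eq using measurable_orthogonal_image[OF T' box] measure_orthogonal_image[OF T' box] box by (metis emeasure_eq_measure2)
  also have "\<dots> = (\<Prod>b\<in>Basis. (u - l) \<bullet> b)" using lu by (simp add: emeasure_lborel_box)
  finally show "emeasure (distr lborel borel T) (box l u) = (\<Prod>b\<in>Basis. (u - l) \<bullet> b)" .
qed simp

text \<open>A rotation taking \<open>e\<close> to the direction of \<open>z\<close> preserves
  Lebesgue measure and commutes with a radial field, so the energy is the same in all unit
  directions; homogeneity supplies the length of \<open>z\<close>.\<close>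

lemma dir_energy_radial:
  fixes G :: "real^'n::{finite,wellorder} \<Rightarrow> real^'n::_"
  assumes p: "1 \<le> p" and G[measurable]: "G \<in> borel_measurable borel" and rad: "\<And>x. G x = \<psi> (norm x) *\<^sub>R x" and e: "norm e = 1"
  shows "dir_energy p G z = dir_energy p G e * ennreal (norm z powr p)"
proof (cases "z = 0")
  case True
  then show ?thesis by (simp add: dir_energy_0[OF p G])
next
  case False
  have "norm e = norm (sgn z)" using e False by (simp add: norm_sgn)
  then obtain T where T: "orthogonal_transformation T" "T e = sgn z" by (rule orthogonal_transformation_exists)
  have [measurable]: "T \<in> borel_measurable borel"
    using orthogonal_transformation_linear[OF T(1)] by (intro borel_measurable_continuous_onI linear_continuous_on) (simp add: linear_conv_bounded_linear)
  have "dir_energy p G (sgn z) = (\<integral>\<^sup>+x. ennreal (max (G x \<bullet> sgn z) 0 powr p) \<partial>distr lborel borel T)"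
    by (simp add: dir_energy_def distr_lborel_orthogonal[OF T(1)])
  also have "\<dots> = (\<integral>\<^sup>+x. ennreal (max (G (T x) \<bullet> T e) 0 powr p))"
    by (subst nn_integral_distr) (auto simp: T(2))
  also have "\<dots> = dir_energy p G e"
    using T(1) by (simp add: dir_energy_def rad orthogonal_transformation_def orthogonal_transformation_norm[OF T(1)])
  finally have "dir_energy p G (sgn z) = dir_energy p G e" .
  moreover have "z = norm z *\<^sub>R sgn z" using False by (simp add: sgn_div_norm)
  ultimately show ?thesis
    using dir_energy_scaleR[OF p G, of "norm z" "sgn z"] False by (simp add: mult.commute)
qed

text \<open>For the symmetric energy the body \<open>K\<close> satisfies \<open>K = - K\<close>, so
  integrating the symmetrized energy \<open>M\<close> over it gives twice the integral of
  \<open>dir_energy p g\<close>. The one-sided comparison therefore covers both cases, with the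
  constant doubled in the second.\<close>

theorem sphere_energy_rearrangement:
  fixes g G :: "real^'n::{finite,wellorder} \<Rightarrow> real^'n::_"
  assumes p: "1 \<le> p" and g[measurable]: "g \<in> borel_measurable borel"
    and G[measurable]: "G \<in> borel_measurable borel" and rad: "\<And>x. G x = \<psi> (norm x) *\<^sub>R x" and e: "norm e = 1"
    and le: "\<And>K k. K \<in> sets borel \<Longrightarrow> convex K \<Longrightarrow> bounded K \<Longrightarrow> 0 \<le> k \<Longrightarrow> vol K = vol (ball (0::real^'n::_) k) \<Longrightarrow>
      (\<integral>\<^sup>+z. indicator (ball 0 k) z * dir_energy p G z) \<le> (\<integral>\<^sup>+z. indicator K z * dir_energy p g z)"
  shows "(\<integral>\<^sup>+u. epowr (dir_energy p g u) (- real CARD('n) / p) \<partial>sphere_measure) \<le> epowr (dir_energy p G e) (- real CARD('n) / p)"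
    and "(\<integral>\<^sup>+u. epowr (dir_energy p g u + dir_energy p g (- u)) (- real CARD('n) / p) \<partial>sphere_measure) \<le> epowr (2 * dir_energy p G e) (- real CARD('n) / p)"
proof -
  note [measurable] = dir_energy_measurable[OF p g] dir_energy_measurable[OF p G]
  have p0: "0 < p" using p by simp
  have C: "(\<integral>\<^sup>+z. indicator (ball 0 r) z * dir_energy p G z) = dir_energy p G e * (\<integral>\<^sup>+z. indicator (ball (0::real^'n::_) r) z * ennreal (norm z powr p))" for r
  proof -
    have "(\<integral>\<^sup>+z. indicator (ball 0 r) z * dir_energy p G z)
      = (\<integral>\<^sup>+z. dir_energy p G e * (indicator (ball (0::real^'n::_) r) z * ennreal (norm z powr p)))"
    proof (rule nn_integral_cong)
      fix z :: "real^'n::_"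
      show "indicator (ball 0 r) z * dir_energy p G z = dir_energy p G e * (indicator (ball (0::real^'n::_) r) z * ennreal (norm z powr p))"
        by (subst dir_energy_radial[OF p G rad e, of z]) (simp add: mult_ac)
    qed
    then show ?thesis by (simp add: nn_integral_cmult)
  qed
  show "(\<integral>\<^sup>+u. epowr (dir_energy p g u) (- real CARD('n) / p) \<partial>sphere_measure) \<le> epowr (dir_energy p G e) (- real CARD('n) / p)"
  proof (rule sphere_integral_bound[where 'a = "real^'n::_", simplified DIM_cart DIM_real mult_1_right, OF _ _ _ p0])
    fix R r assume "0 \<le> r" "vol ({z. dir_energy p g z \<le> 1} \<inter> ball 0 R) = vol (ball (0::real^'n::_) r)"
    then show "dir_energy p G e * (\<integral>\<^sup>+z. indicator (ball (0::real^'n::_) r) z * ennreal (norm z powr p))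
      \<le> (\<integral>\<^sup>+z. indicator ({z. dir_energy p g z \<le> 1} \<inter> ball 0 R) z * dir_energy p g z)"
      unfolding C[symmetric] by (intro le convex_Int convex_dir_energy_sublevel p) (auto intro: bounded_Int)
  qed (auto simp: dir_energy_scaleR dir_energy_0 p)
  define M where "M z = dir_energy p g z + dir_energy p g (- z)" for z
  have [measurable]: "M \<in> borel_measurable borel" unfolding M_def by measurable
  show "(\<integral>\<^sup>+u. epowr (dir_energy p g u + dir_energy p g (- u)) (- real CARD('n) / p) \<partial>sphere_measure) \<le> epowr (2 * dir_energy p G e) (- real CARD('n) / p)"
    unfolding M_def[symmetric]
  proof (rule sphere_integral_bound[where 'a = "real^'n::_", simplified DIM_cart DIM_real mult_1_right, OF _ _ _ p0])
    fix R r assume r: "0 \<le> r" "vol ({z. M z \<le> 1} \<inter> ball 0 R) = vol (ball (0::real^'n::_) r)"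
    define K where "K = {z. M z \<le> 1} \<inter> ball 0 R"
    have [measurable]: "K \<in> sets borel" unfolding K_def by measurable
    have sym: "- z \<in> K \<longleftrightarrow> z \<in> K" for z by (simp add: K_def M_def add.commute)
    have "(\<integral>\<^sup>+z. indicator K z * dir_energy p g (- z)) = (\<integral>\<^sup>+z. indicator K (0 - z) * dir_energy p g (0 - z))"
      by (intro nn_integral_cong) (simp add: indicator_def sym)
    also have "\<dots> = (\<integral>\<^sup>+z. indicator K z * dir_energy p g z)"
      using nn_integral_lborel_reflect[of "\<lambda>z. indicator K z * dir_energy p g z" 0] by simp
    finally have "(\<integral>\<^sup>+z. indicator K z * M z) = 2 * (\<integral>\<^sup>+z. indicator K z * dir_energy p g z)"
      unfolding M_def distrib_left by (subst nn_integral_add) (auto simp: mult_2)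
    moreover have "convex K" "bounded K"
      unfolding K_def M_def by (auto intro!: convex_Int convex_symmetrized_sublevel p bounded_Int)
    ultimately show "2 * dir_energy p G e * (\<integral>\<^sup>+z. indicator (ball (0::real^'n::_) r) z * ennreal (norm z powr p))
      \<le> (\<integral>\<^sup>+z. indicator ({z. M z \<le> 1} \<inter> ball 0 R) z * M z)"
      using r le[of K r] by (simp add: K_def[symmetric] C mult.assoc mult_left_mono)
  next
    fix c :: real and z assume "0 < c"
    then show "M (c *\<^sub>R z) = ennreal (c powr p) * M z"
      using dir_energy_scaleR[OF p g, of c z] dir_energy_scaleR[OF p g, of c "- z"] by (simp add: M_def distrib_left)
  qed (auto simp: M_def dir_energy_0 p)
qed

section \<open>The energy inequality\<close>

text \<open>The first coordinate vanishes almost nowhere on the open half ball where it is positive,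
  so its mean absolute value is positive. The comparison is Jensen's inequality, since
  \<open>sphere_measure\<close> is a probability measure.\<close>

lemma I_const_facts:
  assumes p: "1 \<le> p"
  shows "0 < I_const TYPE('n::{finite,wellorder}) 1" "I_const TYPE('n) 1 \<le> I_const TYPE('n) p"
proof -
  interpret S: prob_space "sphere_measure :: (real^'n::_) measure" by (rule prob_space_sphere_measure)
  define X where "X u = \<bar>first_coord u\<bar>" for u :: "real^'n::_"
  have [measurable]: "X \<in> borel_measurable borel"
    unfolding X_def first_coord_def by (intro borel_measurable_continuous_onI continuous_intros)
  have X1: "AE u in sphere_measure. X u \<le> 1"
    using AE_sphere_measure
  proof eventually_elim
    case (elim u)
    then show ?case using component_le_norm_cart[of u] by (simp add: X_def first_coord_def)
  qed
  have iX: "integrable sphere_measure X"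
    by (rule S.integrable_const_bound[where B = 1]) (use X1 in \<open>auto simp: X_def\<close>)
  have iXp: "integrable sphere_measure (\<lambda>u. X u powr p)"
  proof (rule S.integrable_const_bound[where B = 1])
    show "AE u in sphere_measure. norm (X u powr p) \<le> 1"
      using X1 by eventually_elim (use p in \<open>auto simp: X_def intro!: powr_le1\<close>)
  qed simp
  have X_nonneg: "0 \<le> X u" for u by (simp add: X_def)
  have E0: "0 \<le> (\<integral>u. X u \<partial>sphere_measure)" by (simp add: X_def)
  have "(\<integral>u. X u \<partial>sphere_measure) \<noteq> 0"
  proof
    assume "(\<integral>u. X u \<partial>sphere_measure) = 0"
    then have "AE u in sphere_measure. X u = 0"
      using integral_nonneg_eq_0_iff_AE[OF iX] X_nonneg by simp
    then have "AE x in uniform_measure lborel (ball (0 :: real^'n::_) 1). X (sgn x) = 0"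
      unfolding sphere_measure_def by (subst (asm) AE_distr_iff) auto
    then have "AE x in lborel. x \<in> ball (0 :: real^'n::_) 1 \<longrightarrow> X (sgn x) = 0"
      by (subst (asm) AE_uniform_measure) (auto simp: emeasure_ball ennreal_eq_0_iff not_le)
    then have "AE x in lborel. x \<notin> ball (0 :: real^'n::_) 1 \<inter> {x. 0 < first_coord x}"
      by eventually_elim (auto simp: X_def first_coord_def sgn_div_norm)
    moreover have o: "open (ball (0 :: real^'n::_) 1 \<inter> {x. 0 < first_coord (x :: real^'n::_)})"
      unfolding first_coord_def by (intro open_Int open_ball open_Collect_less continuous_intros)
    ultimately have "ball (0 :: real^'n::_) 1 \<inter> {x. 0 < first_coord (x :: real^'n::_)} \<in> null_sets lborel"
      by (subst AE_iff_null_sets) auto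
    then have "negligible (ball (0 :: real^'n::_) 1 \<inter> {x. 0 < first_coord (x :: real^'n::_)})"
      by (simp add: negligible_iff_null_sets null_sets_completionI)
    moreover have "(1 / 2) *\<^sub>R axis (LEAST i. True) 1 \<in> ball (0 :: real^'n::_) 1 \<inter> {x. 0 < first_coord (x :: real^'n::_)}"
      by (simp add: first_coord_def norm_axis_1)
    ultimately show False using open_not_negligible[OF o] by blast
  qed
  then have pos: "0 < (\<integral>u. X u \<partial>sphere_measure)" using E0 by simp
  have I1: "I_const TYPE('n) 1 = (\<integral>u. X u \<partial>sphere_measure)"
    using E0 by (simp add: I_const_def X_def)
  then show "0 < I_const TYPE('n) 1" using pos by simp
  \<comment> \<open>The cut-off at 0 extends the power to a convex function on all of
    \<open>UNIV\<close>; it changes nothing on the nonnegative \<open>X\<close>.\<close>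
  have "max (\<integral>u. X u \<partial>sphere_measure) 0 powr p \<le> (\<integral>u. max (X u) 0 powr p \<partial>sphere_measure)"
  proof (rule S.jensens_inequality[OF iX, of UNIV])
    show "convex_on UNIV (\<lambda>x. max x 0 powr p)"
    proof (rule convex_onI)
      fix t x y :: real assume t: "0 < t" "t < 1"
      have "max ((1 - t) * x + t * y) 0 \<le> (1 - t) * max x 0 + t * max y 0"
        using t mult_left_mono[of x "max x 0" "1 - t"] mult_left_mono[of y "max y 0" t] by (auto intro!: add_mono add_nonneg_nonneg)
      then have "max ((1 - t) * x + t * y) 0 powr p \<le> ((1 - t) * max x 0 + t * max y 0) powr p"
        using p by (intro powr_mono2) auto
      also have "\<dots> \<le> (1 - t) * max x 0 powr p + t * max y 0 powr p" using t p by (intro powr_convex_nonneg) auto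
      finally show "max ((1 - t) *\<^sub>R x + t *\<^sub>R y) 0 powr p \<le> (1 - t) * max x 0 powr p + t * max y 0 powr p" by simp
    qed simp
  qed (use iXp in \<open>auto simp: X_def\<close>)
  then have "(\<integral>u. X u \<partial>sphere_measure) powr p \<le> (\<integral>u. X u powr p \<partial>sphere_measure)"
    using E0 by (simp add: X_def)
  then have "((\<integral>u. X u \<partial>sphere_measure) powr p) powr (1 / p) \<le> (\<integral>u. X u powr p \<partial>sphere_measure) powr (1 / p)"
    using p by (intro powr_mono2) auto
  then show "I_const TYPE('n) 1 \<le> I_const TYPE('n) p"
    using p E0 unfolding I1 by (simp add: powr_powr) (simp add: I_const_def X_def)
qed

lemma LI_cong_AE:
  fixes f f' :: "'a::euclidean_space \<Rightarrow> 'b::euclidean_space"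
  assumes f': "LI f'" and [measurable]: "f \<in> borel_measurable borel" and ae: "AE x in lborel. f x = f' x"
  shows "LI f"
  unfolding LI_iff
proof (intro conjI allI)
  have [measurable]: "f' \<in> borel_measurable borel" using f' by (simp add: LI_iff)
  fix R
  show "integrable lborel (\<lambda>x. indicator (cball 0 R) x *\<^sub>R f x)"
    using LI_integrable[OF f', of R] by (rule integrable_cong_AE_imp) (use ae in auto)
qed simp

text \<open>Deals with the choice in \<open>weak_gradient\<close>: once some weak gradient exists,
  the chosen one agrees almost everywhere with every Borel version, by uniqueness.\<close>

lemma weak_gradient_AE:
  assumes w: "wgrad f' g'" and ae: "AE x in lborel. f x = f' x" and f: "has_weak_gradient f g0"
  shows "AE x in lborel. weak_gradient f x = g' x"
proof -
  have "has_weak_gradient f (weak_gradient f)" unfolding weak_gradient_def by (rule someI[of "has_weak_gradient f" g0, OF f])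
  then obtain f2 g2 where 2: "wgrad f2 g2" "AE x in lborel. f x = f2 x" "AE x in lborel. weak_gradient f x = g2 x"
    by (rule has_weak_gradient_borel_version)
  have "wgrad f' g2"
  proof (rule has_weak_gradient_cong_AE)
    show "has_weak_gradient f2 g2" using 2(1) by (simp add: wgrad_def)
    show "AE x in lborel. f2 x = f' x" using 2(2) ae by eventually_elim simp
  qed (use wgrad_LI[OF w] wgrad_LI[OF 2(1)] in auto)
  then have "AE x in lborel. g2 x = g' x" by (rule wgrad_unique[OF _ w])
  with 2(3) show ?thesis by eventually_elim simp
qed

lemma nn_integral_lebesgue_eq_AE:
  assumes "AE x in lborel. F x = G x"
  shows "(\<integral>\<^sup>+x. F x \<partial>lebesgue) = (\<integral>\<^sup>+x. G x)"
  unfolding nn_integral_completion by (rule nn_integral_cong_AE[OF assms])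

lemma Lp_norm_finite_iff: "0 < p \<Longrightarrow> Lp_norm p h < \<infinity> \<longleftrightarrow> (\<integral>\<^sup>+x. ennreal (\<bar>h x\<bar> powr p) \<partial>lebesgue) < \<infinity>"
  by (auto simp: Lp_norm_def epowr_def less_top)

lemma Lp_norm_D_dir:
  assumes p: "1 \<le> p" and [measurable]: "g \<in> borel_measurable borel" and ae: "AE x in lborel. weak_gradient f x = g x"
  shows "Lp_norm p (D_dir_plus f u) = epowr (dir_energy p g u) (1 / p)"
    and "Lp_norm p (D_dir f u) = epowr (dir_energy p g u + dir_energy p g (- u)) (1 / p)"
proof -
  have "AE x in lborel. ennreal (\<bar>D_dir_plus f u x\<bar> powr p) = ennreal (max (g x \<bullet> u) 0 powr p)"
    using ae by eventually_elim (simp add: D_dir_plus_def)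
  then show "Lp_norm p (D_dir_plus f u) = epowr (dir_energy p g u) (1 / p)"
    unfolding Lp_norm_def dir_energy_def by (simp only: nn_integral_lebesgue_eq_AE)
  have "AE x in lborel. ennreal (\<bar>D_dir f u x\<bar> powr p) = ennreal (\<bar>g x \<bullet> u\<bar> powr p)"
    using ae by eventually_elim (simp add: D_dir_def)
  then show "Lp_norm p (D_dir f u) = epowr (dir_energy p g u + dir_energy p g (- u)) (1 / p)"
    unfolding Lp_norm_def dir_energy_symmetrized[OF p assms(2)] by (simp only: nn_integral_lebesgue_eq_AE)
qed

text \<open>Integrability over sets of finite volume follows from
  \<open>h \<le> 1 + h powr p\<close>, and finiteness of superlevel sets is Chebyshev's
  inequality.\<close>

lemma weakly_differentiable_Lp:
  fixes f :: "'a::euclidean_space \<Rightarrow> real"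
  assumes p: "1 \<le> p" and w: "wgrad f g"
    and f: "(\<integral>\<^sup>+x. ennreal (\<bar>f x\<bar> powr p)) < \<infinity>" and g: "(\<integral>\<^sup>+x. ennreal (norm (g x) powr p)) < \<infinity>"
  shows "weakly_differentiable f g"
proof
  show [measurable]: "f \<in> borel_measurable borel" using w by (simp add: wgrad_def)
  have [measurable]: "g \<in> borel_measurable borel" using w by (simp add: wgrad_def)
  have fin: "(\<integral>\<^sup>+x. indicator S x * ennreal (h x)) < \<infinity>"
    if h: "(\<integral>\<^sup>+x. ennreal (h x powr p)) < \<infinity>" "\<And>x. 0 \<le> h x" and [measurable]: "h \<in> borel_measurable borel" "S \<in> sets borel" and S: "vol S < \<infinity>"
    for h :: "'a \<Rightarrow> real" and S
  proof -
    have "(\<integral>\<^sup>+x. indicator S x * ennreal (h x)) \<le> (\<integral>\<^sup>+x. indicator S x + ennreal (h x powr p))"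
    proof (rule nn_integral_mono)
      fix x
      have "h x \<le> 1 + h x powr p"
      proof (cases "h x \<le> 1")
        case False
        then have "h x powr 1 \<le> h x powr p" using p by (intro powr_mono) auto
        then show ?thesis using False by simp
      qed (use powr_ge_zero[of "h x" p] in linarith)
      then have "ennreal (h x) \<le> 1 + ennreal (h x powr p)"
        using h(2)[of x] by (simp flip: ennreal_1 ennreal_plus add: ennreal_leI)
      then show "indicator S x * ennreal (h x) \<le> indicator S x + ennreal (h x powr p)" by (auto simp: indicator_def)
    qed
    also have "\<dots> = vol S + (\<integral>\<^sup>+x. ennreal (h x powr p))" by (simp add: nn_integral_add)
    finally show ?thesis using S h(1) by (simp add: order_le_less_trans)
  qed
  show "(\<integral>\<^sup>+x. indicator S x * ennreal \<bar>f x\<bar>) < \<infinity>" if "S \<in> sets borel" "vol S < \<infinity>" for S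
    by (rule fin) (use that f in auto)
  show "(\<integral>\<^sup>+x. indicator S x * ennreal (norm (g x))) < \<infinity>" if "S \<in> sets borel" "vol S < \<infinity>" for S
    by (rule fin) (use that g in auto)
  fix t :: real assume t: "0 < t"
  have "ennreal (t powr p) * vol {x. \<bar>f x\<bar> > t} = (\<integral>\<^sup>+x. ennreal (t powr p) * indicator {x. \<bar>f x\<bar> > t} x)"
    by (simp add: nn_integral_cmult_indicator)
  also have "\<dots> \<le> (\<integral>\<^sup>+x. ennreal (\<bar>f x\<bar> powr p))"
    using t p by (intro nn_integral_mono) (auto simp: indicator_def intro!: ennreal_leI powr_mono2)
  finally have "ennreal (t powr p) * vol {x. \<bar>f x\<bar> > t} < \<infinity>" using f by (rule order_le_less_trans)
  then show "vol {x. \<bar>f x\<bar> > t} < \<infinity>" using t by (auto simp: ennreal_mult_less_top)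
qed (rule w)

theorem energy_rearrangement:
  fixes f :: "real^'n::{finite,wellorder} \<Rightarrow> real"
  assumes n: "CARD('n) \<ge> 2" and p: "1 \<le> p" and f: "sobolev p f"
  shows "energy p (schwarz_rearr f) \<le> energy p f" "energy_plus p (schwarz_rearr f) \<le> energy_plus p f"
proof -
  have p0: "0 < p" using p by simp
  obtain g0 where g0: "has_weak_gradient f g0" "Lp_norm p (\<lambda>x. norm (g0 x)) < \<infinity>" using f by (auto simp: sobolev_def)
  then obtain f' g' where w: "wgrad f' g'" and ff': "AE x in lborel. f x = f' x" and gg': "AE x in lborel. g0 x = g' x"
    using has_weak_gradient_borel_version by blast
  have [measurable]: "f \<in> borel_measurable lebesgue" using f by (simp add: sobolev_def)
  have [measurable]: "f' \<in> borel_measurable borel" "g' \<in> borel_measurable borel" using w by (auto simp: wgrad_def)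
  interpret W: weakly_differentiable f' g'
  proof (rule weakly_differentiable_Lp[OF p w])
    have "(\<integral>\<^sup>+x. ennreal (\<bar>f x\<bar> powr p) \<partial>lebesgue) = (\<integral>\<^sup>+x. ennreal (\<bar>f' x\<bar> powr p))"
      by (rule nn_integral_lebesgue_eq_AE) (use ff' in auto)
    then show "(\<integral>\<^sup>+x. ennreal (\<bar>f' x\<bar> powr p)) < \<infinity>"
      using f Lp_norm_finite_iff[OF p0, of f] by (simp add: sobolev_def)
    have "(\<integral>\<^sup>+x. ennreal (\<bar>norm (g0 x)\<bar> powr p) \<partial>lebesgue) = (\<integral>\<^sup>+x. ennreal (norm (g' x) powr p))"
      by (rule nn_integral_lebesgue_eq_AE) (use gg' in auto)
    then show "(\<integral>\<^sup>+x. ennreal (norm (g' x) powr p)) < \<infinity>"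
      using g0(2) Lp_norm_finite_iff[OF p0, of "\<lambda>x. norm (g0 x)"] by simp
  qed
  have fg: "AE x in lborel. weak_gradient f x = g' x" by (rule weak_gradient_AE[OF w ff' g0(1)])
  have w0: "wgrad (schwarz0 f') W.\<Gamma>" by (rule W.wgrad_schwarz0) (use n in simp)
  have "emeasure lebesgue {x. \<bar>f x\<bar> > s} = emeasure lebesgue {x. \<bar>f' x\<bar> > s}" for s
  proof (rule emeasure_eq_AE)
    show "AE x in lebesgue. x \<in> {x. \<bar>f x\<bar> > s} \<longleftrightarrow> x \<in> {x. \<bar>f' x\<bar> > s}"
      by (rule AE_completion) (use ff' in auto)
    have [measurable]: "f' \<in> borel_measurable lebesgue" by (simp add: measurable_completion)
    have "{x \<in> space lebesgue. \<bar>f x\<bar> > s} \<in> sets lebesgue" "{x \<in> space lebesgue. \<bar>f' x\<bar> > s} \<in> sets lebesgue" by measurable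
    then show "{x. \<bar>f x\<bar> > s} \<in> sets lebesgue" "{x. \<bar>f' x\<bar> > s} \<in> sets lebesgue" by simp_all
  qed
  \<comment> \<open>The rearrangement depends on \<open>f\<close> only through the volumes of its
    superlevel sets, so the Borel version \<open>f'\<close> has the same profile, and the two
    rearrangements differ at most at the origin.\<close>
  then have "profile f = profile f'" by (simp add: profile_def decr_rearr_def fun_eq_iff)
  then have sr: "schwarz_rearr f x = schwarz0 f' x" if "x \<noteq> 0" for x
    using that by (simp add: schwarz_rearr_eq_profile schwarz0_def)
  have sr_ae: "AE x in lborel. schwarz_rearr f x = schwarz0 f' x"
    using AE_lborel_singleton[of "0 :: real^'n::_"] by eventually_elim (rule sr)
  have [measurable]: "schwarz0 f' \<in> borel_measurable borel" using w0 by (simp add: wgrad_def)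
  have "schwarz_rearr f = (\<lambda>x. if x = 0 then schwarz_rearr f 0 else schwarz0 f' x)" using sr by auto
  also have "\<dots> \<in> borel_measurable borel" by measurable
  finally have "LI (schwarz_rearr f)" by (rule LI_cong_AE[OF wgrad_LI(1)[OF w0] _ sr_ae])
  then have "wgrad (schwarz_rearr f) W.\<Gamma>"
    using w0 sr_ae wgrad_LI(2)[OF w0] by (intro has_weak_gradient_cong_AE[of "schwarz0 f'" W.\<Gamma>]) (auto simp: wgrad_def)
  then have "has_weak_gradient (schwarz_rearr f) W.\<Gamma>" by (simp add: wgrad_def)
  then have sG: "AE x in lborel. weak_gradient (schwarz_rearr f) x = W.\<Gamma> x" by (rule weak_gradient_AE[OF w0 sr_ae])
  obtain \<psi> where rad: "\<And>x. W.\<Gamma> x = \<psi> (norm x) *\<^sub>R x" using W.Gamma_radial by blast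
  \<comment> \<open>Any unit vector serves, since the energy of a radial field does not depend on
    the direction.\<close>
  define e :: "real^'n::_" where "e = axis undefined 1"
  have e: "norm e = 1" by (simp add: e_def norm_axis_1)
  let ?n = "real CARD('n)"
  let ?C = "dir_energy p W.\<Gamma> e"
  have le: "(\<integral>\<^sup>+z. indicator (ball 0 k) z * dir_energy p W.\<Gamma> z) \<le> (\<integral>\<^sup>+z. indicator K z * dir_energy p g' z)"
    if "K \<in> sets borel" "convex K" "bounded K" "0 \<le> k" "vol K = vol (ball (0::real^'n::_) k)" for K k
    unfolding dir_energy_def by (rule W.directional_energy_rearrangement[OF _ p that]) (use n in simp)
  note bound = sphere_energy_rearrangement[OF p W.g_measurable W.Gamma_measurable rad e le]
  have ex: "epowr (epowr x (1 / p)) (- ?n) = epowr x (- ?n / p)" for x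
    using p0 by (subst epowr_epowr) auto
  \<comment> \<open>On the unit sphere the energy of the rearrangement is constant and the sphere
    has total mass 1, so its sphere integral is computed exactly.\<close>
  have const: "(\<integral>\<^sup>+u. epowr (c * dir_energy p W.\<Gamma> u) (- ?n / p) \<partial>sphere_measure) = epowr (c * ?C) (- ?n / p)" for c
  proof -
    interpret S: prob_space "sphere_measure :: (real^'n::_) measure" by (rule prob_space_sphere_measure)
    have "(\<integral>\<^sup>+u. epowr (c * dir_energy p W.\<Gamma> u) (- ?n / p) \<partial>sphere_measure) = (\<integral>\<^sup>+u. epowr (c * ?C) (- ?n / p) \<partial>(sphere_measure :: (real^'n::_) measure))"
    proof (rule nn_integral_cong_AE, use AE_sphere_measure in eventually_elim)
      case (elim u)
      then show ?case using dir_energy_radial[OF p W.Gamma_measurable rad e, of u] by simp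
    qed
    then show ?thesis by (simp add: S.emeasure_space_1[unfolded space_sphere_measure])
  qed
  have neg: "dir_energy p W.\<Gamma> u + dir_energy p W.\<Gamma> (- u) = 2 * dir_energy p W.\<Gamma> u" for u
    using dir_energy_radial[OF p W.Gamma_measurable rad e, of u] dir_energy_radial[OF p W.Gamma_measurable rad e, of "- u"] by (simp add: mult_2)
  \<comment> \<open>The outer exponent \<open>- 1 / n\<close> is negative, so the larger sphere
    integral, that of the rearrangement, yields the smaller energy.\<close>
  show "energy p (schwarz_rearr f) \<le> energy p f"
    unfolding energy_def Lp_norm_D_dir(2)[OF p W.g_measurable fg] Lp_norm_D_dir(2)[OF p W.Gamma_measurable sG] ex neg const
    by (intro mult_left_mono epowr_antimono bound) auto
  show "energy_plus p (schwarz_rearr f) \<le> energy_plus p f"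
    unfolding energy_plus_def Lp_norm_D_dir(1)[OF p W.g_measurable fg] Lp_norm_D_dir(1)[OF p W.Gamma_measurable sG] ex const[of 1, unfolded mult_1]
    by (intro mult_left_mono epowr_antimono bound) auto
qed

theorem proposition3p1:
  fixes f :: "real^'n::{finite,wellorder} \<Rightarrow> real" and p :: real
  assumes "CARD('n) \<ge> 2" and "1 \<le> p" and "sobolev p f"
  shows "energy p (schwarz_rearr f)
           \<le> ennreal (I_const TYPE('n) p / I_const TYPE('n) 1) * energy p f
       \<and> energy_plus p (schwarz_rearr f)
           \<le> ennreal (I_const TYPE('n) p / I_const TYPE('n) 1) * energy_plus p f"
proof -
  have "1 \<le> ennreal (I_const TYPE('n) p / I_const TYPE('n) 1)"
    using I_const_facts[OF assms(2), where 'n = 'n] by simp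
  from mult_right_mono[OF this] show ?thesis
    using energy_rearrangement[OF assms] by (auto intro: order_trans)
qed

end
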